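(* Let $G=\mathrm{Isom}_e\mathbb E^3=\mathrm{SE}(3)$, $K=\mathrm{SO}(3)$, let $M$ be a connected closed oriented $3$-manifold, and let $\rho\colon\pi_1(M)\to G$ be a representation. For the auxiliary connection $\omega^\sigma$ associated with any section $\sigma\colon M\to P_\rho/K$ and the invariant polynomial $p=p_{c_1,c_2}$ ($c_1,c_2\in\mathbb R$), we have $$\mathrm{CS}_p(\omega^\sigma,\omega_\rho)=(2c_1+6c_2)\,\sigma^*\mathrm{vol}_\rho\in\mathcal A^3(M;\mathbb R).$$
   Context: Manifolds, bundles and maps are smooth. $\mathcal A^3(M;\mathbb R)$ denotes real $3$-forms on $M$. $P_\rho=\widetilde M\times_\rho G$ with its flat connection $\omega_\rho$. $G=\mathbb R^3\rtimes\mathrm{SO}(3)$; $\mathfrak g=\mathfrak{se}(3)$ has basis $P_i,J_i$ ($i=1,2,3$; $P_i$ the standard basis of $\mathbb R^3$, $J_i$ generators of $\mathfrak{so}(3)$) with $[J_i,J_j]=\varepsilon_{ijk}J_k$, $[J_i,P_j]=\varepsilon_{ijk}P_k$, $[P_i,P_j]=0$. $p_{c_1,c_2}=\langle\cdot,\cdot\rangle$ is the $\mathrm{Ad}(G)$-invariant symmetric bilinear form with $\langle J_i,J_j\rangle=c_1\delta_{ij}$, $\langle P_i,J_j\rangle=c_2\delta_{ij}$, $\langle P_i,P_j\rangle=0$. For $\mathfrak g$-valued forms, $[\alpha\otimes\xi,\beta\otimes\eta]=(\alpha\wedge\beta)\otimes[\xi,\eta]$ and $\langle\alpha\otimes\xi,\beta\otimes\eta\rangle=(\alpha\wedge\beta)\langle\xi,\eta\rangle$.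 For connections $\omega_1,\omega_0$ with $a=\omega_1-\omega_0$ (an $\mathrm{ad}P$-valued $1$-form on $M$), $\Omega_0=d\omega_0+\frac12[\omega_0,\omega_0]$, $d_{\omega_0}a=da+[\omega_0,a]$, set $\mathrm{CS}_p(\omega_1,\omega_0)=\langle a,d_{\omega_0}a\rangle+\frac13\langle a,[a,a]\rangle+2\langle a,\Omega_0\rangle$. Let $\mathrm{vol}_G$ be the $G$-invariant volume form on $G/K\cong\mathbb E^3$ equal to $P_1^*\wedge P_2^*\wedge P_3^*$ at the identity; $\mathrm{pr}_2^*\mathrm{vol}_G$ on $\widetilde M\times G/K$ descends to a closed $3$-form $\mathrm{vol}_\rho$ on $P_\rho/K=\widetilde M\times_\rho G/K$. For a section $\sigma$ of $P_\rho/K\to M$, $Q_\sigma\subset P_\rho$ is the preimage of $\sigma(M)$ under $P_\rho\to P_\rho/K$, a principal $K$-bundle with inclusion $\iota_\sigma$. Let $e^i$ be the $P_i$-component of $\iota_\sigma^*\omega_\rho$. The form $\widehat e=\sum_ie^iJ_i$ on $Q_\sigma$ is horizontal and $\mathrm{Ad}(K)$-equivariant, hence defines an $\mathrm{ad}P_\rho$-valued $1$-form on $M$ (same symbol for its pullback to $P_\rho$), and $\omega^\sigma=\omega_\rho+\widehat e$. *)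

theory Defs
  imports "HOL-Analysis.Analysis" "HOL-Algebra.Bij"
begin

section \<open>Smooth manifolds given by atlases\<close>

primrec Ck_on :: "nat \<Rightarrow> 'e::euclidean_space set \<Rightarrow> ('e \<Rightarrow> 'v::real_normed_vector) \<Rightarrow> bool" where
  "Ck_on 0 S f = continuous_on S f"
| "Ck_on (Suc k) S f = ((\<forall>x\<in>S. f differentiable (at x)) \<and>
     (\<forall>v. Ck_on k S (\<lambda>x. frechet_derivative f (at x) v)))"

text \<open>Only used for open \<open>S\<close>.\<close>
definition smooth_on :: "'e::euclidean_space set \<Rightarrow> ('e \<Rightarrow> 'v::real_normed_vector) \<Rightarrow> bool" where
  "smooth_on S f \<longleftrightarrow> (\<forall>k. Ck_on k S f)"

text \<open>A chart is its domain together with its coordinate map, whose values outside the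
  domain are irrelevant. A manifold is represented by an atlas alone (not necessarily maximal):
  the underlying set is the union of the chart domains, and the topology is the one
  for which all charts are homeomorphisms onto open sets.\<close>

type_synonym ('a, 'e) chart = "'a set \<times> ('a \<Rightarrow> 'e)"
type_synonym ('a, 'e) atlas = "('a, 'e) chart set"

definition points :: "('a, 'e) atlas \<Rightarrow> 'a set" where
  "points A = \<Union> (fst ` A)"

definition chart_inv :: "('a, 'e) chart \<Rightarrow> 'e \<Rightarrow> 'a" where
  "chart_inv c = inv_into (fst c) (snd c)"

definition transition :: "('a, 'e) chart \<Rightarrow> ('a, 'f) chart \<Rightarrow> 'e \<Rightarrow> 'f" where
  "transition c d = snd d \<circ> chart_inv c"

definition mtop :: "('a, 'e::euclidean_space) atlas \<Rightarrow> 'a topology" where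
  "mtop A = topology (\<lambda>W. W \<subseteq> points A \<and> (\<forall>c\<in>A. open (snd c ` (fst c \<inter> W))))"

lemma openin_mtop:
  assumes "\<forall>c\<in>A. inj_on (snd c) (fst c)"
  shows "openin (mtop A) W \<longleftrightarrow> W \<subseteq> points A \<and> (\<forall>c\<in>A. open (snd c ` (fst c \<inter> W)))"
proof -
  have inter: "snd c ` (fst c \<inter> (S \<inter> T)) = snd c ` (fst c \<inter> S) \<inter> snd c ` (fst c \<inter> T)"
    if "c \<in> A" for c S T
    using that assms by (auto simp: inj_on_def)
  have union: "snd c ` (fst c \<inter> \<Union>K) = (\<Union>S\<in>K. snd c ` (fst c \<inter> S))" for c :: "('a, 'b) chart" and K
    by auto
  have "istopology (\<lambda>W. W \<subseteq> points A \<and> (\<forall>c\<in>A. open (snd c ` (fst c \<inter> W))))"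
    unfolding istopology_def by (auto simp: inter union)
  then show ?thesis
    by (simp add: mtop_def topology_inverse')
qed

definition manifold :: "('a, 'e::euclidean_space) atlas \<Rightarrow> bool" where
  "manifold A \<longleftrightarrow>
     (\<forall>c\<in>A. inj_on (snd c) (fst c) \<and> open (snd c ` fst c)) \<and>
     (\<forall>c\<in>A. \<forall>d\<in>A. open (snd c ` (fst c \<inter> fst d)) \<and>
        smooth_on (snd c ` (fst c \<inter> fst d)) (transition c d)) \<and>
     Hausdorff_space (mtop A) \<and> second_countable (mtop A)"

text \<open>An oriented manifold is given by an atlas all of whose coordinate changes preserve the
  orientation of the model space.\<close>
definition oriented_manifold :: "('a, real^'n) atlas \<Rightarrow> bool" where
  "oriented_manifold A \<longleftrightarrow> manifold A \<and>
     (\<forall>c\<in>A. \<forall>d\<in>A. \<forall>x \<in> fst c \<inter> fst d.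
        det (matrix (frechet_derivative (transition c d) (at (snd c x)))) > 0)"

definition smooth_map ::
  "('a, 'e::euclidean_space) atlas \<Rightarrow> ('b, 'f::euclidean_space) atlas \<Rightarrow> ('a \<Rightarrow> 'b) \<Rightarrow> bool" where
  "smooth_map A B f \<longleftrightarrow> continuous_map (mtop A) (mtop B) f \<and>
     (\<forall>c\<in>A. \<forall>d\<in>B. smooth_on (snd c ` {x \<in> fst c. f x \<in> fst d}) (snd d \<circ> f \<circ> chart_inv c))"

definition open_atlas :: "'e set \<Rightarrow> ('e, 'e) atlas" where
  "open_atlas V = {(V, id)}"

definition restrict_atlas :: "('a, 'e) atlas \<Rightarrow> 'a set \<Rightarrow> ('a, 'e) atlas" where
  "restrict_atlas A W = (\<lambda>c. (fst c \<inter> W, snd c)) ` A"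

definition prod_atlas :: "('a, 'e) atlas \<Rightarrow> ('b, 'f) atlas \<Rightarrow> ('a \<times> 'b, 'e \<times> 'f) atlas" where
  "prod_atlas A B = {(fst c \<times> fst d, map_prod (snd c) (snd d)) | c d. c \<in> A \<and> d \<in> B}"

text \<open>The charts of an embedded submanifold \<open>S\<close>: restrictions of smooth maps defined
  on open sets of the ambient manifold that have smooth inverses.\<close>
definition submanifold_atlas ::
  "('a, 'e::euclidean_space) atlas \<Rightarrow> 'a set \<Rightarrow> ('a, 'k::euclidean_space) atlas" where
  "submanifold_atlas A S = {(S \<inter> W, F) | W F.
     openin (mtop A) W \<and> smooth_map (restrict_atlas A W) (open_atlas UNIV) F \<and>
     inj_on F (S \<inter> W) \<and> open (F ` (S \<inter> W)) \<and>
     smooth_map (open_atlas (F ` (S \<inter> W))) A (inv_into (S \<inter> W) F)}"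

text \<open>The atlas on \<open>q ` points A\<close> for which \<open>q\<close> is a local diffeomorphism. Here \<open>q\<close> will be the
  quotient map of a properly discontinuous free action.\<close>
definition quotient_atlas ::
  "('a, 'e::euclidean_space) atlas \<Rightarrow> ('a \<Rightarrow> 'c) \<Rightarrow> ('c, 'e) atlas" where
  "quotient_atlas A q = {(q ` W, snd c \<circ> inv_into W q) | W c.
     c \<in> A \<and> W \<subseteq> fst c \<and> openin (mtop A) W \<and> inj_on q W}"


section \<open>Tangent vectors and differential forms\<close>

text \<open>A tangent vector at \<open>x\<close> is the family of its coordinate vectors in all charts around \<open>x\<close>,
  extended by \<open>0\<close> to the other charts.\<close>

type_synonym ('a, 'e) tvec = "('a, 'e) chart \<Rightarrow> 'e"

definition tangent :: "('a, 'e::euclidean_space) atlas \<Rightarrow> 'a \<Rightarrow> ('a, 'e) tvec set" where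
  "tangent A x = {v. (\<forall>d. d \<notin> A \<or> x \<notin> fst d \<longrightarrow> v d = 0) \<and>
     (\<forall>c\<in>A. \<forall>d\<in>A. x \<in> fst c \<and> x \<in> fst d \<longrightarrow>
        v d = frechet_derivative (transition c d) (at (snd c x)) (v c))}"

text \<open>The tangent vector at \<open>x\<close> with coordinates \<open>w\<close> in the chart \<open>c\<close>.\<close>
definition coord_vec ::
  "('a, 'e::euclidean_space) atlas \<Rightarrow> ('a, 'e) chart \<Rightarrow> 'a \<Rightarrow> 'e \<Rightarrow> ('a, 'e) tvec" where
  "coord_vec A c x w = (\<lambda>d. if d \<in> A \<and> x \<in> fst d
     then frechet_derivative (transition c d) (at (snd c x)) w else 0)"

definition chart_at :: "('a, 'e) atlas \<Rightarrow> 'a \<Rightarrow> ('a, 'e) chart" where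
  "chart_at A x = (SOME c. c \<in> A \<and> x \<in> fst c)"

definition pushforward :: "('a, 'e::euclidean_space) atlas \<Rightarrow> ('b, 'f::euclidean_space) atlas \<Rightarrow>
    ('a \<Rightarrow> 'b) \<Rightarrow> 'a \<Rightarrow> ('a, 'e) tvec \<Rightarrow> ('b, 'f) tvec" where
  "pushforward A B f x v = (\<lambda>d. if d \<in> B \<and> f x \<in> fst d
     then (let c = chart_at A x
           in frechet_derivative (snd d \<circ> f \<circ> chart_inv c) (at (snd c x)) (v c))
     else 0)"

text \<open>A \<open>k\<close>-form takes a point and the list of its \<open>k\<close> arguments; it is \<open>0\<close> on all other
  arguments, so that equality of forms is equality of functions.\<close>

type_synonym ('a, 'e, 'v) form = "'a \<Rightarrow> ('a, 'e) tvec list \<Rightarrow> 'v"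

definition local_rep :: "('a, 'e::euclidean_space) atlas \<Rightarrow> ('a, 'e, 'v) form \<Rightarrow>
    ('a, 'e) chart \<Rightarrow> 'e \<Rightarrow> 'e list \<Rightarrow> 'v" where
  "local_rep A \<alpha> c y ws = \<alpha> (chart_inv c y) (map (coord_vec A c (chart_inv c y)) ws)"

definition forms :: "nat \<Rightarrow> ('a, 'e::euclidean_space) atlas \<Rightarrow>
    ('a, 'e, 'v::real_normed_vector) form set" where
  "forms k A = {\<alpha>.
     (\<forall>x vs. \<not> (x \<in> points A \<and> length vs = k \<and> set vs \<subseteq> tangent A x) \<longrightarrow> \<alpha> x vs = 0) \<and>
     (\<forall>c\<in>A. \<forall>ws. length ws = k \<longrightarrow>
        smooth_on (snd c ` fst c) (\<lambda>y. local_rep A \<alpha> c y ws) \<and>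
        (\<forall>y \<in> snd c ` fst c.
           (\<forall>i<k. linear (\<lambda>w. local_rep A \<alpha> c y (ws[i := w]))) \<and>
           (\<forall>i<k. \<forall>j<k. i \<noteq> j \<and> ws ! i = ws ! j \<longrightarrow> local_rep A \<alpha> c y ws = 0)))}"

definition pullback :: "('a, 'e::euclidean_space) atlas \<Rightarrow> ('b, 'f::euclidean_space) atlas \<Rightarrow>
    ('a \<Rightarrow> 'b) \<Rightarrow> ('b, 'f, 'v::real_normed_vector) form \<Rightarrow> ('a, 'e, 'v) form" where
  "pullback A B f \<beta> = (\<lambda>x vs. if x \<in> points A \<and> set vs \<subseteq> tangent A x
     then \<beta> (f x) (map (pushforward A B f x) vs) else 0)"

definition form_add :: "('a, 'e, 'v::real_normed_vector) form \<Rightarrow> ('a, 'e, 'v) form \<Rightarrow>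
    ('a, 'e, 'v) form" (infixl \<open>+\<^sub>f\<close> 65) where
  "\<alpha> +\<^sub>f \<beta> = (\<lambda>x vs. \<alpha> x vs + \<beta> x vs)"

definition form_diff :: "('a, 'e, 'v::real_normed_vector) form \<Rightarrow> ('a, 'e, 'v) form \<Rightarrow>
    ('a, 'e, 'v) form" (infixl \<open>-\<^sub>f\<close> 65) where
  "\<alpha> -\<^sub>f \<beta> = (\<lambda>x vs. \<alpha> x vs - \<beta> x vs)"

definition form_scale :: "real \<Rightarrow> ('a, 'e, 'v::real_normed_vector) form \<Rightarrow>
    ('a, 'e, 'v) form" (infixr \<open>*\<^sub>f\<close> 70) where
  "r *\<^sub>f \<alpha> = (\<lambda>x vs. r *\<^sub>R \<alpha> x vs)"

text \<open>The wedge product of a \<open>p\<close>-form and a \<open>q\<close>-form with respect to a bilinear map \<open>B\<close> of their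
  values, so that \<open>\<alpha> \<otimes> \<xi>\<close> and \<open>\<beta> \<otimes> \<eta>\<close> have the product \<open>(\<alpha> \<and> \<beta>) \<otimes> B \<xi> \<eta>\<close>. Normalisation:
  \<open>(\<alpha> \<and> \<beta>)(u, v) = \<alpha>(u) \<beta>(v) - \<alpha>(v) \<beta>(u)\<close> for \<open>1\<close>-forms.\<close>
definition wedge :: "('u \<Rightarrow> 'v \<Rightarrow> 'w::real_normed_vector) \<Rightarrow> nat \<Rightarrow> nat \<Rightarrow>
    ('a, 'e, 'u) form \<Rightarrow> ('a, 'e, 'v) form \<Rightarrow> ('a, 'e, 'w) form" where
  "wedge B p q \<alpha> \<beta> = (\<lambda>x vs. if length vs = p + q
     then (1 / (fact p * fact q)) *\<^sub>R (\<Sum>s | s permutes {..<p + q}. of_int (sign s) *\<^sub>R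
            B (\<alpha> x (map (\<lambda>i. vs ! s i) [0..<p])) (\<beta> x (map (\<lambda>i. vs ! s i) [p..<p + q])))
     else 0)"

definition ext_deriv :: "('a, 'e::euclidean_space) atlas \<Rightarrow> nat \<Rightarrow>
    ('a, 'e, 'v::real_normed_vector) form \<Rightarrow> ('a, 'e, 'v) form" where
  "ext_deriv A k \<alpha> = (\<lambda>x vs. if x \<in> points A \<and> length vs = Suc k \<and> set vs \<subseteq> tangent A x
     then (let c = chart_at A x; ws = map (\<lambda>v. v c) vs in
       \<Sum>i\<le>k. (-1) ^ i *\<^sub>R frechet_derivative
         (\<lambda>y. local_rep A \<alpha> c y (take i ws @ drop (Suc i) ws)) (at (snd c x)) (ws ! i))
     else 0)"

text \<open>The form on \<open>B\<close> to which a form \<open>\<alpha>\<close> on \<open>A\<close> descends along a surjective submersion \<open>f\<close>.\<close>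
definition descend :: "nat \<Rightarrow> ('a, 'e::euclidean_space) atlas \<Rightarrow> ('b, 'f::euclidean_space) atlas \<Rightarrow>
    ('a \<Rightarrow> 'b) \<Rightarrow> ('a, 'e, 'v::real_normed_vector) form \<Rightarrow> ('b, 'f, 'v) form" where
  "descend k A B f \<alpha> = (THE \<beta>. \<beta> \<in> forms k B \<and> pullback A B f \<beta> = \<alpha>)"


section \<open>Fundamental group and universal covering\<close>

definition loops :: "'a topology \<Rightarrow> 'a \<Rightarrow> (real \<Rightarrow> 'a) set" where
  "loops X x0 = {g. pathin X g \<and> g 0 = x0 \<and> g 1 = x0}"

definition loop_homotopic :: "'a topology \<Rightarrow> 'a \<Rightarrow> (real \<Rightarrow> 'a) \<Rightarrow> (real \<Rightarrow> 'a) \<Rightarrow> bool" where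
  "loop_homotopic X x0 g h \<longleftrightarrow>
     homotopic_with (\<lambda>r. r 0 = x0 \<and> r 1 = x0) (top_of_set {0..1}) X g h"

definition loop_class :: "'a topology \<Rightarrow> 'a \<Rightarrow> (real \<Rightarrow> 'a) \<Rightarrow> (real \<Rightarrow> 'a) set" where
  "loop_class X x0 g = {h \<in> loops X x0. loop_homotopic X x0 g h}"

text \<open>First \<open>g\<close>, then \<open>h\<close>; the library's concatenation is restricted to types of class
  \<open>topological_space\<close>.\<close>
definition path_concat :: "(real \<Rightarrow> 'a) \<Rightarrow> (real \<Rightarrow> 'a) \<Rightarrow> real \<Rightarrow> 'a" where
  "path_concat g h = (\<lambda>t. if t \<le> 1/2 then g (2 * t) else h (2 * t - 1))"

definition fundamental_group :: "'a topology \<Rightarrow> 'a \<Rightarrow> (real \<Rightarrow> 'a) set monoid" where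
  "fundamental_group X x0 =
     \<lparr>carrier = loop_class X x0 ` loops X x0,
      mult = (\<lambda>a b. \<Union>g\<in>a. \<Union>h\<in>b. loop_class X x0 (path_concat g h)),
      one = loop_class X x0 (\<lambda>t. x0)\<rparr>"

definition simply_connected_top :: "'a topology \<Rightarrow> bool" where
  "simply_connected_top X \<longleftrightarrow> path_connected_space X \<and>
     (\<forall>x\<in>topspace X. \<forall>g\<in>loops X x. loop_homotopic X x g (\<lambda>t. x))"

definition smooth_covering ::
  "('b, 'e::euclidean_space) atlas \<Rightarrow> ('a, 'e) atlas \<Rightarrow> ('b \<Rightarrow> 'a) \<Rightarrow> bool" where
  "smooth_covering Mt M p \<longleftrightarrow> smooth_map Mt M p \<and> p ` points Mt = points M \<and>
     (\<forall>x\<in>points M. \<exists>U. openin (mtop M) U \<and> x \<in> U \<and>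
        (\<exists>\<V>. \<Union>\<V> = {y \<in> points Mt. p y \<in> U} \<and> pairwise disjnt \<V> \<and>
          (\<forall>V\<in>\<V>. openin (mtop Mt) V \<and> inj_on p V \<and> p ` V = U \<and>
             smooth_map (restrict_atlas M U) Mt (inv_into V p))))"

definition universal_covering ::
  "('b, 'e::euclidean_space) atlas \<Rightarrow> ('a, 'e) atlas \<Rightarrow> ('b \<Rightarrow> 'a) \<Rightarrow> bool" where
  "universal_covering Mt M p \<longleftrightarrow>
     manifold Mt \<and> simply_connected_top (mtop Mt) \<and> smooth_covering Mt M p"

definition deck_group :: "('b, 'e::euclidean_space) atlas \<Rightarrow> ('b \<Rightarrow> 'a) \<Rightarrow> ('b \<Rightarrow> 'b) monoid" where
  "deck_group Mt p = (BijGroup (points Mt))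
     \<lparr>carrier := {\<tau> \<in> Bij (points Mt). smooth_map Mt Mt \<tau> \<and>
        smooth_map Mt Mt (inv_into (points Mt) \<tau>) \<and> (\<forall>y\<in>points Mt. p (\<tau> y) = p y)}\<rparr>"

text \<open>The left action of \<open>\<pi>\<^sub>1(M, p y0)\<close> on the universal covering determined by the base point \<open>y0\<close>:
  the isomorphism onto the group of deck transformations that takes the class of a loop to the
  transformation moving \<open>y0\<close> to the end point of the lift of the loop starting at \<open>y0\<close>.\<close>
definition deck_action :: "('b, 'e::euclidean_space) atlas \<Rightarrow> ('a, 'e) atlas \<Rightarrow> ('b \<Rightarrow> 'a) \<Rightarrow> 'b \<Rightarrow>
    ((real \<Rightarrow> 'a) set \<Rightarrow> 'b \<Rightarrow> 'b) \<Rightarrow> bool" where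
  "deck_action Mt M p y0 act \<longleftrightarrow>
     act \<in> iso (fundamental_group (mtop M) (p y0)) (deck_group Mt p) \<and>
     (\<forall>g. pathin (mtop Mt) g \<and> g 0 = y0 \<and> p (g 1) = p y0 \<longrightarrow>
        act (loop_class (mtop M) (p y0) (p \<circ> g)) y0 = g 1)"


section \<open>The group \<open>SE(3)\<close> and its Lie algebra\<close>

text \<open>\<open>(v, A)\<close> is the isometry \<open>w \<mapsto> v + A w\<close>.\<close>
type_synonym se3_pair = "(real^3) \<times> (real^3^3)"

fun se3_mult :: "se3_pair \<Rightarrow> se3_pair \<Rightarrow> se3_pair" where
  "se3_mult (v, A) (w, B) = (v + A *v w, A ** B)"

definition SE3 :: "se3_pair monoid" where
  "SE3 = \<lparr>carrier = {(v, A) | v A. rotation_matrix A}, mult = se3_mult, one = (0, mat 1)\<rparr>"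


fun se3_move :: "se3_pair \<Rightarrow> real^3 \<Rightarrow> real^3" where
  "se3_move (v, A) w = v + A *v w"

text \<open>\<open>SE(3)\<close> as a submanifold of \<open>\<real>\<^sup>3 \<times> \<real>\<^sup>3\<^sup>\<times>\<^sup>3\<close>, of dimension \<open>6\<close>.\<close>
definition SE3_atlas :: "(se3_pair, (real^3) \<times> (real^3)) atlas" where
  "SE3_atlas = submanifold_atlas (open_atlas UNIV) (carrier SE3)"

text \<open>An element \<open>(x, y)\<close> of \<open>se3\<close> stands for \<open>\<Sum>i. x\<^sub>i P\<^sub>i + y\<^sub>i J\<^sub>i\<close>. With
  \<open>e\<^sub>i \<times> e\<^sub>j = \<epsilon>\<^sub>i\<^sub>j\<^sub>k e\<^sub>k\<close> the cross product encodes the structure constants.\<close>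
type_synonym se3 = "(real^3) \<times> (real^3)"

definition se3_P :: "3 \<Rightarrow> se3" where "se3_P i = (axis i 1, 0)"
definition se3_J :: "3 \<Rightarrow> se3" where "se3_J i = (0, axis i 1)"

fun se3_bracket :: "se3 \<Rightarrow> se3 \<Rightarrow> se3" where
  "se3_bracket (x, y) (x', y') = (cross3 y x' + cross3 x y', cross3 y y')"

text \<open>The identification of \<open>se3\<close> with the tangent space of \<open>SE(3)\<close> at the identity, as a subspace
  of the ambient space: \<open>J\<^sub>i\<close> is the matrix of \<open>w \<mapsto> e\<^sub>i \<times> w\<close>. The inverse map reads off the three
  independent entries of a skew-symmetric matrix.\<close>
fun se3_mat :: "se3 \<Rightarrow> se3_pair" where
  "se3_mat (x, y) = (x, matrix (cross3 y))"

fun se3_of_mat :: "se3_pair \<Rightarrow> se3" where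
  "se3_of_mat (x, X) = (x, vector [X $ 3 $ 2, X $ 1 $ 3, X $ 2 $ 1])"

lemma se3_of_mat_se3_mat: "se3_of_mat (se3_mat \<xi>) = \<xi>"
  by (cases \<xi>) (simp add: matrix_def cross3_def axis_def vec_eq_iff forall_3)

lemma se3_mat_bracket:
  fixes x y x' y' :: "real^3"
  defines "X \<equiv> matrix (cross3 y)" and "X' \<equiv> matrix (cross3 y')"
  shows "se3_mat (se3_bracket (x, y) (x', y')) = (X *v x' - X' *v x, X ** X' - X' ** X)"
  unfolding X_def X'_def
  by (simp add: matrix_def cross3_def axis_def vec_eq_iff forall_3 sum_3
        matrix_vector_mult_def matrix_matrix_mult_def)

lemma se3_bracket_basis:
  "se3_bracket (se3_J i) (se3_J j) = (0, cross3 (axis i 1) (axis j 1))"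
  "se3_bracket (se3_J i) (se3_P j) = (cross3 (axis i 1) (axis j 1), 0)"
  "se3_bracket (se3_P i) (se3_P j) = 0"
  by (simp_all add: se3_P_def se3_J_def zero_prod_def)

text \<open>Multiplication and, for fixed \<open>g\<close>, conjugation by \<open>g\<close> are defined on the whole ambient space,
  so that their differentials can be taken there.\<close>
definition se3_Ad :: "se3_pair \<Rightarrow> se3 \<Rightarrow> se3" where
  "se3_Ad g \<xi> = se3_of_mat (frechet_derivative
     (\<lambda>h. se3_mult (se3_mult g h) (inv\<^bsub>SE3\<^esub> g)) (at \<one>\<^bsub>SE3\<^esub>) (se3_mat \<xi>))"

text \<open>The left-invariant Maurer--Cartan form, \<open>v \<mapsto> d(L\<^sub>g\<^sup>-\<^sup>1) v\<close> at \<open>g\<close>. The last argument of the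
  derivative is \<open>v\<close> as a vector of the ambient space.\<close>
definition maurer_cartan :: "(se3_pair, (real^3) \<times> (real^3), se3) form" where
  "maurer_cartan = (\<lambda>g vs.
     if g \<in> carrier SE3 \<and> length vs = 1 \<and> set vs \<subseteq> tangent SE3_atlas g
     then se3_of_mat (frechet_derivative (se3_mult (inv\<^bsub>SE3\<^esub> g)) (at g)
            (pushforward SE3_atlas (open_atlas UNIV) id g (hd vs) (UNIV, id)))
     else 0)"

fun inv_poly :: "real \<Rightarrow> real \<Rightarrow> se3 \<Rightarrow> se3 \<Rightarrow> real" where
  "inv_poly c1 c2 (x, y) (x', y') = c1 * (y \<bullet> y') + c2 * (x \<bullet> y' + y \<bullet> x')"

text \<open>\<open>G/K\<close> is Euclidean space \<open>\<real>\<^sup>3\<close>, with base point \<open>0\<close>; the projection is \<open>g \<mapsto> g 0\<close>, and its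
  differential at the identity sends \<open>P\<^sub>i\<close> to \<open>e\<^sub>i\<close>, so \<open>P\<^sub>1\<^sup>* \<and> P\<^sub>2\<^sup>* \<and> P\<^sub>3\<^sup>*\<close> is the determinant.\<close>

definition SO3 :: "se3_pair set" where
  "SO3 = {(0, A) | A. rotation_matrix A}"

lemma se3_move_0_eq_iff:
  assumes "g \<in> carrier SE3" "h \<in> carrier SE3"
  shows "se3_move g 0 = se3_move h 0 \<longleftrightarrow> (\<exists>k\<in>SO3. h = g \<otimes>\<^bsub>SE3\<^esub> k)"
proof
  obtain v A w B where gh: "g = (v, A)" "h = (w, B)" and rot: "rotation_matrix A" "rotation_matrix B"
    using assms by (auto simp: SE3_def)
  assume "se3_move g 0 = se3_move h 0"
  then have "w = v" by (simp add: gh)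
  moreover have "rotation_matrix (transpose A ** B)"
    using rot by (auto simp: rotation_matrix_def det_mul intro: orthogonal_matrix_mul)
  moreover have "A ** (transpose A ** B) = B"
    using rot by (simp add: rotation_matrix_def orthogonal_matrix_def matrix_mul_assoc)
  ultimately show "\<exists>k\<in>SO3. h = g \<otimes>\<^bsub>SE3\<^esub> k"
    by (intro bexI[of _ "(0, transpose A ** B)"]) (auto simp: gh SE3_def SO3_def)
next
  assume "\<exists>k\<in>SO3. h = g \<otimes>\<^bsub>SE3\<^esub> k"
  then show "se3_move g 0 = se3_move h 0"
    by (cases g) (auto simp: SE3_def SO3_def)
qed

abbreviation E3_atlas :: "(real^3, real^3) atlas" where
  "E3_atlas \<equiv> open_atlas UNIV"

definition vol_G :: "(real^3, real^3, real) form" where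
  "vol_G = (THE \<eta>. \<eta> \<in> forms 3 E3_atlas \<and>
     (\<forall>g\<in>carrier SE3. pullback E3_atlas E3_atlas (se3_move g) \<eta> = \<eta>) \<and>
     (\<forall>u v w. \<eta> 0 (map (coord_vec E3_atlas (UNIV, id) 0) [u, v, w]) = det (vector [u, v, w])))"


section \<open>The flat bundle \<open>P\<^sub>\<rho>\<close> and the Chern--Simons form\<close>

text \<open>For a group \<open>\<Gamma>\<close> acting from the left on \<open>Mt\<close> by \<open>act\<close> and on \<open>F\<close> by \<open>lact\<close>,
  \<open>orbit_map\<close> is the quotient map \<open>Mt \<times> F \<rightarrow> \<Gamma> \ (Mt \<times> F)\<close> for the diagonal action.\<close>
definition orbit_map :: "'g monoid \<Rightarrow> ('g \<Rightarrow> 'b \<Rightarrow> 'b) \<Rightarrow> ('g \<Rightarrow> 'f \<Rightarrow> 'f) \<Rightarrow> 'b \<times> 'f \<Rightarrow> ('b \<times> 'f) set"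
  where "orbit_map \<Gamma> act lact z = (\<lambda>\<gamma>. (act \<gamma> (fst z), lact \<gamma> (snd z))) ` carrier \<Gamma>"

definition P_quot :: "'g monoid \<Rightarrow> ('g \<Rightarrow> 'b \<Rightarrow> 'b) \<Rightarrow> ('g \<Rightarrow> se3_pair) \<Rightarrow>
    'b \<times> se3_pair \<Rightarrow> ('b \<times> se3_pair) set" where
  "P_quot \<Gamma> act \<rho> = orbit_map \<Gamma> act (\<lambda>\<gamma> g. \<rho> \<gamma> \<otimes>\<^bsub>SE3\<^esub> g)"

definition PK_quot :: "'g monoid \<Rightarrow> ('g \<Rightarrow> 'b \<Rightarrow> 'b) \<Rightarrow> ('g \<Rightarrow> se3_pair) \<Rightarrow>
    'b \<times> (real^3) \<Rightarrow> ('b \<times> (real^3)) set" where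
  "PK_quot \<Gamma> act \<rho> = orbit_map \<Gamma> act (\<lambda>\<gamma>. se3_move (\<rho> \<gamma>))"

definition P_atlas :: "('b, real^3) atlas \<Rightarrow> 'g monoid \<Rightarrow> ('g \<Rightarrow> 'b \<Rightarrow> 'b) \<Rightarrow> ('g \<Rightarrow> se3_pair) \<Rightarrow>
    (('b \<times> se3_pair) set, (real^3) \<times> (real^3) \<times> (real^3)) atlas" where
  "P_atlas Mt \<Gamma> act \<rho> = quotient_atlas (prod_atlas Mt SE3_atlas) (P_quot \<Gamma> act \<rho>)"

text \<open>\<open>P\<^sub>\<rho>/K\<close>, as the associated bundle with fibre \<open>G/K\<close>.\<close>
definition PK_atlas :: "('b, real^3) atlas \<Rightarrow> 'g monoid \<Rightarrow> ('g \<Rightarrow> 'b \<Rightarrow> 'b) \<Rightarrow> ('g \<Rightarrow> se3_pair) \<Rightarrow>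
    (('b \<times> (real^3)) set, (real^3) \<times> (real^3)) atlas" where
  "PK_atlas Mt \<Gamma> act \<rho> = quotient_atlas (prod_atlas Mt E3_atlas) (PK_quot \<Gamma> act \<rho>)"

text \<open>The projection \<open>[y, f] \<mapsto> p y\<close> of an associated bundle to \<open>M\<close>.\<close>
definition bundle_proj :: "('b \<Rightarrow> 'a) \<Rightarrow> ('b \<times> 'f) set \<Rightarrow> 'a" where
  "bundle_proj p z = the_elem (p ` fst ` z)"

text \<open>The projection \<open>P\<^sub>\<rho> \<rightarrow> P\<^sub>\<rho>/K\<close>, \<open>[y, g] \<mapsto> [y, g 0]\<close>, and the right action
  \<open>[y, g] \<mapsto> [y, g h]\<close> of \<open>h \<in> G\<close> on \<open>P\<^sub>\<rho>\<close>.\<close>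
definition mod_K :: "('b \<times> se3_pair) set \<Rightarrow> ('b \<times> (real^3)) set" where
  "mod_K z = (\<lambda>(y, g). (y, se3_move g 0)) ` z"

definition right_act :: "se3_pair \<Rightarrow> ('b \<times> se3_pair) set \<Rightarrow> ('b \<times> se3_pair) set" where
  "right_act h z = (\<lambda>(y, g). (y, g \<otimes>\<^bsub>SE3\<^esub> h)) ` z"

definition omega_rho where
  "omega_rho Mt \<Gamma> act \<rho> = descend 1 (prod_atlas Mt SE3_atlas) (P_atlas Mt \<Gamma> act \<rho>) (P_quot \<Gamma> act \<rho>)
     (pullback (prod_atlas Mt SE3_atlas) SE3_atlas snd maurer_cartan)"

definition vol_rho where
  "vol_rho Mt \<Gamma> act \<rho> = descend 3 (prod_atlas Mt E3_atlas) (PK_atlas Mt \<Gamma> act \<rho>) (PK_quot \<Gamma> act \<rho>)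
     (pullback (prod_atlas Mt E3_atlas) E3_atlas snd vol_G)"

text \<open>\<open>ad P\<close>-valued \<open>1\<close>-forms on \<open>M\<close>, as horizontal equivariant forms on \<open>P\<close>.\<close>
definition adP_forms ::
  "(('b \<times> se3_pair) set, 'e::euclidean_space) atlas \<Rightarrow> ('a, 'f::euclidean_space) atlas \<Rightarrow>
   ('b \<Rightarrow> 'a) \<Rightarrow> (('b \<times> se3_pair) set, 'e, se3) form set" where
  "adP_forms P M p = {a \<in> forms 1 P.
     (\<forall>z\<in>points P. \<forall>v\<in>tangent P z.
        pushforward P M (bundle_proj p) z v = (\<lambda>_. 0) \<longrightarrow> a z [v] = 0) \<and>
     (\<forall>h\<in>carrier SE3. pullback P P (right_act h) a = (\<lambda>z vs. se3_Ad (inv\<^bsub>SE3\<^esub> h) (a z vs)))}"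

definition is_section :: "('a, 'e::euclidean_space) atlas \<Rightarrow> ('c, 'f::euclidean_space) atlas \<Rightarrow>
    ('c \<Rightarrow> 'a) \<Rightarrow> ('a \<Rightarrow> 'c) \<Rightarrow> bool" where
  "is_section M E pr \<sigma> \<longleftrightarrow> smooth_map M E \<sigma> \<and> (\<forall>x\<in>points M. pr (\<sigma> x) = x)"

text \<open>The manifold \<open>Q\<^sub>\<sigma>\<close>, of dimension \<open>6\<close>.\<close>
definition Q_atlas :: "(('b \<times> se3_pair) set, 'e::euclidean_space) atlas \<Rightarrow> ('a, 'f) atlas \<Rightarrow>
    ('a \<Rightarrow> ('b \<times> (real^3)) set) \<Rightarrow> (('b \<times> se3_pair) set, (real^3) \<times> (real^3)) atlas" where
  "Q_atlas P M \<sigma> = submanifold_atlas P {z \<in> points P. mod_K z \<in> \<sigma> ` points M}"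

text \<open>The form \<open>\<Sum>i. e\<^sup>i J\<^sub>i\<close> on \<open>Q\<^sub>\<sigma>\<close>; \<open>\<omega>\<close> is a connection form on \<open>P\<close>.\<close>
definition e_hat_Q where
  "e_hat_Q P M \<omega> \<sigma> = (\<lambda>z vs.
     \<Sum>i\<in>UNIV. (fst (pullback (Q_atlas P M \<sigma>) P id \<omega> z vs) $ i) *\<^sub>R se3_J i)"

definition e_hat where
  "e_hat P M p \<omega> \<sigma> =
     (THE a. a \<in> adP_forms P M p \<and> pullback (Q_atlas P M \<sigma>) P id a = e_hat_Q P M \<omega> \<sigma>)"

definition omega_sigma where
  "omega_sigma P M p \<omega> \<sigma> = \<omega> +\<^sub>f e_hat P M p \<omega> \<sigma>"

definition curvature where
  "curvature P \<omega> = ext_deriv P 1 \<omega> +\<^sub>f (1/2) *\<^sub>f wedge se3_bracket 1 1 \<omega> \<omega>"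

definition cov_deriv where
  "cov_deriv P \<omega> a = ext_deriv P 1 a +\<^sub>f wedge se3_bracket 1 1 \<omega> a"

text \<open>The Chern--Simons form \<open>CS\<^sub>p(\<omega>1, \<omega>0)\<close> for \<open>p = B\<close>, as a form on \<open>P\<close> and, descended, on \<open>M\<close>.\<close>
definition CS_upstairs where
  "CS_upstairs P B \<omega>1 \<omega>0 = (let a = \<omega>1 -\<^sub>f \<omega>0 in
     wedge B 1 2 a (cov_deriv P \<omega>0 a)
     +\<^sub>f (1/3) *\<^sub>f wedge B 1 2 a (wedge se3_bracket 1 1 a a)
     +\<^sub>f 2 *\<^sub>f wedge B 1 2 a (curvature P \<omega>0))"

definition CS :: "(('b \<times> se3_pair) set, 'e::euclidean_space) atlas \<Rightarrow>
    ('a, 'f::euclidean_space) atlas \<Rightarrow> ('b \<Rightarrow> 'a) \<Rightarrow> (se3 \<Rightarrow> se3 \<Rightarrow> real) \<Rightarrow>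
    (('b \<times> se3_pair) set, 'e, se3) form \<Rightarrow> (('b \<times> se3_pair) set, 'e, se3) form \<Rightarrow>
    ('a, 'f, real) form" where
  "CS P M p B \<omega>1 \<omega>0 = descend 3 P M (bundle_proj p) (CS_upstairs P B \<omega>1 \<omega>0)"

end

(*
  Lift the section to an equivariant map s from the universal covering to R^3. On the product of the
  universal covering with SE(3), at a group element g = (v, A), the flat connection is the Maurer--Cartan
  form g^-1 dg = (A^T dv, A^T dA). The form e_hat lives on Q_sigma, which is given by v = s, and equals
  (0, A^T ds) there; being horizontal and equivariant, it extends uniquely to
  a = Ad(g^-1)(s x ds, ds) = (A^T ((s - v) x ds), A^T ds).
  Since Ad(g^-1) turns d into the covariant derivative, d_omega a = Ad(g^-1)(ds x ds, 0), and the curvature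
  vanishes. Put tau = A^T (s - v), theta = A^T ds and let D be the determinant of ds. Then
  <a, d_omega a> = 6 c2 D, where only the pairing of J with P contributes, while <a, [a, a]> = 6 c1 D: the
  c2-part is linear in tau and vanishes since triple products are invariant under the infinitesimal
  rotation tau. Hence CS = (6 c2 + 2 c1) D, and D is the pullback of the volume form along s. All of this
  is computed upstairs, and forms on M are determined by their pullbacks.
*)

theory Submission
  imports Defs
begin

section \<open>Calculus of smooth functions\<close>

text \<open>Two kinds of definition shape the proof. \<open>descend\<close>, \<open>e_hat\<close>
  and \<open>vol_G\<close> are definite descriptions, so each becomes usable only after existence
  and uniqueness of the form are proved. Forms on \<open>P\<close> and \<open>P/K\<close> exist by
  invariance under deck transformations, and descended forms are unique because the projections have
  local right inverses. \<open>submanifold_atlas\<close> collects whatever admissible charts there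
  are and could be empty, so charts must be exhibited: Rodrigues coordinates for
  \<open>SE(3)\<close>, the graph v = s for \<open>Q_\<sigma>\<close>. That the lift s exists and is
  unique rests on deck transformations acting simply transitively on the fibres of \<open>p\<close>.
  This follows from unique lifting on a connected space together with the end-point rule of
  \<open>deck_action\<close>. In the coefficient, 6 c2 consists of three cyclic terms 2 c2, the 2
  coming from antisymmetrising ds x ds; 2 c1 is one third of three terms 2 c1, which come from
  [a, a].\<close>

lemma frechet_derivative_cong_open:
  assumes "open S" "x \<in> S" "\<And>y. y \<in> S \<Longrightarrow> f y = g y"
  shows "frechet_derivative f (at x) = frechet_derivative g (at x)"
proof -
  \<comment> \<open>\<open>frechet_derivative\<close> is a choice among the admissible
    \<open>D\<close>. Equal sets of admissible \<open>D\<close> lead to the same choice, whether or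
    not the functions are differentiable.\<close>
  have "(f has_derivative D) (at x) \<longleftrightarrow> (g has_derivative D) (at x)" for D
    using has_derivative_transform_within_open[OF _ assms(1,2), of f D UNIV g]
      has_derivative_transform_within_open[OF _ assms(1,2), of g D UNIV f] assms(3) by auto
  then show ?thesis by (simp add: frechet_derivative_def)
qed

lemma Ck_on_SucD: "Ck_on (Suc k) S f \<Longrightarrow> Ck_on k S f"
proof (induction k arbitrary: f)
  case 0
  then show ?case
    by (auto intro!: continuous_at_imp_continuous_on differentiable_imp_continuous_within)
next
  case (Suc k)
  then show ?case by (metis Ck_on.simps(2))
qed

lemma Ck_on_subset: "Ck_on k S f \<Longrightarrow> T \<subseteq> S \<Longrightarrow> Ck_on k T f"
  by (induction k arbitrary: f) (auto intro: continuous_on_subset)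

text \<open>On an open set agreement of functions passes to their derivatives, so the recursion can
  be followed down.\<close>

lemma Ck_on_cong:
  assumes "open S" "\<And>x. x \<in> S \<Longrightarrow> f x = g x" "Ck_on k S f"
  shows "Ck_on k S g"
  using assms(2,3)
proof (induction k arbitrary: f g)
  case 0
  then show ?case using continuous_on_cong[of S S f g] by simp
next
  case (Suc k)
  have D: "frechet_derivative f (at x) = frechet_derivative g (at x)" if "x \<in> S" for x
    using frechet_derivative_cong_open[OF assms(1) that, of f g] Suc.prems(1) by simp
  have "g differentiable (at x)" if "x \<in> S" for x
  proof -
    have "(f has_derivative frechet_derivative f (at x)) (at x)"
      using Suc.prems(2) that by (simp add: frechet_derivative_works[symmetric])
    then show ?thesis
      using has_derivative_transform_within_open[OF _ assms(1) that, of f _ UNIV g] Suc.prems(1)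
      unfolding differentiable_def by blast
  qed
  moreover have "Ck_on k S (\<lambda>x. frechet_derivative g (at x) v)" for v
    by (rule Suc.IH[of "\<lambda>x. frechet_derivative f (at x) v"]) (use D Suc.prems in auto)
  ultimately show ?case by simp
qed

text \<open>The working form of the successor step: any explicit derivative may be supplied, since
  it must coincide with the chosen \<open>frechet_derivative\<close>.\<close>

lemma Ck_on_SucI:
  assumes "open S" "\<And>x. x \<in> S \<Longrightarrow> (f has_derivative f' x) (at x)"
    and "\<And>v. Ck_on k S (\<lambda>x. f' x v)"
  shows "Ck_on (Suc k) S f"
proof -
  have "f' x = frechet_derivative f (at x)" if "x \<in> S" for x
    using frechet_derivative_at assms(2)[OF that] by blast
  then have "Ck_on k S (\<lambda>x. frechet_derivative f (at x) v)" for v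
    by (intro Ck_on_cong[OF assms(1) _ assms(3)[of v]]) simp
  moreover have "f differentiable (at x)" if "x \<in> S" for x
    using assms(2)[OF that] unfolding differentiable_def by blast
  ultimately show ?thesis by simp
qed

lemma Ck_on_has_derivative:
  "Ck_on (Suc k) S f \<Longrightarrow> x \<in> S \<Longrightarrow> (f has_derivative frechet_derivative f (at x)) (at x)"
  by (simp add: frechet_derivative_works[symmetric])

lemma Ck_on_local:
  assumes "\<And>x. x \<in> S \<Longrightarrow> \<exists>T. open T \<and> x \<in> T \<and> Ck_on k T f"
  shows "Ck_on k S f"
  using assms
proof (induction k arbitrary: f)
  case 0
  have "continuous (at x) f" if "x \<in> S" for x
  proof -
    from 0[OF that] obtain T where "open T" "x \<in> T" "continuous_on T f" by auto
    then show ?thesis using continuous_on_eq_continuous_at by blast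
  qed
  then show ?case by (simp add: continuous_at_imp_continuous_on)
next
  case (Suc k)
  have "f differentiable (at x)" if "x \<in> S" for x
    using Suc.prems[OF that] by auto
  moreover have "Ck_on k S (\<lambda>x. frechet_derivative f (at x) v)" for v
    by (rule Suc.IH) (use Suc.prems in fastforce)
  ultimately show ?case by simp
qed

lemma Ck_on_const: "Ck_on k S (\<lambda>x. c)"
proof (induction k arbitrary: c)
  case (Suc k)
  then show ?case by simp
qed simp

lemma Ck_on_id: assumes "open S" shows "Ck_on k S (\<lambda>x. x)"
proof (cases k)
  case (Suc j)
  then show ?thesis using Ck_on_SucI[OF assms, of "\<lambda>x. x" "\<lambda>_ v. v" j] by (simp add: Ck_on_const)
qed simp

lemma Ck_on_linear:
  assumes L: "bounded_linear L" and S: "open S"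
  shows "Ck_on k S f \<Longrightarrow> Ck_on k S (\<lambda>x. L (f x))"
proof (induction k arbitrary: f)
  case 0
  then show ?case using bounded_linear.continuous_on[OF L] by simp
next
  case (Suc k)
  show ?case
  proof (rule Ck_on_SucI[OF S])
    show "((\<lambda>x. L (f x)) has_derivative (\<lambda>v. L (frechet_derivative f (at x) v))) (at x)"
      if "x \<in> S" for x
      using bounded_linear.has_derivative[OF L Ck_on_has_derivative[OF Suc.prems that]] .
  qed (use Suc in auto)
qed

lemma Ck_on_add:
  assumes S: "open S"
  shows "Ck_on k S f \<Longrightarrow> Ck_on k S g \<Longrightarrow> Ck_on k S (\<lambda>x. f x + g x)"
proof (induction k arbitrary: f g)
  case 0
  then show ?case by (simp add: continuous_on_add)
next
  case (Suc k)
  show ?case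
    by (rule Ck_on_SucI[OF S has_derivative_add[OF Ck_on_has_derivative Ck_on_has_derivative]])
       (use Suc in auto)
qed

text \<open>The product rule expresses the derivative through \<open>B\<close> again, with one
  factor differentiated. The other factor is lowered by one order, and the induction hypothesis
  applies to both summands.\<close>

lemma Ck_on_bilinear:
  assumes B: "bounded_bilinear B" and S: "open S"
  shows "Ck_on k S f \<Longrightarrow> Ck_on k S g \<Longrightarrow> Ck_on k S (\<lambda>x. B (f x) (g x))"
proof (induction k arbitrary: f g)
  case 0
  then show ?case using bounded_bilinear.continuous_on[OF B] by simp
next
  case (Suc k)
  show ?case
  proof (rule Ck_on_SucI[OF S bounded_bilinear.FDERIV[OF B Ck_on_has_derivative Ck_on_has_derivative]])
    show "Ck_on k S (\<lambda>x. B (f x) (frechet_derivative g (at x) v) +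
        B (frechet_derivative f (at x) v) (g x))" for v
      using Suc.prems by (intro Ck_on_add[OF S] Suc.IH Ck_on_SucD[OF Suc.prems(1)]
          Ck_on_SucD[OF Suc.prems(2)]) auto
  qed (use Suc.prems in auto)
qed

lemma Ck_on_sum:
  assumes "open S" "\<And>i. i \<in> I \<Longrightarrow> Ck_on k S (f i)"
  shows "Ck_on k S (\<lambda>x. \<Sum>i\<in>I. f i x)"
proof (cases "finite I")
  case True
  then show ?thesis using assms(2)
    by (induction I) (auto intro: Ck_on_add[OF assms(1)] Ck_on_const)
qed (simp add: Ck_on_const)

text \<open>Reduces a varying argument of a linear map to fixed vectors, which is what
  \<open>Ck_on\<close> and \<open>forms\<close> speak about.\<close>

lemma linear_basis_expansion:
  fixes L :: "'e::euclidean_space \<Rightarrow> 'v::real_normed_vector"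
  assumes "linear L"
  shows "L v = (\<Sum>b\<in>Basis. (v \<bullet> b) *\<^sub>R L b)"
proof -
  have "L v = L (\<Sum>b\<in>Basis. (v \<bullet> b) *\<^sub>R b)" by (simp add: euclidean_representation)
  also have "\<dots> = (\<Sum>b\<in>Basis. (v \<bullet> b) *\<^sub>R L b)"
    using assms by (simp add: linear_sum linear_scale)
  finally show ?thesis .
qed

lemma Ck_on_compose:
  fixes f :: "'e::euclidean_space \<Rightarrow> 'f::euclidean_space" and g :: "'f \<Rightarrow> 'v::real_normed_vector"
  assumes S: "open S" and T: "open T" and sub: "f ` S \<subseteq> T"
  shows "Ck_on k S f \<Longrightarrow> Ck_on k T g \<Longrightarrow> Ck_on k S (\<lambda>x. g (f x))"
proof (induction k arbitrary: g)
  case 0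
  then show ?case using continuous_on_compose2[OF _ _ sub] by simp
next
  case (Suc k)
  show ?case
  proof (rule Ck_on_SucI[OF S])
    \<comment> \<open>The chain rule evaluates the derivative of \<open>g\<close> in the direction
      \<open>frechet_derivative f (at x) v\<close>, which moves with \<open>x\<close>, whereas the
      recursion controls fixed directions only; hence the expansion in the basis.\<close>
    show "((\<lambda>x. g (f x)) has_derivative
        (\<lambda>v. \<Sum>b\<in>Basis. (frechet_derivative f (at x) v \<bullet> b) *\<^sub>R frechet_derivative g (at (f x)) b)) (at x)"
      if x: "x \<in> S" for x
    proof -
      have Dg: "(g has_derivative frechet_derivative g (at (f x))) (at (f x))"
        using Ck_on_has_derivative[OF Suc.prems(2)] sub x by blast
      show ?thesis
        using diff_chain_at[OF Ck_on_has_derivative[OF Suc.prems(1) x] Dg]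
        unfolding o_def linear_basis_expansion[OF has_derivative_linear[OF Dg],
            of "frechet_derivative f (at x) _"] .
    qed
    show "Ck_on k S (\<lambda>x. \<Sum>b\<in>Basis. (frechet_derivative f (at x) v \<bullet> b) *\<^sub>R
        frechet_derivative g (at (f x)) b)" for v
    proof (intro Ck_on_sum[OF S] Ck_on_bilinear[OF bounded_bilinear_scaleR S])
      fix b :: 'f
      show "Ck_on k S (\<lambda>x. frechet_derivative f (at x) v \<bullet> b)"
        by (rule Ck_on_linear[OF bounded_linear_inner_left S]) (use Suc.prems in simp)
      show "Ck_on k S (\<lambda>x. frechet_derivative g (at (f x)) b)"
        by (rule Suc.IH[OF Ck_on_SucD[OF Suc.prems(1)]]) (use Suc.prems(2) in simp)
    qed
  qed
qed

text \<open>The derivative -(1/x) v (1/x) is again a product of inverses and constants, so the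
  induction closes on itself.\<close>

lemma Ck_on_inverse: "Ck_on k (- {0}) (inverse :: real \<Rightarrow> real)"
proof (induction k)
  case 0
  then show ?case by (auto intro: continuous_on_inverse)
next
  case (Suc k)
  show ?case
  proof (rule Ck_on_SucI)
    show "Ck_on k (- {0}) (\<lambda>x. - (inverse x * v * inverse x))" for v :: real
      by (intro Ck_on_linear[OF bounded_linear_minus[OF bounded_linear_ident]]
          Ck_on_bilinear[OF bounded_bilinear_mult] Suc Ck_on_const) auto
  qed (auto intro!: has_derivative_inverse')
qed

named_theorems smooth_intros

lemma smooth_on_subset: "smooth_on S f \<Longrightarrow> T \<subseteq> S \<Longrightarrow> smooth_on T f"
  unfolding smooth_on_def using Ck_on_subset by blast

lemma smooth_on_cong:
  "open S \<Longrightarrow> (\<And>x. x \<in> S \<Longrightarrow> f x = g x) \<Longrightarrow> smooth_on S f \<Longrightarrow> smooth_on S g"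
  unfolding smooth_on_def using Ck_on_cong[of S f g] by blast

lemma smooth_on_local:
  "(\<And>x. x \<in> S \<Longrightarrow> \<exists>T. open T \<and> x \<in> T \<and> smooth_on T f) \<Longrightarrow> smooth_on S f"
  unfolding smooth_on_def by (meson Ck_on_local)

lemma smooth_on_const [smooth_intros]: "smooth_on S (\<lambda>x. c)"
  by (simp add: smooth_on_def Ck_on_const)

lemma smooth_on_ident [smooth_intros]: "open S \<Longrightarrow> smooth_on S (\<lambda>x. x)"
  by (simp add: smooth_on_def Ck_on_id)

lemma smooth_on_linear:
  "bounded_linear L \<Longrightarrow> open S \<Longrightarrow> smooth_on S f \<Longrightarrow> smooth_on S (\<lambda>x. L (f x))"
  by (simp add: smooth_on_def Ck_on_linear)

lemma smooth_on_bilinear: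
  "bounded_bilinear B \<Longrightarrow> open S \<Longrightarrow> smooth_on S f \<Longrightarrow> smooth_on S g \<Longrightarrow>
    smooth_on S (\<lambda>x. B (f x) (g x))"
  by (simp add: smooth_on_def Ck_on_bilinear)

lemma smooth_on_add [smooth_intros]:
  "open S \<Longrightarrow> smooth_on S f \<Longrightarrow> smooth_on S g \<Longrightarrow> smooth_on S (\<lambda>x. f x + g x)"
  by (simp add: smooth_on_def Ck_on_add)

lemma smooth_on_minus [smooth_intros]:
  "open S \<Longrightarrow> smooth_on S f \<Longrightarrow> smooth_on S (\<lambda>x. - f x)"
  using smooth_on_linear[OF bounded_linear_minus[OF bounded_linear_ident]] by blast

lemma smooth_on_diff [smooth_intros]:
  "open S \<Longrightarrow> smooth_on S f \<Longrightarrow> smooth_on S g \<Longrightarrow> smooth_on S (\<lambda>x. f x - g x)"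
  using smooth_on_add[OF _ _ smooth_on_minus, of S f g] by simp

lemmas smooth_on_mult [smooth_intros] = smooth_on_bilinear[OF bounded_bilinear_mult]
lemmas smooth_on_scaleR [smooth_intros] = smooth_on_bilinear[OF bounded_bilinear_scaleR]
lemmas smooth_on_inner [smooth_intros] = smooth_on_bilinear[OF bounded_bilinear_inner]
lemmas smooth_on_fst [smooth_intros] = smooth_on_linear[OF bounded_linear_fst]
lemmas smooth_on_snd [smooth_intros] = smooth_on_linear[OF bounded_linear_snd]
lemmas smooth_on_vec_nth [smooth_intros] = smooth_on_linear[OF bounded_linear_vec_nth]

lemma smooth_on_sum [smooth_intros]:
  "open S \<Longrightarrow> (\<And>i. i \<in> I \<Longrightarrow> smooth_on S (f i)) \<Longrightarrow> smooth_on S (\<lambda>x. \<Sum>i\<in>I. f i x)"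
  by (simp add: smooth_on_def Ck_on_sum)

lemma smooth_on_compose:
  assumes "open S" "open T" "f ` S \<subseteq> T" "smooth_on S f" "smooth_on T g"
  shows "smooth_on S (\<lambda>x. g (f x))"
  using assms by (simp add: smooth_on_def Ck_on_compose)

lemma smooth_on_inverse [smooth_intros]:
  fixes f :: "'e::euclidean_space \<Rightarrow> real"
  assumes "open S" "smooth_on S f" "\<And>x. x \<in> S \<Longrightarrow> f x \<noteq> 0"
  shows "smooth_on S (\<lambda>x. inverse (f x))"
  by (rule smooth_on_compose[OF assms(1), of "- {0}"])
     (use assms in \<open>auto simp: smooth_on_def Ck_on_inverse\<close>)

lemma smooth_on_Pair [smooth_intros]:
  assumes "open S" "smooth_on S f" "smooth_on S g"
  shows "smooth_on S (\<lambda>x. (f x, g x))"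
proof -
  have "bounded_linear (\<lambda>x::'b. (x, 0::'c))" "bounded_linear (\<lambda>x::'c. (0::'b, x))"
    by (auto intro: bounded_linear_Pair bounded_linear_ident bounded_linear_zero)
  then have "smooth_on S (\<lambda>x. (f x, 0) + (0, g x))"
    using assms by (intro smooth_on_add smooth_on_linear[of "\<lambda>x. (x, 0)"] smooth_on_linear[of "\<lambda>x. (0, x)"])
  then show ?thesis by simp
qed

lemma smooth_on_euclidean:
  fixes f :: "'e::euclidean_space \<Rightarrow> 'f::euclidean_space"
  assumes "open S" "\<And>b. b \<in> Basis \<Longrightarrow> smooth_on S (\<lambda>x. f x \<bullet> b)"
  shows "smooth_on S f"
proof -
  have "smooth_on S (\<lambda>x. \<Sum>b\<in>Basis. (f x \<bullet> b) *\<^sub>R b)"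
    using assms by (intro smooth_on_sum smooth_on_scaleR smooth_on_const) auto
  then show ?thesis by (simp add: euclidean_representation)
qed

lemma smooth_on_vec:
  fixes f :: "'e::euclidean_space \<Rightarrow> 'f::euclidean_space^'n"
  assumes "open S" "\<And>i. smooth_on S (\<lambda>x. f x $ i)"
  shows "smooth_on S f"
proof (rule smooth_on_euclidean[OF assms(1)])
  fix b :: "'f^'n" assume "b \<in> Basis"
  then obtain i u where "b = axis i u" by (auto simp: Basis_vec_def)
  then show "smooth_on S (\<lambda>x. f x \<bullet> b)"
    using assms by (simp add: inner_axis smooth_on_inner smooth_on_const)
qed

lemma smooth_on_derivative [smooth_intros]:
  "smooth_on S f \<Longrightarrow> smooth_on S (\<lambda>x. frechet_derivative f (at x) v)"
  unfolding smooth_on_def using Ck_on.simps(2) by blast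

lemma smooth_on_has_derivative:
  "smooth_on S f \<Longrightarrow> x \<in> S \<Longrightarrow> (f has_derivative frechet_derivative f (at x)) (at x)"
  unfolding smooth_on_def using Ck_on_has_derivative by blast

lemma smooth_on_imp_continuous_on: "smooth_on S f \<Longrightarrow> continuous_on S f"
  unfolding smooth_on_def using Ck_on.simps(1) by blast

lemma smooth_on_linear_derivative:
  "smooth_on S f \<Longrightarrow> x \<in> S \<Longrightarrow> linear (frechet_derivative f (at x))"
  using smooth_on_has_derivative has_derivative_linear by blast

lemma smooth_on_derivative_compose:
  assumes "smooth_on S f" "x \<in> S" "smooth_on T g" "f x \<in> T"
  shows "frechet_derivative (\<lambda>x. g (f x)) (at x) v
      = frechet_derivative g (at (f x)) (frechet_derivative f (at x) v)"
  using frechet_derivative_at[OF diff_chain_at[OF smooth_on_has_derivative[OF assms(1,2)]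
      smooth_on_has_derivative[OF assms(3,4)]]]
  by (simp add: o_def fun_eq_iff)

section \<open>Symmetry of mixed second derivatives\<close>

lemma second_difference:
  fixes f :: "'e::euclidean_space \<Rightarrow> real"
  assumes S: "smooth_on (ball x e) f" and s: "0 < s" "s * (norm v + norm w) < e"
  shows "\<exists>\<xi>\<in>cball x (s * (norm v + norm w)).
    f (x + s *\<^sub>R v + s *\<^sub>R w) - f (x + s *\<^sub>R v) - f (x + s *\<^sub>R w) + f x
      = s * s * frechet_derivative (\<lambda>y. frechet_derivative f (at y) v) (at \<xi>) w"
proof -
  let ?D = "\<lambda>y. frechet_derivative f (at y)"
  \<comment> \<open>The whole parallelogram lies in this closed ball, hence so does the intermediate
    point found below.\<close>
  have cball: "x + a *\<^sub>R v + b *\<^sub>R w \<in> cball x (s * (norm v + norm w))"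
    if "0 \<le> a" "a \<le> s" "0 \<le> b" "b \<le> s" for a b
  proof -
    have "norm (a *\<^sub>R v + b *\<^sub>R w) \<le> a * norm v + b * norm w"
      using that norm_triangle_ineq[of "a *\<^sub>R v" "b *\<^sub>R w"] by simp
    also have "\<dots> \<le> s * norm v + s * norm w"
      using that by (intro add_mono mult_right_mono) auto
    finally have "norm (a *\<^sub>R v + b *\<^sub>R w) \<le> s * (norm v + norm w)"
      by (simp add: algebra_simps)
    moreover have "dist x (x + a *\<^sub>R v + b *\<^sub>R w) = norm (a *\<^sub>R v + b *\<^sub>R w)"
      using norm_minus_cancel[of "a *\<^sub>R v + b *\<^sub>R w"] by (simp add: dist_norm algebra_simps)
    ultimately show ?thesis by simp
  qed
  have ball: "x + a *\<^sub>R v + b *\<^sub>R w \<in> ball x e"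
    if "0 \<le> a" "a \<le> s" "0 \<le> b" "b \<le> s" for a b
    using cball[OF that] s by (auto simp: mem_ball mem_cball)
  have D1: "((\<lambda>a. f (x + a *\<^sub>R v + b *\<^sub>R w)) has_real_derivative ?D (x + a *\<^sub>R v + b *\<^sub>R w) v) (at a)"
    if "0 \<le> a" "a \<le> s" "0 \<le> b" "b \<le> s" for a b
  proof -
    have "((\<lambda>a. x + a *\<^sub>R v + b *\<^sub>R w) has_derivative (\<lambda>r. r *\<^sub>R v)) (at a)"
      by (auto intro!: derivative_eq_intros)
    from diff_chain_at[OF this smooth_on_has_derivative[OF S ball[OF that]]]
    show ?thesis
      using linear_scale[OF smooth_on_linear_derivative[OF S ball[OF that]]]
      by (simp add: o_def has_field_derivative_def mult_commute_abs)
  qed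
  have D2: "((\<lambda>b. ?D (x + a *\<^sub>R v + b *\<^sub>R w) v) has_real_derivative
      frechet_derivative (\<lambda>y. ?D y v) (at (x + a *\<^sub>R v + b *\<^sub>R w)) w) (at b)"
    if "0 \<le> a" "a \<le> s" "0 \<le> b" "b \<le> s" for a b
  proof -
    note S' = smooth_on_derivative[OF S, of v]
    have "((\<lambda>b. x + a *\<^sub>R v + b *\<^sub>R w) has_derivative (\<lambda>r. r *\<^sub>R w)) (at b)"
      by (auto intro!: derivative_eq_intros)
    from diff_chain_at[OF this smooth_on_has_derivative[OF S' ball[OF that]]]
    show ?thesis
      using linear_scale[OF smooth_on_linear_derivative[OF S' ball[OF that]]]
      by (simp add: o_def has_field_derivative_def mult_commute_abs)
  qed
  \<comment> \<open>The mean value theorem is used twice: along \<open>v\<close> for the difference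
    \<open>h\<close> of two parallel edges, then along \<open>w\<close> for the resulting difference
    of first derivatives. Each use contributes one factor \<open>s\<close>.\<close>
  define h where "h a = f (x + a *\<^sub>R v + s *\<^sub>R w) - f (x + a *\<^sub>R v)" for a
  have "\<exists>a>0. a < s \<and> h s - h 0 = (s - 0) * (?D (x + a *\<^sub>R v + s *\<^sub>R w) v - ?D (x + a *\<^sub>R v) v)"
    by (rule MVT2) (use s D1[of _ s] D1[of _ 0] in \<open>auto simp: h_def intro!: DERIV_diff\<close>)
  then obtain a where a: "0 < a" "a < s"
    "h s - h 0 = s * (?D (x + a *\<^sub>R v + s *\<^sub>R w) v - ?D (x + a *\<^sub>R v) v)" by auto
  have "\<exists>b>0. b < s \<and> ?D (x + a *\<^sub>R v + s *\<^sub>R w) v - ?D (x + a *\<^sub>R v + 0 *\<^sub>R w) v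
      = (s - 0) * frechet_derivative (\<lambda>y. ?D y v) (at (x + a *\<^sub>R v + b *\<^sub>R w)) w"
    by (rule MVT2) (use s a D2[of a] in auto)
  then obtain b where b: "0 < b" "b < s"
    "?D (x + a *\<^sub>R v + s *\<^sub>R w) v - ?D (x + a *\<^sub>R v) v
      = s * frechet_derivative (\<lambda>y. ?D y v) (at (x + a *\<^sub>R v + b *\<^sub>R w)) w" by auto
  show ?thesis
    by (rule bexI[of _ "x + a *\<^sub>R v + b *\<^sub>R w"])
       (use a b cball[of a b] in \<open>auto simp: h_def algebra_simps\<close>)
qed

text \<open>The second difference is symmetric in \<open>v\<close> and \<open>w\<close>. Divided by
  \<open>s * s\<close> it is a value of either mixed derivative near \<open>x\<close>, and
  continuity at \<open>x\<close> forces the two to agree.\<close>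

lemma symmetric_second_derivative_real:
  fixes f :: "'e::euclidean_space \<Rightarrow> real"
  assumes "open S" "x \<in> S" "smooth_on S f"
  shows "frechet_derivative (\<lambda>y. frechet_derivative f (at y) v) (at x) w
       = frechet_derivative (\<lambda>y. frechet_derivative f (at y) w) (at x) v"
proof (rule ccontr)
  let ?A = "\<lambda>v w z. frechet_derivative (\<lambda>y. frechet_derivative f (at y) v) (at z) w"
  \<comment> \<open>Half the gap: a number within \<open>\<delta>\<close> of one mixed derivative is
    not within \<open>\<delta>\<close> of the other.\<close>
  define \<delta> where "\<delta> = \<bar>?A v w x - ?A w v x\<bar> / 2"
  assume "\<not> ?thesis"
  then have \<delta>: "\<delta> > 0" by (simp add: \<delta>_def)
  obtain e where e: "e > 0" "ball x e \<subseteq> S" using assms openE by blast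
  have S: "smooth_on (ball x e) f" using smooth_on_subset assms e by blast
  have "continuous (at x) (?A v w)" "continuous (at x) (?A w v)"
    using smooth_on_imp_continuous_on[OF smooth_on_derivative[OF smooth_on_derivative[OF S]]] e
    by (auto simp: continuous_on_eq_continuous_at)
  then obtain d1 d2 where d: "d1 > 0" "\<forall>z. dist z x < d1 \<longrightarrow> dist (?A v w z) (?A v w x) < \<delta>"
     "d2 > 0" "\<forall>z. dist z x < d2 \<longrightarrow> dist (?A w v z) (?A w v x) < \<delta>"
    using \<delta> unfolding continuous_at_eps_delta by metis
  define m where "m = min e (min d1 d2)"
  \<comment> \<open>Small enough for the parallelogram to stay in all three balls; the summand 1
    keeps the denominator positive when \<open>v\<close> and \<open>w\<close> vanish.\<close>
  define s where "s = m / (2 * (norm v + norm w + 1))"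
  have m: "m > 0" using e d by (simp add: m_def)
  have s: "s > 0" "s * (norm v + norm w) < m"
  proof -
    have n: "norm v + norm w + 1 > 0" by (smt (verit) norm_ge_zero)
    then show "s > 0" using m by (simp add: s_def)
    have "s * (norm v + norm w) < s * (2 * (norm v + norm w + 1))"
      using \<open>s > 0\<close> by (smt (verit) norm_ge_zero mult_strict_left_mono)
    also have "\<dots> = m" using n by (simp add: s_def)
    finally show "s * (norm v + norm w) < m" .
  qed
  obtain \<xi> where \<xi>: "\<xi> \<in> cball x (s * (norm v + norm w))"
    "f (x + s *\<^sub>R v + s *\<^sub>R w) - f (x + s *\<^sub>R v) - f (x + s *\<^sub>R w) + f x = s * s * ?A v w \<xi>"
    using second_difference[OF S s(1), of v w] s(2) by (auto simp: m_def)
  obtain \<zeta> where \<zeta>: "\<zeta> \<in> cball x (s * (norm w + norm v))"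
    "f (x + s *\<^sub>R w + s *\<^sub>R v) - f (x + s *\<^sub>R w) - f (x + s *\<^sub>R v) + f x = s * s * ?A w v \<zeta>"
    using second_difference[OF S s(1), of w v] s(2) by (auto simp: m_def add.commute)
  have "s * s * ?A v w \<xi> = s * s * ?A w v \<zeta>"
    using \<xi>(2) \<zeta>(2) by (simp add: algebra_simps)
  then have "?A v w \<xi> = ?A w v \<zeta>" using s by simp
  moreover have "dist (?A v w \<xi>) (?A v w x) < \<delta>" "dist (?A w v \<zeta>) (?A w v x) < \<delta>"
    using d(2,4) \<xi>(1) \<zeta>(1) s(2) by (auto simp: m_def dist_commute add.commute)
  ultimately show False by (simp add: \<delta>_def dist_real_def abs_if split: if_splits)
qed

text \<open>Passes to components, because the mean value theorem is about real values.\<close>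

lemma symmetric_second_derivative:
  fixes f :: "'e::euclidean_space \<Rightarrow> 'v::euclidean_space"
  assumes S: "open S" "x \<in> S" "smooth_on S f"
  shows "frechet_derivative (\<lambda>y. frechet_derivative f (at y) v) (at x) w
       = frechet_derivative (\<lambda>y. frechet_derivative f (at y) w) (at x) v"
proof (rule euclidean_eqI)
  fix b :: 'v assume "b \<in> Basis"
  have 1: "frechet_derivative (\<lambda>y. g y \<bullet> b) (at y) u = frechet_derivative g (at y) u \<bullet> b"
    if "smooth_on S g" "y \<in> S" for g :: "'e \<Rightarrow> 'v" and y u
  proof -
    have "((\<lambda>y. g y \<bullet> b) has_derivative (\<lambda>u. frechet_derivative g (at y) u \<bullet> b)) (at y)"
      using smooth_on_has_derivative[OF that] by (rule has_derivative_inner_left)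
    then show ?thesis by (metis frechet_derivative_at)
  qed
  have 2: "frechet_derivative (\<lambda>y. frechet_derivative f (at y) v) (at x) w \<bullet> b
     = frechet_derivative (\<lambda>y. frechet_derivative (\<lambda>y. f y \<bullet> b) (at y) v) (at x) w" for v w
  proof -
    have "frechet_derivative (\<lambda>y. frechet_derivative (\<lambda>y. f y \<bullet> b) (at y) v) (at x)
        = frechet_derivative (\<lambda>y. frechet_derivative f (at y) v \<bullet> b) (at x)"
      by (rule frechet_derivative_cong_open[OF S(1,2)]) (use 1 S in auto)
    then show ?thesis using 1[OF smooth_on_derivative[OF S(3)] S(2)] by simp
  qed
  show "frechet_derivative (\<lambda>y. frechet_derivative f (at y) v) (at x) w \<bullet> b
     = frechet_derivative (\<lambda>y. frechet_derivative f (at y) w) (at x) v \<bullet> b"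
    unfolding 2 by (rule symmetric_second_derivative_real[OF S(1,2)])
      (intro smooth_intros S)
qed

section \<open>Atlases and smooth maps\<close>

text \<open>The conditions of \<open>manifold\<close> that are checked chart by chart. The calculus
  of forms works with these, and they pass directly to products, open subsets, submanifolds and
  quotients.\<close>

definition smooth_atlas :: "('a, 'e::euclidean_space) atlas \<Rightarrow> bool" where
  "smooth_atlas A \<longleftrightarrow>
     (\<forall>c\<in>A. inj_on (snd c) (fst c) \<and> open (snd c ` fst c)) \<and>
     (\<forall>c\<in>A. \<forall>d\<in>A. open (snd c ` (fst c \<inter> fst d)) \<and>
        smooth_on (snd c ` (fst c \<inter> fst d)) (transition c d))"

definition coord_map :: "('a, 'e) chart \<Rightarrow> ('b, 'f) chart \<Rightarrow> ('a \<Rightarrow> 'b) \<Rightarrow> 'e \<Rightarrow> 'f" where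
  "coord_map c d f = snd d \<circ> f \<circ> chart_inv c"

definition dmap :: "('a, 'e::euclidean_space) chart \<Rightarrow> ('b, 'f::euclidean_space) chart \<Rightarrow>
    ('a \<Rightarrow> 'b) \<Rightarrow> 'a \<Rightarrow> 'e \<Rightarrow> 'f" where
  "dmap c d f x = frechet_derivative (coord_map c d f) (at (snd c x))"

lemma manifold_smooth_atlas: "manifold A \<Longrightarrow> smooth_atlas A"
  by (simp add: manifold_def smooth_atlas_def)

lemma smooth_atlas_inj: "smooth_atlas A \<Longrightarrow> c \<in> A \<Longrightarrow> inj_on (snd c) (fst c)"
  and smooth_atlas_open: "smooth_atlas A \<Longrightarrow> c \<in> A \<Longrightarrow> open (snd c ` fst c)"
  by (auto simp: smooth_atlas_def)

lemma transition_coord_map: "transition c d = coord_map c d id"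
  by (simp add: transition_def coord_map_def)

lemma coord_map_apply: "coord_map c d f y = snd d (f (chart_inv c y))"
  by (simp add: coord_map_def)

lemma smooth_atlas_overlap:
  assumes "smooth_atlas A" "c \<in> A" "d \<in> A"
  shows "open (snd c ` (fst c \<inter> fst d))" "smooth_on (snd c ` (fst c \<inter> fst d)) (coord_map c d id)"
  using assms by (auto simp: smooth_atlas_def transition_coord_map)

lemma points_iff: "x \<in> points A \<longleftrightarrow> (\<exists>c\<in>A. x \<in> fst c)"
  by (auto simp: points_def)

lemma chart_inv_in: "y \<in> snd c ` fst c \<Longrightarrow> chart_inv c y \<in> fst c"
  and snd_chart_inv: "y \<in> snd c ` fst c \<Longrightarrow> snd c (chart_inv c y) = y"
  by (simp_all add: chart_inv_def inv_into_into f_inv_into_f)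

lemma chart_inv_snd:
  "smooth_atlas A \<Longrightarrow> c \<in> A \<Longrightarrow> x \<in> fst c \<Longrightarrow> chart_inv c (snd c x) = x"
  by (simp add: chart_inv_def smooth_atlas_inj)

lemma chart_at_in: assumes "x \<in> points A" shows "chart_at A x \<in> A" "x \<in> fst (chart_at A x)"
proof -
  have "\<exists>c. c \<in> A \<and> x \<in> fst c" using assms by (auto simp: points_def)
  then have "chart_at A x \<in> A \<and> x \<in> fst (chart_at A x)" unfolding chart_at_def by (rule someI_ex)
  then show "chart_at A x \<in> A" "x \<in> fst (chart_at A x)" by auto
qed

lemma openin_atlas:
  assumes "smooth_atlas A"
  shows "openin (mtop A) W \<longleftrightarrow> W \<subseteq> points A \<and> (\<forall>c\<in>A. open (snd c ` (fst c \<inter> W)))"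
  by (rule openin_mtop) (use assms in \<open>simp add: smooth_atlas_def\<close>)

lemma topspace_mtop: assumes "smooth_atlas A" shows "topspace (mtop A) = points A"
proof -
  have "fst c \<inter> points A = fst c" if "c \<in> A" for c using that by (auto simp: points_def)
  then have "openin (mtop A) (points A)"
    by (simp add: openin_atlas[OF assms] smooth_atlas_open[OF assms])
  then show ?thesis
    using openin_atlas[OF assms, of "topspace (mtop A)"] by (auto dest: openin_subset)
qed

text \<open>Read in another chart \<open>d\<close>, the set is the preimage of \<open>U\<close>
  under the transition from \<open>d\<close> to \<open>c\<close>, which is continuous on an open
  domain.\<close>

lemma openin_chart_image:
  assumes A: "smooth_atlas A" and c: "c \<in> A" and U: "open U" "U \<subseteq> snd c ` fst c"
  shows "openin (mtop A) (chart_inv c ` U)"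
  unfolding openin_atlas[OF A]
proof (intro conjI ballI)
  have "chart_inv c u \<in> fst c" if "u \<in> U" for u
    using chart_inv_in[of u c] U(2) that by blast
  then show "chart_inv c ` U \<subseteq> points A"
    using c unfolding points_iff subset_iff by blast
  fix d assume d: "d \<in> A"
  let ?T = "snd d ` (fst d \<inter> fst c)"
  have "snd d ` (fst d \<inter> chart_inv c ` U) = ?T \<inter> coord_map d c id -` U"
  proof (intro equalityI subsetI)
    fix z assume "z \<in> snd d ` (fst d \<inter> chart_inv c ` U)"
    then obtain u where u: "u \<in> U" "chart_inv c u \<in> fst d" "z = snd d (chart_inv c u)" by auto
    moreover have "coord_map d c id z = u"
      using u U(2) snd_chart_inv[of u c] by (simp add: coord_map_apply chart_inv_snd[OF A d] subset_iff)
    ultimately show "z \<in> ?T \<inter> coord_map d c id -` U"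
      using U(2) chart_inv_in[of u c] by blast
  next
    fix z assume z: "z \<in> ?T \<inter> coord_map d c id -` U"
    then obtain x where x: "x \<in> fst d" "x \<in> fst c" "z = snd d x" by auto
    then have "snd c x \<in> U" using z by (simp add: coord_map_apply chart_inv_snd[OF A d])
    then have "x \<in> chart_inv c ` U" using x chart_inv_snd[OF A c x(2)] by force
    then show "z \<in> snd d ` (fst d \<inter> chart_inv c ` U)" using x by auto
  qed
  moreover have "open (?T \<inter> coord_map d c id -` U)"
    using smooth_on_imp_continuous_on[OF smooth_atlas_overlap(2)[OF A d c]]
      smooth_atlas_overlap(1)[OF A d c] U(1) by (auto intro: continuous_open_preimage)
  ultimately show "open (snd d ` (fst d \<inter> chart_inv c ` U))" by simp
qed

lemma chart_inv_range:
  assumes "smooth_atlas A" "c \<in> A" shows "chart_inv c ` (snd c ` fst c) = fst c"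
  using chart_inv_snd[OF assms] by (force simp: image_image)

lemma openin_chart: "smooth_atlas A \<Longrightarrow> c \<in> A \<Longrightarrow> openin (mtop A) (fst c)"
  using openin_chart_image[of A c "snd c ` fst c"] chart_inv_range[of A c] smooth_atlas_open[of A c]
  by simp

lemma open_chart_Int: "smooth_atlas A \<Longrightarrow> c \<in> A \<Longrightarrow> openin (mtop A) W \<Longrightarrow> open (snd c ` (fst c \<inter> W))"
  by (simp add: openin_atlas)

lemma smooth_map_image: "smooth_map A B f \<Longrightarrow> smooth_atlas A \<Longrightarrow> smooth_atlas B \<Longrightarrow>
    x \<in> points A \<Longrightarrow> f x \<in> points B"
  using continuous_map_image_subset_topspace[of "mtop A" "mtop B" f]
  by (auto simp: smooth_map_def topspace_mtop)

lemma smooth_mapD: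
  assumes f: "smooth_map A B f" and A: "smooth_atlas A" and B: "smooth_atlas B"
    and c: "c \<in> A" and d: "d \<in> B"
  shows "open (snd c ` {x \<in> fst c. f x \<in> fst d})"
    "smooth_on (snd c ` {x \<in> fst c. f x \<in> fst d}) (coord_map c d f)"
proof -
  have "openin (mtop A) {x \<in> topspace (mtop A). f x \<in> fst d}"
    using f openin_chart[OF B d] unfolding smooth_map_def continuous_map_def by blast
  from open_chart_Int[OF A c this]
  have "open (snd c ` (fst c \<inter> {x \<in> points A. f x \<in> fst d}))" by (simp add: topspace_mtop[OF A])
  moreover have "fst c \<inter> {x \<in> points A. f x \<in> fst d} = {x \<in> fst c. f x \<in> fst d}"
    using c by (auto simp: points_def)
  ultimately show "open (snd c ` {x \<in> fst c. f x \<in> fst d})" by simp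
  show "smooth_on (snd c ` {x \<in> fst c. f x \<in> fst d}) (coord_map c d f)"
    using f c d by (simp add: smooth_map_def coord_map_def)
qed

lemma smooth_map_openin_preimage:
  assumes "smooth_map A B f" "smooth_atlas A" "openin (mtop B) W"
  shows "openin (mtop A) {x \<in> points A. f x \<in> W}"
  using assms openin_continuous_map_preimage[of "mtop A" "mtop B" f W]
  by (simp add: smooth_map_def topspace_mtop)

text \<open>\<open>smooth_map\<close> speaks of all pairs of charts and of global continuity. One
  good pair about each point suffices, because the expression in any other pair arises by
  composition with transition maps.\<close>

lemma smooth_mapI:
  assumes A: "smooth_atlas A" and B: "smooth_atlas B"
    and loc: "\<And>x. x \<in> points A \<Longrightarrow> \<exists>c\<in>A. \<exists>d\<in>B. \<exists>U. x \<in> fst c \<and> open U \<and> snd c x \<in> U \<and>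
      U \<subseteq> snd c ` fst c \<and> (\<forall>y\<in>U. f (chart_inv c y) \<in> fst d) \<and> smooth_on U (coord_map c d f)"
  shows "smooth_map A B f"
  unfolding smooth_map_def
proof (intro conjI ballI)
  show "continuous_map (mtop A) (mtop B) f"
    unfolding continuous_map_def topspace_mtop[OF A] topspace_mtop[OF B]
  proof (intro conjI allI impI)
    show "f \<in> points A \<rightarrow> points B"
    proof
      fix x assume "x \<in> points A"
      from loc[OF this] obtain c d U where cd: "c \<in> A" "d \<in> B" "x \<in> fst c" "snd c x \<in> U"
        "\<forall>y\<in>U. f (chart_inv c y) \<in> fst d" by blast
      then have "f x \<in> fst d" using chart_inv_snd[OF A cd(1,3)] by force
      then show "f x \<in> points B" using cd(2) by (auto simp: points_def)
    qed
    fix W assume W: "openin (mtop B) W"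
    show "openin (mtop A) {x \<in> points A. f x \<in> W}"
    proof (subst openin_subopen, intro ballI)
      fix x assume "x \<in> {x \<in> points A. f x \<in> W}"
      then have x: "x \<in> points A" "f x \<in> W" by auto
      from loc[OF x(1)] obtain c d U where cd: "c \<in> A" "d \<in> B" "x \<in> fst c" "open U" "snd c x \<in> U"
        "U \<subseteq> snd c ` fst c" "\<forall>y\<in>U. f (chart_inv c y) \<in> fst d" "smooth_on U (coord_map c d f)" by blast
      \<comment> \<open>The part of \<open>U\<close> that \<open>f\<close> sends into
        \<open>W\<close>, tested in the chart \<open>d\<close>; its image under
        \<open>chart_inv c\<close> is the neighbourhood sought.\<close>
      let ?V = "U \<inter> coord_map c d f -` (snd d ` (fst d \<inter> W))"
      have "open ?V"
        using continuous_open_preimage[OF smooth_on_imp_continuous_on[OF cd(8)] cd(4)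
            open_chart_Int[OF B cd(2) W]] .
      then have "openin (mtop A) (chart_inv c ` ?V)"
        using openin_chart_image[OF A cd(1)] cd(6) by blast
      moreover have "x \<in> chart_inv c ` ?V"
      proof (rule image_eqI[of _ _ "snd c x"])
        show "x = chart_inv c (snd c x)" using chart_inv_snd[OF A cd(1,3)] by simp
        then show "snd c x \<in> ?V" using cd(5,7) x(2) by (auto simp: coord_map_apply)
      qed
      moreover have "chart_inv c ` ?V \<subseteq> {x \<in> points A. f x \<in> W}"
      proof
        fix z assume "z \<in> chart_inv c ` ?V"
        then obtain y w where y: "y \<in> U" "z = chart_inv c y" "snd d (f z) = snd d w" "w \<in> fst d" "w \<in> W"
          by (auto simp: coord_map_apply)
        have fz: "f z \<in> fst d" using y(1,2) cd(7) by blast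
        have "f z = w" by (rule inj_onD[OF smooth_atlas_inj[OF B cd(2)] y(3) fz y(4)])
        moreover have "z \<in> fst c" using chart_inv_in[of "_" c] y(1,2) cd(6) by blast
        ultimately show "z \<in> {x \<in> points A. f x \<in> W}" using y cd(1) by (auto simp: points_def)
      qed
      ultimately show "\<exists>T. openin (mtop A) T \<and> x \<in> T \<and> T \<subseteq> {x \<in> points A. f x \<in> W}" by blast
    qed
  qed
next
  fix c' d' assume c': "c' \<in> A" and d': "d' \<in> B"
  show "smooth_on (snd c' ` {x \<in> fst c'. f x \<in> fst d'}) (snd d' \<circ> f \<circ> chart_inv c')"
  proof (rule smooth_on_local)
    fix y assume "y \<in> snd c' ` {x \<in> fst c'. f x \<in> fst d'}"
    then obtain x where x: "x \<in> fst c'" "f x \<in> fst d'" "y = snd c' x" by auto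
    then have "x \<in> points A" using c' by (auto simp: points_def)
    from loc[OF this] obtain c d U where cd: "c \<in> A" "d \<in> B" "x \<in> fst c" "open U" "snd c x \<in> U"
        "U \<subseteq> snd c ` fst c" "\<forall>y\<in>U. f (chart_inv c y) \<in> fst d" "smooth_on U (coord_map c d f)" by blast
    \<comment> \<open>\<open>V\<close> and \<open>T\<close> shrink the domain until both transitions
      are defined: from \<open>c'\<close> to \<open>c\<close> before the known expression, from
      \<open>d\<close> to \<open>d'\<close> after it.\<close>
    define V where "V = U \<inter> coord_map c d f -` (snd d ` (fst d \<inter> fst d'))"
    define T where "T = snd c' ` (fst c' \<inter> fst c) \<inter> coord_map c' c id -` V"
    have V: "open V" unfolding V_def
      by (rule continuous_open_preimage[OF smooth_on_imp_continuous_on[OF cd(8)] cd(4)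
            smooth_atlas_overlap(1)[OF B cd(2) d']])
    have T: "open T" unfolding T_def
      by (rule continuous_open_preimage[OF smooth_on_imp_continuous_on[OF smooth_atlas_overlap(2)[OF A c' cd(1)]]
            smooth_atlas_overlap(1)[OF A c' cd(1)] V])
    have fx: "f x \<in> fst d" using cd(5,7) chart_inv_snd[OF A cd(1,3)] by force
    have "snd c x \<in> V"
      using cd(3,5) fx x(2) by (auto simp: V_def coord_map_apply chart_inv_snd[OF A cd(1)])
    then have yT: "y \<in> T"
      using x cd(3) by (auto simp: T_def coord_map_apply chart_inv_snd[OF A c'])
    have "smooth_on T (\<lambda>y. coord_map d d' id (coord_map c d f (coord_map c' c id y)))"
    proof (rule smooth_on_compose[OF T smooth_atlas_overlap(1)[OF B cd(2) d'] _ _ smooth_atlas_overlap(2)[OF B cd(2) d']])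
      show "(\<lambda>x. coord_map c d f (coord_map c' c id x)) ` T \<subseteq> snd d ` (fst d \<inter> fst d')"
        by (auto simp: T_def V_def)
      show "smooth_on T (\<lambda>y. coord_map c d f (coord_map c' c id y))"
        by (rule smooth_on_compose[OF T cd(4) _ _ cd(8)])
           (use smooth_on_subset[OF smooth_atlas_overlap(2)[OF A c' cd(1)]] in \<open>auto simp: T_def V_def\<close>)
    qed
    moreover have "coord_map d d' id (coord_map c d f (coord_map c' c id z)) = (snd d' \<circ> f \<circ> chart_inv c') z"
      if "z \<in> T" for z
    proof -
      from that obtain u where u: "u \<in> fst c'" "u \<in> fst c" "z = snd c' u" and zV: "coord_map c' c id z \<in> V"
        unfolding T_def by blast
      have "snd c u \<in> V" using zV u by (simp add: coord_map_apply chart_inv_snd[OF A c'])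
      then have "f u \<in> fst d" using cd(7) chart_inv_snd[OF A cd(1) u(2)] unfolding V_def by force
      then show ?thesis
        using u by (simp add: coord_map_apply chart_inv_snd[OF A c'] chart_inv_snd[OF A cd(1)] chart_inv_snd[OF B cd(2)])
    qed
    ultimately have "smooth_on T (snd d' \<circ> f \<circ> chart_inv c')"
      by (rule smooth_on_cong[OF T, rotated])
    then show "\<exists>T. open T \<and> y \<in> T \<and> smooth_on T (snd d' \<circ> f \<circ> chart_inv c')" using T yT by blast
  qed
qed

lemma smooth_map_id: assumes "smooth_atlas A" shows "smooth_map A A id"
proof (rule smooth_mapI[OF assms assms])
  fix x assume "x \<in> points A"
  then obtain c where c: "c \<in> A" "x \<in> fst c" by (auto simp: points_def)
  show "\<exists>c\<in>A. \<exists>d\<in>A. \<exists>U. x \<in> fst c \<and> open U \<and> snd c x \<in> U \<and>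
      U \<subseteq> snd c ` fst c \<and> (\<forall>y\<in>U. id (chart_inv c y) \<in> fst d) \<and> smooth_on U (coord_map c d id)"
    using c smooth_atlas_open[OF assms c(1)] smooth_atlas_overlap(2)[OF assms c(1) c(1)]
    by (intro bexI[of _ c] exI[of _ "snd c ` fst c"]) (auto simp: chart_inv_in)
qed

lemma coord_map_compose:
  assumes "smooth_atlas B" "d \<in> B" "f (chart_inv c y) \<in> fst d"
  shows "coord_map c e (g \<circ> f) y = coord_map d e g (coord_map c d f y)"
  by (simp add: coord_map_apply chart_inv_snd[OF assms])

lemma smooth_map_compose:
  assumes f: "smooth_map A B f" and g: "smooth_map B C g"
    and A: "smooth_atlas A" and B: "smooth_atlas B" and C: "smooth_atlas C"
  shows "smooth_map A C (g \<circ> f)"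
proof (rule smooth_mapI[OF A C])
  fix x assume x: "x \<in> points A"
  have fx: "f x \<in> points B" using smooth_map_image[OF f A B x] .
  have gx: "g (f x) \<in> points C" using smooth_map_image[OF g B C fx] .
  obtain c d e where cde: "c \<in> A" "x \<in> fst c" "d \<in> B" "f x \<in> fst d" "e \<in> C" "g (f x) \<in> fst e"
    using x fx gx unfolding points_iff by blast
  define V where "V = snd d ` {x \<in> fst d. g x \<in> fst e}"
  define U where "U = snd c ` {x \<in> fst c. f x \<in> fst d} \<inter> coord_map c d f -` V"
  note Dg = smooth_mapD[OF g B C cde(3,5), folded V_def]
  note Df = smooth_mapD[OF f A B cde(1,3)]
  have U: "open U" unfolding U_def
    by (rule continuous_open_preimage[OF smooth_on_imp_continuous_on[OF Df(2)] Df(1) Dg(1)])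
  have fU: "f (chart_inv c y) \<in> fst d" "g (f (chart_inv c y)) \<in> fst e" if y: "y \<in> U" for y
  proof -
    obtain z where z: "z \<in> fst c" "f z \<in> fst d" "y = snd c z" using y by (auto simp: U_def)
    then have yz: "chart_inv c y = z" using chart_inv_snd[OF A cde(1)] by simp
    then show "f (chart_inv c y) \<in> fst d" using z by simp
    obtain u where u: "u \<in> fst d" "g u \<in> fst e" "snd d (f z) = snd d u"
      using y yz by (auto simp: U_def V_def coord_map_apply)
    have "f z = u" using inj_onD[OF smooth_atlas_inj[OF B cde(3)] u(3) z(2) u(1)] .
    then show "g (f (chart_inv c y)) \<in> fst e" using u yz by simp
  qed
  have "smooth_on U (\<lambda>y. coord_map d e g (coord_map c d f y))"
    by (rule smooth_on_compose[OF U Dg(1) _ _ Dg(2)])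
       (use smooth_on_subset[OF Df(2)] in \<open>auto simp: U_def\<close>)
  then have "smooth_on U (coord_map c e (g \<circ> f))"
    by (rule smooth_on_cong[OF U, rotated]) (rule coord_map_compose[OF B cde(3), symmetric], rule fU(1))
  moreover have "snd c x \<in> U" "U \<subseteq> snd c ` fst c"
    using cde by (auto simp: U_def V_def coord_map_apply chart_inv_snd[OF A cde(1)])
  ultimately show "\<exists>c\<in>A. \<exists>d\<in>C. \<exists>U. x \<in> fst c \<and> open U \<and> snd c x \<in> U \<and>
      U \<subseteq> snd c ` fst c \<and> (\<forall>y\<in>U. (g \<circ> f) (chart_inv c y) \<in> fst d) \<and> smooth_on U (coord_map c d (g \<circ> f))"
    using cde U fU by (intro bexI[of _ c] bexI[of _ e] exI[of _ U]) auto
qed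

text \<open>Maps are total functions with arbitrary values off the manifold. Two descriptions of one
  map, such as \<open>id\<close> and the extensional identity among the deck transformations, agree
  on \<open>points A\<close> only.\<close>

lemma smooth_map_cong:
  assumes f: "smooth_map A B f" and A: "smooth_atlas A" and B: "smooth_atlas B"
    and fg: "\<And>x. x \<in> points A \<Longrightarrow> f x = g x"
  shows "smooth_map A B g"
proof (rule smooth_mapI[OF A B])
  fix x assume x: "x \<in> points A"
  obtain c d where cd: "c \<in> A" "x \<in> fst c" "d \<in> B" "f x \<in> fst d"
    using x smooth_map_image[OF f A B x] unfolding points_iff by blast
  define U where "U = snd c ` {x \<in> fst c. f x \<in> fst d}"
  note D = smooth_mapD[OF f A B cd(1,3), folded U_def]
  have eq: "f (chart_inv c y) = g (chart_inv c y)" "f (chart_inv c y) \<in> fst d" if "y \<in> U" for y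
  proof -
    from that obtain z where z: "z \<in> fst c" "f z \<in> fst d" "y = snd c z" unfolding U_def by blast
    then have yz: "chart_inv c y = z" using chart_inv_snd[OF A cd(1)] by simp
    have "z \<in> points A" using z(1) cd(1) unfolding points_iff by blast
    from fg[OF this] show "f (chart_inv c y) = g (chart_inv c y)" unfolding yz .
    show "f (chart_inv c y) \<in> fst d" unfolding yz by (rule z(2))
  qed
  have "smooth_on U (coord_map c d g)"
    by (rule smooth_on_cong[OF D(1) _ D(2)]) (simp only: coord_map_apply eq(1))
  moreover have "snd c x \<in> U" "U \<subseteq> snd c ` fst c" using cd unfolding U_def by blast+
  moreover have "\<forall>y\<in>U. g (chart_inv c y) \<in> fst d" using eq by fastforce
  ultimately show "\<exists>c\<in>A. \<exists>d\<in>B. \<exists>U. x \<in> fst c \<and> open U \<and> snd c x \<in> U \<and>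
      U \<subseteq> snd c ` fst c \<and> (\<forall>y\<in>U. g (chart_inv c y) \<in> fst d) \<and> smooth_on U (coord_map c d g)"
    using cd D(1) by blast
qed

section \<open>Tangent vectors\<close>

lemma dmap_linear:
  assumes "smooth_map A B f" "smooth_atlas A" "smooth_atlas B" "c \<in> A" "d \<in> B" "x \<in> fst c" "f x \<in> fst d"
  shows "linear (dmap c d f x)"
  unfolding dmap_def
  by (rule smooth_on_linear_derivative[OF smooth_mapD(2)[OF assms(1-5)]]) (use assms in auto)

lemma dmap_compose:
  assumes f: "smooth_map A B f" and g: "smooth_map B C g"
    and A: "smooth_atlas A" and B: "smooth_atlas B" and C: "smooth_atlas C"
    and cde: "c \<in> A" "d \<in> B" "e \<in> C" "x \<in> fst c" "f x \<in> fst d" "g (f x) \<in> fst e"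
  shows "dmap c e (g \<circ> f) x w = dmap d e g (f x) (dmap c d f x w)"
proof -
  let ?U = "snd c ` {x \<in> fst c. f x \<in> fst d}"
  have x: "snd c x \<in> ?U" using cde by auto
  have "dmap c e (g \<circ> f) x = frechet_derivative (\<lambda>y. coord_map d e g (coord_map c d f y)) (at (snd c x))"
    unfolding dmap_def
    by (rule frechet_derivative_cong_open[OF smooth_mapD(1)[OF f A B cde(1,2)] x])
       (auto intro!: coord_map_compose[OF B cde(2)] simp: chart_inv_snd[OF A cde(1)])
  then have "dmap c e (g \<circ> f) x w = frechet_derivative (\<lambda>y. coord_map d e g (coord_map c d f y)) (at (snd c x)) w"
    by simp
  also have "\<dots> = frechet_derivative (coord_map d e g) (at (coord_map c d f (snd c x)))
       (frechet_derivative (coord_map c d f) (at (snd c x)) w)"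
    by (rule smooth_on_derivative_compose[OF smooth_mapD(2)[OF f A B cde(1,2)] x smooth_mapD(2)[OF g B C cde(2,3)]])
       (use cde in \<open>auto simp: coord_map_apply chart_inv_snd[OF A cde(1)]\<close>)
  also have "\<dots> = dmap d e g (f x) (dmap c d f x w)"
    by (simp add: dmap_def coord_map_apply chart_inv_snd[OF A cde(1,4)])
  finally show ?thesis .
qed

lemma dmap_cong:
  assumes A: "smooth_atlas A" and c: "c \<in> A" "x \<in> fst c" and fg: "\<And>z. z \<in> points A \<Longrightarrow> f z = g z"
  shows "dmap c d f x = dmap c d g x"
  unfolding dmap_def
proof (rule frechet_derivative_cong_open[OF smooth_atlas_open[OF A c(1)]])
  fix y assume "y \<in> snd c ` fst c"
  then have "chart_inv c y \<in> points A" using chart_inv_in[of y c] c(1) unfolding points_iff by blast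
  from fg[OF this] show "coord_map c d f y = coord_map c d g y" unfolding coord_map_apply by (rule arg_cong)
next
  show "snd c x \<in> snd c ` fst c" using c(2) by (rule imageI)
qed

lemma dmap_id:
  assumes A: "smooth_atlas A" and c: "c \<in> A" "x \<in> fst c"
  shows "dmap c c id x w = w"
proof -
  have "dmap c c id x = frechet_derivative (\<lambda>y. y) (at (snd c x))"
    unfolding dmap_def
    by (rule frechet_derivative_cong_open[OF smooth_atlas_open[OF A c(1)]])
       (use c in \<open>auto simp: coord_map_apply snd_chart_inv\<close>)
  then show ?thesis by simp
qed

lemma coord_vec_dmap:
  "coord_vec A c x w = (\<lambda>d. if d \<in> A \<and> x \<in> fst d then dmap c d id x w else 0)"
  unfolding coord_vec_def dmap_def transition_coord_map by (rule refl)

lemma pushforward_dmap: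
  "pushforward A B f x v = (\<lambda>d. if d \<in> B \<and> f x \<in> fst d
     then dmap (chart_at A x) d f x (v (chart_at A x)) else 0)"
  unfolding pushforward_def dmap_def coord_map_def Let_def by (rule refl)

lemma tangent_transition:
  "v \<in> tangent A x \<Longrightarrow> c \<in> A \<Longrightarrow> d \<in> A \<Longrightarrow> x \<in> fst c \<Longrightarrow> x \<in> fst d \<Longrightarrow> v d = dmap c d id x (v c)"
  unfolding tangent_def dmap_def transition_coord_map by blast

lemma tangent_outside: "v \<in> tangent A x \<Longrightarrow> d \<notin> A \<or> x \<notin> fst d \<Longrightarrow> v d = 0"
  unfolding tangent_def by blast

lemma tangentI:
  assumes "\<And>d. d \<notin> A \<or> x \<notin> fst d \<Longrightarrow> v d = 0"
    "\<And>c d. c \<in> A \<Longrightarrow> d \<in> A \<Longrightarrow> x \<in> fst c \<Longrightarrow> x \<in> fst d \<Longrightarrow> v d = dmap c d id x (v c)"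
  shows "v \<in> tangent A x"
  using assms unfolding tangent_def dmap_def transition_coord_map by blast

lemma dmap_trans:
  assumes "smooth_atlas A" "c \<in> A" "d \<in> A" "e \<in> A" "x \<in> fst c" "x \<in> fst d" "x \<in> fst e"
  shows "dmap c e id x w = dmap d e id x (dmap c d id x w)"
  using dmap_compose[OF smooth_map_id smooth_map_id, OF assms(1) assms(1) assms(1) assms(1) assms(1) assms(2-5)] assms
  by simp

text \<open>This is the cocycle property of the derivatives of transition maps.\<close>

lemma coord_vec_tangent:
  assumes "smooth_atlas A" "c \<in> A" "x \<in> fst c"
  shows "coord_vec A c x w \<in> tangent A x"
proof (rule tangentI)
  fix d e assume de: "d \<in> A" "e \<in> A" "x \<in> fst d" "x \<in> fst e"
  show "coord_vec A c x w e = dmap d e id x (coord_vec A c x w d)"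
    using dmap_trans[OF assms(1,2) de(1,2) assms(3) de(3,4)] de by (simp add: coord_vec_dmap)
qed (auto simp: coord_vec_dmap)

lemma coord_vec_same:
  assumes "smooth_atlas A" "c \<in> A" "x \<in> fst c"
  shows "coord_vec A c x w c = w"
  using assms by (simp add: coord_vec_dmap dmap_id)

lemma coord_vec_coord:
  assumes "v \<in> tangent A x" "c \<in> A" "x \<in> fst c"
  shows "coord_vec A c x (v c) = v"
proof
  fix d show "coord_vec A c x (v c) d = v d"
  proof (cases "d \<in> A \<and> x \<in> fst d")
    case True
    then show ?thesis
      using tangent_transition[OF assms(1,2) _ assms(3), of d] by (simp add: coord_vec_dmap)
  next
    case False
    then show ?thesis
      using tangent_outside[OF assms(1), of d] by (auto simp: coord_vec_dmap)
  qed
qed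

lemma tangent_eqI:
  assumes "v \<in> tangent A x" "v' \<in> tangent A x" "c \<in> A" "x \<in> fst c" "v c = v' c"
  shows "v = v'"
  using coord_vec_coord[OF assms(1,3,4)] coord_vec_coord[OF assms(2,3,4)] unfolding assms(5) by (rule trans[OF sym])

text \<open>\<open>pushforward\<close> is computed through the arbitrary chart
  \<open>chart_at\<close>; the compatibility built into tangent vectors makes every other chart give
  the same result.\<close>

lemma pushforward_apply:
  assumes f: "smooth_map A B f" and A: "smooth_atlas A" and B: "smooth_atlas B"
    and v: "v \<in> tangent A x" and cd: "c \<in> A" "x \<in> fst c" "d \<in> B" "f x \<in> fst d"
  shows "pushforward A B f x v d = dmap c d f x (v c)"
proof -
  let ?a = "chart_at A x"
  have "x \<in> points A" using cd unfolding points_iff by blast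
  note a = chart_at_in[OF this]
  have "dmap c d (f \<circ> id) x (v c) = dmap ?a d f x (dmap c ?a id x (v c))"
    using dmap_compose[OF smooth_map_id[OF A] f A A B cd(1) a(1) cd(3)] cd a by simp
  also have "dmap c ?a id x (v c) = v ?a"
    using tangent_transition[OF v cd(1) a(1) cd(2) a(2)] by simp
  finally show ?thesis using cd by (simp add: pushforward_dmap)
qed

lemma pushforward_coord_vec:
  assumes f: "smooth_map A B f" and A: "smooth_atlas A" and B: "smooth_atlas B"
    and cd: "c \<in> A" "x \<in> fst c" "d \<in> B" "f x \<in> fst d"
  shows "pushforward A B f x (coord_vec A c x w) = coord_vec B d (f x) (dmap c d f x w)"
proof
  fix e
  show "pushforward A B f x (coord_vec A c x w) e = coord_vec B d (f x) (dmap c d f x w) e"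
  proof (cases "e \<in> B \<and> f x \<in> fst e")
    case True
    then have "pushforward A B f x (coord_vec A c x w) e = dmap c e f x w"
      using pushforward_apply[OF f A B coord_vec_tangent[OF A cd(1,2)] cd(1,2), of e w]
        coord_vec_same[OF A cd(1,2)] by simp
    also have "\<dots> = dmap d e id (f x) (dmap c d f x w)"
      using dmap_compose[OF f smooth_map_id[OF B] A B B cd(1,3) _ cd(2,4), of e] True by simp
    finally show ?thesis using True by (simp add: coord_vec_dmap)
  next
    case False
    then show ?thesis by (auto simp: pushforward_dmap coord_vec_dmap)
  qed
qed

lemma tangent_coordE:
  assumes "v \<in> tangent A x" "c \<in> A" "x \<in> fst c"
  obtains w where "v = coord_vec A c x w"
  using coord_vec_coord[OF assms] by metis

lemma pushforward_tangent:
  assumes f: "smooth_map A B f" and A: "smooth_atlas A" and B: "smooth_atlas B"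
    and x: "x \<in> points A" and v: "v \<in> tangent A x"
  shows "pushforward A B f x v \<in> tangent B (f x)"
proof -
  obtain c d where cd: "c \<in> A" "x \<in> fst c" "d \<in> B" "f x \<in> fst d"
    using x smooth_map_image[OF f A B x] unfolding points_iff by blast
  obtain w where w: "v = coord_vec A c x w" by (rule tangent_coordE[OF v cd(1,2)])
  show ?thesis unfolding w pushforward_coord_vec[OF f A B cd]
    by (rule coord_vec_tangent[OF B cd(3,4)])
qed

lemma pushforward_compose:
  assumes f: "smooth_map A B f" and g: "smooth_map B C g"
    and A: "smooth_atlas A" and B: "smooth_atlas B" and C: "smooth_atlas C"
    and x: "x \<in> points A" and v: "v \<in> tangent A x"
  shows "pushforward A C (g \<circ> f) x v = pushforward B C g (f x) (pushforward A B f x v)"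
proof -
  have fx: "f x \<in> points B" using smooth_map_image[OF f A B x] .
  obtain c d e where cd: "c \<in> A" "x \<in> fst c" "d \<in> B" "f x \<in> fst d" and e: "e \<in> C" "g (f x) \<in> fst e"
    using x fx smooth_map_image[OF g B C fx] unfolding points_iff by blast
  obtain w where w: "v = coord_vec A c x w" by (rule tangent_coordE[OF v cd(1,2)])
  have "pushforward A C (g \<circ> f) x v = coord_vec C e (g (f x)) (dmap c e (g \<circ> f) x w)"
    using pushforward_coord_vec[OF smooth_map_compose[OF f g A B C] A C cd(1,2) e(1)] e(2) w by simp
  also have "dmap c e (g \<circ> f) x w = dmap d e g (f x) (dmap c d f x w)"
    by (rule dmap_compose[OF f g A B C cd(1,3) e(1) cd(2,4) e(2)])
  finally show ?thesis
    unfolding w pushforward_coord_vec[OF f A B cd] pushforward_coord_vec[OF g B C cd(3,4) e] .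
qed

lemma pushforward_cong:
  fixes B :: "('b, 'f::euclidean_space) atlas"
  assumes A: "smooth_atlas A" and x: "x \<in> points A" and fg: "\<And>z. z \<in> points A \<Longrightarrow> f z = g z"
  shows "pushforward A B f x = pushforward A B g x"
proof (intro ext)
  fix v and d :: "('b, 'f) chart"
  have "dmap (chart_at A x) d f x = dmap (chart_at A x) d g x"
    by (rule dmap_cong[OF A chart_at_in[OF x]]) (rule fg)
  then show "pushforward A B f x v d = pushforward A B g x v d"
    unfolding pushforward_dmap fg[OF x] by presburger
qed

text \<open>Tangent vectors are functions on charts, with pointwise linear structure. Differences
  are what the comparison of two lifts of one vector on the base requires.\<close>

lemma tangent_diff:
  assumes A: "smooth_atlas A" and x: "x \<in> points A" and v: "v \<in> tangent A x" "v' \<in> tangent A x"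
  shows "(\<lambda>d. v d - v' d) \<in> tangent A x"
proof (rule tangentI)
  fix c d assume cd: "c \<in> A" "d \<in> A" "x \<in> fst c" "x \<in> fst d"
  have "linear (dmap c d id x)" by (rule dmap_linear[OF smooth_map_id[OF A] A A cd(1,2,3)]) (use cd in simp)
  then show "v d - v' d = dmap c d id x (v c - v' c)"
    unfolding tangent_transition[OF v(1) cd] tangent_transition[OF v(2) cd] by (simp add: linear_diff)
qed (simp add: tangent_outside[OF v(1)] tangent_outside[OF v(2)])

lemma pushforward_diff:
  assumes f: "smooth_map A B f" and A: "smooth_atlas A" and B: "smooth_atlas B"
    and x: "x \<in> points A"
  shows "pushforward A B f x (\<lambda>d. v d - v' d) d = pushforward A B f x v d - pushforward A B f x v' d"
proof (cases "d \<in> B \<and> f x \<in> fst d")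
  case True
  then have "linear (dmap (chart_at A x) d f x)"
    using dmap_linear[OF f A B chart_at_in(1)[OF x] _ chart_at_in(2)[OF x]] by simp
  then show ?thesis using True by (simp add: pushforward_dmap linear_diff)
qed (auto simp: pushforward_dmap)

section \<open>Differential forms and pullbacks\<close>

text \<open>The pointwise condition in \<open>forms\<close>, split off so that it can be transported
  along linear maps.\<close>

definition alt_multilinear :: "nat \<Rightarrow> ('e::real_vector list \<Rightarrow> 'v::real_vector) \<Rightarrow> bool" where
  "alt_multilinear k g \<longleftrightarrow> (\<forall>ws. length ws = k \<longrightarrow>
     (\<forall>i<k. linear (\<lambda>w. g (ws[i := w]))) \<and>
     (\<forall>i<k. \<forall>j<k. i \<noteq> j \<and> ws ! i = ws ! j \<longrightarrow> g ws = 0))"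

lemma alt_multilinear_compose:
  fixes L :: "'a::real_vector \<Rightarrow> 'b::real_vector"
  assumes g: "alt_multilinear k g" and L: "linear L"
  shows "alt_multilinear k (\<lambda>ws. g (map L ws))"
  unfolding alt_multilinear_def
proof (intro allI impI conjI)
  fix ws :: "'a list" and i
  assume ws: "length ws = k" "i < k"
  have "linear ((\<lambda>w. g ((map L ws)[i := w])) \<circ> L)"
    using g ws by (intro linear_compose[OF L]) (simp add: alt_multilinear_def)
  then show "linear (\<lambda>w. g (map L (ws[i := w])))" by (simp add: o_def map_update)
next
  fix ws :: "'a list" and i j
  assume "length ws = k" "i < k" "j < k" "i \<noteq> j \<and> ws ! i = ws ! j"
  then show "g (map L ws) = 0"
    using g unfolding alt_multilinear_def by (metis length_map nth_map)
qed

text \<open>\<open>forms\<close> asks for smoothness with constant vectors inserted. Under a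
  pullback or a change of charts the inserted vectors vary with the point, and multilinearity
  reduces them to constant ones.\<close>

lemma smooth_on_multilinear:
  fixes \<theta> :: "'n::euclidean_space \<Rightarrow> 'f::euclidean_space list \<Rightarrow> 'v::real_normed_vector"
  assumes S: "open S" and T: "open T" and F: "smooth_on S F" "F ` S \<subseteq> T"
    and smooth: "\<And>ws. length ws = k \<Longrightarrow> smooth_on T (\<lambda>y. \<theta> y ws)"
    and lin: "\<And>y. y \<in> T \<Longrightarrow> alt_multilinear k (\<theta> y)"
    and hs: "length hs = k" "\<And>h. h \<in> set hs \<Longrightarrow> smooth_on S h"
  shows "smooth_on S (\<lambda>x. \<theta> (F x) (map (\<lambda>h. h x) hs))"
proof -
  \<comment> \<open>Induction on \<open>j\<close>: the slots from \<open>j\<close> on hold constant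
    functions, the first \<open>j\<close> slots may vary. At \<open>j = k\<close> the restriction is
    empty.\<close>
  have "\<forall>hs. length hs = k \<and> (\<forall>h\<in>set hs. smooth_on S h) \<and> (\<forall>i<k. j \<le> i \<longrightarrow> (\<exists>w. hs ! i = (\<lambda>_. w))) \<longrightarrow>
      smooth_on S (\<lambda>x. \<theta> (F x) (map (\<lambda>h. h x) hs))" if "j \<le> k" for j
    using that
  proof (induction j)
    case 0
    show ?case
    proof (intro allI impI, elim conjE)
      fix hs :: "('a \<Rightarrow> 'f) list"
      assume hs: "length hs = k" "\<forall>i<k. 0 \<le> i \<longrightarrow> (\<exists>w. hs ! i = (\<lambda>_. w))"
      have "map (\<lambda>h. h x) hs = map (\<lambda>h. h undefined) hs" for x
      proof (rule nth_equalityI)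
        fix i assume "i < length (map (\<lambda>h. h x) hs)"
        then obtain w where "i < k" "hs ! i = (\<lambda>_. w)" using hs by auto
        then show "map (\<lambda>h. h x) hs ! i = map (\<lambda>h. h undefined) hs ! i" using hs(1) by simp
      qed simp
      then have eq: "(\<lambda>x. \<theta> (F x) (map (\<lambda>h. h x) hs)) = (\<lambda>x. \<theta> (F x) (map (\<lambda>h. h undefined) hs))"
        by (intro ext) (rule arg_cong)
      show "smooth_on S (\<lambda>x. \<theta> (F x) (map (\<lambda>h. h x) hs))"
        unfolding eq by (rule smooth_on_compose[OF S T F(2,1) smooth]) (simp add: hs(1))
    qed
  next
    case (Suc j)
    show ?case
    proof (intro allI impI, elim conjE)
      fix hs :: "('a \<Rightarrow> 'f) list"
      assume hs: "length hs = k" "\<forall>h\<in>set hs. smooth_on S h"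
        "\<forall>i<k. Suc j \<le> i \<longrightarrow> (\<exists>w. hs ! i = (\<lambda>_. w))"
      have jk: "j < k" using Suc.prems by simp
      have sj: "smooth_on S (hs ! j)" using hs jk by simp
      have "smooth_on S (\<lambda>x. \<theta> (F x) (map (\<lambda>h. h x) (hs[j := \<lambda>_. b])))" for b
      proof (rule Suc.IH[rule_format])
        show "length (hs[j := \<lambda>_. b]) = k \<and> (\<forall>h\<in>set (hs[j := \<lambda>_. b]). smooth_on S h) \<and>
            (\<forall>i<k. j \<le> i \<longrightarrow> (\<exists>w. hs[j := \<lambda>_. b] ! i = (\<lambda>_. w)))"
        proof (intro conjI allI impI ballI)
          fix h assume "h \<in> set (hs[j := \<lambda>_. b])"
          then have "h \<in> set hs \<or> h = (\<lambda>_. b)" using set_update_subset_insert by fastforce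
          then show "smooth_on S h" using hs(2) smooth_on_const by blast
        next
          fix i assume "i < k" "j \<le> i"
          then show "\<exists>w. hs[j := \<lambda>_. b] ! i = (\<lambda>_. w)"
            using hs(1,3) jk by (cases "i = j") auto
        qed (simp add: hs(1))
      qed (use jk in simp)
      \<comment> \<open>Slot \<open>j\<close> is expanded in the basis; each summand is constant in
        that slot and falls under the induction hypothesis.\<close>
      then have "smooth_on S (\<lambda>x. \<Sum>b\<in>Basis. ((hs ! j) x \<bullet> b) *\<^sub>R \<theta> (F x) (map (\<lambda>h. h x) (hs[j := \<lambda>_. b])))"
        by (intro smooth_on_sum[OF S] smooth_on_scaleR[OF S] smooth_on_inner[OF S] sj smooth_on_const)
      then show "smooth_on S (\<lambda>x. \<theta> (F x) (map (\<lambda>h. h x) hs))"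
      proof (rule smooth_on_cong[OF S, rotated])
        fix x assume "x \<in> S"
        then have "alt_multilinear k (\<theta> (F x))" using lin F(2) by blast
        then have "linear (\<lambda>w. \<theta> (F x) ((map (\<lambda>h. h x) hs)[j := w]))"
          using hs(1) jk by (simp add: alt_multilinear_def)
        have same: "(map (\<lambda>h. h x) hs)[j := (hs ! j) x] = map (\<lambda>h. h x) hs"
          using hs(1) jk by (simp add: list_update_same_conv)
        from linear_basis_expansion[OF \<open>linear _\<close>, of "(hs ! j) x"]
        show "(\<Sum>b\<in>Basis. ((hs ! j) x \<bullet> b) *\<^sub>R \<theta> (F x) (map (\<lambda>h. h x) (hs[j := \<lambda>_. b])))
            = \<theta> (F x) (map (\<lambda>h. h x) hs)"
          unfolding same by (simp add: map_update)
      qed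
    qed
  qed
  from this[of k] show ?thesis using hs by simp
qed

lemma forms_outside:
  "\<alpha> \<in> forms k A \<Longrightarrow> \<not> (x \<in> points A \<and> length vs = k \<and> set vs \<subseteq> tangent A x) \<Longrightarrow> \<alpha> x vs = 0"
  by (simp add: forms_def)

lemma forms_smooth:
  "\<alpha> \<in> forms k A \<Longrightarrow> c \<in> A \<Longrightarrow> length ws = k \<Longrightarrow> smooth_on (snd c ` fst c) (\<lambda>y. local_rep A \<alpha> c y ws)"
  by (simp add: forms_def)

lemma forms_alt_multilinear:
  "\<alpha> \<in> forms k A \<Longrightarrow> c \<in> A \<Longrightarrow> y \<in> snd c ` fst c \<Longrightarrow> alt_multilinear k (local_rep A \<alpha> c y)"
  unfolding forms_def alt_multilinear_def by blast

lemma local_rep_at: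
  assumes "smooth_atlas A" "c \<in> A" "x \<in> fst c"
  shows "local_rep A \<alpha> c (snd c x) ws = \<alpha> x (map (coord_vec A c x) ws)"
  by (simp add: local_rep_def chart_inv_snd[OF assms])

lemma form_apply:
  assumes A: "smooth_atlas A" and c: "c \<in> A" "x \<in> fst c" and vs: "set vs \<subseteq> tangent A x"
  shows "\<alpha> x vs = local_rep A \<alpha> c (snd c x) (map (\<lambda>v. v c) vs)"
proof -
  have "map (coord_vec A c x) (map (\<lambda>v. v c) vs) = vs"
    using vs by (auto intro!: map_idI simp: coord_vec_coord[OF _ c] subset_iff)
  then show ?thesis unfolding local_rep_at[OF A c] by simp
qed

lemma local_rep_pullback:
  assumes f: "smooth_map A B f" and A: "smooth_atlas A" and B: "smooth_atlas B"
    and cd: "c \<in> A" "d \<in> B" "y \<in> snd c ` fst c" "f (chart_inv c y) \<in> fst d"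
  shows "local_rep A (pullback A B f \<beta>) c y ws
    = local_rep B \<beta> d (coord_map c d f y) (map (frechet_derivative (coord_map c d f) (at y)) ws)"
proof -
  let ?x = "chart_inv c y"
  have x: "?x \<in> fst c" "snd c ?x = y" using cd(3) by (rule chart_inv_in, rule snd_chart_inv)
  have xA: "?x \<in> points A" using x(1) cd(1) unfolding points_iff by blast
  have tan: "set (map (coord_vec A c ?x) ws) \<subseteq> tangent A ?x"
    using coord_vec_tangent[OF A cd(1) x(1)] by auto
  have inv: "chart_inv d (coord_map c d f y) = f ?x"
    by (simp add: coord_map_apply chart_inv_snd[OF B cd(2,4)])
  have "local_rep A (pullback A B f \<beta>) c y ws
      = \<beta> (f ?x) (map (pushforward A B f ?x) (map (coord_vec A c ?x) ws))"
    using xA tan by (simp add: local_rep_def pullback_def)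
  also have "map (pushforward A B f ?x) (map (coord_vec A c ?x) ws)
      = map (coord_vec B d (f ?x)) (map (dmap c d f ?x) ws)"
    using pushforward_coord_vec[OF f A B cd(1) x(1) cd(2,4)] by simp
  finally show ?thesis by (simp add: local_rep_def inv dmap_def x(2) o_def)
qed

lemma local_rep_chart_change:
  assumes A: "smooth_atlas A" and cd: "c \<in> A" "d \<in> A" "y \<in> snd c ` (fst c \<inter> fst d)"
  shows "local_rep A \<alpha> c y ws
    = local_rep A \<alpha> d (coord_map c d id y) (map (frechet_derivative (coord_map c d id) (at y)) ws)"
proof -
  let ?x = "chart_inv c y"
  obtain z where z: "z \<in> fst c" "z \<in> fst d" "y = snd c z" using cd(3) by blast
  then have x: "?x = z" using chart_inv_snd[OF A cd(1)] by simp
  have inv: "chart_inv d (coord_map c d id y) = z"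
    by (simp add: coord_map_apply x chart_inv_snd[OF A cd(2) z(2)])
  have "coord_vec A c z w = coord_vec A d z (dmap c d id z w)" for w
  proof (rule tangent_eqI[of _ A z _ d])
    show "coord_vec A c z w d = coord_vec A d z (dmap c d id z w) d"
      unfolding coord_vec_same[OF A cd(2) z(2)] using cd z by (simp add: coord_vec_dmap)
  qed (use coord_vec_tangent[OF A] cd z in auto)
  then have "coord_vec A c z = (\<lambda>w. coord_vec A d z (dmap c d id z w))" by (rule ext)
  then have "map (coord_vec A c z) ws = map (coord_vec A d z) (map (dmap c d id z) ws)"
    by (simp only: map_map o_def)
  then show ?thesis unfolding local_rep_def x inv by (simp only: dmap_def z(3))
qed

text \<open>One chart about each point is enough: in another chart a local representative is
  obtained by inserting a transition map and its derivative, which keeps smoothness and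
  alternation.\<close>

lemma formsI:
  assumes A: "smooth_atlas A"
    and out: "\<And>x vs. \<not> (x \<in> points A \<and> length vs = k \<and> set vs \<subseteq> tangent A x) \<Longrightarrow> \<alpha> x vs = 0"
    and loc: "\<And>x. x \<in> points A \<Longrightarrow> \<exists>c\<in>A. \<exists>U. x \<in> fst c \<and> open U \<and> snd c x \<in> U \<and> U \<subseteq> snd c ` fst c \<and>
      (\<forall>ws. length ws = k \<longrightarrow> smooth_on U (\<lambda>y. local_rep A \<alpha> c y ws)) \<and>
      (\<forall>y\<in>U. alt_multilinear k (local_rep A \<alpha> c y))"
  shows "\<alpha> \<in> forms k A"
proof -
  have main: "\<exists>T. open T \<and> y \<in> T \<and> (\<forall>ws. length ws = k \<longrightarrow> smooth_on T (\<lambda>y. local_rep A \<alpha> d y ws)) \<and>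
      alt_multilinear k (local_rep A \<alpha> d y)" if d: "d \<in> A" "y \<in> snd d ` fst d" for d y
  proof -
    obtain x where x: "x \<in> fst d" "y = snd d x" using d by blast
    have "x \<in> points A" using x d unfolding points_iff by blast
    from loc[OF this] obtain c U where c: "c \<in> A" "x \<in> fst c" "open U" "snd c x \<in> U" "U \<subseteq> snd c ` fst c"
      and sm: "\<forall>ws. length ws = k \<longrightarrow> smooth_on U (\<lambda>y. local_rep A \<alpha> c y ws)"
      and ml: "\<forall>y\<in>U. alt_multilinear k (local_rep A \<alpha> c y)" by blast
    let ?F = "coord_map d c id"
    define T where "T = snd d ` (fst d \<inter> fst c) \<inter> ?F -` U"
    note ov = smooth_atlas_overlap[OF A d(1) c(1)]
    have T: "open T" unfolding T_def
      by (rule continuous_open_preimage[OF smooth_on_imp_continuous_on[OF ov(2)] ov(1) c(3)])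
    have F: "smooth_on T ?F" by (rule smooth_on_subset[OF ov(2)]) (auto simp: T_def)
    have yT: "y \<in> T" using x c(2,4) by (simp add: T_def coord_map_apply chart_inv_snd[OF A d(1) x(1)])
    have eq: "local_rep A \<alpha> d z ws = local_rep A \<alpha> c (?F z) (map (frechet_derivative ?F (at z)) ws)"
      if "z \<in> T" for z ws
      using local_rep_chart_change[OF A d(1) c(1)] that by (auto simp: T_def)
    have "smooth_on T (\<lambda>y. local_rep A \<alpha> d y ws)" if ws: "length ws = k" for ws
    proof -
      have "smooth_on T (\<lambda>z. local_rep A \<alpha> c (?F z) (map (\<lambda>h. h z) (map (\<lambda>w z. frechet_derivative ?F (at z) w) ws)))"
      proof (rule smooth_on_multilinear[OF T c(3) F, where k = k])
        show "?F ` T \<subseteq> U" by (auto simp: T_def)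
        show "h \<in> set (map (\<lambda>w z. frechet_derivative ?F (at z) w) ws) \<Longrightarrow> smooth_on T h" for h
          using smooth_on_derivative[OF F] by (auto simp del: id_apply)
      qed (use sm ml ws in simp_all)
      then show ?thesis
        by (rule smooth_on_cong[OF T, rotated]) (simp add: eq o_def)
    qed
    moreover have "alt_multilinear k (local_rep A \<alpha> d y)"
    proof -
      have "alt_multilinear k (local_rep A \<alpha> c (?F y))" using ml yT by (simp add: T_def)
      from alt_multilinear_compose[OF this smooth_on_linear_derivative[OF F yT]]
      show ?thesis unfolding eq[OF yT, abs_def] .
    qed
    ultimately show ?thesis using T yT by blast
  qed
  show ?thesis
    unfolding forms_def mem_Collect_eq
  proof (intro conjI allI impI ballI)
    fix x vs assume "\<not> (x \<in> points A \<and> length vs = k \<and> set vs \<subseteq> tangent A x)"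
    then show "\<alpha> x vs = 0" by (rule out)
  next
    fix c and ws :: "'b list" assume c: "c \<in> A" and ws: "length ws = k"
    show "smooth_on (snd c ` fst c) (\<lambda>y. local_rep A \<alpha> c y ws)"
      by (rule smooth_on_local) (use main[OF c] ws in blast)
    fix y i assume y: "y \<in> snd c ` fst c" and "i < k"
    then have ml: "alt_multilinear k (local_rep A \<alpha> c y)" using main[OF c] by blast
    then show "linear (\<lambda>w. local_rep A \<alpha> c y (ws[i := w]))"
      using ws \<open>i < k\<close> by (simp add: alt_multilinear_def)
    show "local_rep A \<alpha> c y ws = 0" if "j < k" "i \<noteq> j \<and> ws ! i = ws ! j" for j
      using ml ws \<open>i < k\<close> that unfolding alt_multilinear_def by blast
  qed
qed

text \<open>The mechanism is that of a change of charts, with the coordinate expression of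
  \<open>f\<close> in place of the transition.\<close>

lemma pullback_forms:
  assumes f: "smooth_map A B f" and A: "smooth_atlas A" and B: "smooth_atlas B"
    and \<beta>: "\<beta> \<in> forms k B"
  shows "pullback A B f \<beta> \<in> forms k A"
proof (rule formsI[OF A])
  fix x vs assume "\<not> (x \<in> points A \<and> length vs = k \<and> set vs \<subseteq> tangent A x)"
  then show "pullback A B f \<beta> x vs = 0"
    using forms_outside[OF \<beta>, of "f x" "map (pushforward A B f x) vs"] by (auto simp: pullback_def)
next
  fix x assume x: "x \<in> points A"
  obtain c d where cd: "c \<in> A" "x \<in> fst c" "d \<in> B" "f x \<in> fst d"
    using x smooth_map_image[OF f A B x] unfolding points_iff by blast
  let ?F = "coord_map c d f"
  define U where "U = snd c ` {x \<in> fst c. f x \<in> fst d}"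
  note D = smooth_mapD[OF f A B cd(1,3), folded U_def]
  have U: "y \<in> snd c ` fst c" "f (chart_inv c y) \<in> fst d" "?F y \<in> snd d ` fst d" if "y \<in> U" for y
  proof -
    obtain z where z: "z \<in> fst c" "f z \<in> fst d" "y = snd c z" using \<open>y \<in> U\<close> unfolding U_def by blast
    then have yz: "chart_inv c y = z" using chart_inv_snd[OF A cd(1)] by simp
    show "y \<in> snd c ` fst c" "f (chart_inv c y) \<in> fst d" "?F y \<in> snd d ` fst d"
      using z unfolding coord_map_apply yz by blast+
  qed
  have eq: "local_rep A (pullback A B f \<beta>) c y ws
      = local_rep B \<beta> d (?F y) (map (frechet_derivative ?F (at y)) ws)" if "y \<in> U" for y ws
    using local_rep_pullback[OF f A B cd(1,3)] U[OF that] by blast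
  have "smooth_on U (\<lambda>y. local_rep A (pullback A B f \<beta>) c y ws)" if ws: "length ws = k" for ws
  proof -
    have "smooth_on U (\<lambda>z. local_rep B \<beta> d (?F z) (map (\<lambda>h. h z) (map (\<lambda>w z. frechet_derivative ?F (at z) w) ws)))"
    proof (rule smooth_on_multilinear[OF D(1) smooth_atlas_open[OF B cd(3)] D(2), where k = k])
      show "?F ` U \<subseteq> snd d ` fst d" using U(3) by blast
      show "h \<in> set (map (\<lambda>w z. frechet_derivative ?F (at z) w) ws) \<Longrightarrow> smooth_on U h" for h
        using smooth_on_derivative[OF D(2)] by auto
    qed (use forms_smooth[OF \<beta> cd(3)] forms_alt_multilinear[OF \<beta> cd(3)] ws in simp_all)
    then show ?thesis
      by (rule smooth_on_cong[OF D(1), rotated]) (simp add: eq o_def)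
  qed
  moreover have "alt_multilinear k (local_rep A (pullback A B f \<beta>) c y)" if "y \<in> U" for y
    unfolding eq[OF that, abs_def]
    by (rule alt_multilinear_compose[OF forms_alt_multilinear[OF \<beta> cd(3) U(3)[OF that]]
          smooth_on_linear_derivative[OF D(2) that]])
  moreover have "snd c x \<in> U" using cd unfolding U_def by blast
  ultimately show "\<exists>c\<in>A. \<exists>U. x \<in> fst c \<and> open U \<and> snd c x \<in> U \<and> U \<subseteq> snd c ` fst c \<and>
      (\<forall>ws. length ws = k \<longrightarrow> smooth_on U (\<lambda>y. local_rep A (pullback A B f \<beta>) c y ws)) \<and>
      (\<forall>y\<in>U. alt_multilinear k (local_rep A (pullback A B f \<beta>) c y))"
    using D(1) cd U(1) by blast
qed

lemma pullback_apply:
  "x \<in> points A \<Longrightarrow> set vs \<subseteq> tangent A x \<Longrightarrow>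
    pullback A B f \<beta> x vs = \<beta> (f x) (map (pushforward A B f x) vs)"
  by (simp add: pullback_def)

lemma pullback_compose:
  assumes f: "smooth_map A B f" and g: "smooth_map B C g"
    and A: "smooth_atlas A" and B: "smooth_atlas B" and C: "smooth_atlas C"
  shows "pullback A B f (pullback B C g \<gamma>) = pullback A C (g \<circ> f) \<gamma>"
proof (intro ext)
  fix x vs
  show "pullback A B f (pullback B C g \<gamma>) x vs = pullback A C (g \<circ> f) \<gamma> x vs"
  proof (cases "x \<in> points A \<and> set vs \<subseteq> tangent A x")
    case True
    then have x: "x \<in> points A" and vs: "set vs \<subseteq> tangent A x" by auto
    have "set (map (pushforward A B f x) vs) \<subseteq> tangent B (f x)"
      using pushforward_tangent[OF f A B x] vs by auto
    moreover have "map (pushforward B C g (f x)) (map (pushforward A B f x) vs) = map (pushforward A C (g \<circ> f) x) vs"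
      using pushforward_compose[OF f g A B C x] vs by auto
    ultimately show ?thesis
      unfolding pullback_apply[OF x vs] by (simp add: pullback_apply[OF smooth_map_image[OF f A B x]] del: map_map)
  next
    case False
    then show ?thesis by (simp only: pullback_def if_False)
  qed
qed

lemma pullback_cong:
  assumes A: "smooth_atlas A" and fg: "\<And>z. z \<in> points A \<Longrightarrow> f z = g z"
  shows "pullback A B f \<beta> = pullback A B g \<beta>"
proof (intro ext)
  fix x vs
  show "pullback A B f \<beta> x vs = pullback A B g \<beta> x vs"
  proof (cases "x \<in> points A")
    case True
    have "pushforward A B f x = pushforward A B g x"
      by (rule pushforward_cong[OF A True]) (rule fg)
    then show ?thesis unfolding pullback_def fg[OF True] by simp
  qed (simp add: pullback_def)
qed

lemma pullback_scale: "pullback A B f (r *\<^sub>f \<beta>) = r *\<^sub>f pullback A B f \<beta>"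
  unfolding pullback_def form_scale_def by (intro ext) simp

lemma forms_scale:
  assumes A: "smooth_atlas A" and \<alpha>: "\<alpha> \<in> forms k A" shows "r *\<^sub>f \<alpha> \<in> forms k A"
proof (rule formsI[OF A])
  have rep: "local_rep A (r *\<^sub>f \<alpha>) c y ws = r *\<^sub>R local_rep A \<alpha> c y ws" for c y ws
    by (simp add: local_rep_def form_scale_def)
  fix x assume "x \<in> points A"
  then obtain c where c: "c \<in> A" "x \<in> fst c" unfolding points_iff by blast
  have "smooth_on (snd c ` fst c) (\<lambda>y. local_rep A (r *\<^sub>f \<alpha>) c y ws)" if "length ws = k" for ws
    unfolding rep using smooth_atlas_open[OF A c(1)] forms_smooth[OF \<alpha> c(1) that]
    by (intro smooth_on_scaleR smooth_on_const)
  moreover have "alt_multilinear k (local_rep A (r *\<^sub>f \<alpha>) c y)" if "y \<in> snd c ` fst c" for y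
    using forms_alt_multilinear[OF \<alpha> c(1) that] unfolding alt_multilinear_def rep
    by (auto intro!: linear_compose_scale_right)
  ultimately show "\<exists>c\<in>A. \<exists>U. x \<in> fst c \<and> open U \<and> snd c x \<in> U \<and> U \<subseteq> snd c ` fst c \<and>
      (\<forall>ws. length ws = k \<longrightarrow> smooth_on U (\<lambda>y. local_rep A (r *\<^sub>f \<alpha>) c y ws)) \<and>
      (\<forall>y\<in>U. alt_multilinear k (local_rep A (r *\<^sub>f \<alpha>) c y))"
    using c smooth_atlas_open[OF A c(1)] by blast
qed (use forms_outside[OF \<alpha>] in \<open>auto simp: form_scale_def\<close>)

text \<open>A local right inverse \<open>g\<close> of \<open>f\<close>, written in charts, makes the differential of \<open>f\<close> surjective.\<close>

lemma pullback_injective: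
  assumes f: "smooth_map A B f" and A: "smooth_atlas A" and B: "smooth_atlas B"
    and sec: "\<And>b. b \<in> points B \<Longrightarrow> \<exists>c\<in>A. \<exists>d\<in>B. \<exists>U g. b \<in> fst d \<and> open U \<and> snd d b \<in> U \<and> U \<subseteq> snd d ` fst d \<and>
      smooth_on U g \<and> g ` U \<subseteq> snd c ` fst c \<and> (\<forall>y\<in>U. f (chart_inv c (g y)) = chart_inv d y)"
    and \<beta>: "\<beta> \<in> forms k B" "\<beta>' \<in> forms k B" and eq: "pullback A B f \<beta> = pullback A B f \<beta>'"
  shows "\<beta> = \<beta>'"
proof (intro ext)
  fix b vs
  show "\<beta> b vs = \<beta>' b vs"
  proof (cases "b \<in> points B \<and> length vs = k \<and> set vs \<subseteq> tangent B b")
    case False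
    then show ?thesis using forms_outside[OF \<beta>(1)] forms_outside[OF \<beta>(2)] by metis
  next
    case True
    then have b: "b \<in> points B" and vs: "set vs \<subseteq> tangent B b" by auto
    from sec[OF b] obtain c d U g where cd: "c \<in> A" "d \<in> B" "b \<in> fst d" "open U" "snd d b \<in> U" "U \<subseteq> snd d ` fst d"
      and g: "smooth_on U g" "g ` U \<subseteq> snd c ` fst c" "\<forall>y\<in>U. f (chart_inv c (g y)) = chart_inv d y" by blast
    let ?F = "coord_map c d f" and ?y = "snd d b"
    let ?x = "chart_inv c (g ?y)"
    have gy: "g ?y \<in> snd c ` fst c" using g(2) cd(5) by blast
    have x: "?x \<in> fst c" "snd c ?x = g ?y" using gy by (rule chart_inv_in, rule snd_chart_inv)
    have xA: "?x \<in> points A" using x(1) cd(1) unfolding points_iff by blast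
    have fx: "f ?x = b" using g(3) cd(5) chart_inv_snd[OF B cd(2,3)] by simp
    let ?S = "snd c ` {x \<in> fst c. f x \<in> fst d}"
    have gS: "g ` U \<subseteq> ?S"
    proof
      fix z assume "z \<in> g ` U"
      then obtain u where u: "u \<in> U" "z = g u" by blast
      have zc: "z \<in> snd c ` fst c" using g(2) u by blast
      have "chart_inv d u \<in> fst d" using chart_inv_in[of u d] cd(6) u(1) by blast
      then have "f (chart_inv c z) \<in> fst d" using g(3) u by simp
      then show "z \<in> ?S" using chart_inv_in[OF zc] snd_chart_inv[OF zc] by force
    qed
    note D = smooth_mapD[OF f A B cd(1,2)]
    have "frechet_derivative ?F (at (g ?y)) (frechet_derivative g (at ?y) w) = w" for w
    proof -
      have "frechet_derivative (\<lambda>y. ?F (g y)) (at ?y) w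
          = frechet_derivative ?F (at (g ?y)) (frechet_derivative g (at ?y) w)"
        by (rule smooth_on_derivative_compose[OF g(1) cd(5) D(2)]) (use gS cd(5) in blast)
      moreover have "frechet_derivative (\<lambda>y. ?F (g y)) (at ?y) = frechet_derivative (\<lambda>y. y) (at ?y)"
        by (rule frechet_derivative_cong_open[OF cd(4,5)])
           (use g(3) cd(6) in \<open>auto simp: coord_map_apply subset_iff snd_chart_inv\<close>)
      ultimately show ?thesis by simp
    qed
    then have push: "pushforward A B f ?x (coord_vec A c ?x (frechet_derivative g (at ?y) w)) = coord_vec B d b w" for w
      using pushforward_coord_vec[OF f A B cd(1) x(1) cd(2)] fx cd(3) by (simp add: dmap_def x(2))
    \<comment> \<open>Lifts of the given vectors through the derivative of \<open>g\<close>. Pushing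
      them forward returns \<open>vs\<close>, so the pullbacks determine the values at
      \<open>b\<close>.\<close>
    define us where "us = map (\<lambda>v. coord_vec A c ?x (frechet_derivative g (at ?y) (v d))) vs"
    have us: "set us \<subseteq> tangent A ?x" unfolding us_def using coord_vec_tangent[OF A cd(1) x(1)] by auto
    have "map (pushforward A B f ?x) us = vs"
      unfolding us_def by (auto intro!: map_idI simp: push o_def) (use vs coord_vec_coord[OF _ cd(2,3)] in blast)
    then show ?thesis
      using fun_cong[OF fun_cong[OF eq, of ?x], of us] fx by (simp add: pullback_apply[OF xA us])
  qed
qed

text \<open>\<open>descend\<close> is a definite description; the third premise supplies the
  uniqueness it requires, for the exhibited \<open>\<beta>\<close>.\<close>

lemma descend_eqI:
  assumes "\<beta> \<in> forms k B" "pullback A B f \<beta> = \<alpha>"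
    and "\<And>\<beta>'. \<beta>' \<in> forms k B \<Longrightarrow> pullback A B f \<beta>' = pullback A B f \<beta> \<Longrightarrow> \<beta>' = \<beta>"
  shows "descend k A B f \<alpha> = \<beta>"
  unfolding descend_def
proof (rule the_equality)
  show "\<beta>' = \<beta>" if "\<beta>' \<in> forms k B \<and> pullback A B f \<beta>' = \<alpha>" for \<beta>'
    using that assms(3)[of \<beta>'] unfolding assms(2) by simp
qed (simp add: assms)

section \<open>Products, open subsets, submanifolds and quotients\<close>

lemma open_atlas_simps [simp]:
  "points (open_atlas V) = V" "(V, id) \<in> open_atlas V"
  by (simp_all add: points_def open_atlas_def)

lemma chart_inv_open_atlas: "y \<in> V \<Longrightarrow> chart_inv (V, id) y = y"
  by (simp add: chart_inv_def)

lemma smooth_atlas_open_atlas: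
  fixes V :: "'e::euclidean_space set"
  assumes "open V" shows "smooth_atlas (open_atlas V)"
proof -
  have "smooth_on V (coord_map (V, id) (V, id) id)"
    by (rule smooth_on_cong[OF assms _ smooth_on_ident[OF assms]])
       (simp add: coord_map_apply chart_inv_open_atlas)
  then show ?thesis using assms
    by (simp add: smooth_atlas_def open_atlas_def transition_coord_map)
qed

lemma smooth_map_into_openI:
  fixes f :: "'a \<Rightarrow> 'f::euclidean_space"
  assumes A: "smooth_atlas A" and V: "open V" "f ` points A \<subseteq> V"
    and sm: "\<And>x. x \<in> points A \<Longrightarrow> \<exists>c\<in>A. \<exists>U. x \<in> fst c \<and> open U \<and> snd c x \<in> U \<and> U \<subseteq> snd c ` fst c \<and>
       smooth_on U (\<lambda>y. f (chart_inv c y))"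
  shows "smooth_map A (open_atlas V) f"
proof (rule smooth_mapI[OF A smooth_atlas_open_atlas[OF V(1)]])
  fix x assume "x \<in> points A"
  from sm[OF this] obtain c U where c: "c \<in> A" "x \<in> fst c" "open U" "snd c x \<in> U" "U \<subseteq> snd c ` fst c"
    "smooth_on U (\<lambda>y. f (chart_inv c y))" by blast
  have "f (chart_inv c y) \<in> V" if "y \<in> U" for y
  proof -
    have "chart_inv c y \<in> points A" unfolding points_iff using chart_inv_in[of y c] c(1,5) that by blast
    then show ?thesis using V(2) by blast
  qed
  moreover have "coord_map c (V, id) f = (\<lambda>y. f (chart_inv c y))"
    by (simp add: coord_map_apply fun_eq_iff)
  ultimately show "\<exists>c\<in>A. \<exists>d\<in>open_atlas V. \<exists>U. x \<in> fst c \<and> open U \<and> snd c x \<in> U \<and>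
      U \<subseteq> snd c ` fst c \<and> (\<forall>y\<in>U. f (chart_inv c y) \<in> fst d) \<and> smooth_on U (coord_map c d f)"
    using c by (intro bexI[of _ c] bexI[of _ "(V, id)"] exI[of _ U]) simp_all
qed

lemma smooth_map_into_openD:
  fixes f :: "'a \<Rightarrow> 'f::euclidean_space"
  assumes f: "smooth_map A (open_atlas V) f" and A: "smooth_atlas A" and V: "open V" and c: "c \<in> A"
  shows "smooth_on (snd c ` fst c) (\<lambda>y. f (chart_inv c y))"
proof -
  have "f x \<in> V" if x: "x \<in> fst c" for x
  proof -
    have "x \<in> points A" using c x unfolding points_iff by blast
    from smooth_map_image[OF f A smooth_atlas_open_atlas[OF V] this] show ?thesis by simp
  qed
  then have "{x \<in> fst c. f x \<in> fst (V, id)} = fst c" by auto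
  moreover have "coord_map c (V, id) f = (\<lambda>y. f (chart_inv c y))"
    by (simp add: coord_map_apply fun_eq_iff)
  ultimately show ?thesis
    using smooth_mapD(2)[OF f A smooth_atlas_open_atlas[OF V] c, of "(V, id)"] by simp
qed

lemma smooth_map_open_open:
  fixes f :: "'e::euclidean_space \<Rightarrow> 'f::euclidean_space"
  assumes "open T" "open V" "f ` T \<subseteq> V" "smooth_on T f"
  shows "smooth_map (open_atlas T) (open_atlas V) f"
proof (rule smooth_map_into_openI[OF smooth_atlas_open_atlas[OF assms(1)] assms(2)])
  fix x assume x: "x \<in> points (open_atlas T)"
  have "smooth_on T (\<lambda>y. f (chart_inv (T, id) y))"
    by (rule smooth_on_cong[OF assms(1) _ assms(4)]) (simp add: chart_inv_open_atlas)
  then show "\<exists>c\<in>open_atlas T. \<exists>U. x \<in> fst c \<and> open U \<and> snd c x \<in> U \<and> U \<subseteq> snd c ` fst c \<and>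
       smooth_on U (\<lambda>y. f (chart_inv c y))"
    using x assms(1) by (intro bexI[of _ "(T, id)"] exI[of _ T]) simp_all
qed (use assms in simp)

lemma openin_open_atlas:
  fixes V :: "'e::euclidean_space set"
  assumes "open V" shows "openin (mtop (open_atlas V)) T \<longleftrightarrow> T \<subseteq> V \<and> open T"
proof -
  have "openin (mtop (open_atlas V)) T \<longleftrightarrow> T \<subseteq> V \<and> open (V \<inter> T)"
    using openin_atlas[OF smooth_atlas_open_atlas[OF assms], of T] by (simp add: open_atlas_def points_def)
  then show ?thesis by (metis Int_absorb1)
qed

lemma smooth_map_Pair_open:
  fixes f :: "'a \<Rightarrow> 'f::euclidean_space" and g :: "'a \<Rightarrow> 'g::euclidean_space"
  assumes f: "smooth_map A (open_atlas UNIV) f" and g: "smooth_map A (open_atlas UNIV) g"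
    and A: "smooth_atlas A"
  shows "smooth_map A (open_atlas UNIV) (\<lambda>x. (f x, g x))"
proof (rule smooth_map_into_openI[OF A])
  fix x assume "x \<in> points A"
  then obtain c where c: "c \<in> A" "x \<in> fst c" unfolding points_iff by blast
  have "smooth_on (snd c ` fst c) (\<lambda>y. (f (chart_inv c y), g (chart_inv c y)))"
    using smooth_map_into_openD[OF f A open_UNIV c(1)] smooth_map_into_openD[OF g A open_UNIV c(1)]
    by (intro smooth_on_Pair smooth_atlas_open[OF A c(1)])
  then show "\<exists>c\<in>A. \<exists>U. x \<in> fst c \<and> open U \<and> snd c x \<in> U \<and> U \<subseteq> snd c ` fst c \<and>
       smooth_on U (\<lambda>y. (f (chart_inv c y), g (chart_inv c y)))"
    using c smooth_atlas_open[OF A c(1)] by blast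
qed auto

section \<open>Products of atlases\<close>

definition prod_chart :: "('a, 'e) chart \<Rightarrow> ('b, 'f) chart \<Rightarrow> ('a \<times> 'b, 'e \<times> 'f) chart" where
  "prod_chart c d = (fst c \<times> fst d, map_prod (snd c) (snd d))"

lemma prod_atlas_iff: "e \<in> prod_atlas A B \<longleftrightarrow> (\<exists>c\<in>A. \<exists>d\<in>B. e = prod_chart c d)"
  unfolding prod_atlas_def prod_chart_def by blast

lemma prod_chart_in: "c \<in> A \<Longrightarrow> d \<in> B \<Longrightarrow> prod_chart c d \<in> prod_atlas A B"
  unfolding prod_atlas_iff by blast

lemma prod_chart_simps:
  "fst (prod_chart c d) = fst c \<times> fst d" "snd (prod_chart c d) (x, y) = (snd c x, snd d y)"
  "snd (prod_chart c d) ` fst (prod_chart c d) = snd c ` fst c \<times> snd d ` fst d"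
  by (auto simp: prod_chart_def)

lemma points_prod: "points (prod_atlas A B) = points A \<times> points B"
proof (intro equalityI subsetI)
  fix z assume "z \<in> points (prod_atlas A B)"
  then obtain e where "e \<in> prod_atlas A B" "z \<in> fst e" unfolding points_iff by blast
  then obtain c d where "c \<in> A" "d \<in> B" "z \<in> fst c \<times> fst d"
    unfolding prod_atlas_iff using prod_chart_simps(1) by metis
  then show "z \<in> points A \<times> points B" unfolding points_def by auto
next
  fix z assume "z \<in> points A \<times> points B"
  then obtain c d where "c \<in> A" "fst z \<in> fst c" "d \<in> B" "snd z \<in> fst d" unfolding points_def by auto
  then have "prod_chart c d \<in> prod_atlas A B" "z \<in> fst (prod_chart c d)"
    using prod_chart_in[of c A d B] by (simp_all add: prod_chart_simps mem_Times_iff)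
  then show "z \<in> points (prod_atlas A B)" unfolding points_iff by blast
qed

lemma chart_inv_prod:
  assumes A: "smooth_atlas A" and B: "smooth_atlas B" and cd: "c \<in> A" "d \<in> B"
    and y: "y \<in> snd c ` fst c" "z \<in> snd d ` fst d"
  shows "chart_inv (prod_chart c d) (y, z) = (chart_inv c y, chart_inv d z)"
proof -
  have "inj_on (snd (prod_chart c d)) (fst (prod_chart c d))"
    using smooth_atlas_inj[OF A cd(1)] smooth_atlas_inj[OF B cd(2)]
    by (auto simp: prod_chart_simps inj_on_def)
  moreover have "(chart_inv c y, chart_inv d z) \<in> fst (prod_chart c d)"
    using chart_inv_in[OF y(1)] chart_inv_in[OF y(2)] by (simp add: prod_chart_simps)
  moreover have "snd (prod_chart c d) (chart_inv c y, chart_inv d z) = (y, z)"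
    by (simp add: prod_chart_simps snd_chart_inv y)
  ultimately show ?thesis unfolding chart_inv_def[of "prod_chart c d"] by (rule inv_into_f_eq)
qed

lemma smooth_atlas_prod:
  assumes A: "smooth_atlas A" and B: "smooth_atlas B"
  shows "smooth_atlas (prod_atlas A B)"
  unfolding smooth_atlas_def
proof (intro conjI ballI)
  fix e assume "e \<in> prod_atlas A B"
  then obtain c d where cd: "c \<in> A" "d \<in> B" "e = prod_chart c d" unfolding prod_atlas_iff by blast
  show "inj_on (snd e) (fst e)"
    using smooth_atlas_inj[OF A cd(1)] smooth_atlas_inj[OF B cd(2)]
    by (auto simp: cd(3) prod_chart_simps inj_on_def)
  show "open (snd e ` fst e)"
    unfolding cd(3) prod_chart_simps(3)
    by (intro open_Times smooth_atlas_open[OF A cd(1)] smooth_atlas_open[OF B cd(2)])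
  fix e' assume "e' \<in> prod_atlas A B"
  then obtain c' d' where cd': "c' \<in> A" "d' \<in> B" "e' = prod_chart c' d'" unfolding prod_atlas_iff by blast
  let ?S = "snd c ` (fst c \<inter> fst c')" and ?T = "snd d ` (fst d \<inter> fst d')"
  have eq: "snd e ` (fst e \<inter> fst e') = ?S \<times> ?T"
  proof -
    have "snd e ` (fst e \<inter> fst e') = map_prod (snd c) (snd d) ` ((fst c \<inter> fst c') \<times> (fst d \<inter> fst d'))"
      unfolding cd(3) cd'(3) by (simp add: prod_chart_def Times_Int_Times)
    then show ?thesis by (simp add: map_prod_surj_on)
  qed
  note S = smooth_atlas_overlap[OF A cd(1) cd'(1)] and T = smooth_atlas_overlap[OF B cd(2) cd'(2)]
  show op: "open (snd e ` (fst e \<inter> fst e'))" unfolding eq by (intro open_Times S T)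
  have "smooth_on (?S \<times> ?T) (\<lambda>y. (coord_map c c' id (fst y), coord_map d d' id (snd y)))"
    using op unfolding eq
    by (intro smooth_on_Pair smooth_on_compose[OF _ S(1) _ _ S(2)] smooth_on_compose[OF _ T(1) _ _ T(2)])
       (auto intro: smooth_intros)
  then show "smooth_on (snd e ` (fst e \<inter> fst e')) (transition e e')"
    unfolding eq
  proof (rule smooth_on_cong[OF op[unfolded eq], rotated])
    fix y assume "y \<in> ?S \<times> ?T"
    then have "fst y \<in> snd c ` fst c" "snd y \<in> snd d ` fst d" by auto
    from chart_inv_prod[OF A B cd(1,2) this]
    show "(coord_map c c' id (fst y), coord_map d d' id (snd y)) = transition e e' y"
      by (simp add: transition_coord_map coord_map_apply cd(3) cd'(3) prod_chart_simps)
  qed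
qed

lemma smooth_map_fst:
  assumes A: "smooth_atlas A" and B: "smooth_atlas B"
  shows "smooth_map (prod_atlas A B) A fst" "smooth_map (prod_atlas A B) B snd"
proof -
  have main: "\<exists>c\<in>A. \<exists>d\<in>B. x \<in> fst (prod_chart c d) \<and> prod_chart c d \<in> prod_atlas A B \<and>
      (\<forall>y\<in>snd (prod_chart c d) ` fst (prod_chart c d).
        chart_inv (prod_chart c d) y = (chart_inv c (fst y), chart_inv d (snd y)) \<and>
        fst y \<in> snd c ` fst c \<and> snd y \<in> snd d ` fst d) \<and>
      open (snd (prod_chart c d) ` fst (prod_chart c d)) \<and>
      snd (prod_chart c d) x \<in> snd (prod_chart c d) ` fst (prod_chart c d)"
    if "x \<in> points (prod_atlas A B)" for x
  proof -
    from that obtain e where e: "e \<in> prod_atlas A B" "x \<in> fst e" unfolding points_iff by blast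
    then obtain c d where cd: "c \<in> A" "d \<in> B" "e = prod_chart c d" unfolding prod_atlas_iff by blast
    have "chart_inv (prod_chart c d) y = (chart_inv c (fst y), chart_inv d (snd y)) \<and>
        fst y \<in> snd c ` fst c \<and> snd y \<in> snd d ` fst d"
      if "y \<in> snd (prod_chart c d) ` fst (prod_chart c d)" for y
    proof -
      have "fst y \<in> snd c ` fst c" "snd y \<in> snd d ` fst d" using that unfolding prod_chart_simps(3) by auto
      then show ?thesis using chart_inv_prod[OF A B cd(1,2)] by (metis prod.collapse)
    qed
    then show ?thesis
      using cd(1,2) e unfolding cd(3)
      using smooth_atlas_open[OF smooth_atlas_prod[OF A B] e(1)[unfolded cd(3)]] by blast
  qed
  show "smooth_map (prod_atlas A B) A fst"
  proof (rule smooth_mapI[OF smooth_atlas_prod[OF A B] A])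
    fix x assume "x \<in> points (prod_atlas A B)"
    from main[OF this] obtain c d where cd: "c \<in> A" "d \<in> B" "x \<in> fst (prod_chart c d)"
      "prod_chart c d \<in> prod_atlas A B"
      and inv: "\<forall>y\<in>snd (prod_chart c d) ` fst (prod_chart c d).
        chart_inv (prod_chart c d) y = (chart_inv c (fst y), chart_inv d (snd y)) \<and>
        fst y \<in> snd c ` fst c \<and> snd y \<in> snd d ` fst d"
      and op: "open (snd (prod_chart c d) ` fst (prod_chart c d))"
        "snd (prod_chart c d) x \<in> snd (prod_chart c d) ` fst (prod_chart c d)" by blast
    have "smooth_on (snd (prod_chart c d) ` fst (prod_chart c d)) (coord_map (prod_chart c d) c fst)"
      by (rule smooth_on_cong[OF op(1) _ smooth_on_fst[OF op(1) smooth_on_ident[OF op(1)]]])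
         (simp add: coord_map_apply inv snd_chart_inv)
    moreover have "\<forall>y\<in>snd (prod_chart c d) ` fst (prod_chart c d). fst (chart_inv (prod_chart c d) y) \<in> fst c"
      using inv by (auto simp: chart_inv_in)
    ultimately show "\<exists>c\<in>prod_atlas A B. \<exists>d\<in>A. \<exists>U. x \<in> fst c \<and> open U \<and> snd c x \<in> U \<and>
        U \<subseteq> snd c ` fst c \<and> (\<forall>y\<in>U. fst (chart_inv c y) \<in> fst d) \<and> smooth_on U (coord_map c d fst)"
      using cd op by blast
  qed
  show "smooth_map (prod_atlas A B) B snd"
  proof (rule smooth_mapI[OF smooth_atlas_prod[OF A B] B])
    fix x assume "x \<in> points (prod_atlas A B)"
    from main[OF this] obtain c d where cd: "c \<in> A" "d \<in> B" "x \<in> fst (prod_chart c d)"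
      "prod_chart c d \<in> prod_atlas A B"
      and inv: "\<forall>y\<in>snd (prod_chart c d) ` fst (prod_chart c d).
        chart_inv (prod_chart c d) y = (chart_inv c (fst y), chart_inv d (snd y)) \<and>
        fst y \<in> snd c ` fst c \<and> snd y \<in> snd d ` fst d"
      and op: "open (snd (prod_chart c d) ` fst (prod_chart c d))"
        "snd (prod_chart c d) x \<in> snd (prod_chart c d) ` fst (prod_chart c d)" by blast
    have "smooth_on (snd (prod_chart c d) ` fst (prod_chart c d)) (coord_map (prod_chart c d) d snd)"
      by (rule smooth_on_cong[OF op(1) _ smooth_on_snd[OF op(1) smooth_on_ident[OF op(1)]]])
         (simp add: coord_map_apply inv snd_chart_inv)
    moreover have "\<forall>y\<in>snd (prod_chart c d) ` fst (prod_chart c d). snd (chart_inv (prod_chart c d) y) \<in> fst d"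
      using inv by (auto simp: chart_inv_in)
    ultimately show "\<exists>c\<in>prod_atlas A B. \<exists>d\<in>B. \<exists>U. x \<in> fst c \<and> open U \<and> snd c x \<in> U \<and>
        U \<subseteq> snd c ` fst c \<and> (\<forall>y\<in>U. snd (chart_inv c y) \<in> fst d) \<and> smooth_on U (coord_map c d snd)"
      using cd op by blast
  qed
qed

lemma smooth_map_local:
  assumes f: "smooth_map A B f" and A: "smooth_atlas A" and B: "smooth_atlas B"
    and x: "c \<in> A" "d \<in> B" "x \<in> fst c" "f x \<in> fst d"
  obtains U where "open U" "snd c x \<in> U" "U \<subseteq> snd c ` fst c" "\<forall>y\<in>U. f (chart_inv c y) \<in> fst d"
    "smooth_on U (coord_map c d f)"
proof
  let ?U = "snd c ` {x \<in> fst c. f x \<in> fst d}"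
  show "open ?U" "smooth_on ?U (coord_map c d f)" using smooth_mapD[OF f A B x(1,2)] .
  show "\<forall>y\<in>?U. f (chart_inv c y) \<in> fst d"
  proof
    fix y assume "y \<in> ?U"
    then obtain z where "z \<in> fst c" "f z \<in> fst d" "y = snd c z" by blast
    then show "f (chart_inv c y) \<in> fst d" using chart_inv_snd[OF A x(1)] by simp
  qed
qed (use x in blast)+

lemma smooth_map_Pair:
  assumes f: "smooth_map A B f" and g: "smooth_map A C g"
    and A: "smooth_atlas A" and B: "smooth_atlas B" and C: "smooth_atlas C"
  shows "smooth_map A (prod_atlas B C) (\<lambda>x. (f x, g x))"
proof (rule smooth_mapI[OF A smooth_atlas_prod[OF B C]])
  fix x assume x: "x \<in> points A"
  obtain a b c where abc: "a \<in> A" "x \<in> fst a" "b \<in> B" "f x \<in> fst b" "c \<in> C" "g x \<in> fst c"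
    using x smooth_map_image[OF f A B x] smooth_map_image[OF g A C x] unfolding points_iff by blast
  obtain U where U: "open U" "snd a x \<in> U" "U \<subseteq> snd a ` fst a" "\<forall>y\<in>U. f (chart_inv a y) \<in> fst b"
    "smooth_on U (coord_map a b f)" by (rule smooth_map_local[OF f A B abc(1,3,2,4)])
  obtain V where V: "open V" "snd a x \<in> V" "V \<subseteq> snd a ` fst a" "\<forall>y\<in>V. g (chart_inv a y) \<in> fst c"
    "smooth_on V (coord_map a c g)" by (rule smooth_map_local[OF g A C abc(1,5,2,6)])
  have W: "open (U \<inter> V)" using U V by blast
  have "smooth_on (U \<inter> V) (\<lambda>y. (coord_map a b f y, coord_map a c g y))"
    using smooth_on_subset[OF U(5)] smooth_on_subset[OF V(5)] by (intro smooth_on_Pair W) auto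
  moreover have "(\<lambda>y. (coord_map a b f y, coord_map a c g y)) = coord_map a (prod_chart b c) (\<lambda>x. (f x, g x))"
    by (simp add: coord_map_apply prod_chart_simps fun_eq_iff)
  ultimately have "smooth_on (U \<inter> V) (coord_map a (prod_chart b c) (\<lambda>x. (f x, g x)))" by simp
  moreover have "\<forall>y\<in>U \<inter> V. (f (chart_inv a y), g (chart_inv a y)) \<in> fst (prod_chart b c)"
    using U(4) V(4) by (simp add: prod_chart_simps)
  moreover have "snd a x \<in> U \<inter> V" "U \<inter> V \<subseteq> snd a ` fst a" using U V by blast+
  ultimately show "\<exists>c\<in>A. \<exists>d\<in>prod_atlas B C. \<exists>U. x \<in> fst c \<and> open U \<and> snd c x \<in> U \<and> U \<subseteq> snd c ` fst c \<and>
      (\<forall>y\<in>U. (f (chart_inv c y), g (chart_inv c y)) \<in> fst d) \<and> smooth_on U (coord_map c d (\<lambda>x. (f x, g x)))"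
    using abc W prod_chart_in[OF abc(3,5)] by blast
qed

section \<open>Open subsets\<close>

lemma restrict_atlas_iff: "d \<in> restrict_atlas A W \<longleftrightarrow> (\<exists>c\<in>A. d = (fst c \<inter> W, snd c))"
  by (auto simp: restrict_atlas_def)

lemma points_restrict: "points (restrict_atlas A W) = points A \<inter> W"
  by (auto simp: points_def restrict_atlas_def)

lemma chart_inv_restrict:
  assumes "smooth_atlas A" "c \<in> A" "y \<in> snd c ` (fst c \<inter> W)"
  shows "chart_inv (fst c \<inter> W, snd c) y = chart_inv c y"
proof -
  obtain x where x: "x \<in> fst c" "x \<in> W" "y = snd c x" using assms(3) by blast
  have "inj_on (snd c) (fst c \<inter> W)"
    by (rule inj_on_subset[OF smooth_atlas_inj[OF assms(1,2)]]) simp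
  then have "chart_inv (fst c \<inter> W, snd c) y = x" using x by (simp add: chart_inv_def)
  then show ?thesis using chart_inv_snd[OF assms(1,2) x(1)] x(3) by simp
qed

lemma smooth_atlas_restrict:
  assumes A: "smooth_atlas A" and W: "openin (mtop A) W"
  shows "smooth_atlas (restrict_atlas A W)"
  unfolding smooth_atlas_def
proof (intro conjI ballI)
  fix c' assume "c' \<in> restrict_atlas A W"
  then obtain c where c: "c \<in> A" "c' = (fst c \<inter> W, snd c)" unfolding restrict_atlas_iff by blast
  show "inj_on (snd c') (fst c')"
    unfolding c(2) using inj_on_subset[OF smooth_atlas_inj[OF A c(1)]] by simp
  show "open (snd c' ` fst c')" unfolding c(2) using open_chart_Int[OF A c(1) W] by simp
  fix d' assume "d' \<in> restrict_atlas A W"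
  then obtain d where d: "d \<in> A" "d' = (fst d \<inter> W, snd d)" unfolding restrict_atlas_iff by blast
  have "openin (mtop A) (fst d \<inter> W)" using openin_chart[OF A d(1)] W by blast
  from open_chart_Int[OF A c(1) this]
  show op: "open (snd c' ` (fst c' \<inter> fst d'))"
    unfolding c(2) d(2) by (simp add: Int_ac)
  have sub: "snd c' ` (fst c' \<inter> fst d') \<subseteq> snd c ` (fst c \<inter> W) \<inter> snd c ` (fst c \<inter> fst d)"
    unfolding c(2) d(2) by auto
  show "smooth_on (snd c' ` (fst c' \<inter> fst d')) (transition c' d')"
  proof (rule smooth_on_cong[OF op _ smooth_on_subset[OF smooth_atlas_overlap(2)[OF A c(1) d(1)]]])
    fix y assume "y \<in> snd c' ` (fst c' \<inter> fst d')"
    then have "y \<in> snd c ` (fst c \<inter> W)" using sub by blast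
    from chart_inv_restrict[OF A c(1) this] show "coord_map c d id y = transition c' d' y"
      by (simp add: transition_coord_map coord_map_apply c(2) d(2))
  qed (use sub in blast)
qed

lemma smooth_map_into_restrict:
  assumes f: "smooth_map B A f" and A: "smooth_atlas A" and B: "smooth_atlas B"
    and W: "openin (mtop A) W" and fW: "f ` points B \<subseteq> W"
  shows "smooth_map B (restrict_atlas A W) f"
proof (rule smooth_mapI[OF B smooth_atlas_restrict[OF A W]])
  fix x assume x: "x \<in> points B"
  obtain c d where cd: "c \<in> B" "x \<in> fst c" "d \<in> A" "f x \<in> fst d"
    using x smooth_map_image[OF f B A x] unfolding points_iff by blast
  obtain U where U: "open U" "snd c x \<in> U" "U \<subseteq> snd c ` fst c" "\<forall>y\<in>U. f (chart_inv c y) \<in> fst d"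
    "smooth_on U (coord_map c d f)" by (rule smooth_map_local[OF f B A cd(1,3,2,4)])
  have "f (chart_inv c y) \<in> fst (fst d \<inter> W, snd d)" if "y \<in> U" for y
  proof -
    have "chart_inv c y \<in> points B" using chart_inv_in[of y c] U(3) that cd(1) unfolding points_iff by blast
    then show ?thesis using U(4) that fW by auto
  qed
  moreover have "coord_map c (fst d \<inter> W, snd d) f = coord_map c d f" by (simp add: coord_map_def)
  moreover have "(fst d \<inter> W, snd d) \<in> restrict_atlas A W" using cd(3) unfolding restrict_atlas_iff by blast
  ultimately show "\<exists>c\<in>B. \<exists>d\<in>restrict_atlas A W. \<exists>U. x \<in> fst c \<and> open U \<and> snd c x \<in> U \<and> U \<subseteq> snd c ` fst c \<and>
      (\<forall>y\<in>U. f (chart_inv c y) \<in> fst d) \<and> smooth_on U (coord_map c d f)"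
    using cd U by (intro bexI[of _ c] bexI[of _ "(fst d \<inter> W, snd d)"] exI[of _ U]) simp_all
qed

lemma smooth_map_restrict_inclusion:
  assumes A: "smooth_atlas A" and W: "openin (mtop A) W"
  shows "smooth_map (restrict_atlas A W) A id"
proof (rule smooth_mapI[OF smooth_atlas_restrict[OF A W] A])
  fix x assume "x \<in> points (restrict_atlas A W)"
  then have x: "x \<in> points A" "x \<in> W" unfolding points_restrict by auto
  obtain c where c: "c \<in> A" "x \<in> fst c" using x(1) unfolding points_iff by blast
  let ?c = "(fst c \<inter> W, snd c)"
  have cR: "?c \<in> restrict_atlas A W" using c(1) unfolding restrict_atlas_iff by blast
  have op: "open (snd c ` (fst c \<inter> W))" by (rule open_chart_Int[OF A c(1) W])
  have "smooth_on (snd c ` (fst c \<inter> W)) (coord_map ?c c id)"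
    by (rule smooth_on_cong[OF op _ smooth_on_ident[OF op]])
       (auto simp: coord_map_apply chart_inv_restrict[OF A c(1)] chart_inv_snd[OF A c(1)])
  moreover have "\<forall>y\<in>snd c ` (fst c \<inter> W). id (chart_inv ?c y) \<in> fst c"
    by (auto simp: chart_inv_restrict[OF A c(1)] chart_inv_snd[OF A c(1)])
  ultimately show "\<exists>c\<in>restrict_atlas A W. \<exists>d\<in>A. \<exists>U. x \<in> fst c \<and> open U \<and> snd c x \<in> U \<and> U \<subseteq> snd c ` fst c \<and>
      (\<forall>y\<in>U. id (chart_inv c y) \<in> fst d) \<and> smooth_on U (coord_map c d id)"
    using c x(2) op cR by (intro bexI[of _ ?c] bexI[of _ c] exI[of _ "snd c ` (fst c \<inter> W)"]) simp_all
qed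

section \<open>Embedded submanifolds\<close>

lemma submanifold_chartE:
  assumes "c \<in> submanifold_atlas A S"
  obtains W F where "c = (S \<inter> W, F)" "openin (mtop A) W" "smooth_map (restrict_atlas A W) (open_atlas UNIV) F"
    "inj_on F (S \<inter> W)" "open (F ` (S \<inter> W))" "smooth_map (open_atlas (F ` (S \<inter> W))) A (inv_into (S \<inter> W) F)"
  using assms unfolding submanifold_atlas_def by blast

text \<open>A transition is the parametrisation \<open>inv_into (S \<inter> W) F\<close>, smooth
  into the ambient manifold, followed by \<open>F'\<close>, which is smooth on an ambient open
  set.\<close>

lemma smooth_atlas_submanifold:
  fixes A :: "('a, 'e::euclidean_space) atlas"
  assumes A: "smooth_atlas A"
  shows "smooth_atlas (submanifold_atlas A S :: ('a, 'k::euclidean_space) atlas)"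
  unfolding smooth_atlas_def
proof (intro conjI ballI)
  fix c :: "('a, 'k) chart" assume "c \<in> submanifold_atlas A S"
  then obtain W F where c: "c = (S \<inter> W, F)" "openin (mtop A) W" "smooth_map (restrict_atlas A W) (open_atlas UNIV) F"
    "inj_on F (S \<inter> W)" "open (F ` (S \<inter> W))" "smooth_map (open_atlas (F ` (S \<inter> W))) A (inv_into (S \<inter> W) F)"
    by (rule submanifold_chartE)
  show "inj_on (snd c) (fst c)" "open (snd c ` fst c)" using c by simp_all
  fix d :: "('a, 'k) chart" assume "d \<in> submanifold_atlas A S"
  then obtain W' F' where d: "d = (S \<inter> W', F')" "openin (mtop A) W'" "smooth_map (restrict_atlas A W') (open_atlas UNIV) F'"
    "inj_on F' (S \<inter> W')" "open (F' ` (S \<inter> W'))" "smooth_map (open_atlas (F' ` (S \<inter> W'))) A (inv_into (S \<inter> W') F')"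
    by (rule submanifold_chartE)
  let ?V = "F ` (S \<inter> W)" and ?j = "inv_into (S \<inter> W) F"
  define T where "T = {y \<in> ?V. ?j y \<in> W'}"
  have eq: "snd c ` (fst c \<inter> fst d) = T"
  proof (intro equalityI subsetI)
    fix y assume "y \<in> snd c ` (fst c \<inter> fst d)"
    then obtain x where "x \<in> S \<inter> W" "x \<in> W'" "y = F x" unfolding c(1) d(1) by auto
    then show "y \<in> T" using c(4) by (simp add: T_def)
  next
    fix y assume y: "y \<in> T"
    then have yV: "y \<in> ?V" by (simp add: T_def)
    have "?j y \<in> S \<inter> W" "F (?j y) = y" using inv_into_into[OF yV] f_inv_into_f[OF yV] .
    moreover have "?j y \<in> W'" using y by (simp add: T_def)
    ultimately show "y \<in> snd c ` (fst c \<inter> fst d)"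
      unfolding c(1) d(1) by (intro image_eqI[of _ _ "?j y"]) simp_all
  qed
  have "openin (mtop (open_atlas ?V)) T"
    using smooth_map_openin_preimage[OF c(6) smooth_atlas_open_atlas[OF c(5)] d(2)] unfolding T_def by simp
  then have T: "open T" "T \<subseteq> ?V" unfolding openin_open_atlas[OF c(5)] by auto
  show "open (snd c ` (fst c \<inter> fst d))" unfolding eq by (rule T(1))
  note aT = smooth_atlas_open_atlas[OF T(1)]
  have "smooth_map (open_atlas T) (open_atlas ?V) id"
    by (rule smooth_map_open_open[OF T(1) c(5)]) (use T in \<open>auto simp: id_def intro: smooth_on_ident\<close>)
  from smooth_map_compose[OF this c(6) aT smooth_atlas_open_atlas[OF c(5)] A]
  have "smooth_map (open_atlas T) A ?j" by simp
  then have "smooth_map (open_atlas T) (restrict_atlas A W') ?j"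
    by (rule smooth_map_into_restrict[OF _ A aT d(2)]) (auto simp: T_def)
  from smooth_map_compose[OF this d(3) aT smooth_atlas_restrict[OF A d(2)] smooth_atlas_open_atlas[OF open_UNIV]]
  have "smooth_map (open_atlas T) (open_atlas UNIV) (F' \<circ> ?j)" .
  from smooth_map_into_openD[OF this aT open_UNIV, of "(T, id)"]
  have "smooth_on T (\<lambda>y. (F' \<circ> ?j) (chart_inv (T, id) y))" by simp
  then have "smooth_on T (transition c d)"
    by (rule smooth_on_cong[OF T(1), rotated])
       (simp add: chart_inv_open_atlas transition_def chart_inv_def c(1) d(1))
  then show "smooth_on (snd c ` (fst c \<inter> fst d)) (transition c d)" unfolding eq .
qed

text \<open>In a chart of the submanifold the inclusion is the parametrisation, smooth by the
  definition of the atlas.\<close>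

lemma smooth_map_submanifold_inclusion:
  fixes A :: "('a, 'e::euclidean_space) atlas"
  assumes A: "smooth_atlas A"
  shows "smooth_map (submanifold_atlas A S :: ('a, 'k::euclidean_space) atlas) A id"
proof (rule smooth_mapI[OF smooth_atlas_submanifold[OF A] A])
  fix x assume "x \<in> points (submanifold_atlas A S :: ('a, 'k) atlas)"
  then obtain c :: "('a, 'k) chart" where cx: "c \<in> submanifold_atlas A S" "x \<in> fst c" unfolding points_iff by blast
  obtain W F where c: "c = (S \<inter> W, F)" "openin (mtop A) W" "smooth_map (restrict_atlas A W) (open_atlas UNIV) F"
    "inj_on F (S \<inter> W)" "open (F ` (S \<inter> W))" "smooth_map (open_atlas (F ` (S \<inter> W))) A (inv_into (S \<inter> W) F)"
    using cx(1) by (rule submanifold_chartE)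
  let ?V = "F ` (S \<inter> W)" and ?j = "inv_into (S \<inter> W) F"
  have xV: "F x \<in> ?V" "?j (F x) = x" using cx(2) c(1,4) by auto
  note aV = smooth_atlas_open_atlas[OF c(5)]
  have "x \<in> points A" using smooth_map_image[OF c(6) aV A, of "F x"] xV by simp
  then obtain d where d: "d \<in> A" "x \<in> fst d" unfolding points_iff by blast
  obtain U where U: "open U" "F x \<in> U" "U \<subseteq> ?V" "\<forall>y\<in>U. ?j (chart_inv (?V, id) y) \<in> fst d"
    "smooth_on U (coord_map (?V, id) d ?j)"
    by (rule smooth_map_local[OF c(6) aV A, of "(?V, id)" d "F x"]) (use d xV in auto)
  have inv: "chart_inv (?V, id) y = y" if "y \<in> U" for y
    by (rule chart_inv_open_atlas) (use that U(3) in blast)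
  have "smooth_on U (coord_map c d id)"
    by (rule smooth_on_cong[OF U(1) _ U(5)]) (simp add: coord_map_apply inv c(1) chart_inv_def[of "(S \<inter> W, F)"])
  moreover have "\<forall>y\<in>U. id (chart_inv c y) \<in> fst d"
    using U(4) inv by (simp add: c(1) chart_inv_def[of "(S \<inter> W, F)"])
  moreover have "snd c x \<in> U" "U \<subseteq> snd c ` fst c" using U c(1) by simp_all
  ultimately show "\<exists>c\<in>submanifold_atlas A S :: ('a, 'k) atlas. \<exists>d\<in>A. \<exists>U. x \<in> fst c \<and> open U \<and> snd c x \<in> U \<and> U \<subseteq> snd c ` fst c \<and>
      (\<forall>y\<in>U. id (chart_inv c y) \<in> fst d) \<and> smooth_on U (coord_map c d id)"
    using cx d U(1) by blast
qed

text \<open>Charts are restrictions of maps \<open>F\<close> smooth on ambient open sets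
  \<open>W\<close>, so \<open>F \<circ> f\<close> is smooth on the open set that \<open>f\<close>
  sends into \<open>W\<close>. Values in \<open>points\<close> of the new atlas are demanded, since
  a chart need not exist at every point of \<open>S\<close>.\<close>

lemma smooth_map_into_submanifold:
  fixes A :: "('a, 'e::euclidean_space) atlas"
  assumes f: "smooth_map B A f" and A: "smooth_atlas A" and B: "smooth_atlas B"
    and im: "f ` points B \<subseteq> points (submanifold_atlas A S :: ('a, 'k::euclidean_space) atlas)"
  shows "smooth_map B (submanifold_atlas A S :: ('a, 'k) atlas) f"
proof (rule smooth_mapI[OF B smooth_atlas_submanifold[OF A]])
  fix x assume x: "x \<in> points B"
  then have "f x \<in> points (submanifold_atlas A S :: ('a, 'k) atlas)" using im by blast
  then obtain c :: "('a, 'k) chart" where cx: "c \<in> submanifold_atlas A S" "f x \<in> fst c" unfolding points_iff by blast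
  obtain W F where c: "c = (S \<inter> W, F)" "openin (mtop A) W" "smooth_map (restrict_atlas A W) (open_atlas UNIV) F"
    "inj_on F (S \<inter> W)" "open (F ` (S \<inter> W))" "smooth_map (open_atlas (F ` (S \<inter> W))) A (inv_into (S \<inter> W) F)"
    using cx(1) by (rule submanifold_chartE)
  have imS: "f z \<in> S" if "z \<in> points B" for z
  proof -
    have "f z \<in> points (submanifold_atlas A S :: ('a, 'k) atlas)" using im that by blast
    then obtain c :: "('a, 'k) chart" where "c \<in> submanifold_atlas A S" "f z \<in> fst c" unfolding points_iff by blast
    then show ?thesis by (elim submanifold_chartE) simp
  qed
  let ?W = "{x \<in> points B. f x \<in> W}"
  have W: "openin (mtop B) ?W" by (rule smooth_map_openin_preimage[OF f B c(2)])
  note BW = smooth_atlas_restrict[OF B W]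
  have "smooth_map (restrict_atlas B ?W) A (f \<circ> id)"
    by (rule smooth_map_compose[OF smooth_map_restrict_inclusion[OF B W] f BW B A])
  then have "smooth_map (restrict_atlas B ?W) (restrict_atlas A W) f"
    by (intro smooth_map_into_restrict[OF _ A BW c(2)]) (auto simp: points_restrict)
  from smooth_map_compose[OF this c(3) BW smooth_atlas_restrict[OF A c(2)] smooth_atlas_open_atlas[OF open_UNIV]]
  have Ff: "smooth_map (restrict_atlas B ?W) (open_atlas UNIV) (F \<circ> f)" .
  obtain b where b: "b \<in> B" "x \<in> fst b" using x unfolding points_iff by blast
  let ?b = "(fst b \<inter> ?W, snd b)" and ?U = "snd b ` (fst b \<inter> ?W)"
  have "?b \<in> restrict_atlas B ?W" using b(1) unfolding restrict_atlas_iff by blast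
  from smooth_map_into_openD[OF Ff BW open_UNIV this]
  have sm: "smooth_on ?U (\<lambda>y. F (f (chart_inv ?b y)))" by simp
  have U: "open ?U" by (rule open_chart_Int[OF B b(1) W])
  have inv: "chart_inv ?b y = chart_inv b y" "chart_inv b y \<in> ?W" if "y \<in> ?U" for y
    using chart_inv_restrict[OF B b(1) that] that chart_inv_snd[OF B b(1)] by auto
  have "smooth_on ?U (coord_map b c f)"
    by (rule smooth_on_cong[OF U _ sm]) (simp only: inv(1) coord_map_apply c(1) snd_conv)
  moreover have "\<forall>y\<in>?U. f (chart_inv b y) \<in> fst c"
    using inv(2) imS unfolding c(1) by simp
  moreover have "snd b x \<in> ?U" "?U \<subseteq> snd b ` fst b" using b x cx(2) unfolding c(1) by auto
  ultimately show "\<exists>b\<in>B. \<exists>d\<in>submanifold_atlas A S :: ('a, 'k) atlas. \<exists>U. x \<in> fst b \<and> open U \<and> snd b x \<in> U \<and> U \<subseteq> snd b ` fst b \<and>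
      (\<forall>y\<in>U. f (chart_inv b y) \<in> fst d) \<and> smooth_on U (coord_map b d f)"
    using b cx(1) U by blast
qed

section \<open>Quotients by deck transformations\<close>

definition quotient_setting ::
  "('a, 'e::euclidean_space) atlas \<Rightarrow> ('a \<Rightarrow> 'c) \<Rightarrow> ('a \<Rightarrow> 'a) set \<Rightarrow> bool" where
  "quotient_setting X q T \<longleftrightarrow> smooth_atlas X \<and>
     (\<forall>x\<in>points X. \<exists>W. openin (mtop X) W \<and> x \<in> W \<and> inj_on q W) \<and>
     (\<forall>\<tau>\<in>T. smooth_map X X \<tau> \<and> (\<forall>z\<in>points X. q (\<tau> z) = q z)) \<and>
     (\<forall>x\<in>points X. \<forall>x'\<in>points X. q x = q x' \<longrightarrow> (\<exists>\<tau>\<in>T. \<tau> x = x'))"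

definition quotient_chart :: "('a \<Rightarrow> 'c) \<Rightarrow> 'a set \<Rightarrow> ('a, 'e) chart \<Rightarrow> ('c, 'e) chart" where
  "quotient_chart q W e = (q ` W, snd e \<circ> inv_into W q)"

lemma quotient_chartE:
  assumes "c \<in> quotient_atlas X q"
  obtains W e where "c = quotient_chart q W e" "e \<in> X" "W \<subseteq> fst e" "openin (mtop X) W" "inj_on q W"
  using assms unfolding quotient_atlas_def quotient_chart_def by blast

lemma quotient_chart_in:
  "e \<in> X \<Longrightarrow> W \<subseteq> fst e \<Longrightarrow> openin (mtop X) W \<Longrightarrow> inj_on q W \<Longrightarrow> quotient_chart q W e \<in> quotient_atlas X q"
  unfolding quotient_atlas_def quotient_chart_def by blast

lemma quotient_chart_simps:
  assumes X: "smooth_atlas X" and e: "e \<in> X" "W \<subseteq> fst e" "openin (mtop X) W" "inj_on q W"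
  shows "fst (quotient_chart q W e) = q ` W"
    "w \<in> W \<Longrightarrow> snd (quotient_chart q W e) (q w) = snd e w"
    "snd (quotient_chart q W e) ` fst (quotient_chart q W e) = snd e ` W"
    "inj_on (snd (quotient_chart q W e)) (q ` W)"
    "open (snd e ` W)" "snd e ` W \<subseteq> snd e ` fst e"
    "y \<in> snd e ` W \<Longrightarrow> chart_inv e y \<in> W"
    "y \<in> snd e ` W \<Longrightarrow> chart_inv (quotient_chart q W e) y = q (chart_inv e y)"
proof -
  show f: "fst (quotient_chart q W e) = q ` W" by (simp add: quotient_chart_def)
  show s: "snd (quotient_chart q W e) (q w) = snd e w" if "w \<in> W" for w
    using that e(4) by (simp add: quotient_chart_def)
  show "snd (quotient_chart q W e) ` fst (quotient_chart q W e) = snd e ` W"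
    unfolding f image_image by (rule image_cong[OF refl]) (rule s)
  have inj: "inj_on (snd e) W" by (rule inj_on_subset[OF smooth_atlas_inj[OF X e(1)] e(2)])
  show i: "inj_on (snd (quotient_chart q W e)) (q ` W)"
  proof (rule inj_onI)
    fix a b assume "a \<in> q ` W" "b \<in> q ` W" and eq: "snd (quotient_chart q W e) a = snd (quotient_chart q W e) b"
    then obtain u v where uv: "u \<in> W" "a = q u" "v \<in> W" "b = q v" by blast
    then have "u = v" using eq s inj_onD[OF inj] by simp
    then show "a = b" using uv by simp
  qed
  have "fst e \<inter> W = W" using e(2) by blast
  then show "open (snd e ` W)" using open_chart_Int[OF X e(1,3)] by simp
  show "snd e ` W \<subseteq> snd e ` fst e" using e(2) by blast
  fix y assume "y \<in> snd e ` W"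
  then obtain w where w: "w \<in> W" "y = snd e w" by blast
  then have ew: "chart_inv e y = w" using chart_inv_snd[OF X e(1)] e(2) by blast
  then show "chart_inv e y \<in> W" using w by simp
  show "chart_inv (quotient_chart q W e) y = q (chart_inv e y)"
    unfolding ew chart_inv_def[of "quotient_chart q W e"] f
    by (rule inv_into_f_eq[OF i]) (use w s in auto)
qed

text \<open>An axiomatic free and properly discontinuous action with deck transformations
  \<open>T\<close>. Both \<open>P\<close> and \<open>P/K\<close> are instances.\<close>

locale quotient =
  fixes X :: "('a, 'e::euclidean_space) atlas" and q :: "'a \<Rightarrow> 'c" and T :: "('a \<Rightarrow> 'a) set"
  assumes setting: "quotient_setting X q T"
begin

abbreviation "Q \<equiv> quotient_atlas X q"

lemma X: "smooth_atlas X" using setting by (simp add: quotient_setting_def)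

lemma local_inj:
  assumes "x \<in> points X" obtains W where "openin (mtop X) W" "x \<in> W" "inj_on q W"
  using setting assms unfolding quotient_setting_def by blast

lemma deck:
  assumes "x \<in> points X" "x' \<in> points X" "q x = q x'"
  obtains \<tau> where "\<tau> \<in> T" "smooth_map X X \<tau>" "\<forall>z\<in>points X. q (\<tau> z) = q z" "\<tau> x = x'"
  using setting assms unfolding quotient_setting_def by blast

lemma points_subset: "openin (mtop X) W \<Longrightarrow> W \<subseteq> points X"
  using openin_subset[of "mtop X" W] by (simp add: topspace_mtop[OF X])

lemma chart_at_point:
  assumes x: "x \<in> points X" and V: "openin (mtop X) V" "x \<in> V"
  obtains W e where "e \<in> X" "W \<subseteq> fst e" "openin (mtop X) W" "inj_on q W" "x \<in> W" "W \<subseteq> V"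
proof -
  obtain W where W: "openin (mtop X) W" "x \<in> W" "inj_on q W" by (rule local_inj[OF x])
  obtain e where e: "e \<in> X" "x \<in> fst e" using x unfolding points_iff by blast
  show thesis
  proof (rule that[OF e(1)])
    show "openin (mtop X) (W \<inter> fst e \<inter> V)"
      by (intro openin_Int W V openin_chart[OF X e(1)])
    show "inj_on q (W \<inter> fst e \<inter> V)" by (rule inj_on_subset[OF W(3)]) blast
  qed (use W e V in auto)
qed

lemma points_Q: "points Q = q ` points X"
proof (intro equalityI subsetI)
  fix z assume "z \<in> points Q"
  then obtain c where c: "c \<in> Q" "z \<in> fst c" unfolding points_iff by blast
  obtain W e where "c = quotient_chart q W e" "openin (mtop X) W" by (rule quotient_chartE[OF c(1)])
  then show "z \<in> q ` points X" using c(2) points_subset by (auto simp: quotient_chart_def)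
next
  fix z assume "z \<in> q ` points X"
  then obtain x where x: "x \<in> points X" "z = q x" by blast
  have "openin (mtop X) (points X)" using openin_topspace[of "mtop X"] by (simp add: topspace_mtop[OF X])
  then obtain W e where "e \<in> X" "W \<subseteq> fst e" "openin (mtop X) W" "inj_on q W" "x \<in> W"
    using chart_at_point[OF x(1) _ x(1)] by metis
  then show "z \<in> points Q"
    unfolding points_iff using quotient_chart_in[of e X W q] x(2) by (intro bexI[of _ "quotient_chart q W e"]) (auto simp: quotient_chart_def)
qed

text \<open>Two quotient charts meet where a deck transformation \<open>\<tau>\<close> carries one
  sheet to the other; there the transition is the coordinate expression of
  \<open>\<tau>\<close>.\<close>

lemma overlap_local:
  assumes e1: "e1 \<in> X" "W1 \<subseteq> fst e1" "openin (mtop X) W1" "inj_on q W1"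
    and e2: "e2 \<in> X" "W2 \<subseteq> fst e2" "openin (mtop X) W2" "inj_on q W2"
    and w: "w1 \<in> W1" "w2 \<in> W2" "q w1 = q w2"
  defines "c \<equiv> quotient_chart q W1 e1" and "d \<equiv> quotient_chart q W2 e2"
  shows "\<exists>T. open T \<and> snd e1 w1 \<in> T \<and> T \<subseteq> snd c ` (fst c \<inter> fst d) \<and> smooth_on T (coord_map c d id)"
proof -
  note s1 = quotient_chart_simps[OF X e1] and s2 = quotient_chart_simps[OF X e2]
  have wX: "w1 \<in> points X" "w2 \<in> points X" using w points_subset e1(3) e2(3) by blast+
  obtain \<tau> where "\<tau> \<in> T" and \<tau>: "smooth_map X X \<tau>" "\<forall>z\<in>points X. q (\<tau> z) = q z" "\<tau> w1 = w2"
    by (rule deck[OF wX w(3)])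
  have we: "w1 \<in> fst e1" "\<tau> w1 \<in> fst e2" using w e1(2) e2(2) \<tau>(3) by blast+
  obtain U where U: "open U" "snd e1 w1 \<in> U" "U \<subseteq> snd e1 ` fst e1" "\<forall>y\<in>U. \<tau> (chart_inv e1 y) \<in> fst e2"
    "smooth_on U (coord_map e1 e2 \<tau>)" by (rule smooth_map_local[OF \<tau>(1) X X e1(1) e2(1) we])
  define T where "T = (U \<inter> coord_map e1 e2 \<tau> -` (snd e2 ` W2)) \<inter> snd e1 ` W1"
  have T: "open T" unfolding T_def
    by (intro open_Int s1(5) continuous_open_preimage[OF smooth_on_imp_continuous_on[OF U(5)] U(1) s2(5)])
  have in2: "\<tau> (chart_inv e1 y) \<in> W2" if y: "y \<in> T" for y
  proof -
    have "snd e2 (\<tau> (chart_inv e1 y)) \<in> snd e2 ` W2" using y by (simp add: T_def coord_map_apply)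
    then obtain v where v: "v \<in> W2" "snd e2 (\<tau> (chart_inv e1 y)) = snd e2 v" by blast
    have "\<tau> (chart_inv e1 y) \<in> fst e2" using U(4) y by (simp add: T_def)
    then have "\<tau> (chart_inv e1 y) = v"
      using inj_onD[OF smooth_atlas_inj[OF X e2(1)] v(2)] v(1) e2(2) by blast
    then show ?thesis using v by simp
  qed
  have q2: "q (chart_inv e1 y) = q (\<tau> (chart_inv e1 y))" "chart_inv e1 y \<in> W1" if y: "y \<in> T" for y
  proof -
    show "chart_inv e1 y \<in> W1" using s1(7) y by (simp add: T_def)
    then show "q (chart_inv e1 y) = q (\<tau> (chart_inv e1 y))"
      using \<tau>(2) points_subset[OF e1(3)] by (metis subsetD)
  qed
  have inv: "chart_inv c y = q (\<tau> (chart_inv e1 y))" if "y \<in> T" for y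
    unfolding c_def using s1(8)[of y] q2(1)[OF that] that by (simp add: T_def)
  have "snd e1 w1 \<in> T"
    using w U(2) \<tau>(3) by (auto simp: T_def coord_map_apply chart_inv_snd[OF X e1(1) we(1)])
  moreover have "T \<subseteq> snd c ` (fst c \<inter> fst d)"
  proof
    fix y assume y: "y \<in> T"
    have "chart_inv c y \<in> fst d" unfolding inv[OF y] d_def s2(1) using in2[OF y] by (rule imageI)
    moreover have "y \<in> snd c ` fst c" unfolding c_def s1(3) using y by (simp add: T_def)
    ultimately show "y \<in> snd c ` (fst c \<inter> fst d)"
      using chart_inv_in[of y c] snd_chart_inv[of y c] by (intro image_eqI[of _ _ "chart_inv c y"]) simp_all
  qed
  moreover have "smooth_on T (coord_map c d id)"
  proof (rule smooth_on_cong[OF T _ smooth_on_subset[OF U(5)]])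
    fix y assume y: "y \<in> T"
    show "coord_map e1 e2 \<tau> y = coord_map c d id y"
      using s2(2)[OF in2[OF y]] by (simp add: coord_map_apply inv[OF y] d_def)
  qed (auto simp: T_def)
  ultimately show ?thesis using T by blast
qed

lemma smooth_atlas_Q: "smooth_atlas Q"
  unfolding smooth_atlas_def
proof (intro conjI ballI)
  fix c assume cQ: "c \<in> Q"
  obtain W1 e1 where c: "c = quotient_chart q W1 e1" and e1: "e1 \<in> X" "W1 \<subseteq> fst e1" "openin (mtop X) W1" "inj_on q W1"
    by (rule quotient_chartE[OF cQ])
  note s1 = quotient_chart_simps[OF X e1]
  show "inj_on (snd c) (fst c)" "open (snd c ` fst c)" unfolding c using s1(4) s1(1) s1(3) s1(5) by simp_all
  fix d assume dQ: "d \<in> Q"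
  obtain W2 e2 where d: "d = quotient_chart q W2 e2" and e2: "e2 \<in> X" "W2 \<subseteq> fst e2" "openin (mtop X) W2" "inj_on q W2"
    by (rule quotient_chartE[OF dQ])
  note s2 = quotient_chart_simps[OF X e2]
  have loc: "\<exists>T. open T \<and> y \<in> T \<and> T \<subseteq> snd c ` (fst c \<inter> fst d) \<and> smooth_on T (coord_map c d id)"
    if y: "y \<in> snd c ` (fst c \<inter> fst d)" for y
  proof -
    from y obtain u where u: "u \<in> q ` W1" "u \<in> q ` W2" "y = snd c u" unfolding c d s1(1) s2(1) by blast
    then obtain w1 w2 where ww: "w1 \<in> W1" "u = q w1" "w2 \<in> W2" "u = q w2" by blast
    have w: "w1 \<in> W1" "w2 \<in> W2" "q w1 = q w2" "y = snd c (q w1)"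
      using ww(1,3) u(3) by (simp_all flip: ww(2,4))
    have "y = snd e1 w1" using s1(2)[OF w(1)] w(4) c by simp
    then show ?thesis using overlap_local[OF e1 e2 w(1,2,3)] unfolding c d by simp
  qed
  show "open (snd c ` (fst c \<inter> fst d))"
    by (subst open_subopen) (use loc in blast)
  show "smooth_on (snd c ` (fst c \<inter> fst d)) (transition c d)"
    unfolding transition_coord_map by (rule smooth_on_local) (use loc in blast)
qed

text \<open>In the charts \<open>e\<close> and \<open>quotient_chart q W e\<close> the map
  \<open>q\<close> is the identity.\<close>

lemma smooth_map_q: "smooth_map X Q q"
proof (rule smooth_mapI[OF X smooth_atlas_Q])
  fix x assume x: "x \<in> points X"
  have "openin (mtop X) (points X)" using openin_topspace[of "mtop X"] by (simp add: topspace_mtop[OF X])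
  then obtain W e where e: "e \<in> X" "W \<subseteq> fst e" "openin (mtop X) W" "inj_on q W" and xW: "x \<in> W"
    using chart_at_point[OF x _ x] by metis
  note s = quotient_chart_simps[OF X e]
  have "smooth_on (snd e ` W) (coord_map e (quotient_chart q W e) q)"
  proof (rule smooth_on_cong[OF s(5) _ smooth_on_ident[OF s(5)]])
    fix y assume y: "y \<in> snd e ` W"
    show "y = coord_map e (quotient_chart q W e) q y"
      using s(2)[OF s(7)[OF y]] y s(6) snd_chart_inv[of y e] by (simp add: coord_map_apply subset_iff)
  qed
  moreover have "\<forall>y\<in>snd e ` W. q (chart_inv e y) \<in> fst (quotient_chart q W e)"
    using s(7) unfolding s(1) by blast
  ultimately show "\<exists>c\<in>X. \<exists>d\<in>Q. \<exists>U. x \<in> fst c \<and> open U \<and> snd c x \<in> U \<and> U \<subseteq> snd c ` fst c \<and>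
      (\<forall>y\<in>U. q (chart_inv c y) \<in> fst d) \<and> smooth_on U (coord_map c d q)"
    using e xW s(5,6) quotient_chart_in[OF e]
    by (intro bexI[of _ e] bexI[of _ "quotient_chart q W e"] exI[of _ "snd e ` W"]) auto
qed

text \<open>The universal property of the quotient: in suitable charts \<open>f\<close> and
  \<open>f \<circ> q\<close> have the same coordinate expression.\<close>

lemma smooth_map_from_Q:
  assumes f: "smooth_map X B (f \<circ> q)" and B: "smooth_atlas B"
  shows "smooth_map Q B f"
proof (rule smooth_mapI[OF smooth_atlas_Q B])
  fix z assume "z \<in> points Q"
  then obtain x where x: "x \<in> points X" "z = q x" unfolding points_Q by blast
  have "openin (mtop X) (points X)" using openin_topspace[of "mtop X"] by (simp add: topspace_mtop[OF X])
  then obtain W e where e: "e \<in> X" "W \<subseteq> fst e" "openin (mtop X) W" "inj_on q W" and xW: "x \<in> W"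
    using chart_at_point[OF x(1) _ x(1)] by metis
  note s = quotient_chart_simps[OF X e]
  obtain b where b: "b \<in> B" "(f \<circ> q) x \<in> fst b"
    using smooth_map_image[OF f X B x(1)] unfolding points_iff by blast
  have xe: "x \<in> fst e" using e(2) xW by blast
  obtain U where U: "open U" "snd e x \<in> U" "U \<subseteq> snd e ` fst e" "\<forall>y\<in>U. (f \<circ> q) (chart_inv e y) \<in> fst b"
    "smooth_on U (coord_map e b (f \<circ> q))" by (rule smooth_map_local[OF f X B e(1) b(1) xe b(2)])
  let ?c = "quotient_chart q W e" and ?U = "U \<inter> snd e ` W"
  have op: "open ?U" using U(1) s(5) by blast
  have "smooth_on ?U (coord_map ?c b f)"
    by (rule smooth_on_cong[OF op _ smooth_on_subset[OF U(5)]]) (simp_all add: coord_map_apply s(8))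
  moreover have "\<forall>y\<in>?U. f (chart_inv ?c y) \<in> fst b" using U(4) s(8) by simp
  moreover have "z \<in> fst ?c" "snd ?c z \<in> ?U" "?U \<subseteq> snd ?c ` fst ?c"
    unfolding s(3) using s(1) s(2)[OF xW] xW U(2) x(2) by auto
  ultimately show "\<exists>c\<in>Q. \<exists>d\<in>B. \<exists>U. z \<in> fst c \<and> open U \<and> snd c z \<in> U \<and> U \<subseteq> snd c ` fst c \<and>
      (\<forall>y\<in>U. f (chart_inv c y) \<in> fst d) \<and> smooth_on U (coord_map c d f)"
    using b(1) quotient_chart_in[OF e] op by blast
qed

text \<open>The derivative of \<open>q\<close> in these charts is the identity, so coordinate
  computations on the quotient can be carried out on \<open>X\<close>.\<close>

lemma local_rep_quotient:
  assumes e: "e \<in> X" "W \<subseteq> fst e" "openin (mtop X) W" "inj_on q W" and y: "y \<in> snd e ` W"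
  shows "local_rep Q \<beta> (quotient_chart q W e) y ws = local_rep X (pullback X Q q \<beta>) e y ws"
proof -
  note s = quotient_chart_simps[OF X e]
  let ?c = "quotient_chart q W e"
  have id: "coord_map e ?c q y' = y'" if "y' \<in> snd e ` W" for y'
    using s(2)[OF s(7)[OF that]] that s(6) snd_chart_inv[of y' e] by (simp add: coord_map_apply subset_iff)
  then have "frechet_derivative (coord_map e ?c q) (at y) = frechet_derivative (\<lambda>y. y) (at y)"
    by (intro frechet_derivative_cong_open[OF s(5) y]) simp
  then have D: "frechet_derivative (coord_map e ?c q) (at y) = (\<lambda>w. w)" by simp
  have "local_rep X (pullback X Q q \<beta>) e y ws
      = local_rep Q \<beta> ?c (coord_map e ?c q y) (map (frechet_derivative (coord_map e ?c q) (at y)) ws)"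
    by (rule local_rep_pullback[OF smooth_map_q X smooth_atlas_Q e(1) quotient_chart_in[OF e]])
       (use y s(1,6,7) in auto)
  then show ?thesis unfolding id[OF y] D by simp
qed

text \<open>The local right inverse demanded by \<open>pullback_injective\<close> is the identity in
  quotient coordinates.\<close>

lemma pullback_q_injective:
  assumes "\<beta> \<in> forms k Q" "\<beta>' \<in> forms k Q" "pullback X Q q \<beta> = pullback X Q q \<beta>'"
  shows "\<beta> = \<beta>'"
proof (rule pullback_injective[OF smooth_map_q X smooth_atlas_Q _ assms])
  fix b assume "b \<in> points Q"
  then obtain d where d: "d \<in> Q" "b \<in> fst d" unfolding points_iff by blast
  obtain W e where dd: "d = quotient_chart q W e" and e: "e \<in> X" "W \<subseteq> fst e" "openin (mtop X) W" "inj_on q W"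
    by (rule quotient_chartE[OF d(1)])
  note s = quotient_chart_simps[OF X e]
  have "snd d b \<in> snd d ` fst d" using d(2) by (rule imageI)
  then have "snd d b \<in> snd e ` W" unfolding dd s(3) .
  then show "\<exists>c\<in>X. \<exists>d\<in>Q. \<exists>U g. b \<in> fst d \<and> open U \<and> snd d b \<in> U \<and> U \<subseteq> snd d ` fst d \<and>
      smooth_on U g \<and> g ` U \<subseteq> snd c ` fst c \<and> (\<forall>y\<in>U. q (chart_inv c (g y)) = chart_inv d y)"
    using d e(1) s(5,6,8) smooth_on_ident[OF s(5)] s(3)
    by (intro bexI[of _ e] bexI[of _ d] exI[of _ "snd e ` W"] exI[of _ "\<lambda>y. y"]) (auto simp: dd)
qed

text \<open>Supplies the lifts of tangent vectors from which forms on the quotient are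
  built.\<close>

lemma pushforward_q_bij:
  assumes x: "x \<in> points X"
  shows "inj_on (pushforward X Q q x) (tangent X x)" "pushforward X Q q x ` tangent X x = tangent Q (q x)"
proof -
  have "openin (mtop X) (points X)" using openin_topspace[of "mtop X"] by (simp add: topspace_mtop[OF X])
  then obtain W e where e: "e \<in> X" "W \<subseteq> fst e" "openin (mtop X) W" "inj_on q W" and xW: "x \<in> W"
    using chart_at_point[OF x _ x] by metis
  note s = quotient_chart_simps[OF X e]
  let ?c = "quotient_chart q W e"
  have xe: "x \<in> fst e" using e(2) xW by blast
  have cQ: "?c \<in> Q" "q x \<in> fst ?c" using quotient_chart_in[OF e] s(1) xW by auto
  have "frechet_derivative (coord_map e ?c q) (at (snd e x)) = frechet_derivative (\<lambda>y. y) (at (snd e x))"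
  proof (rule frechet_derivative_cong_open[OF s(5)])
    show "coord_map e ?c q y' = y'" if "y' \<in> snd e ` W" for y'
      using s(2)[OF s(7)[OF that]] that s(6) snd_chart_inv[of y' e] by (simp add: coord_map_apply subset_iff)
  qed (use xW in blast)
  then have "dmap e ?c q x w = w" for w by (simp add: dmap_def)
  then have push: "pushforward X Q q x (coord_vec X e x w) = coord_vec Q ?c (q x) w" for w
    using pushforward_coord_vec[OF smooth_map_q X smooth_atlas_Q e(1) xe cQ] by simp
  show "inj_on (pushforward X Q q x) (tangent X x)"
  proof (rule inj_onI)
    fix u v assume u: "u \<in> tangent X x" and v: "v \<in> tangent X x"
      and eq: "pushforward X Q q x u = pushforward X Q q x v"
    have "coord_vec Q ?c (q x) (u e) = coord_vec Q ?c (q x) (v e)"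
      using eq push[of "u e"] push[of "v e"] coord_vec_coord[OF u e(1) xe] coord_vec_coord[OF v e(1) xe] by simp
    then have "u e = v e" using coord_vec_same[OF smooth_atlas_Q cQ] by metis
    then show "u = v" by (rule tangent_eqI[OF u v e(1) xe])
  qed
  show "pushforward X Q q x ` tangent X x = tangent Q (q x)"
  proof (intro equalityI subsetI)
    fix v assume v: "v \<in> tangent Q (q x)"
    have "v = pushforward X Q q x (coord_vec X e x (v ?c))"
      unfolding push using coord_vec_coord[OF v cQ] by simp
    then show "v \<in> pushforward X Q q x ` tangent X x" using coord_vec_tangent[OF X e(1) xe] by blast
  qed (use pushforward_tangent[OF smooth_map_q X smooth_atlas_Q x] in blast)
qed

text \<open>A value at \<open>z\<close> is read off at an arbitrarily chosen preimage
  \<open>r z\<close>, with the tangent vectors lifted there. Invariance under \<open>T\<close> makes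
  the choice immaterial, although \<open>r\<close> need not be continuous.\<close>

lemma descent:
  assumes \<alpha>: "\<alpha> \<in> forms k X" and inv: "\<And>\<tau>. \<tau> \<in> T \<Longrightarrow> pullback X X \<tau> \<alpha> = \<alpha>"
  shows "\<exists>\<beta>\<in>forms k Q. pullback X Q q \<beta> = \<alpha>"
proof -
  define lift where "lift x v = inv_into (tangent X x) (pushforward X Q q x) v" for x v
  define r where "r z = (SOME x. x \<in> points X \<and> q x = z)" for z
  define \<beta> where "\<beta> z vs = (if z \<in> points Q \<and> length vs = k \<and> set vs \<subseteq> tangent Q z
      then \<alpha> (r z) (map (lift (r z)) vs) else 0)" for z vs
  have r: "r (q x) \<in> points X" "q (r (q x)) = q x" if "x \<in> points X" for x
  proof -
    have "\<exists>x'. x' \<in> points X \<and> q x' = q x" using that by blast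
    then have "r (q x) \<in> points X \<and> q (r (q x)) = q x" unfolding r_def by (rule someI_ex)
    then show "r (q x) \<in> points X" "q (r (q x)) = q x" by auto
  qed
  have pb: "pullback X Q q \<beta> = \<alpha>"
  proof (intro ext)
    fix x vs
    show "pullback X Q q \<beta> x vs = \<alpha> x vs"
    proof (cases "x \<in> points X \<and> length vs = k \<and> set vs \<subseteq> tangent X x")
      case False
      then show ?thesis using forms_outside[OF \<alpha> False] by (auto simp: pullback_def \<beta>_def)
    next
      case True
      then have x: "x \<in> points X" and vs: "length vs = k" "set vs \<subseteq> tangent X x" by auto
      let ?y = "r (q x)"
      have qx: "q x = q ?y" using r(2)[OF x] by simp
      obtain \<tau> where \<tau>T: "\<tau> \<in> T" and \<tau>: "smooth_map X X \<tau>" "\<forall>z\<in>points X. q (\<tau> z) = q z" "\<tau> x = ?y"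
        by (rule deck[OF x r(1)[OF x] qx])
      \<comment> \<open>The chosen preimage differs from \<open>x\<close> by the deck transformation
        \<open>\<tau>\<close>, and lifting to it a vector pushed down from \<open>x\<close> amounts
        to pushing forward by \<open>\<tau>\<close>.\<close>
      have lift: "lift ?y (pushforward X Q q x v) = pushforward X X \<tau> x v" if v: "v \<in> tangent X x" for v
        unfolding lift_def
      proof (rule inv_into_f_eq[OF pushforward_q_bij(1)[OF r(1)[OF x]]])
        show "pushforward X X \<tau> x v \<in> tangent X ?y"
          using pushforward_tangent[OF \<tau>(1) X X x v] \<tau>(3) by simp
        have "pushforward X Q q (\<tau> x) (pushforward X X \<tau> x v) = pushforward X Q (q \<circ> \<tau>) x v"
          using pushforward_compose[OF \<tau>(1) smooth_map_q X X smooth_atlas_Q x v] by simp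
        also have "pushforward X Q (q \<circ> \<tau>) x = pushforward X Q q x"
          by (rule pushforward_cong[OF X x]) (simp add: \<tau>(2))
        finally show "pushforward X Q q ?y (pushforward X X \<tau> x v) = pushforward X Q q x v" unfolding \<tau>(3) .
      qed
      have "pullback X Q q \<beta> x vs = \<beta> (q x) (map (pushforward X Q q x) vs)"
        by (rule pullback_apply[OF x vs(2)])
      also have "\<dots> = \<alpha> ?y (map (lift ?y) (map (pushforward X Q q x) vs))"
      proof -
        have "set (map (pushforward X Q q x) vs) \<subseteq> tangent Q (q x)"
          using vs(2) pushforward_tangent[OF smooth_map_q X smooth_atlas_Q x] by auto
        moreover have "q x \<in> points Q" unfolding points_Q using x by blast
        ultimately show ?thesis unfolding \<beta>_def using vs(1) by simp
      qed
      also have "map (lift ?y) (map (pushforward X Q q x) vs) = map (pushforward X X \<tau> x) vs"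
        using lift vs(2) by auto
      also have "\<alpha> ?y (map (pushforward X X \<tau> x) vs) = pullback X X \<tau> \<alpha> x vs"
        unfolding pullback_apply[OF x vs(2)] \<tau>(3) ..
      also have "\<dots> = \<alpha> x vs" using inv[OF \<tau>T] by simp
      finally show ?thesis .
    qed
  qed
  have "\<beta> \<in> forms k Q"
  proof (rule formsI[OF smooth_atlas_Q])
    fix z assume "z \<in> points Q"
    then obtain d where d: "d \<in> Q" "z \<in> fst d" unfolding points_iff by blast
    obtain W e where dd: "d = quotient_chart q W e" and e: "e \<in> X" "W \<subseteq> fst e" "openin (mtop X) W" "inj_on q W"
      by (rule quotient_chartE[OF d(1)])
    note s = quotient_chart_simps[OF X e]
    \<comment> \<open>Smoothness comes after the identity \<open>pb\<close>, which gives
      \<open>\<beta>\<close> the local representatives of \<open>\<alpha>\<close>.\<close>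
    have eq: "local_rep Q \<beta> d y ws = local_rep X \<alpha> e y ws" if "y \<in> snd e ` W" for y ws
      unfolding dd local_rep_quotient[OF e that] pb ..
    have "smooth_on (snd e ` W) (\<lambda>y. local_rep Q \<beta> d y ws)" if "length ws = k" for ws
      by (rule smooth_on_cong[OF s(5) _ smooth_on_subset[OF forms_smooth[OF \<alpha> e(1) that] s(6)]])
         (simp add: eq)
    moreover have "alt_multilinear k (local_rep Q \<beta> d y)" if "y \<in> snd e ` W" for y
      unfolding eq[OF that, abs_def] using forms_alt_multilinear[OF \<alpha> e(1)] s(6) that by blast
    moreover have "snd d z \<in> snd e ` W" using d(2) unfolding dd s(3)[symmetric] by (rule imageI)
    moreover have "snd e ` W \<subseteq> snd d ` fst d" unfolding dd s(3) by (rule subset_refl)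
    ultimately show "\<exists>c\<in>Q. \<exists>U. z \<in> fst c \<and> open U \<and> snd c z \<in> U \<and> U \<subseteq> snd c ` fst c \<and>
        (\<forall>ws. length ws = k \<longrightarrow> smooth_on U (\<lambda>y. local_rep Q \<beta> c y ws)) \<and>
        (\<forall>y\<in>U. alt_multilinear k (local_rep Q \<beta> c y))"
      using d s(5) by (intro bexI[of _ d] exI[of _ "snd e ` W"]) simp_all
  qed (auto simp: \<beta>_def)
  then show ?thesis using pb by blast
qed

lemma descend_q:
  assumes "\<alpha> \<in> forms k X" and "\<And>\<tau>. \<tau> \<in> T \<Longrightarrow> pullback X X \<tau> \<alpha> = \<alpha>"
  shows "descend k X Q q \<alpha> \<in> forms k Q" "pullback X Q q (descend k X Q q \<alpha>) = \<alpha>"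
proof -
  obtain \<beta> where \<beta>: "\<beta> \<in> forms k Q" "pullback X Q q \<beta> = \<alpha>" using descent[OF assms] by blast
  have "descend k X Q q \<alpha> = \<beta>"
    by (rule descend_eqI[OF \<beta>]) (use pullback_q_injective \<beta> in blast)
  then show "descend k X Q q \<alpha> \<in> forms k Q" "pullback X Q q (descend k X Q q \<alpha>) = \<alpha>" using \<beta> by simp_all
qed

end

section \<open>The group \<open>SE(3)\<close>\<close>

text \<open>The simplifier would otherwise turn \<open>transpose A *v x\<close> into
  \<open>x v* A\<close> and hide the pattern on which the rotation lemmas act.\<close>

declare transpose_matrix_vector [simp del]

lemma rotation_matrix_mult_transpose:
  assumes "rotation_matrix (A :: real^3^3)"
  shows "A ** transpose A = mat 1" "transpose A ** A = mat 1"
  using assms by (auto simp: rotation_matrix_def orthogonal_matrix_def)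

lemma rotation_matrix_mult:
  "rotation_matrix (A :: real^3^3) \<Longrightarrow> rotation_matrix B \<Longrightarrow> rotation_matrix (A ** B)"
  by (simp add: rotation_matrix_def det_mul orthogonal_matrix_mul)

lemma rotation_matrix_transpose: "rotation_matrix (A :: real^3^3) \<Longrightarrow> rotation_matrix (transpose A)"
  by (simp add: rotation_matrix_def orthogonal_matrix_transpose det_transpose)

lemma rotation_matrix_one: "rotation_matrix (mat 1 :: real^3^3)"
  by (simp add: rotation_matrix_def orthogonal_matrix_id)

lemma rotation_cancel:
  assumes "rotation_matrix (A :: real^3^3)"
  shows "A *v (transpose A *v x) = x" "transpose A *v (A *v x) = x"
  using rotation_matrix_mult_transpose[OF assms] by (simp_all add: matrix_vector_mul_assoc)

lemma cross_transpose_rotation: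
  assumes "rotation_matrix A"
  shows "cross3 (transpose A *v x) (transpose A *v y) = transpose A *v cross3 x y"
  by (rule cross_rotation_matrix[OF rotation_matrix_transpose[OF assms]])

lemma matrix_cross3_nth:
  "matrix (cross3 y) $ 1 $ 1 = 0" "matrix (cross3 y) $ 1 $ 2 = - y $ 3" "matrix (cross3 y) $ 1 $ 3 = y $ 2"
  "matrix (cross3 y) $ 2 $ 1 = y $ 3" "matrix (cross3 y) $ 2 $ 2 = 0" "matrix (cross3 y) $ 2 $ 3 = - y $ 1"
  "matrix (cross3 y) $ 3 $ 1 = - y $ 2" "matrix (cross3 y) $ 3 $ 2 = y $ 1" "matrix (cross3 y) $ 3 $ 3 = 0"
  by (simp_all add: matrix_def cross3_def axis_def)

lemma matrix_cross3_mult: "matrix (cross3 y) *v z = cross3 y z"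
  by (simp add: vec_eq_iff forall_3 matrix_vector_mult_def sum_3 matrix_cross3_nth cross3_def)

text \<open>Inverse of the hat map, from \<open>y\<close> to \<open>matrix (cross3 y)\<close>, on
  skew matrices. Elsewhere it just reads three entries and is therefore linear on all
  matrices.\<close>

definition vee :: "real^3^3 \<Rightarrow> real^3" where
  "vee X = vector [X $ 3 $ 2, X $ 1 $ 3, X $ 2 $ 1]"

lemma se3_of_mat_vee: "se3_of_mat z = (fst z, vee (snd z))"
  by (cases z) (simp add: vee_def)

lemma vee_nth: "vee X $ 1 = X $ 3 $ 2" "vee X $ 2 = X $ 1 $ 3" "vee X $ 3 = X $ 2 $ 1"
  by (simp_all add: vee_def)

lemma vee_matrix_cross3: "vee (matrix (cross3 y)) = y"
  by (simp add: vec_eq_iff forall_3 vee_nth matrix_cross3_nth)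

lemma linear_vee: "linear vee"
  by (rule linearI) (simp_all add: vec_eq_iff forall_3 vee_nth)

lemma SE3_simps:
  "(v, A) \<in> carrier SE3 \<longleftrightarrow> rotation_matrix A" "g \<otimes>\<^bsub>SE3\<^esub> h = se3_mult g h" "\<one>\<^bsub>SE3\<^esub> = (0, mat 1)"
  by (simp_all add: SE3_def)

lemma carrier_SE3_iff: "g \<in> carrier SE3 \<longleftrightarrow> rotation_matrix (snd g)"
  by (cases g) (simp add: SE3_simps)

lemma se3_mult_pair: "se3_mult g h = (fst g + snd g *v fst h, snd g ** snd h)"
  by (cases g, cases h) simp

lemma se3_move_pair: "se3_move g w = fst g + snd g *v w"
  by (cases g) simp

lemma group_SE3: "group SE3"
proof (rule groupI)
  fix x assume "x \<in> carrier SE3"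
  then obtain v A where x: "x = (v, A)" "rotation_matrix A" by (cases x) (auto simp: SE3_simps)
  show "\<exists>y\<in>carrier SE3. y \<otimes>\<^bsub>SE3\<^esub> x = \<one>\<^bsub>SE3\<^esub>"
    by (rule bexI[of _ "(- (transpose A *v v), transpose A)"])
       (use x rotation_matrix_mult_transpose[OF x(2)] rotation_matrix_transpose in \<open>auto simp: SE3_simps\<close>)
qed (auto simp: SE3_simps carrier_SE3_iff se3_mult_pair rotation_matrix_mult rotation_matrix_one
      matrix_mul_assoc matrix_vector_mul_assoc matrix_vector_right_distrib add.assoc)

lemma inv_SE3:
  assumes "g \<in> carrier SE3"
  shows "inv\<^bsub>SE3\<^esub> g = (- (transpose (snd g) *v fst g), transpose (snd g))"
proof (rule group.inv_equality[OF group_SE3 _ assms])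
  have A: "rotation_matrix (snd g)" using assms by (simp add: carrier_SE3_iff)
  show "(- (transpose (snd g) *v fst g), transpose (snd g)) \<in> carrier SE3"
    by (simp add: SE3_simps rotation_matrix_transpose[OF A])
  show "(- (transpose (snd g) *v fst g), transpose (snd g)) \<otimes>\<^bsub>SE3\<^esub> g = \<one>\<^bsub>SE3\<^esub>"
    by (simp add: SE3_simps se3_mult_pair rotation_matrix_mult_transpose[OF A])
qed

text \<open>The transposed variants serve the product rule for A^T dv and A^T dA without a separate
  derivative of the transpose.\<close>

lemma linear_matrix_bilinear:
  "bounded_bilinear (\<lambda>A::real^3^3. \<lambda>x. A *v x)" "bounded_bilinear (\<lambda>A::real^3^3. \<lambda>B::real^3^3. A ** B)"
  "bounded_bilinear (\<lambda>A::real^3^3. \<lambda>x. transpose A *v x)" "bounded_bilinear (\<lambda>A::real^3^3. \<lambda>B::real^3^3. transpose A ** B)"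
  "bounded_bilinear cross3"
proof -
  show "bounded_bilinear (\<lambda>A::real^3^3. \<lambda>x. A *v x)"
    unfolding bilinear_conv_bounded_bilinear[symmetric] bilinear_def
    by (auto intro!: linearI simp: vec_eq_iff matrix_vector_mult_def sum_3 forall_3 algebra_simps)
  show "bounded_bilinear (\<lambda>A::real^3^3. \<lambda>B::real^3^3. A ** B)"
    unfolding bilinear_conv_bounded_bilinear[symmetric] bilinear_def
    by (auto intro!: linearI simp: vec_eq_iff matrix_matrix_mult_def sum_3 forall_3 algebra_simps)
  show "bounded_bilinear (\<lambda>A::real^3^3. \<lambda>x. transpose A *v x)"
    unfolding bilinear_conv_bounded_bilinear[symmetric] bilinear_def
    by (auto intro!: linearI simp: vec_eq_iff matrix_vector_mult_def transpose_def sum_3 forall_3 algebra_simps)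
  show "bounded_bilinear (\<lambda>A::real^3^3. \<lambda>B::real^3^3. transpose A ** B)"
    unfolding bilinear_conv_bounded_bilinear[symmetric] bilinear_def
    by (auto intro!: linearI simp: vec_eq_iff matrix_matrix_mult_def transpose_def sum_3 forall_3 algebra_simps)
  show "bounded_bilinear cross3"
    unfolding bilinear_conv_bounded_bilinear[symmetric] by (rule bilinear_cross)
qed

lemma bounded_linear_transpose: "bounded_linear (transpose :: real^3^3 \<Rightarrow> real^3^3)"
  unfolding linear_conv_bounded_linear[symmetric]
  by (rule linearI) (simp_all add: vec_eq_iff transpose_def)

lemma bounded_linear_vee: "bounded_linear vee"
  using linear_vee by (simp add: linear_conv_bounded_linear)

lemmas smooth_on_matrix [smooth_intros] = linear_matrix_bilinear[THEN smooth_on_bilinear]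
lemmas smooth_on_transpose [smooth_intros] = smooth_on_linear[OF bounded_linear_transpose]
lemmas smooth_on_vee [smooth_intros] = smooth_on_linear[OF bounded_linear_vee]

text \<open>Conjugation by \<open>g\<close> is affine in the ambient coordinates, so its derivative
  is the linear part at every point. The translation part picks up -(A y) x v = v x (A y).\<close>

lemma se3_Ad_eq:
  assumes "g \<in> carrier SE3"
  shows "se3_Ad g (x, y) = (snd g *v x + cross3 (fst g) (snd g *v y), snd g *v y)"
proof -
  obtain v A where g: "g = (v, A)" by (cases g)
  have A: "rotation_matrix A" using assms by (simp add: g SE3_simps)
  let ?X = "matrix (cross3 y)"
  have eq: "(\<lambda>h. se3_mult (se3_mult g h) (inv\<^bsub>SE3\<^esub> g))
     = (\<lambda>h. (v + A *v fst h - (A ** snd h) *v (transpose A *v v), (A ** snd h) ** transpose A))"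
  proof -
    have inv: "inv\<^bsub>SE3\<^esub> g = (- (transpose A *v v), transpose A)" using inv_SE3[OF assms] by (simp add: g)
    show ?thesis
      unfolding inv se3_mult_pair by (simp add: fun_eq_iff g linear_neg[OF matrix_vector_mul_linear])
  qed
  have D: "((\<lambda>h. (v + A *v fst h - (A ** snd h) *v (transpose A *v v), (A ** snd h) ** transpose A))
     has_derivative (\<lambda>h. (A *v fst h - (A ** snd h) *v (transpose A *v v), (A ** snd h) ** transpose A))) (at h0)" for h0
  proof -
    have l: "bounded_linear (\<lambda>h::se3_pair. A *v fst h)" "bounded_linear (\<lambda>h::se3_pair. (A ** snd h) *v (transpose A *v v))"
      "bounded_linear (\<lambda>h::se3_pair. (A ** snd h) ** transpose A)"
      by (auto simp: linear_conv_bounded_linear[symmetric] vec_eq_iff matrix_vector_mult_def matrix_matrix_mult_def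
          sum_3 forall_3 algebra_simps intro!: linearI)
    show ?thesis
      using has_derivative_Pair[OF has_derivative_diff[OF has_derivative_add[OF has_derivative_const[of v]
            bounded_linear.has_derivative[OF l(1) has_derivative_ident]]
            bounded_linear.has_derivative[OF l(2) has_derivative_ident]]
            bounded_linear.has_derivative[OF l(3) has_derivative_ident], of h0 UNIV] by simp
  qed
  have "se3_Ad g (x, y) = (A *v x - (A ** ?X) *v (transpose A *v v), vee ((A ** ?X) ** transpose A))"
    unfolding se3_Ad_def eq frechet_derivative_at[OF D, symmetric] by (simp add: se3_of_mat_vee)
  \<comment> \<open>Conjugating the hat matrix of \<open>y\<close> by a rotation gives the hat
    matrix of \<open>A *v y\<close>, because rotations respect the cross product.\<close>
  moreover have X: "((A ** ?X) ** transpose A) = matrix (cross3 (A *v y))"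
  proof -
    have "((A ** ?X) ** transpose A) *v z = matrix (cross3 (A *v y)) *v z" for z
    proof -
      have "((A ** ?X) ** transpose A) *v z = A *v cross3 y (transpose A *v z)"
        by (simp add: matrix_vector_mul_assoc[symmetric] matrix_cross3_mult)
      also have "\<dots> = cross3 (A *v y) (A *v (transpose A *v z))"
        using cross_rotation_matrix[OF A] by simp
      finally show ?thesis by (simp add: rotation_cancel[OF A] matrix_cross3_mult)
    qed
    then show ?thesis by (simp add: matrix_eq)
  qed
  moreover have "(A ** ?X) *v (transpose A *v v) = cross3 (A *v y) v"
    using X by (simp add: matrix_vector_mul_assoc matrix_cross3_mult[symmetric])
  ultimately show ?thesis
    by (simp add: g vee_matrix_cross3 cross_skew[of "A *v y" v])
qed

section \<open>Rodrigues coordinates on SO(3) and charts of SE(3)\<close>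

text \<open>The Rodrigues vector \<open>tan(\<theta>/2) n\<close> of the rotation by \<open>\<theta>\<close> about \<open>n\<close> gives charts of \<open>SO(3)\<close>.\<close>

definition rot_of :: "real^3 \<Rightarrow> real^3^3" where
  "rot_of r = (\<chi> i j. ((1 - r \<bullet> r) * (if i = j then 1 else 0) + 2 * (r $ i * r $ j) + 2 * matrix (cross3 r) $ i $ j)
      * inverse (1 + r \<bullet> r))"

text \<open>For the rotation by an angle t about the unit vector n, 1 + trace is 2 + 2 cos t and the
  difference of the two \<open>vee\<close> vectors is 2 sin(t) n; the quotient is tan(t/2)
  n.\<close>

definition rodrigues :: "real^3^3 \<Rightarrow> real^3" where
  "rodrigues A = inverse (1 + trace A) *\<^sub>R (vee A - vee (transpose A))"

lemma inner_self_pos: "1 + r \<bullet> r > 0" for r :: "real^3"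
  using inner_ge_zero[of r] by linarith

text \<open>With \<open>d\<close> for the inverse of 1 + r . r, all entries are polynomials, and the
  claims are polynomial identities modulo the single relation \<open>d1\<close>.\<close>

lemma rot_of_properties:
  shows trace_rot_of: "1 + trace (rot_of r) = 4 * inverse (1 + r \<bullet> r)"
    and rodrigues_rot_of: "rodrigues (rot_of r) = r"
    and rotation_rot_of: "rotation_matrix (rot_of r)"
proof -
  define d where "d = inverse (1 + r \<bullet> r)"
  obtain a b c where abc: "r $ 1 = a" "r $ 2 = b" "r $ 3 = c" by blast
  have "1 + r \<bullet> r \<noteq> 0" using inner_self_pos[of r] by simp
  then have d1: "d * (1 + (a * a + b * b + c * c)) = 1" by (simp add: d_def inner_vec_def sum_3 abc)
  have rr: "r \<bullet> r = a * a + b * b + c * c" by (simp add: inner_vec_def sum_3 abc)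
  have nth: "rot_of r $ i $ j = ((1 - (a * a + b * b + c * c)) * (if i = j then 1 else 0) + 2 * (r $ i * r $ j)
     + 2 * matrix (cross3 r) $ i $ j) * d" for i j
    by (simp add: rot_of_def d_def rr)
  have tr: "1 + trace (rot_of r) = 4 * d"
    unfolding trace_def sum_3 nth matrix_cross3_nth abc
    by (simp, insert d1, algebra)
  then show "1 + trace (rot_of r) = 4 * inverse (1 + r \<bullet> r)" by (simp add: d_def)
  have "d \<noteq> 0" using d1 by auto
  moreover have "vee (rot_of r) - vee (transpose (rot_of r)) = (4 * d) *\<^sub>R r"
    by (simp add: vec_eq_iff forall_3 vee_nth transpose_def nth matrix_cross3_nth abc algebra_simps)
  ultimately show "rodrigues (rot_of r) = r" unfolding rodrigues_def tr by simp
  have "transpose (rot_of r) ** rot_of r = mat 1"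
    unfolding vec_eq_iff forall_3 matrix_matrix_mult_def
    apply (simp add: transpose_def sum_3 mat_def nth matrix_cross3_nth abc)
    by (intro conjI; (use d1 in algebra | simp add: algebra_simps))
  moreover have "det (rot_of r) = 1"
    unfolding det_3 apply (simp add: nth matrix_cross3_nth abc)
    using d1 by algebra
  ultimately show "rotation_matrix (rot_of r)"
    by (simp add: rotation_matrix_def orthogonal_matrix)
qed

text \<open>Prepares the case t = 1 + trace A and w = 2 sin(angle) n, where the norm relation says 4
  sin^2 = (2 + 2 cos)(2 - 2 cos). It turns the denominator of \<open>rot_of\<close> into 4 / t and
  leaves a single division by \<open>t\<close>.\<close>

lemma rot_of_scaled:
  assumes t: "t > 0" and w: "w \<bullet> w = t * (4 - t)"
  shows "rot_of (inverse t *\<^sub>R w) $ i $ j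
     = ((2 * t - 4) * (if i = j then 1 else 0) + 2 * (w $ i * w $ j * inverse t) + 2 * matrix (cross3 w) $ i $ j) / 4"
proof -
  have "(inverse t *\<^sub>R w) \<bullet> (inverse t *\<^sub>R w) = (4 - t) * inverse t"
    using t w by (simp add: field_simps power2_eq_square)
  moreover have "1 + (4 - t) * inverse t = 4 * inverse t" using t by (simp add: field_simps)
  moreover have "matrix (cross3 (inverse t *\<^sub>R w)) $ i $ j = inverse t * matrix (cross3 w) $ i $ j"
    by (simp add: matrix_def cross_mult_left)
  ultimately have "rot_of (inverse t *\<^sub>R w) $ i $ j = ((1 - (4 - t) * inverse t) * (if i = j then 1 else 0)
      + 2 * ((inverse t * w $ i) * (inverse t * w $ j)) + 2 * (inverse t * matrix (cross3 w) $ i $ j)) * inverse (4 * inverse t)"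
    unfolding rot_of_def by (simp only: vec_lambda_beta vector_scaleR_component real_scaleR_def)
  also have "inverse (4 * inverse t) = t / 4" by simp
  also have "((1 - (4 - t) * inverse t) * x + 2 * ((inverse t * a) * (inverse t * b)) + 2 * (inverse t * m)) * (t / 4)
      = ((2 * t - 4) * x + 2 * (a * b * inverse t) + 2 * m) / 4" for x a b m
    using t by (simp add: field_simps)
  finally show ?thesis .
qed

text \<open>After the previous lemma the only denominator left is \<open>t\<close>, and
  orthogonality together with determinant 1 makes every product of two entries of \<open>w\<close>
  divisible by it.\<close>

lemma rot_of_rodrigues:
  assumes A: "rotation_matrix A" and t: "1 + trace A > 0"
  shows "rot_of (rodrigues A) = A"
proof -
  obtain a b c d e f g h i where A1: "A $ 1 $ 1 = a" "A $ 1 $ 2 = b" "A $ 1 $ 3 = c"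
    "A $ 2 $ 1 = d" "A $ 2 $ 2 = e" "A $ 2 $ 3 = f" "A $ 3 $ 1 = g" "A $ 3 $ 2 = h" "A $ 3 $ 3 = i" by blast
  have rows: "a*a + b*b + c*c = 1" "d*d + e*e + f*f = 1" "g*g + h*h + i*i = 1"
     "a*d + b*e + c*f = 0" "a*g + b*h + c*i = 0" "d*g + e*h + f*i = 0"
    using rotation_matrix_mult_transpose(1)[OF A]
    by (simp_all add: vec_eq_iff forall_3 matrix_matrix_mult_def transpose_def mat_def sum_3 A1)
  have cols: "a*a + d*d + g*g = 1" "b*b + e*e + h*h = 1" "c*c + f*f + i*i = 1"
     "a*b + d*e + g*h = 0" "a*c + d*f + g*i = 0" "b*c + e*f + h*i = 0"
    using rotation_matrix_mult_transpose(2)[OF A]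
    by (simp_all add: vec_eq_iff forall_3 matrix_matrix_mult_def transpose_def mat_def sum_3 A1)
  \<comment> \<open>Every entry equals its cofactor: a rotation respects the cross products of the
    basis vectors, hence its columns are cyclic cross products of each other.\<close>
  have cof: "a = e*i - f*h" "b = f*g - d*i" "c = d*h - e*g" "d = c*h - b*i" "e = a*i - c*g" "f = b*g - a*h"
    "g = b*f - c*e" "h = c*d - a*f" "i = a*e - b*d"
    using cross_rotation_matrix[OF A, of "axis 1 1" "axis 2 1"] cross_rotation_matrix[OF A, of "axis 2 1" "axis 3 1"]
      cross_rotation_matrix[OF A, of "axis 3 1" "axis 1 1"]
    by (simp_all add: cross_basis vec_eq_iff forall_3 matrix_vector_mult_def sum_3 axis_def cross3_def A1 algebra_simps)
  define t where "t = 1 + (a + e + i)"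
  define w where "w = vee A - vee (transpose A)"
  have tr: "1 + trace A = t" by (simp add: trace_def sum_3 t_def A1)
  have tpos: "t > 0" using t tr by simp
  have w: "w $ 1 = h - f" "w $ 2 = c - g" "w $ 3 = d - b"
    by (simp_all add: w_def vee_nth transpose_def A1)
  \<comment> \<open>These factorisations cancel the remaining \<open>inverse t\<close> in
    \<open>rot_of_scaled\<close>.\<close>
  have ww: "w $ 1 * w $ 1 = t * (2 + 2 * a - t)" "w $ 2 * w $ 2 = t * (2 + 2 * e - t)" "w $ 3 * w $ 3 = t * (2 + 2 * i - t)"
    "w $ 1 * w $ 2 = t * (b + d)" "w $ 1 * w $ 3 = t * (c + g)" "w $ 2 * w $ 3 = t * (f + h)"
    unfolding w t_def using rows cols cof by algebra+
  have "w \<bullet> w = t * (4 - t)"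
    unfolding inner_vec_def sum_3 inner_real_def ww t_def by (simp add: algebra_simps)
  note rs = rot_of_scaled[OF tpos this]
  have ww': "w $ 2 * w $ 1 = t * (b + d)" "w $ 3 * w $ 1 = t * (c + g)" "w $ 3 * w $ 2 = t * (f + h)"
    using ww by (simp_all add: mult.commute)
  have inv: "t * x * inverse t = x" for x using tpos by simp
  show ?thesis
    unfolding rodrigues_def tr w_def[symmetric] vec_eq_iff forall_3 rs ww ww' inv
    unfolding matrix_cross3_nth w A1
    by (simp add: t_def field_simps)
qed

text \<open>Rodrigues coordinates centred at \<open>B\<close>. Since 1 + trace is 2 + 2 cos(angle),
  the condition excludes exactly the rotations by a half turn relative to \<open>B\<close>.\<close>

definition SE3_chart :: "real^3^3 \<Rightarrow> (se3_pair, (real^3) \<times> (real^3)) chart" where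
  "SE3_chart B = (carrier SE3 \<inter> {g. 0 < 1 + trace (transpose B ** snd g)},
     \<lambda>g. (fst g, rodrigues (transpose B ** snd g)))"

lemma smooth_on_rot_of: "smooth_on UNIV rot_of"
proof (intro smooth_on_vec open_UNIV)
  fix i j
  have m: "smooth_on UNIV (\<lambda>r. matrix (cross3 r) $ i $ j)"
    unfolding matrix_def by (simp, intro smooth_intros open_UNIV)
  have eq: "(\<lambda>r. rot_of r $ i $ j) = (\<lambda>r. ((1 - r \<bullet> r) * (if i = j then 1 else 0) + 2 * (r $ i * r $ j)
      + 2 * matrix (cross3 r) $ i $ j) * inverse (1 + r \<bullet> r))"
    by (simp add: rot_of_def)
  have nz: "1 + r \<bullet> r \<noteq> 0" for r :: "real^3" using inner_self_pos[of r] by simp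
  show "smooth_on UNIV (\<lambda>r. rot_of r $ i $ j)"
    unfolding eq
    by (intro smooth_on_mult smooth_on_add smooth_on_diff smooth_on_inner smooth_on_const smooth_on_ident
        smooth_on_inverse m smooth_on_vec_nth open_UNIV nz)
qed

lemma SE3_chart_bij:
  assumes B: "rotation_matrix B"
  defines "S \<equiv> carrier SE3 \<inter> {g. 0 < 1 + trace (transpose B ** snd g)}"
    and "F \<equiv> \<lambda>g. (fst g, rodrigues (transpose B ** snd g))"
  shows "inj_on F S" "F ` S = UNIV" "inv_into S F y = (fst y, B ** rot_of (snd y))"
proof -
  have inS: "(v, B ** rot_of r) \<in> S" and F: "F (v, B ** rot_of r) = (v, r)" for v r
  proof -
    have "transpose B ** (B ** rot_of r) = rot_of r"
      by (simp add: matrix_mul_assoc rotation_matrix_mult_transpose[OF B])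
    then show "(v, B ** rot_of r) \<in> S" "F (v, B ** rot_of r) = (v, r)"
      using inner_self_pos[of r] rotation_matrix_mult[OF B rotation_rot_of]
      by (simp_all add: S_def F_def SE3_simps trace_rot_of rodrigues_rot_of)
  qed
  have left: "(fst (F g), B ** rot_of (snd (F g))) = g" if "g \<in> S" for g
  proof -
    have "rotation_matrix (transpose B ** snd g)"
      using that rotation_matrix_mult[OF rotation_matrix_transpose[OF B]] by (simp add: S_def carrier_SE3_iff)
    then have "rot_of (rodrigues (transpose B ** snd g)) = transpose B ** snd g"
      using rot_of_rodrigues that by (simp add: S_def)
    then show ?thesis by (simp add: F_def matrix_mul_assoc rotation_matrix_mult_transpose[OF B])
  qed
  show i: "inj_on F S" by (rule inj_onI) (metis left)
  show "F ` S = UNIV" using inS F by (metis (no_types, opaque_lifting) UNIV_eq_I image_eqI prod.collapse)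
  show "inv_into S F y = (fst y, B ** rot_of (snd y))"
    by (rule inv_into_f_eq[OF i inS]) (simp add: F)
qed

lemma restrict_open_atlas: "restrict_atlas (open_atlas UNIV) W = open_atlas W"
  by (simp add: restrict_atlas_def open_atlas_def)

text \<open>Shows that the atlas covers the group: each rotation \<open>B\<close> lies in the chart
  centred at it.\<close>

lemma SE3_chart_in_atlas:
  assumes B: "rotation_matrix B"
  shows "SE3_chart B \<in> SE3_atlas"
proof -
  let ?W = "{g::se3_pair. 0 < 1 + trace (transpose B ** snd g)}"
  let ?S = "carrier SE3 \<inter> ?W"
  let ?F = "\<lambda>g::se3_pair. (fst g, rodrigues (transpose B ** snd g))"
  have tr: "smooth_on UNIV (\<lambda>g::se3_pair. 1 + trace (transpose B ** snd g))"
    unfolding trace_def by (intro smooth_intros open_UNIV)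
  have W: "open ?W"
    using continuous_open_preimage[OF smooth_on_imp_continuous_on[OF tr] open_UNIV open_greaterThan, of 0]
    by (simp add: vimage_def)
  have 1: "openin (mtop (open_atlas UNIV)) ?W" using openin_open_atlas[OF open_UNIV] W by blast
  have 2: "smooth_map (restrict_atlas (open_atlas UNIV) ?W) (open_atlas UNIV) ?F"
    unfolding restrict_open_atlas
  proof (rule smooth_map_open_open[OF W open_UNIV])
    have h: "smooth_on ?W (\<lambda>g. inverse (1 + trace (transpose B ** snd g)))"
      by (rule smooth_on_inverse[OF W smooth_on_subset[OF tr]]) auto
    show "smooth_on ?W ?F"
      unfolding rodrigues_def
      by (intro smooth_on_Pair smooth_on_fst smooth_on_snd smooth_on_ident h smooth_on_scaleR smooth_on_diff
          smooth_on_vee smooth_on_transpose smooth_on_matrix smooth_on_const W)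
  qed simp
  have 3: "smooth_map (open_atlas (?F ` ?S)) (open_atlas UNIV) (inv_into ?S ?F)"
    unfolding SE3_chart_bij(2)[OF B]
  proof (rule smooth_map_open_open[OF open_UNIV open_UNIV])
    have "smooth_on UNIV (\<lambda>y. (fst y, B ** rot_of (snd y)))"
      by (intro smooth_intros open_UNIV smooth_on_compose[OF _ _ _ _ smooth_on_rot_of]) simp
    then show "smooth_on UNIV (inv_into ?S ?F)"
      by (rule smooth_on_cong[OF open_UNIV, rotated]) (simp add: SE3_chart_bij(3)[OF B])
  qed simp
  have 4: "open (?F ` ?S)" unfolding SE3_chart_bij(2)[OF B] by simp
  show ?thesis
    unfolding SE3_atlas_def submanifold_atlas_def SE3_chart_def mem_Collect_eq
    by (rule exI[of _ ?W], rule exI[of _ ?F]) (intro conjI refl 1 2 3 4 SE3_chart_bij(1)[OF B])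
qed

lemma SE3_chart_simps:
  assumes B: "rotation_matrix B"
  shows "(v, B) \<in> fst (SE3_chart B)" "snd (SE3_chart B) ` fst (SE3_chart B) = UNIV"
    "chart_inv (SE3_chart B) y = (fst y, B ** rot_of (snd y))" "fst (snd (SE3_chart B) g) = fst g"
proof -
  have "trace (mat 1 :: real^3^3) = 3" by (simp add: trace_def mat_def sum_3)
  then show "(v, B) \<in> fst (SE3_chart B)"
    by (simp add: SE3_chart_def SE3_simps B rotation_matrix_mult_transpose[OF B])
  show "snd (SE3_chart B) ` fst (SE3_chart B) = UNIV"
    unfolding SE3_chart_def fst_conv snd_conv by (rule SE3_chart_bij(2)[OF B])
  show "chart_inv (SE3_chart B) y = (fst y, B ** rot_of (snd y))"
    unfolding chart_inv_def SE3_chart_def fst_conv snd_conv by (rule SE3_chart_bij(3)[OF B])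
qed (simp add: SE3_chart_def)

lemma smooth_atlas_SE3: "smooth_atlas SE3_atlas"
  unfolding SE3_atlas_def by (rule smooth_atlas_submanifold[OF smooth_atlas_open_atlas[OF open_UNIV]])

lemma points_SE3: "points SE3_atlas = carrier SE3"
proof (intro equalityI subsetI)
  fix g assume "g \<in> points SE3_atlas"
  then obtain c where "c \<in> SE3_atlas" "g \<in> fst c" unfolding points_iff by blast
  then show "g \<in> carrier SE3" unfolding SE3_atlas_def by (elim submanifold_chartE) simp
next
  fix g assume "g \<in> carrier SE3"
  then have B: "rotation_matrix (snd g)" by (simp add: carrier_SE3_iff)
  show "g \<in> points SE3_atlas"
    unfolding points_iff using SE3_chart_in_atlas[OF B] SE3_chart_simps(1)[OF B, of "fst g"] by auto
qed

lemma smooth_map_SE3_inclusion: "smooth_map SE3_atlas (open_atlas UNIV) id"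
  unfolding SE3_atlas_def
  by (rule smooth_map_submanifold_inclusion[OF smooth_atlas_open_atlas[OF open_UNIV]])

lemma smooth_map_into_SE3:
  assumes "smooth_map A (open_atlas UNIV) f" "smooth_atlas A" "f ` points A \<subseteq> carrier SE3"
  shows "smooth_map A SE3_atlas f"
  unfolding SE3_atlas_def
  by (rule smooth_map_into_submanifold[OF assms(1) smooth_atlas_open_atlas[OF open_UNIV] assms(2)])
     (use assms(3) points_SE3 in \<open>simp add: SE3_atlas_def\<close>)

lemma smooth_map_SE3_mult:
  assumes "g \<in> carrier SE3"
  shows "smooth_map SE3_atlas SE3_atlas (\<lambda>h. se3_mult g h)" "smooth_map SE3_atlas SE3_atlas (\<lambda>h. se3_mult h g)"
proof -
  have U: "smooth_atlas (open_atlas UNIV :: (se3_pair, se3_pair) atlas)"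
    by (rule smooth_atlas_open_atlas[OF open_UNIV])
  have s: "smooth_map SE3_atlas SE3_atlas f"
    if f: "smooth_on UNIV f" "f ` carrier SE3 \<subseteq> carrier SE3" for f
  proof -
    have "smooth_map (open_atlas UNIV) (open_atlas UNIV) f"
      by (rule smooth_map_open_open) (use f in auto)
    from smooth_map_compose[OF smooth_map_SE3_inclusion this smooth_atlas_SE3 U U]
    have "smooth_map SE3_atlas (open_atlas UNIV) f" by simp
    then show ?thesis
      by (rule smooth_map_into_SE3[OF _ smooth_atlas_SE3]) (use f in \<open>simp add: points_SE3\<close>)
  qed
  show "smooth_map SE3_atlas SE3_atlas (\<lambda>h. se3_mult g h)"
  proof (rule s)
    show "smooth_on UNIV (\<lambda>h. se3_mult g h)" unfolding se3_mult_pair by (intro smooth_intros open_UNIV)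
  qed (use assms in \<open>auto simp: carrier_SE3_iff se3_mult_pair rotation_matrix_mult\<close>)
  show "smooth_map SE3_atlas SE3_atlas (\<lambda>h. se3_mult h g)"
  proof (rule s)
    show "smooth_on UNIV (\<lambda>h. se3_mult h g)" unfolding se3_mult_pair by (intro smooth_intros open_UNIV)
  qed (use assms in \<open>auto simp: carrier_SE3_iff se3_mult_pair rotation_matrix_mult\<close>)
qed

lemma smooth_map_se3_move: "smooth_map E3_atlas E3_atlas (se3_move g)"
proof (rule smooth_map_open_open)
  show "smooth_on UNIV (se3_move g)"
    unfolding se3_move_pair[abs_def] by (intro smooth_intros open_UNIV)
qed auto

section \<open>The universal covering and its deck transformations\<close>

lemma loop_homotopic_concat:
  assumes "loop_homotopic X x0 g g'" "loop_homotopic X x0 h h'"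
  shows "loop_homotopic X x0 (path_concat g h) (path_concat g' h')"
proof -
  let ?I = "top_of_set {0..1::real}"
  obtain H1 where H1: "continuous_map (prod_topology ?I ?I) X H1" "\<And>x. H1 (0, x) = g x" "\<And>x. H1 (1, x) = g' x"
    "\<And>t. t \<in> {0..1} \<Longrightarrow> H1 (t, 0) = x0 \<and> H1 (t, 1) = x0"
    using assms(1) unfolding loop_homotopic_def homotopic_with_def by auto
  obtain H2 where H2: "continuous_map (prod_topology ?I ?I) X H2" "\<And>x. H2 (0, x) = h x" "\<And>x. H2 (1, x) = h' x"
    "\<And>t. t \<in> {0..1} \<Longrightarrow> H2 (t, 0) = x0 \<and> H2 (t, 1) = x0"
    using assms(2) unfolding loop_homotopic_def homotopic_with_def by auto
  define K where "K z = (if snd z \<le> 1/2 then H1 (fst z, 2 * snd z) else H2 (fst z, 2 * snd z - 1))" for z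
  have prod: "prod_topology ?I ?I = top_of_set ({0..1} \<times> {0..1})"
    by (simp add: prod_topology_subtopology_eu)
  have "continuous_map (prod_topology ?I ?I) X K"
    unfolding K_def
  proof (rule continuous_map_cases_le)
    show "continuous_map (prod_topology ?I ?I) euclideanreal snd" "continuous_map (prod_topology ?I ?I) euclideanreal (\<lambda>z. 1/2)"
      unfolding prod by (auto intro!: continuous_intros)
    let ?S = "{z \<in> topspace (prod_topology ?I ?I). snd z \<le> 1 / 2}"
    have "continuous_map (subtopology (prod_topology ?I ?I) ?S) (prod_topology ?I ?I) (\<lambda>z. (fst z, 2 * snd z))"
      unfolding prod subtopology_subtopology by (auto intro!: continuous_intros)
    from continuous_map_compose[OF this H1(1)]
    show "continuous_map (subtopology (prod_topology ?I ?I) ?S) X (\<lambda>z. H1 (fst z, 2 * snd z))"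
      by (simp add: o_def)
    let ?T = "{z \<in> topspace (prod_topology ?I ?I). 1 / 2 \<le> snd z}"
    have "continuous_map (subtopology (prod_topology ?I ?I) ?T) (prod_topology ?I ?I) (\<lambda>z. (fst z, 2 * snd z - 1))"
      unfolding prod subtopology_subtopology by (auto intro!: continuous_intros)
    from continuous_map_compose[OF this H2(1)]
    show "continuous_map (subtopology (prod_topology ?I ?I) ?T) X (\<lambda>z. H2 (fst z, 2 * snd z - 1))"
      by (simp add: o_def)
  next
    fix z assume z: "z \<in> topspace (prod_topology ?I ?I)" "snd z = 1/2"
    then have "fst z \<in> {0..1}" by auto
    \<comment> \<open>Both homotopies keep the end points at \<open>x0\<close>, so the two halves
      match at time 1/2.\<close>
    then have "H1 (fst z, 1) = H2 (fst z, 0)" using H1(4) H2(4) by simp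
    then show "H1 (fst z, 2 * snd z) = H2 (fst z, 2 * snd z - 1)" unfolding z(2) by simp
  qed
  then show ?thesis
    unfolding loop_homotopic_def homotopic_with_def
    using H1 H2 by (intro exI[of _ K]) (auto simp: K_def path_concat_def)
qed

lemma loop_class_self: "g \<in> loops X x0 \<Longrightarrow> g \<in> loop_class X x0 g"
  by (auto simp: loop_class_def loop_homotopic_def loops_def pathin_def)

lemma loop_class_cong:
  assumes "loop_homotopic X x0 g h" shows "loop_class X x0 g = loop_class X x0 h"
  using assms homotopic_with_trans homotopic_with_sym
  unfolding loop_class_def loop_homotopic_def by blast

text \<open>The product is a union over all representatives. Homotopy invariance of concatenation
  makes all classes in the union equal, so the union is one class.\<close>

lemma fundamental_group_mult_closed:
  assumes "a \<in> carrier (fundamental_group X x0)" "b \<in> carrier (fundamental_group X x0)"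
  shows "a \<otimes>\<^bsub>fundamental_group X x0\<^esub> b \<in> carrier (fundamental_group X x0)"
proof -
  obtain g h where g: "g \<in> loops X x0" "a = loop_class X x0 g" and h: "h \<in> loops X x0" "b = loop_class X x0 h"
    using assms by (auto simp: fundamental_group_def)
  have eq: "loop_class X x0 (path_concat g' h') = loop_class X x0 (path_concat g h)" if "g' \<in> a" "h' \<in> b" for g' h'
    by (rule sym, rule loop_class_cong, rule loop_homotopic_concat) (use that g h in \<open>auto simp: loop_class_def\<close>)
  have self: "loop_homotopic X x0 g g" "loop_homotopic X x0 h h"
    using loop_class_self[OF g(1)] loop_class_self[OF h(1)] by (auto simp: loop_class_def)
  have "path_concat g h \<in> loops X x0"
    using loop_homotopic_concat[OF self] by (auto simp: loop_homotopic_def loops_def pathin_def)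
  moreover have "a \<otimes>\<^bsub>fundamental_group X x0\<^esub> b = (\<Union>g'\<in>a. \<Union>h'\<in>b. loop_class X x0 (path_concat g' h'))"
    by (simp add: fundamental_group_def)
  moreover have "\<dots> = (\<Union>g'\<in>a. \<Union>h'\<in>b. loop_class X x0 (path_concat g h))"
    by (intro SUP_cong refl eq)
  moreover have "\<dots> = loop_class X x0 (path_concat g h)"
    using loop_class_self[OF g(1)] loop_class_self[OF h(1)] g h by blast
  ultimately show ?thesis by (auto simp: fundamental_group_def)
qed

section \<open>The universal covering with its action of the fundamental group\<close>

locale deck_setting =
  fixes Mt :: "('b, 'e::euclidean_space) atlas" and M :: "('a, 'e) atlas" and p :: "'b \<Rightarrow> 'a"
    and y0 :: 'b and act :: "(real \<Rightarrow> 'a) set \<Rightarrow> 'b \<Rightarrow> 'b"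
  assumes M: "smooth_atlas M" and cover: "universal_covering Mt M p"
    and y0: "y0 \<in> points Mt" and deck: "deck_action Mt M p y0 act"
begin

abbreviation "\<Gamma> \<equiv> fundamental_group (mtop M) (p y0)"

lemma Mt: "smooth_atlas Mt"
  by (rule manifold_smooth_atlas) (use cover in \<open>simp add: universal_covering_def\<close>)

lemma Hausdorff_Mt: "Hausdorff_space (mtop Mt)"
  using cover by (simp add: universal_covering_def manifold_def)

lemma path_connected_Mt: "path_connected_space (mtop Mt)"
  using cover by (simp add: universal_covering_def simply_connected_top_def)

lemma smooth_p: "smooth_map Mt M p"
  using cover by (simp add: universal_covering_def smooth_covering_def)

lemma p_points: "y \<in> points Mt \<Longrightarrow> p y \<in> points M"
  by (rule smooth_map_image[OF smooth_p Mt M])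

lemma p_image: "p ` points Mt = points M"
  using cover by (simp add: universal_covering_def smooth_covering_def)

lemma sheets:
  assumes "x \<in> points M"
  obtains U where "openin (mtop M) U" "x \<in> U"
    "\<forall>y\<in>points Mt. p y \<in> U \<longrightarrow> (\<exists>V. openin (mtop Mt) V \<and> y \<in> V \<and> inj_on p V \<and> p ` V = U \<and>
        smooth_map (restrict_atlas M U) Mt (inv_into V p))"
proof -
  obtain U \<V> where U: "openin (mtop M) U" "x \<in> U" and V: "\<Union>\<V> = {y \<in> points Mt. p y \<in> U}"
    "\<forall>V\<in>\<V>. openin (mtop Mt) V \<and> inj_on p V \<and> p ` V = U \<and> smooth_map (restrict_atlas M U) Mt (inv_into V p)"
    using cover assms unfolding universal_covering_def smooth_covering_def by blast
  show thesis
  proof (rule that[OF U], intro ballI impI)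
    fix y assume "y \<in> points Mt" "p y \<in> U"
    then have "y \<in> \<Union>\<V>" unfolding V(1) by simp
    then obtain V where VV: "V \<in> \<V>" "y \<in> V" by blast
    from V(2) VV(1) have "openin (mtop Mt) V \<and> inj_on p V \<and> p ` V = U \<and> smooth_map (restrict_atlas M U) Mt (inv_into V p)"
      by (rule bspec)
    then show "\<exists>V. openin (mtop Mt) V \<and> y \<in> V \<and> inj_on p V \<and> p ` V = U \<and> smooth_map (restrict_atlas M U) Mt (inv_into V p)"
      using VV(2) by (intro exI[of _ V]) simp
  qed
qed

text \<open>The set where the two lifts agree is closed because \<open>Mt\<close> is Hausdorff, and
  open because \<open>p\<close> is injective on sheets; \<open>Z\<close> is connected.\<close>

lemma unique_lift:
  assumes Z: "connected_space Z" and f: "continuous_map Z (mtop Mt) f" and g: "continuous_map Z (mtop Mt) g"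
    and pfg: "\<And>z. z \<in> topspace Z \<Longrightarrow> p (f z) = p (g z)"
    and z0: "z0 \<in> topspace Z" "f z0 = g z0" and z: "z \<in> topspace Z"
  shows "f z = g z"
proof -
  let ?E = "{z \<in> topspace Z. f z = g z}"
  have fp: "f z \<in> points Mt" if "z \<in> topspace Z" for z
    using continuous_map_image_subset_topspace[OF f] that by (auto simp: topspace_mtop[OF Mt])
  have "closedin Z ?E" by (rule closedin_continuous_maps_eq[OF Hausdorff_Mt f g])
  moreover have "openin Z ?E"
  proof (subst openin_subopen, intro ballI)
    fix z assume "z \<in> ?E"
    then have z: "z \<in> topspace Z" "f z = g z" by auto
    obtain U where U: "openin (mtop M) U" "p (f z) \<in> U" and
      sh: "\<forall>y\<in>points Mt. p y \<in> U \<longrightarrow> (\<exists>V. openin (mtop Mt) V \<and> y \<in> V \<and> inj_on p V \<and> p ` V = U \<and>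
        smooth_map (restrict_atlas M U) Mt (inv_into V p))"
      by (rule sheets[OF p_points[OF fp[OF z(1)]]])
    obtain V where V: "openin (mtop Mt) V" "f z \<in> V" "inj_on p V"
      using sh fp[OF z(1)] U(2) by blast
    let ?N = "{z \<in> topspace Z. f z \<in> V} \<inter> {z \<in> topspace Z. g z \<in> V}"
    have "openin Z ?N"
      by (intro openin_Int openin_continuous_map_preimage[OF f V(1)] openin_continuous_map_preimage[OF g V(1)])
    moreover have "?N \<subseteq> ?E" using V(3) pfg by (auto dest: inj_onD)
    moreover have "z \<in> ?N" using z V(2) by auto
    ultimately show "\<exists>T. openin Z T \<and> z \<in> T \<and> T \<subseteq> ?E" by blast
  qed
  ultimately have "?E = {} \<or> ?E = topspace Z" using Z unfolding connected_space_clopen_in by blast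
  then show ?thesis using z0 z by blast
qed

lemma act_iso: "act \<in> hom \<Gamma> (deck_group Mt p)" "bij_betw act (carrier \<Gamma>) (carrier (deck_group Mt p))"
  using deck by (auto simp: deck_action_def iso_def)

lemma carrier_deck_group:
  "carrier (deck_group Mt p) = {\<tau> \<in> Bij (points Mt). smooth_map Mt Mt \<tau> \<and>
        smooth_map Mt Mt (inv_into (points Mt) \<tau>) \<and> (\<forall>y\<in>points Mt. p (\<tau> y) = p y)}"
  by (simp add: deck_group_def)

lemma act_deck:
  assumes "\<gamma> \<in> carrier \<Gamma>"
  shows "act \<gamma> \<in> Bij (points Mt)" "smooth_map Mt Mt (act \<gamma>)" "smooth_map Mt Mt (inv_into (points Mt) (act \<gamma>))"
    "y \<in> points Mt \<Longrightarrow> p (act \<gamma> y) = p y" "y \<in> points Mt \<Longrightarrow> act \<gamma> y \<in> points Mt"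
proof -
  have "act \<gamma> \<in> carrier (deck_group Mt p)" using act_iso(2) assms by (auto simp: bij_betw_def)
  then show "act \<gamma> \<in> Bij (points Mt)" "smooth_map Mt Mt (act \<gamma>)" "smooth_map Mt Mt (inv_into (points Mt) (act \<gamma>))"
    "y \<in> points Mt \<Longrightarrow> p (act \<gamma> y) = p y" unfolding carrier_deck_group by auto
  then show "y \<in> points Mt \<Longrightarrow> act \<gamma> y \<in> points Mt" using Bij_imp_funcset by blast
qed

lemma \<Gamma>_mult:
  assumes "\<gamma> \<in> carrier \<Gamma>" "\<delta> \<in> carrier \<Gamma>"
  shows "\<gamma> \<otimes>\<^bsub>\<Gamma>\<^esub> \<delta> \<in> carrier \<Gamma>"
    "y \<in> points Mt \<Longrightarrow> act (\<gamma> \<otimes>\<^bsub>\<Gamma>\<^esub> \<delta>) y = act \<gamma> (act \<delta> y)"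
proof -
  show "\<gamma> \<otimes>\<^bsub>\<Gamma>\<^esub> \<delta> \<in> carrier \<Gamma>" by (rule fundamental_group_mult_closed[OF assms])
  have "act (\<gamma> \<otimes>\<^bsub>\<Gamma>\<^esub> \<delta>) = act \<gamma> \<otimes>\<^bsub>deck_group Mt p\<^esub> act \<delta>" by (rule hom_mult[OF act_iso(1) assms])
  also have "\<dots> = compose (points Mt) (act \<gamma>) (act \<delta>)"
    using act_deck(1)[OF assms(1)] act_deck(1)[OF assms(2)] by (simp add: deck_group_def BijGroup_def)
  finally show "y \<in> points Mt \<Longrightarrow> act (\<gamma> \<otimes>\<^bsub>\<Gamma>\<^esub> \<delta>) y = act \<gamma> (act \<delta> y)" by (simp add: compose_def)
qed

text \<open>Freeness of the action. Deck transformations are lifts of \<open>p\<close>, so agreement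
  at one point spreads over \<open>Mt\<close>; extensionality turns this into equality of functions,
  and \<open>act\<close> is injective.\<close>

lemma act_eqI:
  assumes \<gamma>: "\<gamma> \<in> carrier \<Gamma>" and \<delta>: "\<delta> \<in> carrier \<Gamma>" and y: "y \<in> points Mt" "act \<gamma> y = act \<delta> y"
  shows "\<gamma> = \<delta>"
proof -
  have "act \<gamma> z = act \<delta> z" if "z \<in> points Mt" for z
    by (rule unique_lift[OF path_connected_imp_connected_space[OF path_connected_Mt]])
       (use act_deck[OF \<gamma>] act_deck[OF \<delta>] y that in \<open>simp_all add: smooth_map_def topspace_mtop[OF Mt]\<close>)
  then have "act \<gamma> = act \<delta>"
    using extensionalityI[OF Bij_imp_extensional[OF act_deck(1)[OF \<gamma>]] Bij_imp_extensional[OF act_deck(1)[OF \<delta>]]] by blast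
  then show ?thesis using bij_betw_imp_inj_on[OF act_iso(2)] \<gamma> \<delta> by (meson inj_onD)
qed

lemma deck_exists:
  assumes "\<tau> \<in> Bij (points Mt)" "smooth_map Mt Mt \<tau>" "smooth_map Mt Mt (inv_into (points Mt) \<tau>)"
    "\<forall>y\<in>points Mt. p (\<tau> y) = p y"
  obtains \<gamma> where "\<gamma> \<in> carrier \<Gamma>" "act \<gamma> = \<tau>"
proof -
  have "\<tau> \<in> act ` carrier \<Gamma>"
    using assms act_iso(2) unfolding bij_betw_def carrier_deck_group by auto
  then show thesis using that by blast
qed

text \<open>The neutral element is found as the preimage of the identity under \<open>act\<close>.
  Its idempotence is recorded because a homomorphism into a group sends idempotents to the neutral
  element.\<close>

lemma \<Gamma>_unit:
  obtains \<epsilon> where "\<epsilon> \<in> carrier \<Gamma>" "\<forall>y\<in>points Mt. act \<epsilon> y = y" "\<epsilon> \<otimes>\<^bsub>\<Gamma>\<^esub> \<epsilon> = \<epsilon>"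
proof -
  let ?i = "\<lambda>y\<in>points Mt. y"
  have s: "smooth_map Mt Mt ?i"
    by (rule smooth_map_cong[OF smooth_map_id[OF Mt] Mt Mt]) simp
  have "inv_into (points Mt) ?i y = y" if "y \<in> points Mt" for y
    by (rule inv_into_f_eq) (use that in \<open>auto simp: inj_on_def\<close>)
  then have s': "smooth_map Mt Mt (inv_into (points Mt) ?i)"
    by (intro smooth_map_cong[OF smooth_map_id[OF Mt] Mt Mt]) simp
  obtain \<epsilon> where e: "\<epsilon> \<in> carrier \<Gamma>" "act \<epsilon> = ?i" by (rule deck_exists[OF id_Bij s s']) simp
  have id: "\<forall>y\<in>points Mt. act \<epsilon> y = y" by (simp add: e(2))
  have "\<epsilon> \<otimes>\<^bsub>\<Gamma>\<^esub> \<epsilon> = \<epsilon>"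
    by (rule act_eqI[OF \<Gamma>_mult(1)[OF e(1) e(1)] e(1) y0]) (simp add: \<Gamma>_mult(2)[OF e(1) e(1) y0] id y0)
  then show thesis using that e(1) id by blast
qed

lemma \<Gamma>_inverse:
  assumes \<gamma>: "\<gamma> \<in> carrier \<Gamma>"
  obtains \<delta> where "\<delta> \<in> carrier \<Gamma>" "\<forall>y\<in>points Mt. act \<delta> (act \<gamma> y) = y"
proof -
  let ?S = "points Mt"
  let ?i = "\<lambda>y\<in>?S. inv_into ?S (act \<gamma>) y"
  note a = act_deck[OF \<gamma>]
  have bij: "bij_betw (act \<gamma>) ?S ?S" using a(1) by (simp add: Bij_def)
  have s: "smooth_map Mt Mt ?i"
    by (rule smooth_map_cong[OF a(3) Mt Mt]) simp
  have inv: "inv_into ?S (act \<gamma>) (act \<gamma> y) = y" if "y \<in> ?S" for y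
    using bij_betw_imp_inj_on[OF bij] that by simp
  \<comment> \<open>Membership in \<open>deck_group\<close> asks for smoothness of the inverse too;
    the inverse of the inverse is \<open>act \<gamma>\<close> again.\<close>
  have "act \<gamma> y = inv_into ?S ?i y" if "y \<in> ?S" for y
  proof (rule sym, rule inv_into_f_eq)
    show "inj_on ?i ?S" using restrict_inv_into_Bij[OF a(1)] by (simp add: Bij_def bij_betw_def)
  qed (use that a(5) inv in auto)
  then have s': "smooth_map Mt Mt (inv_into ?S ?i)" by (intro smooth_map_cong[OF a(2) Mt Mt]) simp
  have p: "\<forall>y\<in>?S. p (?i y) = p y"
  proof
    fix y assume y: "y \<in> ?S"
    have "p (act \<gamma> (?i y)) = p (?i y)" by (rule a(4)) (use Bij_inv_into_mem[OF a(1) y] y in simp)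
    moreover have "act \<gamma> (?i y) = y" using f_inv_into_f[of y "act \<gamma>" ?S] bij y by (simp add: bij_betw_def)
    ultimately show "p (?i y) = p y" by simp
  qed
  obtain \<delta> where d: "\<delta> \<in> carrier \<Gamma>" "act \<delta> = ?i"
    by (rule deck_exists[OF restrict_inv_into_Bij[OF a(1)] s s' p])
  show thesis by (rule that[OF d(1)]) (use d(2) a(5) inv in simp)
qed

text \<open>Balls in a chart; connectedness is what unique lifting on the neighbourhood will
  require.\<close>

lemma connected_neighbourhood:
  assumes y: "y \<in> points Mt" and V: "openin (mtop Mt) V" "y \<in> V"
  obtains B where "openin (mtop Mt) B" "y \<in> B" "B \<subseteq> V" "connectedin (mtop Mt) B"
proof -
  obtain c where c: "c \<in> Mt" "y \<in> fst c" using y unfolding points_iff by blast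
  have "open (snd c ` (fst c \<inter> V))" by (rule open_chart_Int[OF Mt c(1) V(1)])
  then obtain e where e: "e > 0" "ball (snd c y) e \<subseteq> snd c ` (fst c \<inter> V)"
    using c(2) V(2) by (meson IntI image_eqI openE)
  let ?D = "ball (snd c y) e"
  have sub: "?D \<subseteq> snd c ` fst c" using e(2) by blast
  have "smooth_map (open_atlas ?D) Mt (chart_inv c)"
  proof (rule smooth_mapI[OF smooth_atlas_open_atlas[OF open_ball] Mt])
    fix z assume z: "z \<in> points (open_atlas ?D)"
    have "smooth_on ?D (coord_map (?D, id) c (chart_inv c))"
      by (rule smooth_on_cong[OF open_ball _ smooth_on_ident[OF open_ball]])
         (use sub in \<open>auto simp: coord_map_apply chart_inv_open_atlas snd_chart_inv subset_iff\<close>)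
    moreover have "\<forall>w\<in>?D. chart_inv c (chart_inv (?D, id) w) \<in> fst c"
      using sub chart_inv_in[of _ c] by (simp add: chart_inv_open_atlas subset_iff)
    ultimately show "\<exists>c'\<in>open_atlas ?D. \<exists>d\<in>Mt. \<exists>U. z \<in> fst c' \<and> open U \<and> snd c' z \<in> U \<and> U \<subseteq> snd c' ` fst c' \<and>
        (\<forall>y\<in>U. chart_inv c (chart_inv c' y) \<in> fst d) \<and> smooth_on U (coord_map c' d (chart_inv c))"
      using c(1) z by (intro bexI[of _ "(?D, id)"] bexI[of _ c] exI[of _ ?D]) simp_all
  qed
  then have cont: "continuous_map (mtop (open_atlas ?D)) (mtop Mt) (chart_inv c)" by (simp add: smooth_map_def)
  have top: "mtop (open_atlas ?D) = top_of_set ?D"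
    unfolding topology_eq openin_open_atlas[OF open_ball] by (auto simp: openin_open_eq)
  have "connectedin (mtop Mt) (chart_inv c ` ?D)"
    by (rule connectedin_continuous_map_image[OF cont[unfolded top]]) (simp add: connectedin_subtopology)
  moreover have "openin (mtop Mt) (chart_inv c ` ?D)" by (rule openin_chart_image[OF Mt c(1) open_ball sub])
  moreover have "y \<in> chart_inv c ` ?D"
    using e(1) chart_inv_snd[OF Mt c] by (intro image_eqI[of _ _ "snd c y"]) auto
  moreover have "chart_inv c ` ?D \<subseteq> V"
  proof
    fix z assume "z \<in> chart_inv c ` ?D"
    then obtain w where "w \<in> snd c ` (fst c \<inter> V)" "z = chart_inv c w" using e(2) by blast
    then show "z \<in> V" using chart_inv_snd[OF Mt c(1)] by auto
  qed
  ultimately show thesis using that by blast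
qed

text \<open>The points whose fibre is a single orbit form an open and closed set. Locally, a deck
  transformation found over one point of a connected neighbourhood also works over its other points,
  by unique lifting.\<close>

lemma transitive:
  assumes "y \<in> points Mt" "y' \<in> points Mt" "p y' = p y"
  obtains \<gamma> where "\<gamma> \<in> carrier \<Gamma>" "act \<gamma> y = y'"
proof -
  let ?P = "\<lambda>y. \<forall>y'\<in>points Mt. p y' = p y \<longrightarrow> (\<exists>\<gamma>\<in>carrier \<Gamma>. act \<gamma> y = y')"
  let ?T = "{y \<in> topspace (mtop Mt). ?P y}"
  have loc: "\<exists>B. openin (mtop Mt) B \<and> y1 \<in> B \<and> (\<forall>y\<in>B. \<forall>z\<in>B. ?P y \<longrightarrow> ?P z)" if y1: "y1 \<in> points Mt" for y1
  proof -
    obtain U where U: "openin (mtop M) U" "p y1 \<in> U" and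
      sh: "\<forall>y\<in>points Mt. p y \<in> U \<longrightarrow> (\<exists>V. openin (mtop Mt) V \<and> y \<in> V \<and> inj_on p V \<and> p ` V = U \<and>
        smooth_map (restrict_atlas M U) Mt (inv_into V p))"
      by (rule sheets[OF p_points[OF y1]])
    have "openin (mtop Mt) {y \<in> points Mt. p y \<in> U}" by (rule smooth_map_openin_preimage[OF smooth_p Mt U(1)])
    then obtain B where B: "openin (mtop Mt) B" "y1 \<in> B" "B \<subseteq> {y \<in> points Mt. p y \<in> U}" "connectedin (mtop Mt) B"
      by (rule connected_neighbourhood[OF y1]) (use y1 U(2) in simp)
    have step: "?P z" if yz: "y \<in> B" "z \<in> B" "?P y" for y z
    proof (intro ballI impI)
      fix z' assume z': "z' \<in> points Mt" "p z' = p z"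
      have "p z' \<in> U" using z' yz(2) B(3) by auto
      then obtain V where V: "openin (mtop Mt) V" "z' \<in> V" "inj_on p V" "p ` V = U"
        "smooth_map (restrict_atlas M U) Mt (inv_into V p)" using sh z'(1) by blast
      \<comment> \<open>The sheet through the target \<open>z'\<close> gives a section over
        \<open>U\<close>; composed with \<open>p\<close> it is a second lift of \<open>p\<close> on
        \<open>B\<close>, to be compared with a deck transformation.\<close>
      let ?j = "\<lambda>w. inv_into V p (p w)"
      have j: "?j w \<in> V" "p (?j w) = p w" if "w \<in> B" for w
      proof -
        have "p w \<in> p ` V" using that B(3) V(4) by blast
        then show "?j w \<in> V" "p (?j w) = p w" by (rule inv_into_into, rule f_inv_into_f)
      qed
      have "V \<subseteq> points Mt" using openin_subset[OF V(1)] by (simp add: topspace_mtop[OF Mt])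
      then have "?j y \<in> points Mt" "p (?j y) = p y" using j[OF yz(1)] by auto
      then obtain \<gamma> where \<gamma>: "\<gamma> \<in> carrier \<Gamma>" "act \<gamma> y = ?j y" using yz(3) by blast
      have sB: "smooth_atlas (restrict_atlas Mt B)" by (rule smooth_atlas_restrict[OF Mt B(1)])
      have sU: "smooth_atlas (restrict_atlas M U)" by (rule smooth_atlas_restrict[OF M U(1)])
      note incl = smooth_map_restrict_inclusion[OF Mt B(1)]
      have "smooth_map (restrict_atlas Mt B) M p"
        using smooth_map_compose[OF incl smooth_p sB Mt M] by simp
      then have "smooth_map (restrict_atlas Mt B) (restrict_atlas M U) p"
        by (rule smooth_map_into_restrict[OF _ M sB U(1)]) (use B(3) in \<open>auto simp: points_restrict\<close>)
      from smooth_map_compose[OF this V(5) sB sU Mt]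
      have cj: "continuous_map (mtop (restrict_atlas Mt B)) (mtop Mt) ?j" by (simp add: smooth_map_def o_def)
      have ca: "continuous_map (mtop (restrict_atlas Mt B)) (mtop Mt) (act \<gamma>)"
        using smooth_map_compose[OF incl act_deck(2)[OF \<gamma>(1)] sB Mt Mt] by (simp add: smooth_map_def)
      \<comment> \<open>The lifting lemma is applied to the topology of the restricted atlas,
        whereas connectedness of \<open>B\<close> is known for the subtopology.\<close>
      have "mtop (restrict_atlas Mt B) = subtopology (mtop Mt) B"
        unfolding topology_eq
      proof
        fix S
        have "openin (mtop (restrict_atlas Mt B)) S \<longleftrightarrow> openin (mtop Mt) S \<and> S \<subseteq> B"
        proof (cases "S \<subseteq> B")
          case True
          then have "B \<inter> S = S" by blast
          then show ?thesis
            unfolding openin_atlas[OF sB] openin_atlas[OF Mt] points_restrict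
            unfolding restrict_atlas_def using True by (simp add: Int_assoc)
        next
          case False
          then show ?thesis unfolding openin_atlas[OF sB] points_restrict by auto
        qed
        then show "openin (mtop (restrict_atlas Mt B)) S \<longleftrightarrow> openin (subtopology (mtop Mt) B) S"
          using openin_open_subtopology[OF B(1)] by simp
      qed
      then have con: "connected_space (mtop (restrict_atlas Mt B))" using B(4) by (simp add: connectedin_def)
      have top: "topspace (mtop (restrict_atlas Mt B)) = B"
        using B(3) by (auto simp: topspace_mtop[OF sB] points_restrict)
      \<comment> \<open>The two lifts agree at \<open>y\<close> by the choice of
        \<open>\<gamma>\<close>, hence on the connected set \<open>B\<close>.\<close>
      have "act \<gamma> z = ?j z"
        by (rule unique_lift[OF con ca cj])
           (use top yz \<gamma>(2) j act_deck(4)[OF \<gamma>(1)] B(3) in auto)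
      also have "?j z = z'" using V(2,3) z'(2) by (metis inv_into_f_f)
      finally show "\<exists>\<gamma>\<in>carrier \<Gamma>. act \<gamma> z = z'" using \<gamma>(1) by blast
    qed
    have "\<forall>y\<in>B. \<forall>z\<in>B. ?P y \<longrightarrow> ?P z"
      by (rule ballI, rule ballI, rule impI, rule step)
    with B(1,2) show ?thesis by (intro exI[of _ B] conjI)
  qed
  have sub: "topspace (mtop Mt) = points Mt" by (rule topspace_mtop[OF Mt])
  have "openin (mtop Mt) ?T"
  proof (subst openin_subopen, intro ballI)
    fix y assume y: "y \<in> ?T"
    then have "y \<in> points Mt" and Py: "?P y" using sub by auto
    from loc[OF this(1)] obtain B where B: "openin (mtop Mt) B" "y \<in> B" "\<forall>y\<in>B. \<forall>z\<in>B. ?P y \<longrightarrow> ?P z"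
      by (elim exE conjE)
    have "B \<subseteq> ?T"
    proof
      fix z assume z: "z \<in> B"
      have "?P z" by (rule mp[OF bspec[OF bspec[OF B(3) B(2)] z] Py])
      moreover have "z \<in> topspace (mtop Mt)" using z openin_subset[OF B(1)] by (rule rev_subsetD)
      ultimately show "z \<in> ?T" by simp
    qed
    with B(1,2) show "\<exists>T. openin (mtop Mt) T \<and> y \<in> T \<and> T \<subseteq> ?T" by blast
  qed
  moreover have "openin (mtop Mt) (topspace (mtop Mt) - ?T)"
  proof (subst openin_subopen, intro ballI)
    fix y assume y: "y \<in> topspace (mtop Mt) - ?T"
    then have "y \<in> points Mt" and Py: "\<not> ?P y" using sub by auto
    from loc[OF this(1)] obtain B where B: "openin (mtop Mt) B" "y \<in> B" "\<forall>y\<in>B. \<forall>z\<in>B. ?P y \<longrightarrow> ?P z"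
      by (elim exE conjE)
    have "B \<subseteq> topspace (mtop Mt) - ?T"
    proof
      fix z assume z: "z \<in> B"
      have "\<not> ?P z"
      proof
        assume "?P z"
        then have "?P y" by (rule mp[OF bspec[OF bspec[OF B(3) z] B(2)]])
        then show False using Py by contradiction
      qed
      moreover have "z \<in> topspace (mtop Mt)" using z openin_subset[OF B(1)] by (rule rev_subsetD)
      ultimately show "z \<in> topspace (mtop Mt) - ?T" by simp
    qed
    with B(1,2) show "\<exists>T. openin (mtop Mt) T \<and> y \<in> T \<and> T \<subseteq> topspace (mtop Mt) - ?T" by blast
  qed
  then have "closedin (mtop Mt) ?T" by (simp add: closedin_def)
  ultimately have "?T = {} \<or> ?T = topspace (mtop Mt)"
    using path_connected_imp_connected_space[OF path_connected_Mt] unfolding connected_space_clopen_in by blast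
  \<comment> \<open>The set is nonempty: a path from \<open>y0\<close> to \<open>y'\<close> projects
    to a loop, and \<open>deck_action\<close> says where its class moves \<open>y0\<close>.\<close>
  moreover have "y0 \<in> ?T"
  proof -
    have "\<exists>\<gamma>\<in>carrier \<Gamma>. act \<gamma> y0 = y'" if y': "y' \<in> points Mt" "p y' = p y0" for y'
    proof -
      obtain g where g: "pathin (mtop Mt) g" "g 0 = y0" "g 1 = y'"
        using path_connected_Mt y0 y'(1) unfolding path_connected_space_def sub by blast
      have "pathin (mtop M) (p \<circ> g)"
        using g(1) smooth_p by (auto simp: pathin_def smooth_map_def intro: continuous_map_compose)
      then have "p \<circ> g \<in> loops (mtop M) (p y0)" using g y'(2) by (simp add: loops_def)
      then have "loop_class (mtop M) (p y0) (p \<circ> g) \<in> carrier \<Gamma>" by (simp add: fundamental_group_def)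
      moreover have "act (loop_class (mtop M) (p y0) (p \<circ> g)) y0 = y'"
        using deck g y'(2) unfolding deck_action_def by blast
      ultimately show ?thesis by blast
    qed
    then show ?thesis using y0 sub by blast
  qed
  ultimately have "?P y" using assms(1) sub by blast
  then show thesis using assms(2,3) that by blast
qed

lemma evenly_covered:
  assumes y: "y \<in> points Mt"
  obtains V where "openin (mtop Mt) V" "y \<in> V" "inj_on p V"
proof -
  obtain U where "p y \<in> U" and
    sh: "\<forall>y\<in>points Mt. p y \<in> U \<longrightarrow> (\<exists>V. openin (mtop Mt) V \<and> y \<in> V \<and> inj_on p V \<and> p ` V = U \<and>
        smooth_map (restrict_atlas M U) Mt (inv_into V p))"
    by (rule sheets[OF p_points[OF y]])
  then show thesis using that y by blast
qed

text \<open>The right-inverse clause serves injectivity of the pullback along \<open>p\<close>; the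
  left-inverse clause, on the neighbourhood \<open>O'\<close>, serves injectivity of the
  differential.\<close>

lemma p_local_inverse:
  assumes y: "y \<in> points Mt" and d: "d \<in> M" "p y \<in> fst d" and c: "c \<in> Mt" "y \<in> fst c"
  obtains U g where "open U" "snd d (p y) \<in> U" "U \<subseteq> snd d ` fst d" "smooth_on U g" "g ` U \<subseteq> snd c ` fst c"
    "\<forall>z\<in>U. p (chart_inv c (g z)) = chart_inv d z"
    "\<exists>O'. open O' \<and> snd c y \<in> O' \<and> (\<forall>w\<in>O'. coord_map c d p w \<in> U \<and> g (coord_map c d p w) = w)"
proof -
  obtain U0 where U0: "openin (mtop M) U0" "p y \<in> U0" and
    sh: "\<forall>y\<in>points Mt. p y \<in> U0 \<longrightarrow> (\<exists>V. openin (mtop Mt) V \<and> y \<in> V \<and> inj_on p V \<and> p ` V = U0 \<and>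
        smooth_map (restrict_atlas M U0) Mt (inv_into V p))"
    by (rule sheets[OF p_points[OF y]])
  obtain V where V: "openin (mtop Mt) V" "y \<in> V" "inj_on p V" "p ` V = U0"
    "smooth_map (restrict_atlas M U0) Mt (inv_into V p)" using sh y U0(2) by blast
  let ?j = "inv_into V p" and ?d = "(fst d \<inter> U0, snd d)"
  have sU: "smooth_atlas (restrict_atlas M U0)" by (rule smooth_atlas_restrict[OF M U0(1)])
  have dR: "?d \<in> restrict_atlas M U0" using d(1) unfolding restrict_atlas_iff by blast
  have jy: "?j (p y) = y" using V(2,3) by simp
  obtain U where U: "open U" "snd ?d (p y) \<in> U" "U \<subseteq> snd ?d ` fst ?d" "\<forall>z\<in>U. ?j (chart_inv ?d z) \<in> fst c"
    "smooth_on U (coord_map ?d c ?j)"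
    by (rule smooth_map_local[OF V(5) sU Mt dR c(1), of "p y"]) (use d U0 c jy in simp_all)
  let ?g = "coord_map ?d c ?j"
  have inv: "chart_inv ?d z = chart_inv d z" "chart_inv d z \<in> U0" "chart_inv d z \<in> fst d" if "z \<in> U" for z
  proof -
    have z: "z \<in> snd d ` (fst d \<inter> U0)" using U(3) that by auto
    show "chart_inv ?d z = chart_inv d z" by (rule chart_inv_restrict[OF M d(1) z])
    show "chart_inv d z \<in> U0" "chart_inv d z \<in> fst d" using z chart_inv_snd[OF M d(1)] by auto
  qed
  have g: "?g ` U \<subseteq> snd c ` fst c" using U(4) unfolding coord_map_apply by blast
  have pg: "\<forall>z\<in>U. p (chart_inv c (?g z)) = chart_inv d z"
  proof
    fix z assume z: "z \<in> U"
    have "chart_inv c (?g z) = ?j (chart_inv d z)"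
      using bspec[OF U(4) z] unfolding coord_map_apply inv(1)[OF z] snd_conv by (rule chart_inv_snd[OF Mt c(1)])
    moreover have "p (?j (chart_inv d z)) = chart_inv d z"
      by (rule f_inv_into_f) (simp add: V(4) inv(2)[OF z])
    ultimately show "p (chart_inv c (?g z)) = chart_inv d z" by simp
  qed
  obtain P where P: "open P" "snd c y \<in> P" "P \<subseteq> snd c ` fst c" "\<forall>w\<in>P. p (chart_inv c w) \<in> fst d"
    "smooth_on P (coord_map c d p)" by (rule smooth_map_local[OF smooth_p Mt M c(1) d(1) c(2) d(2)])
  let ?O = "(P \<inter> coord_map c d p -` U) \<inter> snd c ` (fst c \<inter> V)"
  have "open ?O"
    by (intro open_Int open_chart_Int[OF Mt c(1) V(1)]
        continuous_open_preimage[OF smooth_on_imp_continuous_on[OF P(5)] P(1) U(1)])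
  moreover have "snd c y \<in> ?O" using P(2) U(2) c(2) V(2) by (simp add: coord_map_apply chart_inv_snd[OF Mt c])
  moreover have "coord_map c d p w \<in> U \<and> ?g (coord_map c d p w) = w" if w: "w \<in> ?O" for w
  proof
    show u: "coord_map c d p w \<in> U" using w by simp
    obtain v where v: "v \<in> fst c" "v \<in> V" "w = snd c v" using w by blast
    have wv: "chart_inv c w = v" using v chart_inv_snd[OF Mt c(1)] by simp
    have "p v \<in> fst d" using P(4) w wv by force
    then have "chart_inv d (coord_map c d p w) = p v"
      by (simp add: coord_map_apply wv chart_inv_snd[OF M d(1)])
    then have "?g (coord_map c d p w) = snd c (?j (p v))"
      by (simp add: coord_map_apply[of ?d] inv(1)[OF u])
    then show "?g (coord_map c d p w) = w" using v V(3) by simp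
  qed
  ultimately have "\<exists>O'. open O' \<and> snd c y \<in> O' \<and> (\<forall>w\<in>O'. coord_map c d p w \<in> U \<and> ?g (coord_map c d p w) = w)" by blast
  moreover have "U \<subseteq> snd d ` fst d" using U(3) by auto
  ultimately show thesis using that[OF U(1) _ _ U(5) g pg] U(2) by simp
qed

text \<open>A sheet of the covering provides the local right inverse.\<close>

lemma pullback_p_injective:
  assumes "\<beta> \<in> forms k M" "\<beta>' \<in> forms k M" "pullback Mt M p \<beta> = pullback Mt M p \<beta>'"
  shows "\<beta> = \<beta>'"
proof (rule pullback_injective[OF smooth_p Mt M _ assms])
  fix b assume "b \<in> points M"
  then obtain y where y: "y \<in> points Mt" "b = p y" using p_image by blast
  obtain c d where c: "c \<in> Mt" "y \<in> fst c" and d: "d \<in> M" "p y \<in> fst d"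
    using y(1) p_points[OF y(1)] unfolding points_iff by blast
  obtain U g where "open U" "snd d (p y) \<in> U" "U \<subseteq> snd d ` fst d" "smooth_on U g" "g ` U \<subseteq> snd c ` fst c"
    "\<forall>z\<in>U. p (chart_inv c (g z)) = chart_inv d z"
    "\<exists>O'. open O' \<and> snd c y \<in> O' \<and> (\<forall>w\<in>O'. coord_map c d p w \<in> U \<and> g (coord_map c d p w) = w)"
    by (rule p_local_inverse[OF y(1) d c])
  then show "\<exists>c\<in>Mt. \<exists>d\<in>M. \<exists>U g. b \<in> fst d \<and> open U \<and> snd d b \<in> U \<and> U \<subseteq> snd d ` fst d \<and>
      smooth_on U g \<and> g ` U \<subseteq> snd c ` fst c \<and> (\<forall>y\<in>U. p (chart_inv c (g y)) = chart_inv d y)"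
    using c(1) d y(2) by blast
qed

text \<open>Differentiating the left-inverse relation in coordinates recovers \<open>u\<close> from
  its image.\<close>

lemma pushforward_p_eq_0:
  assumes y: "y \<in> points Mt" and u: "u \<in> tangent Mt y" and 0: "pushforward Mt M p y u = (\<lambda>_. 0)"
  shows "u = (\<lambda>_. 0)"
proof -
  obtain c d where c: "c \<in> Mt" "y \<in> fst c" and d: "d \<in> M" "p y \<in> fst d"
    using y p_points[OF y] unfolding points_iff by blast
  obtain U g where U: "open U" "snd d (p y) \<in> U" "U \<subseteq> snd d ` fst d" "smooth_on U g" "g ` U \<subseteq> snd c ` fst c"
    "\<forall>z\<in>U. p (chart_inv c (g z)) = chart_inv d z"
    and O': "\<exists>O'. open O' \<and> snd c y \<in> O' \<and> (\<forall>w\<in>O'. coord_map c d p w \<in> U \<and> g (coord_map c d p w) = w)"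
    by (rule p_local_inverse[OF y d c])
  obtain S where S: "open S" "snd c y \<in> S" "\<forall>w\<in>S. coord_map c d p w \<in> U \<and> g (coord_map c d p w) = w"
    using O' by blast
  obtain P where P: "open P" "snd c y \<in> P" "P \<subseteq> snd c ` fst c" "\<forall>w\<in>P. p (chart_inv c w) \<in> fst d"
    "smooth_on P (coord_map c d p)" by (rule smooth_map_local[OF smooth_p Mt M c(1) d(1) c(2) d(2)])
  have gy: "coord_map c d p (snd c y) \<in> U" using S by blast
  have "frechet_derivative (\<lambda>w. g (coord_map c d p w)) (at (snd c y)) = frechet_derivative (\<lambda>w. w) (at (snd c y))"
    by (rule frechet_derivative_cong_open[OF S(1,2)]) (use S(3) in blast)
  then have "u c = frechet_derivative (\<lambda>w. g (coord_map c d p w)) (at (snd c y)) (u c)" by simp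
  also have "\<dots> = frechet_derivative g (at (coord_map c d p (snd c y))) (frechet_derivative (coord_map c d p) (at (snd c y)) (u c))"
    by (rule smooth_on_derivative_compose[OF P(5,2) U(4) gy])
  also have "frechet_derivative (coord_map c d p) (at (snd c y)) (u c) = pushforward Mt M p y u d"
    using pushforward_apply[OF smooth_p Mt M u c d] by (simp add: dmap_def)
  also have "pushforward Mt M p y u d = 0" using 0 by simp
  finally have uc: "u c = 0" using linear_0[OF smooth_on_linear_derivative[OF U(4) gy]] by simp
  show ?thesis
  proof
    fix e
    have "coord_vec Mt c y 0 e = 0"
      using dmap_linear[OF smooth_map_id[OF Mt] Mt Mt c(1) _ c(2), of e]
      by (auto simp: coord_vec_dmap linear_0)
    then show "u e = 0" using coord_vec_coord[OF u c] uc by simp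
  qed
qed

text \<open>Treats \<open>P\<close> and \<open>P/K\<close> together. The action on the product is
  free and properly discontinuous because it is so on the first factor; the fibre only has to carry
  a compatible action.\<close>

lemma quotient_setting_associated:
  assumes B: "smooth_atlas B"
    and smooth: "\<And>\<gamma>. \<gamma> \<in> carrier \<Gamma> \<Longrightarrow> smooth_map B B (lact \<gamma>)"
    and unit: "\<And>\<epsilon> f. \<epsilon> \<in> carrier \<Gamma> \<Longrightarrow> \<epsilon> \<otimes>\<^bsub>\<Gamma>\<^esub> \<epsilon> = \<epsilon> \<Longrightarrow> f \<in> points B \<Longrightarrow> lact \<epsilon> f = f"
    and mult: "\<And>\<gamma> \<delta> f. \<gamma> \<in> carrier \<Gamma> \<Longrightarrow> \<delta> \<in> carrier \<Gamma> \<Longrightarrow> f \<in> points B \<Longrightarrow>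
      lact (\<gamma> \<otimes>\<^bsub>\<Gamma>\<^esub> \<delta>) f = lact \<gamma> (lact \<delta> f)"
  shows "quotient_setting (prod_atlas Mt B) (orbit_map \<Gamma> act lact)
      ((\<lambda>\<gamma> z. (act \<gamma> (fst z), lact \<gamma> (snd z))) ` carrier \<Gamma>)"
    "z \<in> points (prod_atlas Mt B) \<Longrightarrow> z' \<in> points (prod_atlas Mt B) \<Longrightarrow>
      orbit_map \<Gamma> act lact z = orbit_map \<Gamma> act lact z' \<longleftrightarrow> (\<exists>\<gamma>\<in>carrier \<Gamma>. z' = (act \<gamma> (fst z), lact \<gamma> (snd z)))"
proof -
  let ?X = "prod_atlas Mt B" and ?q = "orbit_map \<Gamma> act lact"
  let ?\<tau> = "\<lambda>\<gamma> z. (act \<gamma> (fst z), lact \<gamma> (snd z))"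
  have X: "smooth_atlas ?X" by (rule smooth_atlas_prod[OF Mt B])
  have st: "smooth_map ?X ?X (?\<tau> \<gamma>)" if "\<gamma> \<in> carrier \<Gamma>" for \<gamma>
    using smooth_map_Pair[OF smooth_map_compose[OF smooth_map_fst(1)[OF Mt B] act_deck(2)[OF that] X Mt Mt]
        smooth_map_compose[OF smooth_map_fst(2)[OF Mt B] smooth[OF that] X B B] X Mt B]
    by (simp add: o_def)
  have mul: "?\<tau> (\<gamma> \<otimes>\<^bsub>\<Gamma>\<^esub> \<delta>) z = ?\<tau> \<gamma> (?\<tau> \<delta> z)" if "\<gamma> \<in> carrier \<Gamma>" "\<delta> \<in> carrier \<Gamma>" "z \<in> points ?X" for \<gamma> \<delta> z
    using that \<Gamma>_mult(2)[OF that(1,2)] mult[OF that(1,2)] unfolding points_prod by auto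
  obtain \<epsilon> where \<epsilon>: "\<epsilon> \<in> carrier \<Gamma>" "\<forall>y\<in>points Mt. act \<epsilon> y = y" "\<epsilon> \<otimes>\<^bsub>\<Gamma>\<^esub> \<epsilon> = \<epsilon>" by (rule \<Gamma>_unit)
  have eps: "?\<tau> \<epsilon> z = z" if "z \<in> points ?X" for z
    using that \<epsilon>(2) unit[OF \<epsilon>(1,3)] unfolding points_prod by auto
  have sub: "?q (?\<tau> \<gamma> z) \<subseteq> ?q z" if "\<gamma> \<in> carrier \<Gamma>" "z \<in> points ?X" for \<gamma> z
  proof
    fix w assume "w \<in> ?q (?\<tau> \<gamma> z)"
    then obtain \<delta> where \<delta>: "\<delta> \<in> carrier \<Gamma>" "w = ?\<tau> \<delta> (?\<tau> \<gamma> z)" unfolding orbit_map_def by blast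
    then have "w = ?\<tau> (\<delta> \<otimes>\<^bsub>\<Gamma>\<^esub> \<gamma>) z" using mul[OF \<delta>(1) that] by simp
    then show "w \<in> ?q z" unfolding orbit_map_def using \<Gamma>_mult(1)[OF \<delta>(1) that(1)] by blast
  qed
  have inv: "?q (?\<tau> \<gamma> z) = ?q z" if g: "\<gamma> \<in> carrier \<Gamma>" and z: "z \<in> points ?X" for \<gamma> z
  proof -
    obtain \<delta> where \<delta>: "\<delta> \<in> carrier \<Gamma>" "\<forall>y\<in>points Mt. act \<delta> (act \<gamma> y) = y" by (rule \<Gamma>_inverse[OF g])
    \<comment> \<open>Freeness identifies the product with \<open>\<epsilon>\<close>, which
      transports the inverse law from \<open>Mt\<close> to the action \<open>lact\<close> on the
      fibre.\<close>
    have "\<delta> \<otimes>\<^bsub>\<Gamma>\<^esub> \<gamma> = \<epsilon>"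
      by (rule act_eqI[OF \<Gamma>_mult(1)[OF \<delta>(1) g] \<epsilon>(1) y0]) (simp add: \<Gamma>_mult(2)[OF \<delta>(1) g y0] \<delta>(2) \<epsilon>(2) y0)
    then have "?\<tau> \<delta> (?\<tau> \<gamma> z) = z" using mul[OF \<delta>(1) g z] eps[OF z] by simp
    then have "?q z \<subseteq> ?q (?\<tau> \<gamma> z)"
      using sub[OF \<delta>(1) smooth_map_image[OF st[OF g] X X z]] by simp
    then show ?thesis using sub[OF g z] by blast
  qed
  have iff: "?q z = ?q z' \<longleftrightarrow> (\<exists>\<gamma>\<in>carrier \<Gamma>. z' = ?\<tau> \<gamma> z)" if z: "z \<in> points ?X" "z' \<in> points ?X" for z z'
  proof
    assume "?q z = ?q z'"
    moreover have "?\<tau> \<epsilon> z' \<in> ?q z'" unfolding orbit_map_def using \<epsilon>(1) by (rule imageI)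
    ultimately have "z' \<in> ?q z" using eps[OF z(2)] by simp
    then show "\<exists>\<gamma>\<in>carrier \<Gamma>. z' = ?\<tau> \<gamma> z" unfolding orbit_map_def by blast
  next
    assume "\<exists>\<gamma>\<in>carrier \<Gamma>. z' = ?\<tau> \<gamma> z"
    then show "?q z = ?q z'" using inv[OF _ z(1)] by auto
  qed
  show "z \<in> points ?X \<Longrightarrow> z' \<in> points ?X \<Longrightarrow> ?q z = ?q z' \<longleftrightarrow> (\<exists>\<gamma>\<in>carrier \<Gamma>. z' = ?\<tau> \<gamma> z)"
    by (rule iff)
  show "quotient_setting ?X ?q (?\<tau> ` carrier \<Gamma>)"
    unfolding quotient_setting_def
  proof (intro conjI ballI impI)
    fix x assume x: "x \<in> points ?X"
    then have xy: "fst x \<in> points Mt" unfolding points_prod by auto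
    obtain V where V: "openin (mtop Mt) V" "fst x \<in> V" "inj_on p V" by (rule evenly_covered[OF xy])
    let ?W = "{z \<in> points ?X. fst z \<in> V}"
    have "openin (mtop ?X) ?W" by (rule smooth_map_openin_preimage[OF smooth_map_fst(1)[OF Mt B] X V(1)])
    \<comment> \<open>Two points of one orbit over \<open>V\<close> have equal first components,
      since \<open>p\<close> is injective there; freeness on \<open>Mt\<close> then forces the group
      element to be \<open>\<epsilon>\<close>, which fixes the fibre as well.\<close>
    moreover have "inj_on ?q ?W"
    proof (rule inj_onI)
      fix z z' assume z: "z \<in> ?W" and z': "z' \<in> ?W" and eq: "?q z = ?q z'"
      then obtain \<gamma> where g: "\<gamma> \<in> carrier \<Gamma>" "z' = ?\<tau> \<gamma> z" using iff by blast
      have zM: "fst z \<in> points Mt" using z unfolding points_prod by auto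
      have "p (fst z') = p (fst z)" using g act_deck(4)[OF g(1) zM] by simp
      then have "fst z' = fst z" using z z' inj_onD[OF V(3)] by blast
      then have "\<gamma> = \<epsilon>" using act_eqI[OF g(1) \<epsilon>(1) zM] g(2) \<epsilon>(2) zM by simp
      then show "z = z'" using g(2) eps[of z] z by simp
    qed
    ultimately show "\<exists>W. openin (mtop ?X) W \<and> x \<in> W \<and> inj_on ?q W" using x V(2) by blast
    fix x' assume "x' \<in> points ?X" "?q x = ?q x'"
    then obtain \<gamma> where g: "\<gamma> \<in> carrier \<Gamma>" "x' = ?\<tau> \<gamma> x" using iff[OF x] by blast
    show "\<exists>\<tau>\<in>?\<tau> ` carrier \<Gamma>. \<tau> x = x'"
      by (rule bexI[of _ "?\<tau> \<gamma>"]) (rule g(2)[symmetric], rule imageI, rule g(1))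
  next
    fix \<tau> assume "\<tau> \<in> ?\<tau> ` carrier \<Gamma>"
    then obtain \<gamma> where g: "\<gamma> \<in> carrier \<Gamma>" "\<tau> = ?\<tau> \<gamma>" by blast
    show "smooth_map ?X ?X \<tau>" unfolding g(2) by (rule st[OF g(1)])
    show "?q (\<tau> z) = ?q z" if "z \<in> points ?X" for z unfolding g(2) by (rule inv[OF g(1) that])
  qed (rule X)
qed

end

section \<open>Forms on Euclidean spaces and the invariant forms of \<open>SE(3)\<close>\<close>

abbreviation euclid :: "('e, 'e::euclidean_space) atlas" where
  "euclid \<equiv> open_atlas UNIV"

lemma smooth_atlas_euclid: "smooth_atlas euclid"
  by (rule smooth_atlas_open_atlas[OF open_UNIV])

text \<open>Packs coefficient functions into a form that vanishes on invalid arguments, as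
  membership in \<open>forms\<close> requires.\<close>

definition euclid_form :: "nat \<Rightarrow> ('e::euclidean_space \<Rightarrow> 'e list \<Rightarrow> 'v::real_normed_vector) \<Rightarrow> ('e, 'e, 'v) form" where
  "euclid_form k \<theta> = (\<lambda>x vs. if length vs = k \<and> set vs \<subseteq> tangent euclid x
     then \<theta> x (map (\<lambda>v. v (UNIV, id)) vs) else 0)"

text \<open>The pushforward to a Euclidean space read in its only chart, hence an ordinary
  vector.\<close>

definition differential :: "('a, 'e::euclidean_space) atlas \<Rightarrow> ('a \<Rightarrow> 'f::euclidean_space) \<Rightarrow> 'a \<Rightarrow> ('a, 'e) tvec \<Rightarrow> 'f" where
  "differential A f x v = pushforward A euclid f x v (UNIV, id)"

lemma differential_coord:
  assumes f: "smooth_map A euclid f" and A: "smooth_atlas A"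
    and v: "v \<in> tangent A x" and c: "c \<in> A" "x \<in> fst c"
  shows "differential A f x v = frechet_derivative (\<lambda>y. f (chart_inv c y)) (at (snd c x)) (v c)"
proof -
  have "coord_map c (UNIV, id) f = (\<lambda>y. f (chart_inv c y))" by (simp add: coord_map_apply fun_eq_iff)
  then show ?thesis
    using pushforward_apply[OF f A smooth_atlas_euclid v c, of "(UNIV, id)"]
    by (simp add: differential_def dmap_def)
qed

lemma chart_has_derivative:
  assumes f: "smooth_map A euclid f" and A: "smooth_atlas A" and c: "c \<in> A" "x \<in> fst c"
  shows "((\<lambda>y. f (chart_inv c y)) has_derivative frechet_derivative (\<lambda>y. f (chart_inv c y)) (at (snd c x))) (at (snd c x))"
  using smooth_on_has_derivative[OF smooth_map_into_openD[OF f A open_UNIV c(1)]] c(2) by blast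

lemma differential_chain:
  assumes f: "smooth_map A euclid f" and A: "smooth_atlas A" and x: "x \<in> points A" and v: "v \<in> tangent A x"
    and g: "(g has_derivative g') (at (f x))" and h: "\<And>z. z \<in> points A \<Longrightarrow> h z = g (f z)"
    and sh: "smooth_map A euclid h"
  shows "differential A h x v = g' (differential A f x v)"
proof -
  obtain c where c: "c \<in> A" "x \<in> fst c" using x unfolding points_iff by blast
  have "((\<lambda>y. g (f (chart_inv c y))) has_derivative g' \<circ> frechet_derivative (\<lambda>y. f (chart_inv c y)) (at (snd c x))) (at (snd c x))"
    using diff_chain_at[OF chart_has_derivative[OF f A c]] g by (simp add: o_def chart_inv_snd[OF A c])
  from frechet_derivative_at[OF this]
  have "frechet_derivative (\<lambda>y. g (f (chart_inv c y))) (at (snd c x)) (v c)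
      = g' (frechet_derivative (\<lambda>y. f (chart_inv c y)) (at (snd c x)) (v c))" by (metis comp_apply)
  moreover have "frechet_derivative (\<lambda>y. h (chart_inv c y)) (at (snd c x))
      = frechet_derivative (\<lambda>y. g (f (chart_inv c y))) (at (snd c x))"
  proof (rule frechet_derivative_cong_open[OF smooth_atlas_open[OF A c(1)]])
    fix y assume "y \<in> snd c ` fst c"
    then have "chart_inv c y \<in> points A" using chart_inv_in[of y c] c(1) unfolding points_iff by blast
    then show "h (chart_inv c y) = g (f (chart_inv c y))" by (rule h)
  qed (use c in blast)
  ultimately show ?thesis
    by (simp add: differential_coord[OF f A v c] differential_coord[OF sh A v c])
qed

lemma differential_Pair:
  assumes f: "smooth_map A euclid f" and g: "smooth_map A euclid g" and A: "smooth_atlas A"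
    and x: "x \<in> points A" and v: "v \<in> tangent A x"
  shows "differential A (\<lambda>x. (f x, g x)) x v = (differential A f x v, differential A g x v)"
proof -
  obtain c where c: "c \<in> A" "x \<in> fst c" using x unfolding points_iff by blast
  have "frechet_derivative (\<lambda>y. (f (chart_inv c y), g (chart_inv c y))) (at (snd c x)) =
      (\<lambda>w. (frechet_derivative (\<lambda>y. f (chart_inv c y)) (at (snd c x)) w, frechet_derivative (\<lambda>y. g (chart_inv c y)) (at (snd c x)) w))"
    by (rule frechet_derivative_at[symmetric], intro has_derivative_Pair chart_has_derivative[OF f A c] chart_has_derivative[OF g A c])
  then show ?thesis
    by (simp add: differential_coord[OF f A v c] differential_coord[OF g A v c]
        differential_coord[OF smooth_map_Pair_open[OF f g A] A v c])
qed

lemma differential_compose: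
  assumes f: "smooth_map A B f" and g: "smooth_map B euclid g"
    and A: "smooth_atlas A" and B: "smooth_atlas B" and x: "x \<in> points A" and v: "v \<in> tangent A x"
  shows "differential A (g \<circ> f) x v = differential B g (f x) (pushforward A B f x v)"
  unfolding differential_def by (simp add: pushforward_compose[OF f g A B smooth_atlas_euclid x v])

lemma differential_cong:
  assumes "smooth_atlas A" "x \<in> points A" "\<And>z. z \<in> points A \<Longrightarrow> f z = g z"
  shows "differential A f x v = differential A g x v"
  unfolding differential_def using pushforward_cong[OF assms(1,2), of f g] assms(3) by metis

lemma tangent_euclid: "coord_vec euclid (UNIV, id) x w \<in> tangent euclid x" "coord_vec euclid (UNIV, id) x w (UNIV, id) = w"
  by (rule coord_vec_tangent[OF smooth_atlas_euclid], simp, simp)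
     (rule coord_vec_same[OF smooth_atlas_euclid], simp, simp)

lemma local_rep_euclid_form:
  "local_rep euclid (euclid_form k \<theta>) (UNIV, id) y ws = (if length ws = k then \<theta> y ws else 0)"
proof -
  have "set (map (coord_vec euclid (UNIV, id) y) ws) \<subseteq> tangent euclid y" using tangent_euclid(1) by auto
  moreover have "map (\<lambda>v. v (UNIV, id)) (map (coord_vec euclid (UNIV, id) y) ws) = ws"
    by (simp add: o_def tangent_euclid(2))
  moreover have "chart_inv (UNIV, id) y = y" by (simp add: chart_inv_open_atlas)
  ultimately show ?thesis unfolding local_rep_def euclid_form_def by simp
qed

lemma euclid_form_forms:
  assumes smooth: "\<And>ws. length ws = k \<Longrightarrow> smooth_on UNIV (\<lambda>x. \<theta> x ws)" and ml: "\<And>x. alt_multilinear k (\<theta> x)"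
  shows "euclid_form k \<theta> \<in> forms k euclid"
proof (rule formsI[OF smooth_atlas_euclid])
  fix x :: 'a assume "x \<in> points euclid"
  have "alt_multilinear k (local_rep euclid (euclid_form k \<theta>) (UNIV, id) y)" for y
    using ml[of y] unfolding alt_multilinear_def local_rep_euclid_form by simp
  moreover have "smooth_on UNIV (\<lambda>y. local_rep euclid (euclid_form k \<theta>) (UNIV, id) y ws)" if "length ws = k" for ws
    unfolding local_rep_euclid_form using smooth[OF that] that by simp
  ultimately show "\<exists>c\<in>euclid. \<exists>U. x \<in> fst c \<and> open U \<and> snd c x \<in> U \<and> U \<subseteq> snd c ` fst c \<and>
      (\<forall>ws. length ws = k \<longrightarrow> smooth_on U (\<lambda>y. local_rep euclid (euclid_form k \<theta>) c y ws)) \<and>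
      (\<forall>y\<in>U. alt_multilinear k (local_rep euclid (euclid_form k \<theta>) c y))"
    by (intro bexI[of _ "(UNIV, id)"] exI[of _ UNIV]) simp_all
qed (auto simp: euclid_form_def)

lemma pullback_euclid_form:
  assumes f: "smooth_map A euclid f" and A: "smooth_atlas A"
    and x: "x \<in> points A" and vs: "length vs = k" "set vs \<subseteq> tangent A x"
  shows "pullback A euclid f (euclid_form k \<theta>) x vs = \<theta> (f x) (map (differential A f x) vs)"
proof -
  have "set (map (pushforward A euclid f x) vs) \<subseteq> tangent euclid (f x)"
    using pushforward_tangent[OF f A smooth_atlas_euclid x] vs(2) by auto
  then show ?thesis
    unfolding pullback_apply[OF x vs(2)] euclid_form_def using vs(1) by (simp add: o_def differential_def[abs_def])
qed

lemma local_rep_pullback_euclid_form: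
  assumes f: "smooth_map A euclid f" and A: "smooth_atlas A"
    and c: "c \<in> A" "y \<in> snd c ` fst c" and ws: "length ws = k"
  shows "local_rep A (pullback A euclid f (euclid_form k \<theta>)) c y ws
    = \<theta> (f (chart_inv c y)) (map (frechet_derivative (\<lambda>z. f (chart_inv c z)) (at y)) ws)"
proof -
  have "coord_map c (UNIV, id) f = (\<lambda>y. f (chart_inv c y))" by (simp add: coord_map_apply fun_eq_iff)
  then show ?thesis
    using local_rep_pullback[OF f A smooth_atlas_euclid c(1) _ c(2), of "(UNIV, id)" "euclid_form k \<theta>" ws] ws
    by (simp add: local_rep_euclid_form)
qed

text \<open>Between Euclidean spaces an invariance claim becomes an algebraic identity between
  coefficients.\<close>

lemma pullback_euclid_euclid:
  assumes f: "\<And>x. (f has_derivative f' x) (at x)" "smooth_on UNIV f"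
    and eq: "\<And>x ws. length ws = k \<Longrightarrow> \<theta> (f x) (map (f' x) ws) = \<theta>' x ws"
  shows "pullback euclid euclid f (euclid_form k \<theta>) = euclid_form k \<theta>'"
proof (intro ext)
  fix x vs
  have sf: "smooth_map euclid euclid f" by (rule smooth_map_open_open) (use f in auto)
  show "pullback euclid euclid f (euclid_form k \<theta>) x vs = euclid_form k \<theta>' x vs"
  proof (cases "length vs = k \<and> set vs \<subseteq> tangent euclid x")
    case True
    have "differential euclid f x v = f' x (v (UNIV, id))" if "v \<in> tangent euclid x" for v
    proof -
      have "(\<lambda>y. f (chart_inv (UNIV, id) y)) = f" by (simp add: chart_inv_open_atlas)
      then show ?thesis
        using differential_coord[OF sf smooth_atlas_euclid that, of "(UNIV, id)"] frechet_derivative_at[OF f(1)[of x]] by simp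
    qed
    then have "map (differential euclid f x) vs = map (f' x) (map (\<lambda>v. v (UNIV, id)) vs)" using True by auto
    moreover have "pullback euclid euclid f (euclid_form k \<theta>) x vs = \<theta> (f x) (map (differential euclid f x) vs)"
      using pullback_euclid_form[OF sf smooth_atlas_euclid _ conjunct1[OF True] conjunct2[OF True]] by simp
    moreover have "\<theta> (f x) (map (f' x) (map (\<lambda>v. v (UNIV, id)) vs)) = euclid_form k \<theta>' x vs"
      using eq[of "map (\<lambda>v. v (UNIV, id)) vs" x] True by (simp add: euclid_form_def del: map_map)
    ultimately show ?thesis by (simp only:)
  next
    case False
    have "length (map (pushforward euclid euclid f x) vs) = length vs" by simp
    then show ?thesis using False unfolding pullback_def euclid_form_def by (simp only: length_map) simp
  qed
qed

lemma length_3E: assumes "length ws = 3" obtains a b c where "ws = [a, b, c]"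
  using assms by (auto simp: numeral_3_eq_3 length_Suc_conv)

lemma length_1E: assumes "length ws = 1" obtains a where "ws = [a]"
  using assms by (auto simp: length_Suc_conv)

section \<open>The invariant volume form\<close>

definition vol_form :: "(real^3, real^3, real) form" where
  "vol_form = euclid_form 3 (\<lambda>_ ws. det (vector ws))"

lemma det_vector3: "det (vector [a, b, c] :: real^3^3) = a \<bullet> cross3 b c"
  by (simp add: dot_cross_det)

lemma alt_multilinear_det: "alt_multilinear 3 (\<lambda>ws. det (vector ws :: real^3^3))"
  unfolding alt_multilinear_def
proof (intro allI impI conjI)
  fix ws :: "(real^3) list" and i :: nat
  assume "length ws = 3" "i < 3"
  then obtain a b c where ws: "ws = [a, b, c]" by (elim length_3E)
  have "i = 0 \<or> i = 1 \<or> i = 2" using \<open>i < 3\<close> by auto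
  then show "linear (\<lambda>w. det (vector (ws[i := w]) :: real^3^3))"
    by (auto simp: ws det_vector3 inner_left_distrib inner_right_distrib cross_add_left cross_add_right
        cross_mult_left cross_mult_right intro!: linearI)
next
  fix ws :: "(real^3) list" and i j :: nat
  assume "length ws = 3" and ij: "i < 3" "j < 3" "i \<noteq> j \<and> ws ! i = ws ! j"
  then obtain a b c where ws: "ws = [a, b, c]" by (elim length_3E)
  have "i = 0 \<or> i = 1 \<or> i = 2" "j = 0 \<or> j = 1 \<or> j = 2" using ij by auto
  then show "det (vector ws :: real^3^3) = 0"
    using ij(3) by (auto simp: ws det_vector3 dot_cross_self)
qed

lemma vol_form_forms: "vol_form \<in> forms 3 euclid"
  unfolding vol_form_def by (rule euclid_form_forms) (simp_all add: smooth_on_const alt_multilinear_det)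

lemma det_rotation:
  assumes "rotation_matrix A"
  shows "det (vector [A *v a, A *v b, A *v c] :: real^3^3) = det (vector [a, b, c])"
proof -
  have "(A *v a) \<bullet> (A *v d) = a \<bullet> d" for d
    using rotation_cancel(2)[OF assms, of d]
    by (metis dot_lmul_matrix inner_commute transpose_matrix_vector transpose_transpose vector_transpose_matrix)
  then show ?thesis by (simp add: det_vector3 cross_rotation_matrix[OF assms])
qed

lemma has_derivative_se3_move: "(se3_move g has_derivative (\<lambda>w. snd g *v w)) (at x)"
proof -
  have "((\<lambda>x. fst g + snd g *v x) has_derivative (\<lambda>w. 0 + snd g *v w)) (at x)"
    by (intro has_derivative_add has_derivative_const bounded_linear.has_derivative[OF _ has_derivative_ident])
      (simp add: linear_conv_bounded_linear[symmetric])
  then show ?thesis by (simp add: se3_move_pair[abs_def])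
qed

lemma smooth_on_se3_move: "smooth_on UNIV (se3_move g)"
  unfolding se3_move_pair[abs_def] by (intro smooth_intros open_UNIV)

lemma pullback_vol_form:
  assumes "g \<in> carrier SE3"
  shows "pullback E3_atlas E3_atlas (se3_move g) vol_form = vol_form"
  unfolding vol_form_def
proof (rule pullback_euclid_euclid[OF has_derivative_se3_move smooth_on_se3_move])
  fix x :: "real^3" and ws :: "(real^3) list" assume "length ws = 3"
  then obtain a b c where ws: "ws = [a, b, c]" by (elim length_3E)
  show "det (vector (map ((*v) (snd g)) ws) :: real^3^3) = det (vector ws)"
    using det_rotation assms unfolding carrier_SE3_iff ws by simp
qed

text \<open>Uniqueness is homogeneity: an invariant form is determined by its value at 0, because
  translations move 0 to every point.\<close>

lemma vol_G_eq: "vol_G = vol_form"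
  unfolding vol_G_def
proof (rule the_equality)
  have v0: "vol_form 0 (map (coord_vec E3_atlas (UNIV, id) 0) ws) = det (vector ws)" if "length ws = 3" for ws
    using local_rep_euclid_form[of 3 "\<lambda>_ ws. det (vector ws)" 0 ws] that
    unfolding local_rep_def vol_form_def by (simp add: chart_inv_open_atlas)
  show "vol_form \<in> forms 3 E3_atlas \<and> (\<forall>g\<in>carrier SE3. pullback E3_atlas E3_atlas (se3_move g) vol_form = vol_form) \<and>
      (\<forall>u v w. vol_form 0 (map (coord_vec E3_atlas (UNIV, id) 0) [u, v, w]) = det (vector [u, v, w]))"
    by (intro conjI ballI allI vol_form_forms pullback_vol_form v0) simp_all
next
  fix \<eta> :: "(real^3, real^3, real) form"
  assume "\<eta> \<in> forms 3 E3_atlas \<and> (\<forall>g\<in>carrier SE3. pullback E3_atlas E3_atlas (se3_move g) \<eta> = \<eta>) \<and>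
     (\<forall>u v w. \<eta> 0 (map (coord_vec E3_atlas (UNIV, id) 0) [u, v, w]) = det (vector [u, v, w]))"
  then have \<eta>: "\<eta> \<in> forms 3 E3_atlas" and inv: "\<And>g. g \<in> carrier SE3 \<Longrightarrow> pullback E3_atlas E3_atlas (se3_move g) \<eta> = \<eta>"
    and at0: "\<And>u v w. \<eta> 0 (map (coord_vec E3_atlas (UNIV, id) 0) [u, v, w]) = det (vector [u, v, w])" by auto
  show "\<eta> = vol_form"
  proof (intro ext)
    fix x :: "real^3" and vs
    show "\<eta> x vs = vol_form x vs"
    proof (cases "length vs = 3 \<and> set vs \<subseteq> tangent E3_atlas x")
      case False
      then show ?thesis using forms_outside[OF \<eta>, of x vs] forms_outside[OF vol_form_forms, of x vs] by auto
    next
      case True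
      \<comment> \<open>Translation by \<open>x\<close>. Its derivative is the identity, so an
        invariant form has the same coefficients at \<open>x\<close> as at 0.\<close>
      let ?g = "(x, mat 1) :: se3_pair" and ?c = "(UNIV, id) :: (real^3, real^3) chart"
      let ?ws = "map (\<lambda>v. v ?c) vs"
      have g: "?g \<in> carrier SE3" by (simp add: SE3_simps rotation_matrix_one)
      have D: "frechet_derivative (se3_move ?g) (at 0) = (\<lambda>w. w)"
        using frechet_derivative_at[OF has_derivative_se3_move[of ?g 0]] by simp
      have cm: "coord_map ?c ?c (se3_move ?g) = se3_move ?g"
        by (rule ext) (simp add: coord_map_apply chart_inv_open_atlas)
      have "\<eta> x vs = local_rep E3_atlas \<eta> ?c x ?ws"
        using form_apply[OF smooth_atlas_euclid, of ?c x vs \<eta>] True by simp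
      also have "\<dots> = local_rep E3_atlas (pullback E3_atlas E3_atlas (se3_move ?g) \<eta>) ?c 0 ?ws"
        using local_rep_pullback[OF smooth_map_se3_move smooth_atlas_euclid smooth_atlas_euclid, of ?c ?c 0 ?g \<eta> ?ws]
        by (simp add: cm D se3_move_pair)
      also have "\<dots> = local_rep E3_atlas \<eta> ?c 0 ?ws" by (simp add: inv[OF g])
      also have "\<dots> = det (vector ?ws)"
      proof -
        obtain a b c where abc: "?ws = [a, b, c]" using True by (metis length_3E length_map)
        show ?thesis unfolding abc local_rep_def using at0[of a b c] by (simp add: chart_inv_open_atlas)
      qed
      also have "\<dots> = vol_form x vs" using True by (simp add: vol_form_def euclid_form_def)
      finally show ?thesis .
    qed
  qed
qed

text \<open>The form g^-1 dg with the transpose in place of the matrix inverse. It agrees with the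
  Maurer-Cartan form on the group and, being polynomial in the entries, is smooth on the whole
  ambient space.\<close>

definition mc_form :: "(se3_pair, se3_pair, se3) form" where
  "mc_form = euclid_form 1 (\<lambda>g ws. (transpose (snd g) *v fst (hd ws), vee (transpose (snd g) ** snd (hd ws))))"

lemma alt_multilinear_1:
  assumes "linear f" shows "alt_multilinear 1 (\<lambda>ws. f (hd ws))"
  unfolding alt_multilinear_def
proof (intro allI impI conjI)
  fix ws :: "'a list" and i :: nat
  assume "length ws = 1" "i < 1"
  then obtain a where "ws = [a]" by (elim length_1E)
  then show "linear (\<lambda>w. f (hd (ws[i := w])))" using assms \<open>i < 1\<close> by simp
qed simp

lemma mc_form_forms: "mc_form \<in> forms 1 euclid"
  unfolding mc_form_def
proof (rule euclid_form_forms)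
  fix ws :: "se3_pair list"
  show "smooth_on UNIV (\<lambda>g. (transpose (snd g) *v fst (hd ws), vee (transpose (snd g) ** snd (hd ws))))"
    by (intro smooth_on_Pair smooth_on_vee smooth_on_matrix smooth_on_snd smooth_on_ident smooth_on_const open_UNIV smooth_on_transpose)
next
  fix g :: se3_pair
  have "bounded_linear (\<lambda>w::se3_pair. (transpose (snd g) *v fst w, vee (transpose (snd g) ** snd w)))"
    by (intro bounded_linear_Pair
        bounded_linear_compose[OF bounded_bilinear.bounded_linear_right[OF linear_matrix_bilinear(1)] bounded_linear_fst]
        bounded_linear_compose[OF bounded_linear_vee
          bounded_linear_compose[OF bounded_bilinear.bounded_linear_right[OF linear_matrix_bilinear(2)] bounded_linear_snd]])
  from alt_multilinear_1[OF bounded_linear.linear[OF this]]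
  show "alt_multilinear 1 (\<lambda>ws. (transpose (snd g) *v fst (hd ws), vee (transpose (snd g) ** snd (hd ws))))" .
qed

lemma has_derivative_se3_mult:
  "(se3_mult g has_derivative (\<lambda>h. (snd g *v fst h, snd g ** snd h))) (at x)"
  "((\<lambda>x. se3_mult x g) has_derivative (\<lambda>h. (fst h + snd h *v fst g, snd h ** snd g))) (at x)"
proof -
  have l: "bounded_linear (\<lambda>h::se3_pair. snd g *v fst h)" "bounded_linear (\<lambda>h::se3_pair. snd g ** snd h)"
    "bounded_linear (\<lambda>h::se3_pair. snd h *v fst g)" "bounded_linear (\<lambda>h::se3_pair. snd h ** snd g)"
    by (auto simp: linear_conv_bounded_linear[symmetric] vec_eq_iff matrix_vector_mult_def matrix_matrix_mult_def
          sum_3 forall_3 algebra_simps intro!: linearI)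
  have "((\<lambda>h. (fst g + snd g *v fst h, snd g ** snd h)) has_derivative (\<lambda>h. (0 + snd g *v fst h, snd g ** snd h))) (at x)"
    by (intro has_derivative_Pair has_derivative_add has_derivative_const bounded_linear.has_derivative[OF l(1) has_derivative_ident]
        bounded_linear.has_derivative[OF l(2) has_derivative_ident])
  then show "(se3_mult g has_derivative (\<lambda>h. (snd g *v fst h, snd g ** snd h))) (at x)"
    by (simp add: se3_mult_pair[abs_def])
  have "((\<lambda>h. (fst h + snd h *v fst g, snd h ** snd g)) has_derivative (\<lambda>h. (fst h + snd h *v fst g, snd h ** snd g))) (at x)"
    by (intro has_derivative_Pair has_derivative_add has_derivative_fst has_derivative_ident bounded_linear.has_derivative[OF l(3) has_derivative_ident]
        bounded_linear.has_derivative[OF l(4) has_derivative_ident])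
  then show "((\<lambda>x. se3_mult x g) has_derivative (\<lambda>h. (fst h + snd h *v fst g, snd h ** snd g))) (at x)"
    by (simp add: se3_mult_pair[abs_def])
qed

lemma smooth_on_se3_mult: "smooth_on UNIV (se3_mult g)"
  unfolding se3_mult_pair[abs_def] by (intro smooth_intros open_UNIV)

lemma maurer_cartan_eq: "maurer_cartan = pullback SE3_atlas euclid id mc_form"
proof (intro ext)
  fix g vs
  show "maurer_cartan g vs = pullback SE3_atlas euclid id mc_form g vs"
  proof (cases "g \<in> carrier SE3 \<and> length vs = 1 \<and> set vs \<subseteq> tangent SE3_atlas g")
    case True
    then have "length vs = 1" by blast
    then obtain v where v: "vs = [v]" by (rule length_1E)
    have "pullback SE3_atlas euclid id mc_form g vs = (transpose (snd g) *v fst (differential SE3_atlas id g v),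
        vee (transpose (snd g) ** snd (differential SE3_atlas id g v)))"
      using True unfolding mc_form_def
      by (subst pullback_euclid_form[OF smooth_map_SE3_inclusion smooth_atlas_SE3]) (simp_all add: points_SE3 v)
    \<comment> \<open>On the group the inverse has the transpose as rotation part, so
      differentiating the left translation gives the coefficients of \<open>mc_form\<close>.\<close>
    moreover have "frechet_derivative (se3_mult (inv\<^bsub>SE3\<^esub> g)) (at g) = (\<lambda>h. (transpose (snd g) *v fst h, transpose (snd g) ** snd h))"
      using frechet_derivative_at[OF has_derivative_se3_mult(1)[of "inv\<^bsub>SE3\<^esub> g" g]] inv_SE3[of g] True by simp
    ultimately show ?thesis
      using True by (simp add: maurer_cartan_def v se3_of_mat_vee differential_def)
  next
    case False
    then have "maurer_cartan g vs = 0" unfolding maurer_cartan_def by auto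
    moreover have "pullback SE3_atlas euclid id mc_form g vs = 0"
      using False forms_outside[OF pullback_forms[OF smooth_map_SE3_inclusion smooth_atlas_SE3 smooth_atlas_euclid mc_form_forms], of g vs]
      unfolding points_SE3 by blast
    ultimately show ?thesis by simp
  qed
qed

lemma maurer_cartan_forms: "maurer_cartan \<in> forms 1 SE3_atlas"
  unfolding maurer_cartan_eq
  by (rule pullback_forms[OF smooth_map_SE3_inclusion smooth_atlas_SE3 smooth_atlas_euclid mc_form_forms])

lemma pullback_maurer_cartan:
  assumes g: "g \<in> carrier SE3"
  shows "pullback SE3_atlas SE3_atlas (se3_mult g) maurer_cartan = maurer_cartan"
proof -
  have L: "smooth_map SE3_atlas SE3_atlas (se3_mult g)" using smooth_map_SE3_mult(1)[OF g] .
  have LU: "smooth_map euclid euclid (se3_mult g)" by (rule smooth_map_open_open) (use smooth_on_se3_mult in auto)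
  have R: "transpose (snd g) ** snd g = mat 1"
    using g rotation_matrix_mult_transpose(2) by (simp add: carrier_SE3_iff)
  have "pullback SE3_atlas SE3_atlas (se3_mult g) maurer_cartan = pullback SE3_atlas euclid (id \<circ> se3_mult g) mc_form"
    unfolding maurer_cartan_eq
    by (rule pullback_compose[OF L smooth_map_SE3_inclusion smooth_atlas_SE3 smooth_atlas_SE3 smooth_atlas_euclid])
  also have "id \<circ> se3_mult g = se3_mult g \<circ> id" by simp
  also have "pullback SE3_atlas euclid (se3_mult g \<circ> id) mc_form = pullback SE3_atlas euclid id (pullback euclid euclid (se3_mult g) mc_form)"
    by (rule pullback_compose[OF smooth_map_SE3_inclusion LU smooth_atlas_SE3 smooth_atlas_euclid smooth_atlas_euclid, symmetric])
  \<comment> \<open>Invariance is verified in the ambient space, where it rests on orthogonality of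
    the rotation part of \<open>g\<close> alone.\<close>
  also have "pullback euclid euclid (se3_mult g) mc_form = mc_form"
    unfolding mc_form_def
  proof (rule pullback_euclid_euclid[OF has_derivative_se3_mult(1) smooth_on_se3_mult])
    fix h :: se3_pair and ws :: "se3_pair list" assume "length ws = 1"
    then obtain w where w: "ws = [w]" by (elim length_1E)
    have "transpose (snd g ** snd h) *v (snd g *v x) = transpose (snd h) *v x" for x
      using R by (simp add: matrix_vector_mul_assoc matrix_transpose_mul matrix_mul_assoc[symmetric])
    moreover have "transpose (snd g ** snd h) ** (snd g ** X) = transpose (snd h) ** X" for X :: "real^3^3"
    proof -
      have "transpose (snd g ** snd h) ** (snd g ** X) = transpose (snd h) ** ((transpose (snd g) ** snd g) ** X)"
        by (simp only: matrix_transpose_mul matrix_mul_assoc)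
      then show ?thesis by (simp add: R)
    qed
    ultimately show "(transpose (snd (se3_mult g h)) *v fst (hd (map (\<lambda>h. (snd g *v fst h, snd g ** snd h)) ws)),
          vee (transpose (snd (se3_mult g h)) ** snd (hd (map (\<lambda>h. (snd g *v fst h, snd g ** snd h)) ws)))) =
         (transpose (snd h) *v fst (hd ws), vee (transpose (snd h) ** snd (hd ws)))"
      by (simp add: w se3_mult_pair)
  qed
  also have "pullback SE3_atlas euclid id mc_form = maurer_cartan" by (rule maurer_cartan_eq[symmetric])
  finally show ?thesis .
qed

text \<open>At a point \<open>(s, (v, A))\<close>, where \<open>s\<close> is the value of the section and \<open>(v, A)\<close> the group element, the
  extension of \<open>e_hat\<close> from \<open>v = s\<close> to all of \<open>P\<close> is forced by equivariance; it equals
  \<open>Ad (g\<^sup>-\<^sup>1) (s \<times> ds, ds)\<close>.\<close>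

definition kappa :: "(real^3) \<times> se3_pair \<Rightarrow> (real^3) \<times> se3_pair \<Rightarrow> se3" where
  "kappa n w = (transpose (snd (snd n)) *v cross3 (fst n - fst (snd n)) (fst w), transpose (snd (snd n)) *v fst w)"

definition kappa_form :: "((real^3) \<times> se3_pair, (real^3) \<times> se3_pair, se3) form" where
  "kappa_form = euclid_form 1 (\<lambda>n ws. kappa n (hd ws))"

lemma kappa_form_forms: "kappa_form \<in> forms 1 euclid"
  unfolding kappa_form_def
proof (rule euclid_form_forms)
  fix ws :: "((real^3) \<times> se3_pair) list"
  show "smooth_on UNIV (\<lambda>n. kappa n (hd ws))"
    unfolding kappa_def
    by (intro smooth_on_Pair smooth_on_matrix smooth_on_fst smooth_on_snd smooth_on_diff smooth_on_ident smooth_on_const open_UNIV smooth_on_transpose)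
next
  fix n :: "(real^3) \<times> se3_pair"
  show "alt_multilinear 1 (\<lambda>ws. kappa n (hd ws))"
    by (rule alt_multilinear_1[of "kappa n"])
       (auto intro!: linearI simp: kappa_def matrix_vector_right_distrib cross_add_right cross_mult_right matrix_vector_mult_scaleR)
qed

text \<open>The translation of \<open>g\<close> cancels in s - v, and its rotation is undone by the
  transpose because rotations respect the cross product.\<close>

lemma pullback_kappa_form:
  assumes g: "g \<in> carrier SE3"
  shows "pullback euclid euclid (\<lambda>n. (se3_move g (fst n), se3_mult g (snd n))) kappa_form = kappa_form"
  unfolding kappa_form_def
proof (rule pullback_euclid_euclid)
  have A: "rotation_matrix (snd g)" using g by (simp add: carrier_SE3_iff)
  fix n :: "(real^3) \<times> se3_pair"
  show "((\<lambda>n. (se3_move g (fst n), se3_mult g (snd n))) has_derivative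
      (\<lambda>w. (snd g *v fst w, (snd g *v fst (snd w), snd g ** snd (snd w))))) (at n)"
    using has_derivative_Pair[OF has_derivative_compose[OF has_derivative_fst[OF has_derivative_ident] has_derivative_se3_move[of g]]
        has_derivative_compose[OF has_derivative_snd[OF has_derivative_ident] has_derivative_se3_mult(1)[of g]], of n UNIV] by simp
  fix ws :: "((real^3) \<times> se3_pair) list" assume "length ws = 1"
  then obtain w where w: "ws = [w]" by (elim length_1E)
  have R: "transpose (snd g ** B) *v (snd g *v x) = transpose B *v x" for B x
    using rotation_cancel(2)[OF A, of x] by (simp add: matrix_transpose_mul matrix_vector_mul_assoc[symmetric])
  show "kappa (se3_move g (fst n), se3_mult g (snd n)) (hd (map (\<lambda>w. (snd g *v fst w, (snd g *v fst (snd w), snd g ** snd (snd w)))) ws))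
      = kappa n (hd ws)"
    by (simp add: w kappa_def se3_move_pair se3_mult_pair R matrix_vector_mult_diff_distrib[symmetric] cross_rotation_matrix[OF A])
next
  show "smooth_on UNIV (\<lambda>n. (se3_move g (fst n), se3_mult g (snd n)))"
    unfolding se3_move_pair se3_mult_pair by (intro smooth_intros open_UNIV)
qed

text \<open>\<open>kappa\<close> depends on the tangent vector only through ds, which right
  translation does not change; hence \<open>w'\<close> is tied to \<open>w\<close> in the first
  component alone.\<close>

lemma kappa_right_translate:
  assumes A: "rotation_matrix (snd (snd n))" and h: "h \<in> carrier SE3" and ww: "fst w' = fst w"
  shows "kappa (fst n, se3_mult (snd n) h) w' = se3_Ad (inv\<^bsub>SE3\<^esub> h) (kappa n w)"
proof -
  obtain s v B where n: "n = (s, (v, B))" by (cases n) auto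
  obtain t R where hh: "h = (t, R)" by (cases h)
  have rot: "rotation_matrix B" "rotation_matrix R" using A h by (simp_all add: n hh SE3_simps)
  let ?d = "fst w"
  have inv: "inv\<^bsub>SE3\<^esub> h = (- (transpose R *v t), transpose R)" "inv\<^bsub>SE3\<^esub> h \<in> carrier SE3"
    using inv_SE3[OF h] rotation_matrix_transpose[OF rot(2)] by (simp_all add: hh SE3_simps)
  have Ad: "se3_Ad (inv\<^bsub>SE3\<^esub> h) (x, z)
      = (transpose R *v x + cross3 (- (transpose R *v t)) (transpose R *v z), transpose R *v z)" for x z
    by (subst se3_Ad_eq[OF inv(2)]) (simp add: inv(1))
  have h': "fst h = t" "snd h = R" by (simp_all add: hh)
  have "transpose (B ** R) *v x = transpose R *v (transpose B *v x)" for x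
    by (simp add: matrix_transpose_mul matrix_vector_mul_assoc)
  \<comment> \<open>Right translation replaces v by v + B t. The extra term is the cross product
    with -t that the translation part of the inverse of \<open>h\<close> contributes to Ad.\<close>
  moreover have "transpose B *v cross3 (s - (v + B *v t)) ?d = transpose B *v cross3 (s - v) ?d - cross3 t (transpose B *v ?d)"
  proof -
    have "cross3 (s - (v + B *v t)) ?d = cross3 (s - v) ?d - cross3 (B *v t) ?d"
      by (simp add: diff_diff_eq[symmetric] Cross3.left_diff_distrib)
    moreover have "transpose B *v cross3 (B *v t) ?d = cross3 t (transpose B *v ?d)"
      using cross_transpose_rotation[OF rot(1), of "B *v t" ?d] by (simp add: rotation_cancel[OF rot(1)])
    ultimately show ?thesis by (simp add: matrix_vector_mult_diff_distrib)
  qed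
  ultimately show ?thesis
    using ww
    by (simp add: n h' kappa_def se3_mult_pair Ad cross_transpose_rotation[OF rot(2)]
        matrix_vector_mult_diff_distrib)
qed

section \<open>The Chern--Simons integrand in local coordinates\<close>

lemma transpose_matrix_cross3: "transpose (matrix (cross3 y)) = matrix (cross3 (- y))"
  by (simp add: vec_eq_iff forall_3 transpose_def matrix_cross3_nth)

lemma skew_matrix_cross3:
  assumes "S + transpose S = (0 :: real^3^3)" shows "S = matrix (cross3 (vee S))"
proof -
  have "S $ i $ j + S $ j $ i = 0" for i j
    using assms by (simp add: vec_eq_iff transpose_def)
  from this[of 1 1] this[of 2 2] this[of 3 3] this[of 1 2] this[of 1 3] this[of 2 3]
  show ?thesis by (simp add: vec_eq_iff forall_3 matrix_cross3_nth vee_nth)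
qed

text \<open>The hat map is a Lie algebra homomorphism; this identifies the commutator in the
  Maurer-Cartan equation with the rotational part of \<open>se3_bracket\<close>.\<close>

lemma vee_cross3_commutator:
  "vee (matrix (cross3 x) ** matrix (cross3 y) - matrix (cross3 y) ** matrix (cross3 x)) = cross3 x y"
  by (simp add: vec_eq_iff forall_3 vee_nth matrix_matrix_mult_def sum_3 matrix_cross3_nth cross3_def)

context
  fixes s v :: "'e::euclidean_space \<Rightarrow> real^3" and A :: "'e \<Rightarrow> real^3^3"
begin

abbreviation "Ds \<equiv> \<lambda>z w. frechet_derivative s (at z) w"
abbreviation "Dv \<equiv> \<lambda>z w. frechet_derivative v (at z) w"
abbreviation "DA \<equiv> \<lambda>z w. frechet_derivative A (at z) w"

text \<open>\<open>om\<close> and \<open>ka\<close> are the coefficients of the pullbacks of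
  \<open>mc_form\<close> and \<open>kappa_form\<close> in coordinates, for arbitrary functions
  \<open>s\<close>, \<open>v\<close>, \<open>A\<close>, so that the identities below are plain
  vector calculus.\<close>

definition om :: "'e \<Rightarrow> 'e \<Rightarrow> se3" where
  "om z w = (transpose (A z) *v Dv z w, vee (transpose (A z) ** DA z w))"

definition ka :: "'e \<Rightarrow> 'e \<Rightarrow> se3" where
  "ka z w = (transpose (A z) *v cross3 (s z - v z) (Ds z w), transpose (A z) *v Ds z w)"

context
  fixes S :: "'e set" and y :: 'e
  assumes S: "open S" "y \<in> S" and s: "smooth_on S s" and v: "smooth_on S v" and A: "smooth_on S A"
    and rot: "\<And>z. z \<in> S \<Longrightarrow> rotation_matrix (A z)"
begin

text \<open>Differentiating A^T A = 1 shows that A^T dA is skew, hence the hat matrix of the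
  rotational part of \<open>om\<close>.\<close>

lemma DA_eq: "DA y w = A y ** matrix (cross3 (snd (om y w)))"
proof -
  have hA: "(A has_derivative DA y) (at y)" by (rule smooth_on_has_derivative[OF A S(2)])
  have h: "((\<lambda>z. transpose (A z) ** A z) has_derivative (\<lambda>w. transpose (A y) ** DA y w + transpose (DA y w) ** A y)) (at y)"
    by (rule bounded_bilinear.FDERIV[OF linear_matrix_bilinear(4) hA hA])
  have "frechet_derivative (\<lambda>z. transpose (A z) ** A z) (at y) = frechet_derivative (\<lambda>z. mat 1 :: real^3^3) (at y)"
    by (rule frechet_derivative_cong_open[OF S]) (simp add: rotation_matrix_mult_transpose[OF rot])
  then have "transpose (A y) ** DA y w + transpose (DA y w) ** A y = 0"
    using frechet_derivative_at[OF h] by (simp add: fun_eq_iff)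
  then have "transpose (A y) ** DA y w + transpose (transpose (A y) ** DA y w) = 0"
    by (simp add: matrix_transpose_mul)
  from skew_matrix_cross3[OF this]
  have "transpose (A y) ** DA y w = matrix (cross3 (snd (om y w)))" by (simp add: om_def)
  then have "A y ** (transpose (A y) ** DA y w) = A y ** matrix (cross3 (snd (om y w)))" by simp
  then show ?thesis by (simp add: matrix_mul_assoc rotation_matrix_mult_transpose[OF rot[OF S(2)]])
qed

lemma transpose_DA_mult: "transpose (DA y w) *v x = - cross3 (snd (om y w)) (transpose (A y) *v x)"
  by (simp add: DA_eq matrix_transpose_mul transpose_matrix_cross3 matrix_vector_mul_assoc[symmetric] matrix_cross3_mult)

lemma transpose_DA_DA: "transpose (DA y w1) ** DA y w2
    = - (matrix (cross3 (snd (om y w1))) ** matrix (cross3 (snd (om y w2))))"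
proof -
  have "transpose (DA y w1) ** DA y w2 = transpose (matrix (cross3 (snd (om y w1)))) ** (transpose (A y) ** A y) ** matrix (cross3 (snd (om y w2)))"
    unfolding DA_eq by (simp add: matrix_transpose_mul matrix_mul_assoc)
  also have "\<dots> = transpose (matrix (cross3 (snd (om y w1)))) ** matrix (cross3 (snd (om y w2)))"
    by (simp add: rotation_matrix_mult_transpose[OF rot[OF S(2)]])
  finally show ?thesis
    by (simp add: vec_eq_iff forall_3 transpose_def matrix_matrix_mult_def sum_3 matrix_cross3_nth)
qed

lemma om_derivative:
  "frechet_derivative (\<lambda>z. om z w2) (at y) w1 =
    (transpose (A y) *v frechet_derivative (\<lambda>z. Dv z w2) (at y) w1 + transpose (DA y w1) *v Dv y w2,
     vee (transpose (A y) ** frechet_derivative (\<lambda>z. DA z w2) (at y) w1 + transpose (DA y w1) ** DA y w2))"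
proof -
  have hA: "(A has_derivative DA y) (at y)" by (rule smooth_on_has_derivative[OF A S(2)])
  have hv: "((\<lambda>z. Dv z w2) has_derivative frechet_derivative (\<lambda>z. Dv z w2) (at y)) (at y)"
    by (rule smooth_on_has_derivative[OF smooth_on_derivative[OF v] S(2)])
  have hDA: "((\<lambda>z. DA z w2) has_derivative frechet_derivative (\<lambda>z. DA z w2) (at y)) (at y)"
    by (rule smooth_on_has_derivative[OF smooth_on_derivative[OF A] S(2)])
  have D: "((\<lambda>z. om z w2) has_derivative (\<lambda>w1.
    (transpose (A y) *v frechet_derivative (\<lambda>z. Dv z w2) (at y) w1 + transpose (DA y w1) *v Dv y w2,
     vee (transpose (A y) ** frechet_derivative (\<lambda>z. DA z w2) (at y) w1 + transpose (DA y w1) ** DA y w2)))) (at y)"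
    unfolding om_def
    by (intro has_derivative_Pair bounded_linear.has_derivative[OF bounded_linear_vee]
        bounded_bilinear.FDERIV[OF linear_matrix_bilinear(3) hA hv] bounded_bilinear.FDERIV[OF linear_matrix_bilinear(4) hA hDA])
  show ?thesis unfolding frechet_derivative_at[OF D, symmetric] by (rule refl)
qed

text \<open>The Maurer-Cartan equation. Symmetric second derivatives drop out, and the remaining
  products of first derivatives become brackets once dA is written as A times a hat matrix.\<close>

lemma om_flat:
  "frechet_derivative (\<lambda>z. om z w2) (at y) w1 - frechet_derivative (\<lambda>z. om z w1) (at y) w2
     + se3_bracket (om y w1) (om y w2) = 0"
proof -
  have v2: "frechet_derivative (\<lambda>z. Dv z w2) (at y) w1 = frechet_derivative (\<lambda>z. Dv z w1) (at y) w2"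
    by (rule symmetric_second_derivative[OF S v])
  have A2: "frechet_derivative (\<lambda>z. DA z w2) (at y) w1 = frechet_derivative (\<lambda>z. DA z w1) (at y) w2"
    by (rule symmetric_second_derivative[OF S A])
  obtain x1 e1 where o1: "om y w1 = (x1, e1)" by (cases "om y w1")
  obtain x2 e2 where o2: "om y w2 = (x2, e2)" by (cases "om y w2")
  have x: "transpose (A y) *v Dv y w1 = x1" "transpose (A y) *v Dv y w2 = x2" using o1 o2 by (simp_all add: om_def)
  have "frechet_derivative (\<lambda>z. om z w2) (at y) w1 - frechet_derivative (\<lambda>z. om z w1) (at y) w2
      = (transpose (DA y w1) *v Dv y w2 - transpose (DA y w2) *v Dv y w1,
         vee (transpose (DA y w1) ** DA y w2 - transpose (DA y w2) ** DA y w1))"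
    unfolding om_derivative v2 A2 by (simp add: linear_diff[OF linear_vee, symmetric])
  also have "\<dots> = (- cross3 e1 x2 + cross3 e2 x1, - vee (matrix (cross3 e1) ** matrix (cross3 e2) - matrix (cross3 e2) ** matrix (cross3 e1)))"
    unfolding transpose_DA_mult transpose_DA_DA o1 o2 x
    by (simp add: linear_diff[OF linear_vee] linear_neg[OF linear_vee])
  finally show ?thesis
    unfolding vee_cross3_commutator o1 o2
    by (simp add: cross_skew[of x1 e2] zero_prod_def)
qed

lemma ka_derivative:
  "frechet_derivative (\<lambda>z. ka z w2) (at y) w1 =
    (transpose (A y) *v (cross3 (s y - v y) (frechet_derivative (\<lambda>z. Ds z w2) (at y) w1) + cross3 (Ds y w1 - Dv y w1) (Ds y w2))
       + transpose (DA y w1) *v cross3 (s y - v y) (Ds y w2),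
     transpose (A y) *v frechet_derivative (\<lambda>z. Ds z w2) (at y) w1 + transpose (DA y w1) *v Ds y w2)"
proof -
  have hA: "(A has_derivative DA y) (at y)" by (rule smooth_on_has_derivative[OF A S(2)])
  have hs: "((\<lambda>z. Ds z w2) has_derivative frechet_derivative (\<lambda>z. Ds z w2) (at y)) (at y)"
    by (rule smooth_on_has_derivative[OF smooth_on_derivative[OF s] S(2)])
  have hsv: "((\<lambda>z. s z - v z) has_derivative (\<lambda>w. Ds y w - Dv y w)) (at y)"
    by (intro has_derivative_diff smooth_on_has_derivative[OF s S(2)] smooth_on_has_derivative[OF v S(2)])
  have D: "((\<lambda>z. ka z w2) has_derivative (\<lambda>w1.
    (transpose (A y) *v (cross3 (s y - v y) (frechet_derivative (\<lambda>z. Ds z w2) (at y) w1) + cross3 (Ds y w1 - Dv y w1) (Ds y w2))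
       + transpose (DA y w1) *v cross3 (s y - v y) (Ds y w2),
     transpose (A y) *v frechet_derivative (\<lambda>z. Ds z w2) (at y) w1 + transpose (DA y w1) *v Ds y w2))) (at y)"
    unfolding ka_def
    by (intro has_derivative_Pair
        bounded_bilinear.FDERIV[OF linear_matrix_bilinear(3) hA bounded_bilinear.FDERIV[OF linear_matrix_bilinear(5) hsv hs]]
        bounded_bilinear.FDERIV[OF linear_matrix_bilinear(3) hA hs])
  show ?thesis unfolding frechet_derivative_at[OF D, symmetric] by (rule refl)
qed

text \<open>Three cancellations: second derivatives by symmetry, the dA terms against the rotational
  part of the connection, the dv terms against its translational part. What remains is ds x ds
  antisymmetrised, hence the factor 2.\<close>

lemma ka_cov_deriv:
  "frechet_derivative (\<lambda>z. ka z w2) (at y) w1 - frechet_derivative (\<lambda>z. ka z w1) (at y) w2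
     + (se3_bracket (om y w1) (ka y w2) - se3_bracket (om y w2) (ka y w1))
   = (2 *\<^sub>R (transpose (A y) *v cross3 (Ds y w1) (Ds y w2)), 0)"
proof -
  let ?T = "\<lambda>x. transpose (A y) *v x"
  have s2: "frechet_derivative (\<lambda>z. Ds z w2) (at y) w1 = frechet_derivative (\<lambda>z. Ds z w1) (at y) w2"
    by (rule symmetric_second_derivative[OF S s])
  have T: "cross3 (?T a) (?T b) = ?T (cross3 a b)" for a b
    by (rule cross_transpose_rotation[OF rot[OF S(2)]])
  obtain e1 e2 where e: "snd (om y w1) = e1" "snd (om y w2) = e2" by blast
  have om: "om y w1 = (?T (Dv y w1), e1)" "om y w2 = (?T (Dv y w2), e2)"
    using e by (simp_all add: om_def)
  have flip: "cross3 (Ds y w2) (Ds y w1) = - cross3 (Ds y w1) (Ds y w2)" by (rule cross_skew)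
  show ?thesis
    unfolding ka_derivative s2 transpose_DA_mult e
    unfolding om ka_def
    by (simp add: T matrix_vector_right_distrib matrix_vector_mult_diff_distrib Cross3.left_diff_distrib flip
        linear_neg[OF matrix_vector_mul_linear] scaleR_2)
qed

end

end

section \<open>Wedge products and exterior derivatives in low degree\<close>

lemma sum_permutes_2:
  "(\<Sum>p | p permutes {..<2::nat}. of_int (sign p) *\<^sub>R f (p 0) (p 1)) = f 0 1 - (f 1 0 :: 'v::real_vector)"
proof -
  have f: "finite {1::nat}" "0 \<notin> {1::nat}" by auto
  have set: "{..<2::nat} = insert 0 {1}" by auto
  show ?thesis
    unfolding set sum_over_permutations_insert[OF f] permutes_sing
    by (simp add: sign_swap_id sign_id transpose_def)
qed

lemma sum_permutes_3:
  fixes f :: "nat \<Rightarrow> nat \<Rightarrow> nat \<Rightarrow> 'v::real_vector"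
  shows "(\<Sum>p | p permutes {..<3::nat}. of_int (sign p) *\<^sub>R f (p 0) (p 1) (p 2))
    = f 0 1 2 - f 0 2 1 - f 1 0 2 + f 1 2 0 + f 2 0 1 - f 2 1 0"
proof -
  have f12: "finite {2::nat}" "1 \<notin> {2::nat}" and f012: "finite {1, 2::nat}" "0 \<notin> {1, 2::nat}" by auto
  have set: "{..<3::nat} = insert 0 (insert 1 {2})" by auto
  show ?thesis
    unfolding set sum_over_permutations_insert[OF f012] sum_over_permutations_insert[OF f12] permutes_sing
    by (simp add: sign_swap_id sign_compose permutation_swap_id sign_id transpose_def permutation_compose algebra_simps)
qed

lemma wedge_1_1:
  assumes "length vs = 2"
  shows "wedge B 1 1 \<alpha> \<beta> x vs = B (\<alpha> x [vs ! 0]) (\<beta> x [vs ! 1]) - B (\<alpha> x [vs ! 1]) (\<beta> x [vs ! 0])"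
proof -
  have upt: "[0..<1] = [0::nat]" "[1..<2] = [1::nat]" by (simp_all add: upt_rec)
  have "wedge B 1 1 \<alpha> \<beta> x vs = (1 / (fact 1 * fact 1)) *\<^sub>R (\<Sum>s | s permutes {..<2}. of_int (sign s) *\<^sub>R
      B (\<alpha> x (map (\<lambda>i. vs ! s i) [0..<1])) (\<beta> x (map (\<lambda>i. vs ! s i) [1..<2])))"
    unfolding wedge_def one_add_one assms by (simp only: simp_thms if_True)
  then show ?thesis
    unfolding upt list.map sum_permutes_2[of "\<lambda>i j. B (\<alpha> x [vs ! i]) (\<beta> x [vs ! j])"] by simp
qed

text \<open>The six permutations pair up because \<open>\<beta>\<close> is alternating, and the
  normalisation 1/2 cancels the doubling; three cyclic terms remain.\<close>

lemma wedge_1_2: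
  assumes "length vs = 3" and alt: "\<And>u v. \<beta> x [v, u] = - \<beta> x [u, v]" and B: "\<And>a b. B a (- b) = - (B a b :: real)"
  shows "wedge B 1 2 \<alpha> \<beta> x vs = B (\<alpha> x [vs ! 0]) (\<beta> x [vs ! 1, vs ! 2])
     + B (\<alpha> x [vs ! 1]) (\<beta> x [vs ! 2, vs ! 0]) + B (\<alpha> x [vs ! 2]) (\<beta> x [vs ! 0, vs ! 1])"
proof -
  have upt: "[0..<1] = [0::nat]" "[1..<3] = [1, 2::nat]" and three: "1 + 2 = (3::nat)" by (simp_all add: upt_rec)
  let ?f = "\<lambda>i j k. B (\<alpha> x [vs ! i]) (\<beta> x [vs ! j, vs ! k])"
  have f: "?f i k j = - ?f i j k" for i j k using alt[of "vs ! k" "vs ! j"] B by simp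
  have "wedge B 1 2 \<alpha> \<beta> x vs = (1 / (fact 1 * fact 2)) *\<^sub>R (\<Sum>s | s permutes {..<3}. of_int (sign s) *\<^sub>R
      B (\<alpha> x (map (\<lambda>i. vs ! s i) [0..<1])) (\<beta> x (map (\<lambda>i. vs ! s i) [1..<3])))"
    unfolding wedge_def three assms(1) by (simp only: simp_thms if_True)
  then have "wedge B 1 2 \<alpha> \<beta> x vs = (1/2) * (\<Sum>p | p permutes {..<3::nat}. of_int (sign p) *\<^sub>R ?f (p 0) (p 1) (p 2))"
    unfolding upt list.map by (simp only: fact_1 fact_2 mult_1 real_scaleR_def)
  then show ?thesis
    unfolding sum_permutes_3[of ?f] using f[of 0 2 1] f[of 1 0 2] f[of 2 1 0] f[of 0 1 2] f[of 1 2 0] f[of 2 0 1] by simp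
qed

lemma ext_deriv_1:
  assumes "x \<in> points A" "set [v, w] \<subseteq> tangent A x"
  defines "c \<equiv> chart_at A x"
  shows "ext_deriv A 1 \<alpha> x [v, w] = frechet_derivative (\<lambda>y. local_rep A \<alpha> c y [w c]) (at (snd c x)) (v c)
     - frechet_derivative (\<lambda>y. local_rep A \<alpha> c y [v c]) (at (snd c x)) (w c)"
proof -
  have set: "{..1::nat} = {0, 1}" by auto
  show ?thesis using assms by (simp add: ext_deriv_def Let_def set)
qed

lemma inv_poly_minus: "inv_poly c1 c2 a (- b) = - inv_poly c1 c2 a b"
  by (cases a, cases b) (simp add: algebra_simps)

text \<open>With \<open>\<tau> = A\<^sup>T (s - v)\<close> and \<open>\<theta> = A\<^sup>T ds\<close> the form \<open>a\<close> takes the values \<open>(\<tau> \<times> \<theta>, \<theta>)\<close>; the terms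
  containing \<open>\<tau>\<close> cancel because the triple product is invariant under infinitesimal rotations.\<close>

lemma chern_simons_algebra:
  fixes \<tau> a b c :: "real^3"
  defines "k \<equiv> \<lambda>x. (cross3 \<tau> x, x)" and "d \<equiv> a \<bullet> cross3 b c"
  shows "inv_poly c1 c2 (k a) (2 *\<^sub>R cross3 b c, 0) + inv_poly c1 c2 (k b) (2 *\<^sub>R cross3 c a, 0)
     + inv_poly c1 c2 (k c) (2 *\<^sub>R cross3 a b, 0) = 6 * c2 * d" (is ?A)
    "inv_poly c1 c2 (k a) (2 *\<^sub>R se3_bracket (k b) (k c)) + inv_poly c1 c2 (k b) (2 *\<^sub>R se3_bracket (k c) (k a))
     + inv_poly c1 c2 (k c) (2 *\<^sub>R se3_bracket (k a) (k b)) = 6 * c1 * d" (is ?B)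
proof -
  have cyc: "b \<bullet> cross3 c a = d" "c \<bullet> cross3 a b = d"
    by (simp_all add: d_def cross3_simps)
  show ?A by (simp add: k_def cyc d_def[symmetric])
  have z: "cross3 \<tau> x \<bullet> cross3 y w + x \<bullet> (cross3 y (cross3 \<tau> w) + cross3 (cross3 \<tau> y) w) = 0" for x y w :: "real^3"
    by (simp add: cross3_simps)
  have z': "(cross3 \<tau> x) \<bullet> (2 *\<^sub>R cross3 y w) + x \<bullet> (2 *\<^sub>R (cross3 y (cross3 \<tau> w) + cross3 (cross3 \<tau> y) w)) = 0" for x y w :: "real^3"
    using z[of x y w] by simp
  show ?B
    unfolding k_def se3_bracket.simps scaleR_Pair inv_poly.simps z' by (simp add: cyc d_def[symmetric])
qed

section \<open>The flat bundle, its section and the form \<open>e_hat\<close>\<close>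

locale flat_bundle = deck_setting Mt M p y0 act
  for Mt :: "('b, real^3) atlas" and M :: "('a, real^3) atlas" and p :: "'b \<Rightarrow> 'a"
    and y0 :: 'b and act :: "(real \<Rightarrow> 'a) set \<Rightarrow> 'b \<Rightarrow> 'b" +
  fixes \<rho> :: "(real \<Rightarrow> 'a) set \<Rightarrow> se3_pair" and \<sigma> :: "'a \<Rightarrow> ('b \<times> (real^3)) set"
  assumes rho: "\<rho> \<in> hom \<Gamma> SE3"
    and sect: "is_section M (PK_atlas Mt \<Gamma> act \<rho>) (bundle_proj p) \<sigma>"
begin

section \<open>The bundle and its quotient by K as quotients of products\<close>

abbreviation "X \<equiv> prod_atlas Mt SE3_atlas"
abbreviation "XK \<equiv> prod_atlas Mt E3_atlas"
abbreviation "q \<equiv> P_quot \<Gamma> act \<rho>"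
abbreviation "qK \<equiv> PK_quot \<Gamma> act \<rho>"
abbreviation "P \<equiv> quotient_atlas X q"
abbreviation "PK \<equiv> quotient_atlas XK qK"
abbreviation "\<pi> \<equiv> bundle_proj p :: ('b \<times> se3_pair) set \<Rightarrow> 'a"

lemma rho_SE3: "\<gamma> \<in> carrier \<Gamma> \<Longrightarrow> \<rho> \<gamma> \<in> carrier SE3"
  using rho by (auto simp: hom_def)

lemma rho_mult: "\<gamma> \<in> carrier \<Gamma> \<Longrightarrow> \<delta> \<in> carrier \<Gamma> \<Longrightarrow> \<rho> (\<gamma> \<otimes>\<^bsub>\<Gamma>\<^esub> \<delta>) = se3_mult (\<rho> \<gamma>) (\<rho> \<delta>)"
  using hom_mult[OF rho] by (simp add: SE3_simps)

text \<open>An idempotent of a group is its neutral element.\<close>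

lemma rho_unit:
  assumes "\<epsilon> \<in> carrier \<Gamma>" "\<epsilon> \<otimes>\<^bsub>\<Gamma>\<^esub> \<epsilon> = \<epsilon>" shows "\<rho> \<epsilon> = (0, mat 1)"
proof -
  interpret SE3: group SE3 by (rule group_SE3)
  have "\<rho> \<epsilon> \<otimes>\<^bsub>SE3\<^esub> \<rho> \<epsilon> = \<rho> \<epsilon>" using hom_mult[OF rho assms(1,1)] assms(2) by simp
  then have "\<rho> \<epsilon> = \<one>\<^bsub>SE3\<^esub>" using SE3.r_cancel_one rho_SE3[OF assms(1)] by blast
  then show ?thesis by (simp add: SE3_simps)
qed

lemma points_X: "points X = points Mt \<times> carrier SE3" "points XK = points Mt \<times> UNIV"
  by (simp_all add: points_prod points_SE3)

abbreviation "deckP \<equiv> (\<lambda>\<gamma> z. (act \<gamma> (fst z), \<rho> \<gamma> \<otimes>\<^bsub>SE3\<^esub> snd z)) ` carrier \<Gamma>"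
abbreviation "deckK \<equiv> (\<lambda>\<gamma> z. (act \<gamma> (fst z), se3_move (\<rho> \<gamma>) (snd z))) ` carrier \<Gamma>"

lemma quotient_P:
  "quotient_setting X q deckP"
  "z \<in> points X \<Longrightarrow> z' \<in> points X \<Longrightarrow> q z = q z' \<longleftrightarrow>
     (\<exists>\<gamma>\<in>carrier \<Gamma>. z' = (act \<gamma> (fst z), \<rho> \<gamma> \<otimes>\<^bsub>SE3\<^esub> snd z))"
proof -
  have a: "smooth_map SE3_atlas SE3_atlas (\<lambda>g. \<rho> \<gamma> \<otimes>\<^bsub>SE3\<^esub> g)" if "\<gamma> \<in> carrier \<Gamma>" for \<gamma>
    using smooth_map_SE3_mult(1)[OF rho_SE3[OF that]] by (simp add: SE3_simps)
  have b: "\<rho> \<epsilon> \<otimes>\<^bsub>SE3\<^esub> g = g" if "\<epsilon> \<in> carrier \<Gamma>" "\<epsilon> \<otimes>\<^bsub>\<Gamma>\<^esub> \<epsilon> = \<epsilon>" for \<epsilon> g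
    unfolding rho_unit[OF that] by (simp add: SE3_simps se3_mult_pair)
  have c: "\<rho> (\<gamma> \<otimes>\<^bsub>\<Gamma>\<^esub> \<delta>) \<otimes>\<^bsub>SE3\<^esub> g = \<rho> \<gamma> \<otimes>\<^bsub>SE3\<^esub> (\<rho> \<delta> \<otimes>\<^bsub>SE3\<^esub> g)" if "\<gamma> \<in> carrier \<Gamma>" "\<delta> \<in> carrier \<Gamma>" for \<gamma> \<delta> g
    by (simp add: rho_mult[OF that] SE3_simps se3_mult_pair matrix_vector_mul_assoc matrix_mul_assoc
        matrix_vector_right_distrib add.assoc)
  show "quotient_setting X q deckP"
    unfolding P_quot_def by (rule quotient_setting_associated(1)[OF smooth_atlas_SE3]) (use a b c in blast)+
  show "z \<in> points X \<Longrightarrow> z' \<in> points X \<Longrightarrow> q z = q z' \<longleftrightarrow>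
     (\<exists>\<gamma>\<in>carrier \<Gamma>. z' = (act \<gamma> (fst z), \<rho> \<gamma> \<otimes>\<^bsub>SE3\<^esub> snd z))"
    unfolding P_quot_def by (rule quotient_setting_associated(2)[OF smooth_atlas_SE3]) (use a b c in blast)+
qed

lemma quotient_K:
  "quotient_setting XK qK deckK"
  "z \<in> points XK \<Longrightarrow> z' \<in> points XK \<Longrightarrow> qK z = qK z' \<longleftrightarrow>
     (\<exists>\<gamma>\<in>carrier \<Gamma>. z' = (act \<gamma> (fst z), se3_move (\<rho> \<gamma>) (snd z)))"
proof -
  have b: "se3_move (\<rho> \<epsilon>) f = f" if "\<epsilon> \<in> carrier \<Gamma>" "\<epsilon> \<otimes>\<^bsub>\<Gamma>\<^esub> \<epsilon> = \<epsilon>" for \<epsilon> f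
    unfolding rho_unit[OF that] by simp
  have c: "se3_move (\<rho> (\<gamma> \<otimes>\<^bsub>\<Gamma>\<^esub> \<delta>)) f = se3_move (\<rho> \<gamma>) (se3_move (\<rho> \<delta>) f)" if "\<gamma> \<in> carrier \<Gamma>" "\<delta> \<in> carrier \<Gamma>" for \<gamma> \<delta> f
    by (simp add: rho_mult[OF that] se3_move_pair se3_mult_pair matrix_vector_mul_assoc matrix_vector_right_distrib)
  show "quotient_setting XK qK deckK"
    unfolding PK_quot_def by (rule quotient_setting_associated(1)[OF smooth_atlas_euclid smooth_map_se3_move b c])
  show "z \<in> points XK \<Longrightarrow> z' \<in> points XK \<Longrightarrow> qK z = qK z' \<longleftrightarrow>
     (\<exists>\<gamma>\<in>carrier \<Gamma>. z' = (act \<gamma> (fst z), se3_move (\<rho> \<gamma>) (snd z)))"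
    unfolding PK_quot_def by (rule quotient_setting_associated(2)[OF smooth_atlas_euclid smooth_map_se3_move b c])
qed

sublocale P: quotient X q deckP by (rule quotient.intro[OF quotient_P(1)])
sublocale K: quotient XK qK deckK by (rule quotient.intro[OF quotient_K(1)])

lemma \<Gamma>_nonempty: "carrier \<Gamma> \<noteq> {}"
proof -
  obtain \<epsilon> where "\<epsilon> \<in> carrier \<Gamma>" "\<forall>y\<in>points Mt. act \<epsilon> y = y" "\<epsilon> \<otimes>\<^bsub>\<Gamma>\<^esub> \<epsilon> = \<epsilon>" by (rule \<Gamma>_unit)
  then show ?thesis by blast
qed

text \<open>Deck transformations preserve \<open>p\<close>, so the image inside
  \<open>the_elem\<close> is a singleton.\<close>

lemma bundle_proj_orbit:
  assumes "fst z \<in> points Mt" shows "bundle_proj p (orbit_map \<Gamma> act lact z) = p (fst z)"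
proof -
  have "p ` fst ` orbit_map \<Gamma> act lact z = (\<lambda>\<gamma>. p (act \<gamma> (fst z))) ` carrier \<Gamma>"
    by (simp add: orbit_map_def image_image)
  also have "\<dots> = (\<lambda>\<gamma>. p (fst z)) ` carrier \<Gamma>"
    by (rule image_cong[OF refl]) (rule act_deck(4)[OF _ assms])
  also have "\<dots> = {p (fst z)}" using \<Gamma>_nonempty by auto
  finally show ?thesis by (simp add: bundle_proj_def)
qed

lemma bundle_proj_q: "z \<in> points X \<Longrightarrow> bundle_proj p (q z) = p (fst z)"
  unfolding P_quot_def by (rule bundle_proj_orbit) (auto simp: points_X)

lemma bundle_proj_qK: "w \<in> points XK \<Longrightarrow> bundle_proj p (qK w) = p (fst w)"
  unfolding PK_quot_def by (rule bundle_proj_orbit) (auto simp: points_X)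

lemma mod_K_q: "mod_K (q z) = qK (fst z, fst (snd z))"
  unfolding mod_K_def P_quot_def PK_quot_def orbit_map_def image_image
  by (rule image_cong[OF refl]) (simp add: SE3_simps se3_mult_pair se3_move_pair)

text \<open>Left and right multiplication commute, so the right action can be computed on one
  representative.\<close>

lemma right_act_q:
  "right_act h (q z) = q (fst z, se3_mult (snd z) h)"
  unfolding right_act_def P_quot_def orbit_map_def image_image
  by (rule image_cong[OF refl])
    (simp add: SE3_simps se3_mult_pair matrix_vector_mul_assoc matrix_mul_assoc matrix_vector_right_distrib add.assoc)

lemma smooth_proj: "smooth_map P M \<pi>"
proof (rule P.smooth_map_from_Q[OF _ M])
  show "smooth_map X M (\<pi> \<circ> q)"
    by (rule smooth_map_cong[OF smooth_map_compose[OF smooth_map_fst(1)[OF Mt smooth_atlas_SE3] smooth_p P.X Mt M] P.X M])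
       (simp add: bundle_proj_q)
qed

lemma smooth_right_translate:
  assumes h: "h \<in> carrier SE3" shows "smooth_map X X (\<lambda>z. (fst z, se3_mult (snd z) h))"
proof -
  have "smooth_map X SE3_atlas ((\<lambda>g. se3_mult g h) \<circ> snd)"
    by (rule smooth_map_compose[OF smooth_map_fst(2)[OF Mt smooth_atlas_SE3] smooth_map_SE3_mult(2)[OF h] P.X smooth_atlas_SE3 smooth_atlas_SE3])
  then show ?thesis
    using smooth_map_Pair[OF smooth_map_fst(1)[OF Mt smooth_atlas_SE3] _ P.X Mt smooth_atlas_SE3] by (simp add: o_def)
qed

lemma smooth_right_act:
  assumes h: "h \<in> carrier SE3" shows "smooth_map P P (right_act h)"
proof (rule P.smooth_map_from_Q[OF _ P.smooth_atlas_Q])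
  have "right_act h \<circ> q = q \<circ> (\<lambda>z. (fst z, se3_mult (snd z) h))"
    by (rule ext) (simp add: right_act_q)
  then show "smooth_map X P (right_act h \<circ> q)"
    using smooth_map_compose[OF smooth_right_translate[OF h] P.smooth_map_q P.X P.X P.smooth_atlas_Q] by simp
qed

lemma smooth_sigma: "smooth_map M PK \<sigma>" and proj_sigma: "x \<in> points M \<Longrightarrow> bundle_proj p (\<sigma> x) = x"
  using sect unfolding is_section_def PK_atlas_def by auto

text \<open>Existence: transitivity of the deck action moves any representative into the fibre over
  \<open>y\<close>. Uniqueness: the deck action is free.\<close>

lemma sigma_fibre:
  assumes y: "y \<in> points Mt" shows "\<exists>!f. \<sigma> (p y) = qK (y, f)"
proof -
  have "\<sigma> (p y) \<in> points PK" by (rule smooth_map_image[OF smooth_sigma M K.smooth_atlas_Q p_points[OF y]])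
  then obtain w where w: "w \<in> points XK" "\<sigma> (p y) = qK w" unfolding K.points_Q by blast
  have wM: "fst w \<in> points Mt" using w(1) by (auto simp: points_X)
  have "p (fst w) = p y"
    using proj_sigma[OF p_points[OF y]] bundle_proj_qK[OF w(1)] unfolding w(2) by simp
  then obtain \<gamma> where g: "\<gamma> \<in> carrier \<Gamma>" "act \<gamma> (fst w) = y" using transitive[OF wM y] by metis
  have "qK w = qK (y, se3_move (\<rho> \<gamma>) (snd w))"
    using quotient_K(2)[OF w(1), of "(y, se3_move (\<rho> \<gamma>) (snd w))"] g y by (auto simp: points_X)
  then have ex: "\<sigma> (p y) = qK (y, se3_move (\<rho> \<gamma>) (snd w))" using w(2) by simp
  have "f = f'" if ff: "qK (y, f) = qK (y, f')" for f f'
  proof -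
    have "(y, f) \<in> points XK" "(y, f') \<in> points XK" using y by (auto simp: points_X)
    from iffD1[OF quotient_K(2)[OF this] ff]
    obtain \<delta> where d: "\<delta> \<in> carrier \<Gamma>" "act \<delta> y = y" "f' = se3_move (\<rho> \<delta>) f" by auto
    obtain \<epsilon> where e: "\<epsilon> \<in> carrier \<Gamma>" "\<forall>y\<in>points Mt. act \<epsilon> y = y" "\<epsilon> \<otimes>\<^bsub>\<Gamma>\<^esub> \<epsilon> = \<epsilon>" by (rule \<Gamma>_unit)
    have "\<delta> = \<epsilon>" by (rule act_eqI[OF d(1) e(1) y]) (use d(2) e(2) y in simp)
    then show ?thesis using d(3) rho_unit[OF e(1,3)] by simp
  qed
  then show ?thesis using ex by metis
qed

text \<open>The section lifted to an equivariant map from the universal covering to \<open>E\<^sup>3\<close>.\<close>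

definition s :: "'b \<Rightarrow> real^3" where
  "s y = (THE f. \<sigma> (p y) = qK (y, f))"

lemma sigma_s: "y \<in> points Mt \<Longrightarrow> \<sigma> (p y) = qK (y, s y)"
  unfolding s_def by (rule theI', rule sigma_fibre)

lemma s_unique: "y \<in> points Mt \<Longrightarrow> \<sigma> (p y) = qK (y, f) \<Longrightarrow> f = s y"
  using sigma_fibre[of y] sigma_s[of y] by metis

text \<open>Moving the representative over \<open>y\<close> by \<open>\<gamma>\<close> gives one
  over \<open>act \<gamma> y\<close>, and representatives are unique.\<close>

lemma s_equivariant:
  assumes "\<gamma> \<in> carrier \<Gamma>" "y \<in> points Mt" shows "s (act \<gamma> y) = se3_move (\<rho> \<gamma>) (s y)"
proof -
  have "qK (y, s y) = qK (act \<gamma> y, se3_move (\<rho> \<gamma>) (s y))"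
    using quotient_K(2)[of "(y, s y)" "(act \<gamma> y, se3_move (\<rho> \<gamma>) (s y))"] assms act_deck(5)[OF assms] by (auto simp: points_X)
  then have "\<sigma> (p (act \<gamma> y)) = qK (act \<gamma> y, se3_move (\<rho> \<gamma>) (s y))"
    using sigma_s[OF assms(2)] act_deck(4)[OF assms] by simp
  then show ?thesis using s_unique[OF act_deck(5)[OF assms]] by simp
qed

text \<open>Near \<open>y\<close> the lift is the Euclidean coordinate of
  \<open>\<sigma> \<circ> p\<close> in a quotient chart. The chart is taken over a set
  \<open>V\<close> on which \<open>p\<close> is injective, so the representative found there lies
  over the given point and not over a deck translate.\<close>

lemma smooth_s: "smooth_map Mt euclid s"
proof (rule smooth_map_into_openI[OF Mt open_UNIV])
  fix y assume y: "y \<in> points Mt"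
  obtain V where V: "openin (mtop Mt) V" "y \<in> V" "inj_on p V" by (rule evenly_covered[OF y])
  have x: "(y, s y) \<in> points XK" using y by (simp add: points_X)
  have "openin (mtop XK) {z \<in> points XK. fst z \<in> V}"
    by (rule smooth_map_openin_preimage[OF smooth_map_fst(1)[OF Mt smooth_atlas_euclid] K.X V(1)])
  then obtain W e where e: "e \<in> XK" "W \<subseteq> fst e" "openin (mtop XK) W" "inj_on qK W"
    and W: "(y, s y) \<in> W" "W \<subseteq> {z \<in> points XK. fst z \<in> V}"
    by (rule K.chart_at_point[OF x]) (use x V(2) in simp)
  obtain a b where ab: "a \<in> Mt" "b \<in> E3_atlas" "e = prod_chart a b" using e(1) unfolding prod_atlas_iff by blast
  have b: "b = (UNIV, id)" using ab(2) by (simp add: open_atlas_def)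
  note k = quotient_chart_simps[OF K.X e]
  let ?k = "quotient_chart qK W e"
  have kK: "?k \<in> PK" by (rule quotient_chart_in[OF e])
  have sp: "smooth_map Mt PK (\<sigma> \<circ> p)" by (rule smooth_map_compose[OF smooth_p smooth_sigma Mt M K.smooth_atlas_Q])
  obtain c where c: "c \<in> Mt" "y \<in> fst c" using y unfolding points_iff by blast
  have yk: "(\<sigma> \<circ> p) y \<in> fst ?k" unfolding k(1) using sigma_s[OF y] W(1) by simp
  obtain U where U: "open U" "snd c y \<in> U" "U \<subseteq> snd c ` fst c" "\<forall>u\<in>U. (\<sigma> \<circ> p) (chart_inv c u) \<in> fst ?k"
    "smooth_on U (coord_map c ?k (\<sigma> \<circ> p))" by (rule smooth_map_local[OF sp Mt K.smooth_atlas_Q c(1) kK c(2) yk])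
  let ?U = "U \<inter> snd c ` (fst c \<inter> V)"
  have op: "open ?U" using U(1) open_chart_Int[OF Mt c(1) V(1)] by blast
  have eq: "snd (coord_map c ?k (\<sigma> \<circ> p) u) = s (chart_inv c u)" if u: "u \<in> ?U" for u
  proof -
    let ?z = "chart_inv c u"
    have z: "?z \<in> V" "?z \<in> fst c" using u chart_inv_snd[OF Mt c(1)] by auto
    have zM: "?z \<in> points Mt" using z(2) c(1) unfolding points_iff by blast
    obtain w where w: "w \<in> W" "\<sigma> (p ?z) = qK w" using U(4) u unfolding k(1) by auto
    have wX: "w \<in> points XK" "fst w \<in> V" using w(1) W(2) by auto
    have "p (fst w) = p ?z"
      using proj_sigma[OF p_points[OF zM]] bundle_proj_qK[OF wX(1)] unfolding w(2) by simp
    then have "fst w = ?z" using inj_onD[OF V(3) _ wX(2) z(1)] by blast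
    then have ws: "snd w = s ?z" using s_unique[OF zM, of "snd w"] w(2) by (metis prod.collapse)
    have "coord_map c ?k (\<sigma> \<circ> p) u = snd e w" using k(2)[OF w(1)] w(2) by (simp add: coord_map_apply)
    then show ?thesis using ws by (cases w) (simp add: ab(3) b prod_chart_simps)
  qed
  have "smooth_on ?U (\<lambda>u. snd (coord_map c ?k (\<sigma> \<circ> p) u))"
    by (rule smooth_on_snd[OF op smooth_on_subset[OF U(5)]]) blast
  then have "smooth_on ?U (\<lambda>u. s (chart_inv c u))" by (rule smooth_on_cong[OF op, rotated]) (rule eq)
  then show "\<exists>c\<in>Mt. \<exists>U. y \<in> fst c \<and> open U \<and> snd c y \<in> U \<and> U \<subseteq> snd c ` fst c \<and> smooth_on U (\<lambda>u. s (chart_inv c u))"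
    using c U(2,3) V(2) op by blast
qed simp

text \<open>The forms on \<open>X\<close> that occur depend on a point only through this pair, so
  each is the pullback of an explicit form on a Euclidean space.\<close>

definition Phi :: "'b \<times> se3_pair \<Rightarrow> (real^3) \<times> se3_pair" where
  "Phi z = (s (fst z), snd z)"

lemma smooth_fst: "smooth_map X Mt fst" by (rule smooth_map_fst(1)[OF Mt smooth_atlas_SE3])

lemma smooth_snd: "smooth_map X euclid snd"
  using smooth_map_compose[OF smooth_map_fst(2)[OF Mt smooth_atlas_SE3] smooth_map_SE3_inclusion P.X smooth_atlas_SE3 smooth_atlas_euclid] by simp

lemma smooth_s_fst: "smooth_map X euclid (\<lambda>z. s (fst z))"
  using smooth_map_compose[OF smooth_fst smooth_s P.X Mt smooth_atlas_euclid] by (simp add: o_def)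

lemma smooth_Phi: "smooth_map X euclid Phi"
  using smooth_map_Pair_open[OF smooth_s_fst smooth_snd P.X] by (simp add: Phi_def[abs_def])

lemma differential_Phi:
  assumes "x \<in> points X" "w \<in> tangent X x"
  shows "differential X Phi x w = (differential X (\<lambda>z. s (fst z)) x w, differential X snd x w)"
  using differential_Pair[OF smooth_s_fst smooth_snd P.X assms] by (simp add: Phi_def[abs_def])

section \<open>The flat connection and the volume form as descended forms\<close>

abbreviation "\<omega> \<equiv> omega_rho Mt \<Gamma> act \<rho>"
abbreviation "vol\<^sub>\<rho> \<equiv> vol_rho Mt \<Gamma> act \<rho>"

text \<open>Deck transformations act on the group factor by left translation, under which the
  Maurer-Cartan form is invariant; hence it descends.\<close>

lemma omega: "\<omega> \<in> forms 1 P" "pullback X P q \<omega> = pullback X euclid snd mc_form"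
proof -
  let ?\<alpha> = "pullback X SE3_atlas snd maurer_cartan"
  note sn = smooth_map_fst(2)[OF Mt smooth_atlas_SE3]
  have f: "?\<alpha> \<in> forms 1 X" by (rule pullback_forms[OF sn P.X smooth_atlas_SE3 maurer_cartan_forms])
  have inv: "pullback X X \<tau> ?\<alpha> = ?\<alpha>" if \<tau>: "\<tau> \<in> deckP" for \<tau>
  proof -
    obtain \<gamma> where g: "\<gamma> \<in> carrier \<Gamma>" "\<tau> = (\<lambda>z. (act \<gamma> (fst z), \<rho> \<gamma> \<otimes>\<^bsub>SE3\<^esub> snd z))" using \<tau> by blast
    have st: "smooth_map X X \<tau>" using quotient_P(1) \<tau> unfolding quotient_setting_def by blast
    have "pullback X X \<tau> ?\<alpha> = pullback X SE3_atlas (snd \<circ> \<tau>) maurer_cartan"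
      by (rule pullback_compose[OF st sn P.X P.X smooth_atlas_SE3])
    also have "snd \<circ> \<tau> = se3_mult (\<rho> \<gamma>) \<circ> snd" by (rule ext) (simp add: g(2) SE3_simps)
    also have "pullback X SE3_atlas (se3_mult (\<rho> \<gamma>) \<circ> snd) maurer_cartan
        = pullback X SE3_atlas snd (pullback SE3_atlas SE3_atlas (se3_mult (\<rho> \<gamma>)) maurer_cartan)"
      by (rule pullback_compose[OF sn smooth_map_SE3_mult(1)[OF rho_SE3[OF g(1)]] P.X smooth_atlas_SE3 smooth_atlas_SE3, symmetric])
    also have "\<dots> = ?\<alpha>" by (simp add: pullback_maurer_cartan[OF rho_SE3[OF g(1)]])
    finally show ?thesis .
  qed
  have a: "?\<alpha> = pullback X euclid snd mc_form"
    unfolding maurer_cartan_eq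
    using pullback_compose[OF sn smooth_map_SE3_inclusion P.X smooth_atlas_SE3 smooth_atlas_euclid] by simp
  show "\<omega> \<in> forms 1 P" "pullback X P q \<omega> = pullback X euclid snd mc_form"
    unfolding omega_rho_def P_atlas_def a[symmetric] by (rule P.descend_q[OF f inv], assumption)+
qed

lemma vol_rho: "vol\<^sub>\<rho> \<in> forms 3 PK" "pullback XK PK qK vol\<^sub>\<rho> = pullback XK E3_atlas snd vol_form"
proof -
  let ?\<alpha> = "pullback XK E3_atlas snd vol_form"
  note sn = smooth_map_fst(2)[OF Mt smooth_atlas_euclid]
  have f: "?\<alpha> \<in> forms 3 XK" by (rule pullback_forms[OF sn K.X smooth_atlas_euclid vol_form_forms])
  have inv: "pullback XK XK \<tau> ?\<alpha> = ?\<alpha>" if \<tau>: "\<tau> \<in> deckK" for \<tau>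
  proof -
    obtain \<gamma> where g: "\<gamma> \<in> carrier \<Gamma>" "\<tau> = (\<lambda>z. (act \<gamma> (fst z), se3_move (\<rho> \<gamma>) (snd z)))" using \<tau> by blast
    have st: "smooth_map XK XK \<tau>" using quotient_K(1) \<tau> unfolding quotient_setting_def by blast
    have "pullback XK XK \<tau> ?\<alpha> = pullback XK E3_atlas (snd \<circ> \<tau>) vol_form"
      by (rule pullback_compose[OF st sn K.X K.X smooth_atlas_euclid])
    also have "snd \<circ> \<tau> = se3_move (\<rho> \<gamma>) \<circ> snd" by (rule ext) (simp add: g(2))
    also have "pullback XK E3_atlas (se3_move (\<rho> \<gamma>) \<circ> snd) vol_form
        = pullback XK E3_atlas snd (pullback E3_atlas E3_atlas (se3_move (\<rho> \<gamma>)) vol_form)"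
      by (rule pullback_compose[OF sn smooth_map_se3_move K.X smooth_atlas_euclid smooth_atlas_euclid, symmetric])
    also have "\<dots> = ?\<alpha>" by (simp add: pullback_vol_form[OF rho_SE3[OF g(1)]])
    finally show ?thesis .
  qed
  show "vol\<^sub>\<rho> \<in> forms 3 PK" "pullback XK PK qK vol\<^sub>\<rho> = ?\<alpha>"
    unfolding vol_rho_def PK_atlas_def vol_G_eq by (rule K.descend_q[OF f inv], assumption)+
qed

abbreviation "sigma_vol \<equiv> pullback M PK \<sigma> vol\<^sub>\<rho>"

lemma sigma_vol_forms: "sigma_vol \<in> forms 3 M"
  by (rule pullback_forms[OF smooth_sigma M K.smooth_atlas_Q vol_rho(1)])

text \<open>The composite \<open>\<sigma> \<circ> \<pi> \<circ> q\<close> factors as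
  \<open>qK\<close> after sending (y, g) to (y, s y), which brings the volume form back to Euclidean
  space along \<open>s\<close>.\<close>

lemma pullback_sigma_vol:
  "pullback X P q (pullback P M \<pi> sigma_vol) = pullback X euclid (\<lambda>z. s (fst z)) vol_form"
proof -
  have pq: "smooth_map X M (\<pi> \<circ> q)" by (rule smooth_map_compose[OF P.smooth_map_q smooth_proj P.X P.smooth_atlas_Q M])
  have sec: "smooth_map X XK (\<lambda>z. (fst z, s (fst z)))"
    by (rule smooth_map_Pair[OF smooth_fst smooth_s_fst P.X Mt smooth_atlas_euclid])
  have "pullback X P q (pullback P M \<pi> sigma_vol) = pullback X M (\<pi> \<circ> q) sigma_vol"
    by (rule pullback_compose[OF P.smooth_map_q smooth_proj P.X P.smooth_atlas_Q M])
  also have "\<dots> = pullback X PK (\<sigma> \<circ> (\<pi> \<circ> q)) vol\<^sub>\<rho>"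
    by (rule pullback_compose[OF pq smooth_sigma P.X M K.smooth_atlas_Q])
  also have "\<dots> = pullback X PK (qK \<circ> (\<lambda>z. (fst z, s (fst z)))) vol\<^sub>\<rho>"
  proof (rule pullback_cong[OF P.X])
    fix z assume z: "z \<in> points X"
    then have "fst z \<in> points Mt" by (auto simp: points_X)
    then show "(\<sigma> \<circ> (\<pi> \<circ> q)) z = (qK \<circ> (\<lambda>z. (fst z, s (fst z)))) z"
      using bundle_proj_q[OF z] sigma_s by simp
  qed
  also have "\<dots> = pullback X XK (\<lambda>z. (fst z, s (fst z))) (pullback XK PK qK vol\<^sub>\<rho>)"
    by (rule pullback_compose[OF sec K.smooth_map_q P.X K.X K.smooth_atlas_Q, symmetric])
  also have "\<dots> = pullback X euclid (snd \<circ> (\<lambda>z. (fst z, s (fst z)))) vol_form"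
    unfolding vol_rho(2)
    by (rule pullback_compose[OF sec smooth_map_fst(2)[OF Mt smooth_atlas_euclid] P.X K.X smooth_atlas_euclid])
  finally show ?thesis by (simp add: o_def)
qed

text \<open>The candidate for \<open>e_hat\<close>. Invariance of \<open>kappa_form\<close> under
  simultaneous left motions and equivariance of \<open>s\<close> let the pullback along
  \<open>Phi\<close> descend.\<close>

definition aP :: "(('b \<times> se3_pair) set, (real^3) \<times> (real^3) \<times> (real^3), se3) form" where
  "aP = descend 1 X P q (pullback X euclid Phi kappa_form)"

lemma aP: "aP \<in> forms 1 P" "pullback X P q aP = pullback X euclid Phi kappa_form"
proof -
  let ?\<alpha> = "pullback X euclid Phi kappa_form"
  have f: "?\<alpha> \<in> forms 1 X" by (rule pullback_forms[OF smooth_Phi P.X smooth_atlas_euclid kappa_form_forms])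
  have inv: "pullback X X \<tau> ?\<alpha> = ?\<alpha>" if \<tau>: "\<tau> \<in> deckP" for \<tau>
  proof -
    obtain \<gamma> where g: "\<gamma> \<in> carrier \<Gamma>" "\<tau> = (\<lambda>z. (act \<gamma> (fst z), \<rho> \<gamma> \<otimes>\<^bsub>SE3\<^esub> snd z))" using \<tau> by blast
    have st: "smooth_map X X \<tau>" using quotient_P(1) \<tau> unfolding quotient_setting_def by blast
    let ?T = "\<lambda>n. (se3_move (\<rho> \<gamma>) (fst n), se3_mult (\<rho> \<gamma>) (snd n))"
    have T: "smooth_map euclid euclid ?T"
    proof (rule smooth_map_open_open)
      show "smooth_on UNIV ?T"
        unfolding se3_move_pair se3_mult_pair by (intro smooth_intros open_UNIV)
    qed auto
    have "pullback X X \<tau> ?\<alpha> = pullback X euclid (Phi \<circ> \<tau>) kappa_form"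
      by (rule pullback_compose[OF st smooth_Phi P.X P.X smooth_atlas_euclid])
    also have "\<dots> = pullback X euclid (?T \<circ> Phi) kappa_form"
    proof (rule pullback_cong[OF P.X])
      fix z assume "z \<in> points X"
      then have "fst z \<in> points Mt" by (auto simp: points_X)
      then show "(Phi \<circ> \<tau>) z = (?T \<circ> Phi) z" by (simp add: g Phi_def s_equivariant[OF g(1)] SE3_simps)
    qed
    also have "\<dots> = pullback X euclid Phi (pullback euclid euclid ?T kappa_form)"
      by (rule pullback_compose[OF smooth_Phi T P.X smooth_atlas_euclid smooth_atlas_euclid, symmetric])
    also have "\<dots> = ?\<alpha>" by (simp add: pullback_kappa_form[OF rho_SE3[OF g(1)]])
    finally show ?thesis .
  qed
  show "aP \<in> forms 1 P" "pullback X P q aP = ?\<alpha>"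
    unfolding aP_def by (rule P.descend_q[OF f inv], assumption)+
qed

lemma push_q:
  assumes "x \<in> points X" "w \<in> tangent X x" shows "pushforward X P q x w \<in> tangent P (q x)"
  by (rule pushforward_tangent[OF P.smooth_map_q P.X P.smooth_atlas_Q assms])

lemma aP_apply:
  assumes x: "x \<in> points X" and w: "w \<in> tangent X x"
  shows "aP (q x) [pushforward X P q x w] = kappa (Phi x) (differential X Phi x w)" (is "_ = ?r")
proof -
  have "aP (q x) [pushforward X P q x w] = pullback X P q aP x [w]" using pullback_apply[OF x, of "[w]" P q aP] w by simp
  also have "\<dots> = ?r"
    unfolding aP(2) kappa_form_def by (subst pullback_euclid_form[OF smooth_Phi P.X x]) (use w in simp_all)
  finally show ?thesis .
qed

lemma omega_apply:
  assumes x: "x \<in> points X" and w: "w \<in> tangent X x"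
  shows "\<omega> (q x) [pushforward X P q x w] = (transpose (snd (snd x)) *v fst (differential X snd x w),
     vee (transpose (snd (snd x)) ** snd (differential X snd x w)))" (is "_ = ?r")
proof -
  have "\<omega> (q x) [pushforward X P q x w] = pullback X P q \<omega> x [w]" using pullback_apply[OF x, of "[w]" P q \<omega>] w by simp
  also have "\<dots> = ?r"
    unfolding omega(2) mc_form_def by (subst pullback_euclid_form[OF smooth_snd P.X x]) (use w in simp_all)
  finally show ?thesis .
qed

text \<open>The differential of \<open>q\<close> is onto, so identities on \<open>P\<close> may be
  checked on vectors pushed forward from \<open>X\<close>.\<close>

lemma tangent_P_cases:
  assumes z: "z \<in> points P" and v: "v \<in> tangent P z"
  obtains x w where "x \<in> points X" "w \<in> tangent X x" "z = q x" "v = pushforward X P q x w"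
proof -
  obtain x where x: "x \<in> points X" "z = q x" using z unfolding P.points_Q by blast
  then have "v \<in> pushforward X P q x ` tangent X x" using v P.pushforward_q_bij(2)[OF x(1)] by simp
  then show thesis using that x by blast
qed

lemma differential_zero:
  assumes f: "smooth_map A euclid f" and A: "smooth_atlas A" and x: "x \<in> points A"
  shows "differential A f x (\<lambda>_. 0) = 0"
proof -
  obtain c where c: "c \<in> A" "x \<in> fst c" using x unfolding points_iff by blast
  have t: "(\<lambda>_. 0) \<in> tangent A x"
  proof (rule tangentI)
    fix c d assume cd: "c \<in> A" "d \<in> A" "x \<in> fst c" "x \<in> fst d"
    have "linear (dmap c d id x)" by (rule dmap_linear[OF smooth_map_id[OF A] A A cd(1,2,3)]) (simp add: cd(4))
    then show "0 = dmap c d id x 0" by (simp add: linear_0)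
  qed simp
  show ?thesis
    unfolding differential_coord[OF f A t c]
    using linear_0[OF has_derivative_linear[OF chart_has_derivative[OF f A c]]] .
qed

text \<open>Over \<open>X\<close> the projection to \<open>M\<close> factors as
  \<open>p \<circ> fst\<close>, and the differential of \<open>p\<close> is injective, so a vertical
  vector has no component along \<open>Mt\<close>.\<close>

lemma vertical_s_fst:
  assumes x: "x \<in> points X" and w: "w \<in> tangent X x"
    and vert: "pushforward P M \<pi> (q x) (pushforward X P q x w) = (\<lambda>_. 0)"
  shows "differential X (\<lambda>z. s (fst z)) x w = 0"
proof -
  have xM: "fst x \<in> points Mt" using x by (auto simp: points_X)
  have "pushforward X M (\<pi> \<circ> q) x w = pushforward X M (p \<circ> fst) x w"
    using pushforward_cong[OF P.X x, of "\<pi> \<circ> q" "p \<circ> fst" M] by (simp add: bundle_proj_q)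
  then have "pushforward Mt M p (fst x) (pushforward X Mt fst x w) = (\<lambda>_. 0)"
    using vert pushforward_compose[OF P.smooth_map_q smooth_proj P.X P.smooth_atlas_Q M x w]
      pushforward_compose[OF smooth_fst smooth_p P.X Mt M x w] by simp
  from pushforward_p_eq_0[OF xM pushforward_tangent[OF smooth_fst P.X Mt x w] this]
  have "pushforward X Mt fst x w = (\<lambda>_. 0)" .
  then have "differential X (s \<circ> fst) x w = 0"
    unfolding differential_compose[OF smooth_fst smooth_s P.X Mt x w]
    using differential_zero[OF smooth_s Mt xM] by simp
  then show ?thesis by (simp add: o_def)
qed

lemma se3_Ad_0: "h \<in> carrier SE3 \<Longrightarrow> se3_Ad h 0 = 0"
  using se3_Ad_eq[of h 0 0] by (simp add: zero_prod_def)

lemma inv_SE3_carrier: "h \<in> carrier SE3 \<Longrightarrow> inv\<^bsub>SE3\<^esub> h \<in> carrier SE3"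
  by (rule group.inv_closed[OF group_SE3])

lemma right_translate_points: "h \<in> carrier SE3 \<Longrightarrow> x \<in> points X \<Longrightarrow> (fst x, se3_mult (snd x) h) \<in> points X"
  by (auto simp: points_X carrier_SE3_iff se3_mult_pair rotation_matrix_mult)

text \<open>Horizontality holds because \<open>kappa\<close> sees only ds, which vanishes on
  vertical vectors. Equivariance is \<open>kappa_right_translate\<close> for the lift of the right
  action to \<open>X\<close>.\<close>

lemma aP_adP: "aP \<in> adP_forms P M p"
  unfolding adP_forms_def mem_Collect_eq
proof (intro conjI ballI impI)
  fix z v assume z: "z \<in> points P" and v: "v \<in> tangent P z" and vert: "pushforward P M \<pi> z v = (\<lambda>_. 0)"
  obtain x w where x: "x \<in> points X" "w \<in> tangent X x" "z = q x" "v = pushforward X P q x w"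
    by (rule tangent_P_cases[OF z v])
  have "differential X (\<lambda>z. s (fst z)) x w = 0" by (rule vertical_s_fst[OF x(1,2)]) (use vert x in simp)
  then show "aP z [v] = 0"
    unfolding x(3,4) aP_apply[OF x(1,2)] differential_Phi[OF x(1,2)] by (simp add: kappa_def zero_prod_def)
next
  fix h assume h: "h \<in> carrier SE3"
  let ?R = "\<lambda>z. (fst z, se3_mult (snd z) h) :: 'b \<times> se3_pair"
  note R = smooth_right_translate[OF h]
  show "pullback P P (right_act h) aP = (\<lambda>z vs. se3_Ad (inv\<^bsub>SE3\<^esub> h) (aP z vs))"
  proof (intro ext)
    fix z vs
    show "pullback P P (right_act h) aP z vs = se3_Ad (inv\<^bsub>SE3\<^esub> h) (aP z vs)"
    proof (cases "z \<in> points P \<and> length vs = 1 \<and> set vs \<subseteq> tangent P z")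
      case False
      then show ?thesis
        using forms_outside[OF aP(1) False] se3_Ad_0[OF inv_SE3_carrier[OF h]]
          forms_outside[OF pullback_forms[OF smooth_right_act[OF h] P.smooth_atlas_Q P.smooth_atlas_Q aP(1)] False] by simp
    next
      case True
      then have "length vs = 1" by blast
      then obtain v where v: "vs = [v]" by (rule length_1E)
      then have zv: "z \<in> points P" "v \<in> tangent P z" using True by auto
      obtain x w where x: "x \<in> points X" "w \<in> tangent X x" "z = q x" "v = pushforward X P q x w"
        by (rule tangent_P_cases[OF zv])
      have Rx: "?R x \<in> points X" by (rule right_translate_points[OF h x(1)])
      have Rw: "pushforward X X ?R x w \<in> tangent X (?R x)" by (rule pushforward_tangent[OF R P.X P.X x(1,2)])
      have "pullback P P (right_act h) aP z vs = aP (right_act h (q x)) [pushforward P P (right_act h) (q x) (pushforward X P q x w)]"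
        using zv v x by (simp add: pullback_def)
      also have "pushforward P P (right_act h) (q x) (pushforward X P q x w) = pushforward X P (right_act h \<circ> q) x w"
        by (rule pushforward_compose[OF P.smooth_map_q smooth_right_act[OF h] P.X P.smooth_atlas_Q P.smooth_atlas_Q x(1,2), symmetric])
      also have "right_act h \<circ> q = q \<circ> ?R" by (rule ext) (simp add: right_act_q)
      also have "pushforward X P (q \<circ> ?R) x w = pushforward X P q (?R x) (pushforward X X ?R x w)"
        by (rule pushforward_compose[OF R P.smooth_map_q P.X P.X P.smooth_atlas_Q x(1,2)])
      also have "right_act h (q x) = q (?R x)" by (rule right_act_q)
      also have "aP (q (?R x)) [pushforward X P q (?R x) (pushforward X X ?R x w)]
          = kappa (Phi (?R x)) (differential X Phi (?R x) (pushforward X X ?R x w))"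
        by (rule aP_apply[OF Rx Rw])
      also have "Phi (?R x) = (fst (Phi x), se3_mult (snd (Phi x)) h)" by (simp add: Phi_def)
      also have "kappa (fst (Phi x), se3_mult (snd (Phi x)) h) (differential X Phi (?R x) (pushforward X X ?R x w))
          = se3_Ad (inv\<^bsub>SE3\<^esub> h) (kappa (Phi x) (differential X Phi x w))"
      proof (rule kappa_right_translate[OF _ h])
        show "rotation_matrix (snd (snd (Phi x)))" using x(1) by (auto simp: Phi_def points_X carrier_SE3_iff)
        have "differential X (\<lambda>z. s (fst z)) (?R x) (pushforward X X ?R x w) = differential X ((\<lambda>z. s (fst z)) \<circ> ?R) x w"
          by (rule differential_compose[OF R smooth_s_fst P.X P.X x(1,2), symmetric])
        then show "fst (differential X Phi (?R x) (pushforward X X ?R x w)) = fst (differential X Phi x w)"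
          unfolding differential_Phi[OF Rx Rw] differential_Phi[OF x(1,2)] by (simp add: o_def)
      qed
      also have "kappa (Phi x) (differential X Phi x w) = aP z vs" using aP_apply[OF x(1,2)] x(3,4) v by simp
      finally show ?thesis .
    qed
  qed
qed (rule aP(1))

end

context flat_bundle
begin

section \<open>The submanifold \<open>Q\<^sub>\<sigma>\<close>\<close>

abbreviation "QS \<equiv> {z \<in> points P. mod_K z \<in> \<sigma> ` points M}"

text \<open>If \<sigma> m is the class of (y, v), projecting gives m = p y, and then v is s y
  because the representative over \<open>y\<close> is unique.\<close>

lemma q_in_QS:
  assumes x: "x \<in> points X" shows "q x \<in> QS \<longleftrightarrow> fst (snd x) = s (fst x)"
proof -
  have xM: "fst x \<in> points Mt" using x by (auto simp: points_X)
  have K: "(fst x, fst (snd x)) \<in> points XK" using xM by (simp add: points_X)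
  have qx: "q x \<in> points P" unfolding P.points_Q using x by blast
  show ?thesis
  proof
    assume "q x \<in> QS"
    then have "qK (fst x, fst (snd x)) \<in> \<sigma> ` points M" unfolding mod_K_q[symmetric] by blast
    then obtain m where m: "m \<in> points M" "qK (fst x, fst (snd x)) = \<sigma> m" by blast
    then have "m = p (fst x)" using proj_sigma[OF m(1)] bundle_proj_qK[OF K] by simp
    then show "fst (snd x) = s (fst x)" using s_unique[OF xM] m(2) by simp
  next
    assume "fst (snd x) = s (fst x)"
    then have "mod_K (q x) = \<sigma> (p (fst x))" by (simp add: mod_K_q sigma_s[OF xM])
    then show "q x \<in> QS" using qx p_points[OF xM] by auto
  qed
qed

text \<open>A chart has to be exhibited at every point. Over a product chart,
  \<open>Q_\<sigma>\<close> is the graph of v as a function of the base coordinate, so base and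
  Rodrigues coordinates form a chart.\<close>

lemma QS_chart:
  assumes z: "z \<in> QS"
  shows "\<exists>c\<in>Q_atlas P M \<sigma>. z \<in> fst c"
proof -
  obtain x where x: "x \<in> points X" "z = q x" using z unfolding P.points_Q by blast
  obtain y v B where xx: "x = (y, (v, B))" by (cases x) auto
  have y: "y \<in> points Mt" and B: "rotation_matrix B" using x(1) by (auto simp: xx points_X SE3_simps)
  obtain a where a: "a \<in> Mt" "y \<in> fst a" using y unfolding points_iff by blast
  let ?b = "SE3_chart B"
  note b = SE3_chart_in_atlas[OF B] SE3_chart_simps[OF B]
  let ?e = "prod_chart a ?b"
  have e: "?e \<in> X" by (rule prod_chart_in[OF a(1) b(1)])
  have xe: "x \<in> fst ?e" using a(2) b(2) by (simp add: xx prod_chart_simps)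
  obtain W0 where W0: "openin (mtop X) W0" "x \<in> W0" "inj_on q W0" by (rule P.local_inj[OF x(1)])
  let ?W = "W0 \<inter> fst ?e"
  have W: "?W \<subseteq> fst ?e" "openin (mtop X) ?W" "inj_on q ?W" "x \<in> ?W"
    using W0 xe openin_chart[OF P.X e] by (auto intro: inj_on_subset)
  note k = quotient_chart_simps[OF P.X e W(1-3)]
  let ?k = "quotient_chart q ?W ?e"
  have kP: "?k \<in> P" by (rule quotient_chart_in[OF e W(1-3)])
  have WX: "?W \<subseteq> points X" using P.points_subset[OF W(2)] .
  have rng: "snd ?e ` fst ?e = snd a ` fst a \<times> UNIV" using prod_chart_simps(3)[of a ?b] b(3) by simp
  define G where "G u = s (chart_inv a u)" for u
  have G: "smooth_on (snd a ` fst a) G"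
    unfolding G_def by (rule smooth_map_into_openD[OF smooth_s Mt open_UNIV a(1)])
  have aop: "open (snd a ` fst a)" by (rule smooth_atlas_open[OF Mt a(1)])
  have in_QS: "q w \<in> QS \<longleftrightarrow> fst (snd (snd ?e w)) = G (fst (snd ?e w))" if w: "w \<in> ?W" for w
  proof -
    obtain y' g where wg: "w = (y', g)" by (cases w)
    have "y' \<in> fst a" using w by (simp add: wg prod_chart_simps)
    then show ?thesis
      using q_in_QS[of w] w WX
      by (auto simp: wg prod_chart_simps G_def chart_inv_snd[OF Mt a(1)] b(5))
  qed
  \<comment> \<open>\<open>F\<close> forgets the coordinate v; \<open>?J\<close> below restores it
    as the value of \<open>G\<close>.\<close>
  define F where "F z = (fst (snd ?k z), snd (snd (snd ?k z)))" for z
  \<comment> \<open>The coordinates whose restored point stays inside the chart; this turns out to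
    be the image of \<open>F\<close>.\<close>
  define R where "R = {t::(real^3)\<times>(real^3). fst t \<in> snd a ` fst a \<and> (fst t, G (fst t), snd t) \<in> snd ?e ` ?W}"
  let ?D = "QS \<inter> fst ?k"
  let ?J = "\<lambda>t. (fst t, G (fst t), snd t)"
  have V: "open (snd a ` fst a \<times> (UNIV::(real^3) set))" by (intro open_Times aop open_UNIV)
  have sJ: "smooth_on (snd a ` fst a \<times> (UNIV::(real^3) set)) ?J"
    by (intro smooth_on_Pair smooth_on_fst smooth_on_snd smooth_on_ident V smooth_on_compose[OF V aop _ _ G]) auto
  have "R = (snd a ` fst a \<times> UNIV) \<inter> ?J -` (snd ?e ` ?W)" by (auto simp: R_def)
  then have R: "open R"
    using continuous_open_preimage[OF smooth_on_imp_continuous_on[OF sJ] V k(5)] by simp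
  have JR: "chart_inv ?k (?J t) \<in> ?D" "F (chart_inv ?k (?J t)) = t" if t: "t \<in> R" for t
  proof -
    have Jt: "?J t \<in> snd ?e ` ?W" using t by (simp add: R_def)
    let ?w = "chart_inv ?e (?J t)"
    have w: "?w \<in> ?W" "snd ?e ?w = ?J t"
      using k(7)[OF Jt] snd_chart_inv[of "?J t" ?e] Jt k(6) by blast+
    have "q ?w \<in> QS" using in_QS[OF w(1)] w(2) by simp
    then show "chart_inv ?k (?J t) \<in> ?D" unfolding k(8)[OF Jt] k(1) using w(1) by blast
    show "F (chart_inv ?k (?J t)) = t" unfolding F_def k(8)[OF Jt] k(2)[OF w(1)] w(2) by simp
  qed
  have FD: "F z \<in> R" "chart_inv ?k (?J (F z)) = z" if zD: "z \<in> ?D" for z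
  proof -
    obtain w where w: "w \<in> ?W" "z = q w" using zD unfolding k(1) by blast
    have sk: "snd ?k z = snd ?e w" using k(2)[OF w(1)] w(2) by simp
    have we: "snd ?e w \<in> snd ?e ` ?W" using w(1) by (rule imageI)
    have "fst (snd (snd ?e w)) = G (fst (snd ?e w))" using in_QS[OF w(1)] zD w(2) by blast
    then have J: "?J (F z) = snd ?e w" unfolding F_def sk by (metis fst_conv snd_conv prod.collapse)
    have "fst (F z) \<in> snd a ` fst a"
    proof -
      have "snd ?e w \<in> snd a ` fst a \<times> UNIV" using we k(6) rng by blast
      then show ?thesis unfolding F_def sk by (simp add: mem_Times_iff)
    qed
    then show "F z \<in> R" using we J by (simp add: R_def)
    have "chart_inv ?e (snd ?e w) = w" by (rule chart_inv_snd[OF P.X e]) (use w(1) in blast)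
    then show "chart_inv ?k (?J (F z)) = z" unfolding J k(8)[OF we] using w(2) by simp
  qed
  have injF: "inj_on F ?D"
  proof (rule inj_onI)
    fix u w assume u: "u \<in> ?D" and w: "w \<in> ?D" and eq: "F u = F w"
    show "u = w" using FD(2)[OF u] unfolding eq FD(2)[OF w] by (rule sym)
  qed
  have imF: "F ` ?D = R"
  proof
    show "F ` ?D \<subseteq> R" using FD(1) by blast
    show "R \<subseteq> F ` ?D"
    proof
      fix t assume "t \<in> R"
      from JR[OF this] show "t \<in> F ` ?D" by (intro image_eqI[OF sym])
    qed
  qed
  have invF: "inv_into ?D F t = chart_inv ?k (?J t)" if "t \<in> R" for t
    by (rule inv_into_f_eq[OF injF JR(1)[OF that] JR(2)[OF that]])
  have op: "openin (mtop P) (fst ?k)" by (rule openin_chart[OF P.smooth_atlas_Q kP])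
  note rP = smooth_atlas_restrict[OF P.smooth_atlas_Q op]
  have smF: "smooth_map (restrict_atlas P (fst ?k)) (open_atlas UNIV) F"
  proof (rule smooth_map_into_openI[OF rP open_UNIV])
    fix z' assume "z' \<in> points (restrict_atlas P (fst ?k))"
    then have z': "z' \<in> fst ?k" by (simp add: points_restrict)
    let ?k' = "(fst ?k \<inter> fst ?k, snd ?k)"
    have k': "?k' = ?k" by simp
    have "?k' \<in> restrict_atlas P (fst ?k)" unfolding restrict_atlas_iff using kP by blast
    then have kR: "?k \<in> restrict_atlas P (fst ?k)" unfolding k' .
    have kop: "open (snd ?k ` fst ?k)" unfolding k(3) by (rule k(5))
    have "smooth_on (snd ?k ` fst ?k) (\<lambda>u. (fst u, snd (snd u)))"
      by (intro smooth_on_Pair smooth_on_fst smooth_on_snd smooth_on_ident kop)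
    then have "smooth_on (snd ?k ` fst ?k) (\<lambda>u. F (chart_inv ?k u))"
      by (rule smooth_on_cong[OF kop, rotated]) (simp add: F_def snd_chart_inv)
    then show "\<exists>c\<in>restrict_atlas P (fst ?k). \<exists>U. z' \<in> fst c \<and> open U \<and> snd c z' \<in> U \<and> U \<subseteq> snd c ` fst c \<and>
        smooth_on U (\<lambda>u. F (chart_inv c u))"
      using kR z' kop by blast
  qed simp
  have smJ: "smooth_map (open_atlas R) P (inv_into ?D F)"
  proof (rule smooth_mapI[OF smooth_atlas_open_atlas[OF R] P.smooth_atlas_Q])
    fix t assume t: "t \<in> points (open_atlas R)"
    have eq: "inv_into ?D F (chart_inv (R, id) u) = chart_inv ?k (?J u)" if "u \<in> R" for u
      using invF[OF that] that by (simp add: chart_inv_open_atlas)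
    have "smooth_on R (coord_map (R, id) ?k (inv_into ?D F))"
    proof (rule smooth_on_cong[OF R _ smooth_on_subset[OF sJ]])
      show "R \<subseteq> snd a ` fst a \<times> UNIV" by (auto simp: R_def)
      fix u assume u: "u \<in> R"
      then have "?J u \<in> snd ?k ` fst ?k" unfolding k(3) by (simp add: R_def)
      from snd_chart_inv[OF this] show "?J u = coord_map (R, id) ?k (inv_into ?D F) u"
        unfolding coord_map_apply eq[OF u] by simp
    qed
    moreover have "\<forall>u\<in>R. inv_into ?D F (chart_inv (R, id) u) \<in> fst ?k"
      using eq JR(1) by auto
    ultimately show "\<exists>c\<in>open_atlas R. \<exists>d\<in>P. \<exists>U. t \<in> fst c \<and> open U \<and> snd c t \<in> U \<and> U \<subseteq> snd c ` fst c \<and>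
        (\<forall>u\<in>U. inv_into ?D F (chart_inv c u) \<in> fst d) \<and> smooth_on U (coord_map c d (inv_into ?D F))"
      using kP t R by (intro bexI[of _ "(R, id)"] bexI[of _ ?k] exI[of _ R]) simp_all
  qed
  have "(?D, F) \<in> Q_atlas P M \<sigma>"
    unfolding Q_atlas_def submanifold_atlas_def mem_Collect_eq
    by (rule exI[of _ "fst ?k"], rule exI[of _ F]) (simp only: imF, intro conjI refl op smF injF R smJ)
  moreover have "z \<in> ?D" using z W(4) x(2) unfolding k(1) by blast
  ultimately show ?thesis by (intro bexI[of _ "(?D, F)"]) simp_all
qed

abbreviation "QA \<equiv> Q_atlas P M \<sigma>"

lemma smooth_atlas_QA: "smooth_atlas QA"
  unfolding Q_atlas_def by (rule smooth_atlas_submanifold[OF P.smooth_atlas_Q])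

lemma points_QA: "points QA = QS"
proof (intro equalityI subsetI)
  fix z assume "z \<in> points QA"
  then obtain c where "c \<in> QA" "z \<in> fst c" unfolding points_iff by blast
  then show "z \<in> QS" unfolding Q_atlas_def by (elim submanifold_chartE) simp
next
  fix z assume "z \<in> QS"
  from QS_chart[OF this] show "z \<in> points QA" unfolding points_iff .
qed

lemma smooth_QA_inclusion: "smooth_map QA P id"
  unfolding Q_atlas_def by (rule smooth_map_submanifold_inclusion[OF P.smooth_atlas_Q])

lemma smooth_into_QA:
  assumes "smooth_map A P f" "smooth_atlas A" "f ` points A \<subseteq> QS"
  shows "smooth_map A QA f"
  unfolding Q_atlas_def
  by (rule smooth_map_into_submanifold[OF assms(1) P.smooth_atlas_Q assms(2)])
     (use assms(3) points_QA in \<open>simp add: Q_atlas_def\<close>)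

text \<open>The function \<open>[y, (v, A)] \<mapsto> A\<^sup>T (v - s y)\<close> on \<open>P\<close> is well defined and vanishes exactly on \<open>Q\<^sub>\<sigma>\<close>;
  differentiating it along \<open>Q\<^sub>\<sigma>\<close> gives \<open>A\<^sup>T dv = A\<^sup>T ds\<close> there.\<close>

definition offset :: "'b \<times> se3_pair \<Rightarrow> real^3" where
  "offset z = transpose (snd (snd z)) *v (fst (snd z) - s (fst z))"

definition offsetP :: "('b \<times> se3_pair) set \<Rightarrow> real^3" where
  "offsetP z = offset (SOME x. x \<in> points X \<and> q x = z)"

text \<open>\<open>offsetP\<close> evaluates at a chosen representative. Equivariance of
  \<open>s\<close> and cancellation of the left rotation make \<open>offset\<close> constant on
  orbits.\<close>

lemma offsetP_q:
  assumes x: "x \<in> points X" shows "offsetP (q x) = offset x"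
proof -
  have "\<exists>x'. x' \<in> points X \<and> q x' = q x" using x by blast
  then have x': "(SOME x'. x' \<in> points X \<and> q x' = q x) \<in> points X" "q (SOME x'. x' \<in> points X \<and> q x' = q x) = q x"
    by (metis (mono_tags, lifting) someI_ex)+
  have inv: "offset x = offset x'" if x': "x' \<in> points X" "q x' = q x" for x'
  proof -
    obtain \<gamma> where g: "\<gamma> \<in> carrier \<Gamma>" "x' = (act \<gamma> (fst x), \<rho> \<gamma> \<otimes>\<^bsub>SE3\<^esub> snd x)"
      using quotient_P(2)[OF x x'(1)] x'(2) by auto
    have xM: "fst x \<in> points Mt" using x by (auto simp: points_X)
    have A: "rotation_matrix (snd (\<rho> \<gamma>))" using rho_SE3[OF g(1)] by (simp add: carrier_SE3_iff)
    have "transpose (snd (\<rho> \<gamma>) ** B) *v (snd (\<rho> \<gamma>) *v u) = transpose B *v u" for B :: "real^3^3" and u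
      using rotation_cancel(2)[OF A, of u] by (simp add: matrix_transpose_mul matrix_vector_mul_assoc[symmetric])
    then show ?thesis
      by (simp add: g(2) offset_def s_equivariant[OF g(1) xM] SE3_simps se3_mult_pair se3_move_pair
          matrix_vector_mult_diff_distrib[symmetric])
  qed
  show ?thesis unfolding offsetP_def by (rule inv[OF x', symmetric])
qed

text \<open>The product rule has a second summand, the derivative of A^T applied to v - s; it
  vanishes because v = s at \<open>n\<close>.\<close>

lemma has_derivative_offset:
  fixes n :: "(real^3) \<times> se3_pair"
  assumes "fst (snd n) = fst n"
  shows "((\<lambda>n. transpose (snd (snd n)) *v (fst (snd n) - fst n)) has_derivative
     (\<lambda>w. transpose (snd (snd n)) *v (fst (snd w) - fst w))) (at n)"
proof -
  have 1: "((\<lambda>n::(real^3) \<times> se3_pair. snd (snd n)) has_derivative (\<lambda>w. snd (snd w))) (at n)"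
    "((\<lambda>n::(real^3) \<times> se3_pair. fst (snd n) - fst n) has_derivative (\<lambda>w. fst (snd w) - fst w)) (at n)"
    by (auto intro!: derivative_eq_intros)
  show ?thesis
    using bounded_bilinear.FDERIV[OF linear_matrix_bilinear(3) 1] assms by simp
qed

lemma smooth_offset: "smooth_map X euclid offset"
proof -
  have "smooth_map euclid euclid (\<lambda>n::(real^3) \<times> se3_pair. transpose (snd (snd n)) *v (fst (snd n) - fst n))"
    by (rule smooth_map_open_open)
       (auto intro!: smooth_on_matrix smooth_on_transpose smooth_on_fst smooth_on_snd smooth_on_diff smooth_on_ident)
  from smooth_map_compose[OF smooth_Phi this P.X smooth_atlas_euclid smooth_atlas_euclid]
  show ?thesis by (simp add: o_def Phi_def offset_def[abs_def])
qed

lemma smooth_offsetP: "smooth_map P euclid offsetP"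
  by (rule P.smooth_map_from_Q[OF smooth_map_cong[OF smooth_offset P.X smooth_atlas_euclid] smooth_atlas_euclid])
     (simp add: offsetP_q)

lemma tangent_QA:
  assumes z: "z \<in> points QA" and u: "u \<in> tangent QA z"
    and x: "x \<in> points X" "w \<in> tangent X x" "z = q x" "pushforward QA P id z u = pushforward X P q x w"
  shows "transpose (snd (snd x)) *v fst (differential X snd x w) = transpose (snd (snd x)) *v differential X (\<lambda>z. s (fst z)) x w"
proof -
  have v0: "fst (snd x) = s (fst x)" using q_in_QS[OF x(1)] z x(3) by (simp add: points_QA)
  have zero: "(offsetP \<circ> id) z' = (\<lambda>_. 0) z'" if z': "z' \<in> points QA" for z'
  proof -
    have zQ: "z' \<in> QS" using z' by (simp add: points_QA)
    then obtain x' where x': "x' \<in> points X" "z' = q x'" unfolding P.points_Q by blast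
    have "fst (snd x') = s (fst x')" using q_in_QS[OF x'(1)] zQ x'(2) by simp
    then show ?thesis using offsetP_q[OF x'(1)] x'(2) by (simp add: offset_def)
  qed
  have "differential QA (offsetP \<circ> id) z u = differential QA (\<lambda>_. 0) z u"
    by (rule differential_cong[OF smooth_atlas_QA z zero])
  also have "\<dots> = 0"
  proof -
    have "smooth_map QA euclid (\<lambda>_. 0 :: real^3)"
      by (rule smooth_map_into_openI[OF smooth_atlas_QA open_UNIV])
        (use smooth_atlas_open[OF smooth_atlas_QA] in \<open>auto simp: points_iff intro!: smooth_on_const\<close>)
    moreover obtain c where "c \<in> QA" "z \<in> fst c" using z unfolding points_iff by blast
    ultimately show ?thesis using differential_coord[OF _ smooth_atlas_QA u, of "\<lambda>_. 0" c] by simp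
  qed
  finally have "differential P offsetP z (pushforward QA P id z u) = 0"
    using differential_compose[OF smooth_QA_inclusion smooth_offsetP smooth_atlas_QA P.smooth_atlas_Q z u] by simp
  then have "differential X (offsetP \<circ> q) x w = 0"
    using differential_compose[OF P.smooth_map_q smooth_offsetP P.X P.smooth_atlas_Q x(1,2)] x(3,4) by simp
  then have "differential X offset x w = 0"
    using differential_cong[OF P.X x(1), of "offsetP \<circ> q" offset w] by (simp add: offsetP_q)
  moreover have "differential X offset x w = transpose (snd (snd (Phi x))) *v
      (fst (snd (differential X Phi x w)) - fst (differential X Phi x w))"
    by (rule differential_chain[OF smooth_Phi P.X x(1,2) has_derivative_offset _ smooth_offset])
       (simp_all add: Phi_def v0 offset_def)
  ultimately show ?thesis
    unfolding differential_Phi[OF x(1,2)] by (simp add: Phi_def matrix_vector_mult_diff_distrib)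
qed

lemma sum_se3_J: "(\<Sum>i\<in>UNIV. (x $ i) *\<^sub>R se3_J i) = (0, x)"
proof -
  have "(\<Sum>i\<in>UNIV. (x $ i) *\<^sub>R axis i 1) = x"
    by (simp add: vec_eq_iff sum_3 forall_3 axis_def)
  then show ?thesis by (simp add: se3_J_def prod_eq_iff fst_sum snd_sum)
qed

text \<open>On \<open>Q_\<sigma>\<close> the factor s - v kills the first component of
  \<open>kappa\<close>, and A^T ds equals A^T dv there, which is the P-component of the
  connection.\<close>

lemma aP_QA: "pullback QA P id aP = e_hat_Q P M \<omega> \<sigma>"
  unfolding e_hat_Q_def sum_se3_J
proof (intro ext)
  fix z vs
  show "pullback QA P id aP z vs = (0, fst (pullback QA P id \<omega> z vs))"
  proof (cases "z \<in> points QA \<and> length vs = 1 \<and> set vs \<subseteq> tangent QA z")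
    case False
    then show ?thesis
      using forms_outside[OF pullback_forms[OF smooth_QA_inclusion smooth_atlas_QA P.smooth_atlas_Q aP(1)] False]
        forms_outside[OF pullback_forms[OF smooth_QA_inclusion smooth_atlas_QA P.smooth_atlas_Q omega(1)] False]
      by (simp add: zero_prod_def)
  next
    case True
    then have "length vs = 1" by blast
    then obtain u where vs: "vs = [u]" by (rule length_1E)
    have z: "z \<in> points QA" and u: "u \<in> tangent QA z" using True vs by auto
    have zP: "z \<in> points P" using z by (simp add: points_QA)
    have uP: "pushforward QA P id z u \<in> tangent P z"
      using pushforward_tangent[OF smooth_QA_inclusion smooth_atlas_QA P.smooth_atlas_Q z u] by simp
    obtain x w where x: "x \<in> points X" "w \<in> tangent X x" "z = q x" "pushforward QA P id z u = pushforward X P q x w"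
      by (rule tangent_P_cases[OF zP uP])
    have pb: "pullback QA P id \<alpha> z vs = \<alpha> (q x) [pushforward X P q x w]" for \<alpha> :: "(('b \<times> se3_pair) set, (real^3) \<times> (real^3) \<times> (real^3), se3) form"
      using z u vs x by (simp add: pullback_def)
    have v0: "fst (snd x) = s (fst x)" using q_in_QS[OF x(1)] z x(3) by (simp add: points_QA)
    show ?thesis
      unfolding pb aP_apply[OF x(1,2)] omega_apply[OF x(1,2)] differential_Phi[OF x(1,2)]
      using tangent_QA[OF z u x] by (simp add: kappa_def Phi_def v0)
  qed
qed

section \<open>Uniqueness of the horizontal equivariant extension\<close>

lemma form1_diff:
  assumes a: "a \<in> forms 1 A" and A: "smooth_atlas A" and z: "z \<in> points A"
    and uv: "u \<in> tangent A z" "v \<in> tangent A z"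
  shows "a z [\<lambda>d. u d - v d] = a z [u] - a z [v]"
proof -
  obtain c where c: "c \<in> A" "z \<in> fst c" using z unfolding points_iff by blast
  have "alt_multilinear 1 (local_rep A a c (snd c z))"
    by (rule forms_alt_multilinear[OF a c(1)]) (use c in blast)
  \<comment> \<open>The entry 0 is a placeholder of the right length, overwritten at position
    0.\<close>
  then have lin: "linear (\<lambda>w. local_rep A a c (snd c z) ([0][0 := w]))"
    unfolding alt_multilinear_def by (metis One_nat_def length_Cons list.size(3) zero_less_one)
  have "a z [w] = local_rep A a c (snd c z) [w c]" if "w \<in> tangent A z" for w
    using form_apply[OF A c, of "[w]" a] that by simp
  then show ?thesis
    using linear_diff[OF lin, of "u c" "v c"] tangent_diff[OF A z uv] uv by simp
qed

text \<open>At the point \<open>[y, (v, A)]\<close>, right translation by \<open>h = (A\<^sup>T (v - s y), 1)\<close> leads from \<open>Q\<^sub>\<sigma>\<close> to that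
  point, and a horizontal equivariant form takes the same values on vectors with equal projection to \<open>M\<close>.\<close>

lemma adP_determined:
  assumes a: "a \<in> adP_forms P M p" and aE: "pullback QA P id a = E"
    and x: "x \<in> points X" and w: "w \<in> tangent X x"
  defines "r \<equiv> \<lambda>z. (fst z, (s (fst z), snd (snd z))) :: 'b \<times> se3_pair"
    and "h \<equiv> (transpose (snd (snd x)) *v (fst (snd x) - s (fst x)), mat 1) :: se3_pair"
  shows "a (q x) [pushforward X P q x w] = se3_Ad (inv\<^bsub>SE3\<^esub> h) (E (q (r x)) [pushforward X QA (q \<circ> r) x w])"
proof -
  have a1: "a \<in> forms 1 P" and vert: "\<And>z v. z \<in> points P \<Longrightarrow> v \<in> tangent P z \<Longrightarrow> pushforward P M \<pi> z v = (\<lambda>_. 0) \<Longrightarrow> a z [v] = 0"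
    and equi: "\<And>h. h \<in> carrier SE3 \<Longrightarrow> pullback P P (right_act h) a = (\<lambda>z vs. se3_Ad (inv\<^bsub>SE3\<^esub> h) (a z vs))"
    using a unfolding adP_forms_def by auto
  have h: "h \<in> carrier SE3" by (simp add: h_def SE3_simps rotation_matrix_one)
  have A: "rotation_matrix (snd (snd x))" using x by (auto simp: points_X carrier_SE3_iff)
  have "smooth_map X euclid ((\<lambda>n::(real^3) \<times> se3_pair. (fst n, snd (snd n))) \<circ> Phi)"
  proof (rule smooth_map_compose[OF smooth_Phi _ P.X smooth_atlas_euclid smooth_atlas_euclid])
    show "smooth_map euclid euclid (\<lambda>n::(real^3) \<times> se3_pair. (fst n, snd (snd n)))"
      by (rule smooth_map_open_open) (auto intro!: smooth_on_Pair smooth_on_fst smooth_on_snd smooth_on_ident)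
  qed
  then have "smooth_map X euclid (\<lambda>z. (s (fst z), snd (snd z)))" by (simp add: o_def Phi_def)
  then have "smooth_map X SE3_atlas (\<lambda>z. (s (fst z), snd (snd z)))"
    by (rule smooth_map_into_SE3[OF _ P.X]) (auto simp: points_X carrier_SE3_iff)
  then have r: "smooth_map X X r"
    unfolding r_def by (rule smooth_map_Pair[OF smooth_fst _ P.X Mt smooth_atlas_SE3])
  have rX: "r z \<in> points X" if "z \<in> points X" for z by (rule smooth_map_image[OF r P.X P.X that])
  have qr: "smooth_map X P (q \<circ> r)" by (rule smooth_map_compose[OF r P.smooth_map_q P.X P.X P.smooth_atlas_Q])
  have qrS: "(q \<circ> r) ` points X \<subseteq> QS"
  proof
    fix z assume "z \<in> (q \<circ> r) ` points X"
    then obtain x' where "x' \<in> points X" "z = q (r x')" by auto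
    then show "z \<in> QS" using q_in_QS[OF rX] by (simp add: r_def)
  qed
  have qrQ: "smooth_map X QA (q \<circ> r)" by (rule smooth_into_QA[OF qr P.X qrS])
  \<comment> \<open>\<open>h\<close> is frozen at the point \<open>x\<close>, so \<open>?f\<close>
    is smooth and agrees with \<open>q\<close> at \<open>x\<close>, in general not nearby; it shares
    with \<open>q\<close> the projection to \<open>M\<close> everywhere.\<close>
  let ?f = "right_act h \<circ> (q \<circ> r)"
  have f: "smooth_map X P ?f" by (rule smooth_map_compose[OF qr smooth_right_act[OF h] P.X P.smooth_atlas_Q P.smooth_atlas_Q])
  have fx: "?f x = q x"
  proof -
    have "snd (snd x) *v (transpose (snd (snd x)) *v u) = u" for u by (rule rotation_cancel(1)[OF A])
    then have "(fst (r x), se3_mult (snd (r x)) h) = x"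
      by (simp add: r_def h_def se3_mult_pair prod_eq_iff)
    then show ?thesis by (simp add: right_act_q)
  qed
  let ?u = "pushforward X P q x w" and ?v = "pushforward X P ?f x w"
  have u: "?u \<in> tangent P (q x)" by (rule push_q[OF x w])
  have v: "?v \<in> tangent P (q x)" using pushforward_tangent[OF f P.X P.smooth_atlas_Q x w] unfolding fx .
  have qx: "q x \<in> points P" unfolding P.points_Q using x by blast
  have proj: "(\<pi> \<circ> q) z = (\<pi> \<circ> ?f) z" if z: "z \<in> points X" for z
  proof -
    have "(fst (r z), se3_mult (snd (r z)) h) \<in> points X" by (rule right_translate_points[OF h rX[OF z]])
    from bundle_proj_q[OF this] bundle_proj_q[OF z] show ?thesis by (simp add: right_act_q r_def)
  qed
  have "pushforward P M \<pi> (q x) ?u = pushforward X M (\<pi> \<circ> q) x w"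
    by (rule pushforward_compose[OF P.smooth_map_q smooth_proj P.X P.smooth_atlas_Q M x w, symmetric])
  also have "\<dots> = pushforward X M (\<pi> \<circ> ?f) x w" using pushforward_cong[OF P.X x, of "\<pi> \<circ> q" "\<pi> \<circ> ?f" M] proj by simp
  also have "\<dots> = pushforward P M \<pi> (?f x) ?v"
    by (rule pushforward_compose[OF f smooth_proj P.X P.smooth_atlas_Q M x w])
  finally have eq: "pushforward P M \<pi> (q x) ?u = pushforward P M \<pi> (q x) ?v" unfolding fx .
  \<comment> \<open>Two vectors with equal projection differ by a vertical one, on which
    \<open>a\<close> vanishes.\<close>
  have "pushforward P M \<pi> (q x) (\<lambda>d. ?u d - ?v d) = (\<lambda>_. 0)"
    by (rule ext) (simp add: pushforward_diff[OF smooth_proj P.smooth_atlas_Q M qx] eq)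
  from vert[OF qx tangent_diff[OF P.smooth_atlas_Q qx u v] this]
  have "a (q x) [?u] = a (q x) [?v]" using form1_diff[OF a1 P.smooth_atlas_Q qx u v] by simp
  also have "\<dots> = pullback P P (right_act h) a (q (r x)) [pushforward X P (q \<circ> r) x w]"
  proof -
    have "pushforward X P (q \<circ> r) x w \<in> tangent P (q (r x))" "q (r x) \<in> points P"
      using pushforward_tangent[OF qr P.X P.smooth_atlas_Q x w] smooth_map_image[OF qr P.X P.smooth_atlas_Q x] by simp_all
    moreover have "?v = pushforward P P (right_act h) (q (r x)) (pushforward X P (q \<circ> r) x w)"
      using pushforward_compose[OF qr smooth_right_act[OF h] P.X P.smooth_atlas_Q P.smooth_atlas_Q x w] by simp
    ultimately show ?thesis using fx by (simp add: pullback_def)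
  qed
  also have "\<dots> = se3_Ad (inv\<^bsub>SE3\<^esub> h) (a (q (r x)) [pushforward X P (q \<circ> r) x w])"
    unfolding equi[OF h] ..
  also have "a (q (r x)) [pushforward X P (q \<circ> r) x w] = E (q (r x)) [pushforward X QA (q \<circ> r) x w]"
  proof -
    have "pushforward X QA (q \<circ> r) x w \<in> tangent QA (q (r x))" "q (r x) \<in> points QA"
      using pushforward_tangent[OF qrQ P.X smooth_atlas_QA x w] smooth_map_image[OF qrQ P.X smooth_atlas_QA x] by simp_all
    moreover have "pushforward X P (q \<circ> r) x w = pushforward QA P id (q (r x)) (pushforward X QA (q \<circ> r) x w)"
      using pushforward_compose[OF qrQ smooth_QA_inclusion P.X smooth_atlas_QA P.smooth_atlas_Q x w] by simp
    ultimately show ?thesis unfolding aE[symmetric] by (simp add: pullback_def)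
  qed
  finally show ?thesis .
qed

text \<open>\<open>adP_determined\<close> expresses any candidate through its restriction to
  \<open>Q_\<sigma>\<close>; \<open>a\<close> and \<open>aP\<close> have the same restriction and so
  the same values.\<close>

lemma e_hat_eq: "e_hat P M p \<omega> \<sigma> = aP"
  unfolding e_hat_def
proof (rule the_equality)
  show "aP \<in> adP_forms P M p \<and> pullback QA P id aP = e_hat_Q P M \<omega> \<sigma>" using aP_adP aP_QA by blast
  fix a assume "a \<in> adP_forms P M p \<and> pullback QA P id a = e_hat_Q P M \<omega> \<sigma>"
  then have a: "a \<in> adP_forms P M p" "pullback QA P id a = e_hat_Q P M \<omega> \<sigma>" by auto
  have a1: "a \<in> forms 1 P" using a(1) unfolding adP_forms_def by blast
  show "a = aP"
  proof (intro ext)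
    fix z vs
    show "a z vs = aP z vs"
    proof (cases "z \<in> points P \<and> length vs = 1 \<and> set vs \<subseteq> tangent P z")
      case False
      then show ?thesis using forms_outside[OF a1 False] forms_outside[OF aP(1) False] by simp
    next
      case True
      then have "length vs = 1" by blast
      then obtain v where vs: "vs = [v]" by (rule length_1E)
      have z: "z \<in> points P" "v \<in> tangent P z" using True vs by auto
      obtain x w where x: "x \<in> points X" "w \<in> tangent X x" "z = q x" "v = pushforward X P q x w"
        by (rule tangent_P_cases[OF z])
      show ?thesis
        unfolding vs x(3,4) adP_determined[OF a x(1,2)] adP_determined[OF aP_adP aP_QA x(1,2)] ..
    qed
  qed
qed

end

section \<open>The Chern--Simons form\<close>

lemma ext_deriv_outside:
  "\<not> (x \<in> points A \<and> length vs = Suc k \<and> set vs \<subseteq> tangent A x) \<Longrightarrow> ext_deriv A k \<alpha> x vs = 0"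
  unfolding ext_deriv_def by (simp only: if_False)

lemma ext_deriv_1_alternating: "ext_deriv A 1 \<alpha> x [w, v] = - ext_deriv A 1 \<alpha> x [v, w]"
proof (cases "x \<in> points A \<and> set [v, w] \<subseteq> tangent A x")
  case True
  then show ?thesis using ext_deriv_1[of x A v w \<alpha>] ext_deriv_1[of x A w v \<alpha>] by simp
next
  case False
  then show ?thesis
    using ext_deriv_outside[of x A "[v, w]" 1 \<alpha>] ext_deriv_outside[of x A "[w, v]" 1 \<alpha>] by auto
qed

lemma wedge_1_1_pair: "wedge B 1 1 \<alpha> \<beta> x [v, w] = B (\<alpha> x [v]) (\<beta> x [w]) - B (\<alpha> x [w]) (\<beta> x [v])"
  by (subst wedge_1_1) simp_all

lemma wedge_outside: "length vs \<noteq> j + k \<Longrightarrow> wedge B j k \<alpha> \<beta> x vs = 0"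
  by (simp only: wedge_def if_False)

lemma se3_bracket_skew: "se3_bracket \<eta> \<xi> = - se3_bracket \<xi> \<eta>"
proof (cases \<xi>, cases \<eta>)
  fix x e y f assume "\<xi> = (x, e)" "\<eta> = (y, f)"
  then show ?thesis by (simp add: cross_skew[of f x] cross_skew[of y e] cross_skew[of f e])
qed

context
  fixes P' :: "(('b \<times> se3_pair) set, 'e::euclidean_space) atlas" and \<omega>' a :: "(('b \<times> se3_pair) set, 'e, se3) form"
  assumes om: "\<omega>' \<in> forms 1 P'" and a: "a \<in> forms 1 P'"
begin

lemma cov_deriv_2:
  "cov_deriv P' \<omega>' a z [v, w] = ext_deriv P' 1 a z [v, w] + (se3_bracket (\<omega>' z [v]) (a z [w]) - se3_bracket (\<omega>' z [w]) (a z [v]))"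
  unfolding cov_deriv_def form_add_def wedge_1_1_pair ..

lemma curvature_2:
  "curvature P' \<omega>' z [v, w] = ext_deriv P' 1 \<omega>' z [v, w] + se3_bracket (\<omega>' z [v]) (\<omega>' z [w])"
  unfolding curvature_def form_add_def form_scale_def wedge_1_1_pair se3_bracket_skew[of "\<omega>' z [w]" "\<omega>' z [v]"]
  by (simp add: scaleR_2[symmetric])

lemma se3_bracket_0: "se3_bracket 0 \<xi> = 0" "se3_bracket \<xi> 0 = 0"
  by (cases \<xi>, simp add: zero_prod_def)+

lemma inv_poly_0: "inv_poly c1 c2 0 \<xi> = 0" "inv_poly c1 c2 \<xi> 0 = 0"
  by (cases \<xi>, simp add: zero_prod_def)+

text \<open>The wedge products reduce to cyclic sums and flatness removes the curvature term.
  Invalid arguments are covered too, because forms are compared as functions.\<close>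

lemma CS_upstairs_apply:
  assumes flat: "\<forall>v\<in>tangent P' z. \<forall>w\<in>tangent P' z. z \<in> points P' \<longrightarrow> curvature P' \<omega>' z [v, w] = 0"
  shows "CS_upstairs P' (inv_poly c1 c2) (\<omega>' +\<^sub>f a) \<omega>' z vs =
    (if z \<in> points P' \<and> length vs = 3 \<and> set vs \<subseteq> tangent P' z then
       let k = \<lambda>i. a z [vs ! i]; d = \<lambda>i j. cov_deriv P' \<omega>' a z [vs ! i, vs ! j] in
       inv_poly c1 c2 (k 0) (d 1 2) + inv_poly c1 c2 (k 1) (d 2 0) + inv_poly c1 c2 (k 2) (d 0 1)
       + (1/3) * (inv_poly c1 c2 (k 0) (2 *\<^sub>R se3_bracket (k 1) (k 2)) + inv_poly c1 c2 (k 1) (2 *\<^sub>R se3_bracket (k 2) (k 0))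
         + inv_poly c1 c2 (k 2) (2 *\<^sub>R se3_bracket (k 0) (k 1)))
     else 0)"
proof -
  let ?B = "inv_poly c1 c2"
  let ?aa = "wedge se3_bracket 1 1 a a"
  have diff: "(\<omega>' +\<^sub>f a) -\<^sub>f \<omega>' = a" by (simp add: form_add_def form_diff_def fun_eq_iff)
  have CS: "CS_upstairs P' ?B (\<omega>' +\<^sub>f a) \<omega>' z vs
      = wedge ?B 1 2 a (cov_deriv P' \<omega>' a) z vs + (1/3) * wedge ?B 1 2 a ?aa z vs + 2 * wedge ?B 1 2 a (curvature P' \<omega>') z vs"
    unfolding CS_upstairs_def Let_def diff unfolding form_add_def form_scale_def real_scaleR_def ..
  show ?thesis
  proof (cases "length vs = 3")
    case False
    then have "wedge ?B 1 2 \<alpha> \<beta> z vs = 0" for \<alpha> \<beta> by (intro wedge_outside) simp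
    then show ?thesis unfolding CS using False by simp
  next
    case True
  have aa: "?aa x [v, w] = 2 *\<^sub>R se3_bracket (a x [v]) (a x [w])" for x v w
    unfolding wedge_1_1_pair se3_bracket_skew[of "a x [w]" "a x [v]"] by (simp add: scaleR_2)
  have alt1: "cov_deriv P' \<omega>' a x [w, v] = - cov_deriv P' \<omega>' a x [v, w]" for x v w
    unfolding cov_deriv_2 ext_deriv_1_alternating[of P' a x w v] by simp
  have alt2: "?aa x [w, v] = - ?aa x [v, w]" for x v w
    unfolding aa se3_bracket_skew[of "a x [w]" "a x [v]"] by simp
  have alt3: "curvature P' \<omega>' x [w, v] = - curvature P' \<omega>' x [v, w]" for x v w
    unfolding curvature_2 ext_deriv_1_alternating[of P' \<omega>' x w v] se3_bracket_skew[of "\<omega>' x [w]" "\<omega>' x [v]"] by simp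
  note w0 = wedge_1_2[where B = ?B and \<alpha> = a and vs = vs and x = z, OF True _ inv_poly_minus]
  note w = w0[where \<beta> = "cov_deriv P' \<omega>' a", OF alt1] w0[where \<beta> = ?aa, OF alt2]
    w0[where \<beta> = "curvature P' \<omega>'", OF alt3]
  show ?thesis
  proof (cases "z \<in> points P' \<and> set vs \<subseteq> tangent P' z")
    case good: True
    then have v: "vs ! i \<in> tangent P' z" if "i < 3" for i using that True nth_mem[of i vs] by auto
    have "curvature P' \<omega>' z [vs ! i, vs ! j] = 0" if "i < 3" "j < 3" for i j
      using flat v that good by blast
    then show ?thesis
      unfolding CS w aa using good True by (simp add: Let_def inv_poly_0)
  next
    \<comment> \<open>\<open>wedge\<close> does not test tangency, but in every summand an invalid
      vector or base point enters one of the two factors, which is then 0.\<close>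
    case bad: False
    have a0: "a z [v] = 0" "\<omega>' z [v] = 0" if "\<not> (z \<in> points P' \<and> v \<in> tangent P' z)" for v
      using forms_outside[OF a, of z "[v]"] forms_outside[OF om, of z "[v]"] that by auto
    have two: "cov_deriv P' \<omega>' a z [v, w] = 0" "?aa z [v, w] = 0" "curvature P' \<omega>' z [v, w] = 0"
      if vw: "\<not> (z \<in> points P' \<and> v \<in> tangent P' z \<and> w \<in> tangent P' z)" for v w
    proof -
      have "ext_deriv P' 1 a z [v, w] = 0" "ext_deriv P' 1 \<omega>' z [v, w] = 0"
        using vw by (auto intro!: ext_deriv_outside)
      moreover have "a z [v] = 0 \<and> \<omega>' z [v] = 0 \<or> a z [w] = 0 \<and> \<omega>' z [w] = 0" using vw a0 by blast
      ultimately show "cov_deriv P' \<omega>' a z [v, w] = 0" "?aa z [v, w] = 0" "curvature P' \<omega>' z [v, w] = 0"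
        unfolding cov_deriv_2 aa curvature_2 by (auto simp: se3_bracket_0)
    qed
    obtain x y u where vs: "vs = [x, y, u]" using True by (rule length_3E)
    have "\<not> (z \<in> points P' \<and> x \<in> tangent P' z) \<or> \<not> (z \<in> points P' \<and> y \<in> tangent P' z) \<or> \<not> (z \<in> points P' \<and> u \<in> tangent P' z)"
      using bad vs by auto
    then have "?B (a z [x]) (\<beta> z [y, u]) = 0 \<and> ?B (a z [y]) (\<beta> z [u, x]) = 0 \<and> ?B (a z [u]) (\<beta> z [x, y]) = 0"
      if "\<And>v w. \<not> (z \<in> points P' \<and> v \<in> tangent P' z \<and> w \<in> tangent P' z) \<Longrightarrow> \<beta> z [v, w] = 0"
      for \<beta> :: "(('b \<times> se3_pair) set, 'e, se3) form"
      using a0(1)[of x] a0(1)[of y] a0(1)[of u] that[of y u] that[of u x] that[of x y] by (auto simp: inv_poly_0)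
    note z0 = this[of "cov_deriv P' \<omega>' a", OF two(1)] this[of ?aa, OF two(2)] this[of "curvature P' \<omega>'", OF two(3)]
    have out: "\<not> (z \<in> points P' \<and> length vs = 3 \<and> set vs \<subseteq> tangent P' z)" using bad by blast
    show ?thesis
      unfolding CS w if_not_P[OF out] unfolding vs using z0 by simp
  qed
qed
qed

end

context flat_bundle
begin

text \<open>\<open>ext_deriv\<close> is defined through \<open>chart_at\<close>, so coordinates are
  provided for exactly that chart. It is a quotient chart, and local representatives there are those
  of the pullbacks to \<open>X\<close>.\<close>

lemma local_coordinates:
  assumes z: "z \<in> points P" and c: "c = chart_at P z"
  obtains S s' v A y where "open S" "y \<in> S" "y = snd c z" "smooth_on S s'" "smooth_on S v" "smooth_on S A"
    "\<forall>u\<in>S. rotation_matrix (A u)"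
    "\<forall>u\<in>S. \<forall>w. local_rep P \<omega> c u [w] = om v A u w"
    "\<forall>u\<in>S. \<forall>w. local_rep P aP c u [w] = ka s' v A u w"
    "\<forall>ws. length ws = 3 \<longrightarrow> local_rep P (pullback P M \<pi> sigma_vol) c y ws = det (vector (map (frechet_derivative s' (at y)) ws))"
proof -
  have cP: "c \<in> P" "z \<in> fst c" using chart_at_in[OF z] c by auto
  obtain W e where cc: "c = quotient_chart q W e" and e: "e \<in> X" "W \<subseteq> fst e" "openin (mtop X) W" "inj_on q W"
    by (rule quotient_chartE[OF cP(1)])
  note k = quotient_chart_simps[OF P.X e]
  let ?S = "snd e ` W"
  define s' where "s' u = s (fst (chart_inv e u))" for u
  define v where "v u = fst (snd (chart_inv e u))" for u
  define A where "A u = snd (snd (chart_inv e u))" for u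
  have sub: "smooth_on ?S f" if "smooth_on (snd e ` fst e) f" for f :: "_ \<Rightarrow> 'z::real_normed_vector"
    by (rule smooth_on_subset[OF that k(6)])
  have s': "smooth_on ?S s'" unfolding s'_def
    by (rule sub, rule smooth_map_into_openD[OF smooth_s_fst P.X open_UNIV e(1)])
  have g: "smooth_on ?S (\<lambda>u. snd (chart_inv e u))"
    by (rule sub, rule smooth_map_into_openD[OF smooth_snd P.X open_UNIV e(1)])
  have v: "smooth_on ?S v" and A: "smooth_on ?S A"
    unfolding v_def A_def by (intro smooth_on_fst smooth_on_snd k(5) g)+
  have inv_X: "chart_inv e u \<in> points X" if "u \<in> ?S" for u
    using k(7)[OF that] P.points_subset[OF e(3)] by blast
  have rot: "\<forall>u\<in>?S. rotation_matrix (A u)"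
    using inv_X by (fastforce simp: A_def points_X carrier_SE3_iff mem_Times_iff)
  have Dg: "frechet_derivative (\<lambda>u. snd (chart_inv e u)) (at u) w = (frechet_derivative v (at u) w, frechet_derivative A (at u) w)"
    if "u \<in> ?S" for u w
  proof -
    have "((\<lambda>u. (v u, A u)) has_derivative (\<lambda>w. (frechet_derivative v (at u) w, frechet_derivative A (at u) w))) (at u)"
      by (intro has_derivative_Pair smooth_on_has_derivative[OF v that] smooth_on_has_derivative[OF A that])
    moreover have "(\<lambda>u. (v u, A u)) = (\<lambda>u. snd (chart_inv e u))" by (simp add: v_def A_def)
    ultimately have D: "((\<lambda>u. snd (chart_inv e u)) has_derivative (\<lambda>w. (frechet_derivative v (at u) w, frechet_derivative A (at u) w))) (at u)"
      by (simp only:)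
    show ?thesis unfolding frechet_derivative_at[OF D, symmetric] ..
  qed
  have DPhi: "frechet_derivative (\<lambda>u. Phi (chart_inv e u)) (at u) w
      = (frechet_derivative s' (at u) w, frechet_derivative (\<lambda>u. snd (chart_inv e u)) (at u) w)" if "u \<in> ?S" for u w
  proof -
    have "((\<lambda>u. (s' u, snd (chart_inv e u))) has_derivative
        (\<lambda>w. (frechet_derivative s' (at u) w, frechet_derivative (\<lambda>u. snd (chart_inv e u)) (at u) w))) (at u)"
      by (intro has_derivative_Pair smooth_on_has_derivative[OF s' that] smooth_on_has_derivative[OF g that])
    moreover have "(\<lambda>u. (s' u, snd (chart_inv e u))) = (\<lambda>u. Phi (chart_inv e u))" by (simp add: s'_def Phi_def)
    ultimately have D: "((\<lambda>u. Phi (chart_inv e u)) has_derivative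
        (\<lambda>w. (frechet_derivative s' (at u) w, frechet_derivative (\<lambda>u. snd (chart_inv e u)) (at u) w))) (at u)"
      by (simp only:)
    show ?thesis unfolding frechet_derivative_at[OF D, symmetric] ..
  qed
  show thesis
  proof (rule that)
    show "open ?S" "smooth_on ?S s'" "smooth_on ?S v" "smooth_on ?S A" "\<forall>u\<in>?S. rotation_matrix (A u)"
      using k(5) s' v A rot by auto
    show y: "snd c z \<in> ?S" using cP(2) unfolding cc k(3)[symmetric] by (rule imageI)
    show "\<forall>u\<in>?S. \<forall>w. local_rep P \<omega> c u [w] = om v A u w"
    proof (intro ballI allI)
      fix u w assume u: "u \<in> ?S"
      have "local_rep P \<omega> c u [w] = local_rep X (pullback X euclid snd mc_form) e u [w]"
        unfolding cc P.local_rep_quotient[OF e u] omega(2) ..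
      also have "\<dots> = om v A u w"
        unfolding mc_form_def
        by (subst local_rep_pullback_euclid_form[OF smooth_snd P.X e(1)])
           (use u k(6) in \<open>auto simp: om_def Dg A_def\<close>)
      finally show "local_rep P \<omega> c u [w] = om v A u w" .
    qed
    show "\<forall>u\<in>?S. \<forall>w. local_rep P aP c u [w] = ka s' v A u w"
    proof (intro ballI allI)
      fix u w assume u: "u \<in> ?S"
      have "local_rep P aP c u [w] = local_rep X (pullback X euclid Phi kappa_form) e u [w]"
        unfolding cc P.local_rep_quotient[OF e u] aP(2) ..
      also have "\<dots> = ka s' v A u w"
        unfolding kappa_form_def
        by (subst local_rep_pullback_euclid_form[OF smooth_Phi P.X e(1)])
           (use u k(6) in \<open>auto simp: ka_def kappa_def DPhi[unfolded Phi_def] Phi_def A_def s'_def v_def\<close>)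
      finally show "local_rep P aP c u [w] = ka s' v A u w" .
    qed
    show "\<forall>ws. length ws = 3 \<longrightarrow> local_rep P (pullback P M \<pi> sigma_vol) c (snd c z) ws
        = det (vector (map (frechet_derivative s' (at (snd c z))) ws))"
    proof (intro allI impI)
      fix ws :: "((real^3) \<times> (real^3) \<times> (real^3)) list" assume ws: "length ws = 3"
      have "local_rep P (pullback P M \<pi> sigma_vol) c (snd c z) ws = local_rep X (pullback X euclid (\<lambda>z. s (fst z)) vol_form) e (snd c z) ws"
        unfolding cc P.local_rep_quotient[OF e y[unfolded cc]] pullback_sigma_vol ..
      also have "\<dots> = det (vector (map (frechet_derivative s' (at (snd c z))) ws))"
        unfolding vol_form_def
        by (subst local_rep_pullback_euclid_form[OF smooth_s_fst P.X e(1)])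
           (use y k(6) ws in \<open>auto simp: s'_def[abs_def]\<close>)
      finally show "local_rep P (pullback P M \<pi> sigma_vol) c (snd c z) ws
        = det (vector (map (frechet_derivative s' (at (snd c z))) ws))" .
    qed
  qed (rule refl)
qed

lemma ext_deriv_local:
  assumes z: "z \<in> points P" and c: "c = chart_at P z" and S: "open S" "snd c z \<in> S"
    and vw: "v \<in> tangent P z" "w \<in> tangent P z"
    and rep: "\<forall>u\<in>S. \<forall>w. local_rep P \<alpha> c u [w] = f u w"
  shows "ext_deriv P 1 \<alpha> z [v, w] = frechet_derivative (\<lambda>u. f u (w c)) (at (snd c z)) (v c)
     - frechet_derivative (\<lambda>u. f u (v c)) (at (snd c z)) (w c)" "\<alpha> z [v] = f (snd c z) (v c)"
proof -
  have "frechet_derivative (\<lambda>u. local_rep P \<alpha> c u [x]) (at (snd c z)) = frechet_derivative (\<lambda>u. f u x) (at (snd c z))" for x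
    by (rule frechet_derivative_cong_open[OF S]) (use rep in blast)
  then show "ext_deriv P 1 \<alpha> z [v, w] = frechet_derivative (\<lambda>u. f u (w c)) (at (snd c z)) (v c)
     - frechet_derivative (\<lambda>u. f u (v c)) (at (snd c z)) (w c)"
    using ext_deriv_1[OF z, of v w \<alpha>] vw unfolding c by simp
  have "\<alpha> z [v] = local_rep P \<alpha> c (snd c z) (map (\<lambda>v. v c) [v])"
    by (rule form_apply[OF P.smooth_atlas_Q]) (use chart_at_in[OF z] vw c in auto)
  then show "\<alpha> z [v] = f (snd c z) (v c)" using rep S(2) by simp
qed

text \<open>Evaluated in the coordinates of \<open>local_coordinates\<close>: \<open>om_flat\<close>
  gives zero curvature, \<open>ka_cov_deriv\<close> the covariant derivative, and
  \<open>chern_simons_algebra\<close> the value.\<close>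

lemma CS_pullback:
  "CS_upstairs P (inv_poly c1 c2) (\<omega> +\<^sub>f aP) \<omega> = pullback P M \<pi> ((2 * c1 + 6 * c2) *\<^sub>f sigma_vol)"
proof (intro ext)
  fix z vs
  let ?B = "inv_poly c1 c2"
  have volP: "pullback P M \<pi> sigma_vol \<in> forms 3 P"
    by (rule pullback_forms[OF smooth_proj P.smooth_atlas_Q M sigma_vol_forms])
  have flat: "curvature P \<omega> z [v, w] = 0" if vw: "v \<in> tangent P z" "w \<in> tangent P z" and z: "z \<in> points P" for v w
  proof -
    define c where "c = chart_at P z"
    obtain S s' v' A y where S: "open S" "y \<in> S" "y = snd c z" "smooth_on S s'" "smooth_on S v'" "smooth_on S A"
      "\<forall>u\<in>S. rotation_matrix (A u)"
      "\<forall>u\<in>S. \<forall>w. local_rep P \<omega> c u [w] = om v' A u w"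
      "\<forall>u\<in>S. \<forall>w. local_rep P aP c u [w] = ka s' v' A u w"
      "\<forall>ws. length ws = 3 \<longrightarrow> local_rep P (pullback P M \<pi> sigma_vol) c y ws = det (vector (map (frechet_derivative s' (at y)) ws))"
      by (rule local_coordinates[OF z c_def])
    note L = ext_deriv_local[OF z c_def S(1) S(2)[unfolded S(3)]]
    show ?thesis
      unfolding curvature_2[OF omega(1) aP(1)] L(1)[OF vw S(8)] L(2)[OF vw S(8)] L(2)[OF vw(2,1) S(8)]
      using om_flat[OF S(1,2,4,5,6) S(7)[rule_format], of "w c" "v c"] unfolding S(3) by simp
  qed
  then have flat': "\<forall>v\<in>tangent P z. \<forall>w\<in>tangent P z. z \<in> points P \<longrightarrow> curvature P \<omega> z [v, w] = 0" by blast
  show "CS_upstairs P ?B (\<omega> +\<^sub>f aP) \<omega> z vs = pullback P M \<pi> ((2 * c1 + 6 * c2) *\<^sub>f sigma_vol) z vs"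
  proof (cases "z \<in> points P \<and> length vs = 3 \<and> set vs \<subseteq> tangent P z")
    case False
    then show ?thesis
      unfolding CS_upstairs_apply[OF omega(1) aP(1) flat'] if_not_P[OF False] pullback_scale
      unfolding form_scale_def forms_outside[OF volP False] by simp
  next
    case True
    then have z: "z \<in> points P" and len: "length vs = 3" by auto
    obtain v0 v1 v2 where vs: "vs = [v0, v1, v2]" by (rule length_3E[OF len])
    have v: "v0 \<in> tangent P z" "v1 \<in> tangent P z" "v2 \<in> tangent P z" using True vs by auto
    define c where "c = chart_at P z"
    obtain S s' v' A y where S: "open S" "y \<in> S" "y = snd c z" "smooth_on S s'" "smooth_on S v'" "smooth_on S A"
      "\<forall>u\<in>S. rotation_matrix (A u)"
      "\<forall>u\<in>S. \<forall>w. local_rep P \<omega> c u [w] = om v' A u w"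
      "\<forall>u\<in>S. \<forall>w. local_rep P aP c u [w] = ka s' v' A u w"
      "\<forall>ws. length ws = 3 \<longrightarrow> local_rep P (pullback P M \<pi> sigma_vol) c y ws = det (vector (map (frechet_derivative s' (at y)) ws))"
      by (rule local_coordinates[OF z c_def])
    note L = ext_deriv_local[OF z c_def S(1) S(2)[unfolded S(3)]]
    let ?T = "\<lambda>x. transpose (A y) *v x" and ?D = "\<lambda>v. frechet_derivative s' (at y) (v c)"
    have A: "rotation_matrix (A y)" using S(2,7) by blast
    have T: "cross3 (?T a) (?T b) = ?T (cross3 a b)" for a b by (rule cross_transpose_rotation[OF A])
    define \<tau> where "\<tau> = ?T (s' y - v' y)"
    define k where "k x = (cross3 \<tau> x, x)" for x :: "real^3"
    have a: "aP z [v] = k (?T (?D v))" if "v \<in> tangent P z" for v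
      using L(2)[OF that that S(9)] unfolding S(3)[symmetric] by (simp add: ka_def k_def \<tau>_def T)
    have d: "cov_deriv P \<omega> aP z [v, w] = (2 *\<^sub>R cross3 (?T (?D v)) (?T (?D w)), 0)" if vw: "v \<in> tangent P z" "w \<in> tangent P z" for v w
      unfolding cov_deriv_2[OF omega(1) aP(1)] L(1)[OF vw S(9)] L(2)[OF vw S(8)] L(2)[OF vw(2,1) S(8)]
        L(2)[OF vw S(9)] L(2)[OF vw(2,1) S(9)] S(3)[symmetric] T
      by (rule ka_cov_deriv[OF S(1,2,4,5,6) S(7)[rule_format]])
    let ?a = "?T (?D v0)" and ?b = "?T (?D v1)" and ?c = "?T (?D v2)"
    have "CS_upstairs P ?B (\<omega> +\<^sub>f aP) \<omega> z vs =
       (?B (k ?a) (2 *\<^sub>R cross3 ?b ?c, 0) + ?B (k ?b) (2 *\<^sub>R cross3 ?c ?a, 0) + ?B (k ?c) (2 *\<^sub>R cross3 ?a ?b, 0))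
       + (1/3) * (?B (k ?a) (2 *\<^sub>R se3_bracket (k ?b) (k ?c)) + ?B (k ?b) (2 *\<^sub>R se3_bracket (k ?c) (k ?a))
         + ?B (k ?c) (2 *\<^sub>R se3_bracket (k ?a) (k ?b)))"
      using CS_upstairs_apply[OF omega(1) aP(1) flat', of c1 c2 vs] True
      by (simp add: vs a[OF v(1)] a[OF v(2)] a[OF v(3)] d[OF v(1,2)] d[OF v(2,3)] d[OF v(3,1)] Let_def)
    also have "\<dots> = (2 * c1 + 6 * c2) * (?a \<bullet> cross3 ?b ?c)"
      using chern_simons_algebra[where \<tau> = \<tau> and a = ?a and b = ?b and c = ?c and ?c1.0 = c1 and ?c2.0 = c2]
      unfolding k_def[symmetric] by (simp add: algebra_simps)
    \<comment> \<open>The rotation A^T disappears from the triple product, leaving the determinant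
      of ds.\<close>
    also have "?a \<bullet> cross3 ?b ?c = det (vector [?D v0, ?D v1, ?D v2] :: real^3^3)"
      using det_rotation[OF rotation_matrix_transpose[OF A], of "?D v0" "?D v1" "?D v2"] by (simp add: det_vector3)
    also have "\<dots> = local_rep P (pullback P M \<pi> sigma_vol) c y (map (\<lambda>v. v c) vs)"
      using S(10)[rule_format, of "map (\<lambda>v. v c) vs"] by (simp add: vs)
    also have "\<dots> = pullback P M \<pi> sigma_vol z vs"
      using form_apply[OF P.smooth_atlas_Q, of c z vs "pullback P M \<pi> sigma_vol"] chart_at_in[OF z] True S(3) c_def by simp
    finally show ?thesis unfolding pullback_scale unfolding form_scale_def by simp
  qed
qed

text \<open>Sending y to the class of (y, 1) lifts \<open>p\<close> through the bundle projection,
  so injectivity is inherited from the pullback along \<open>p\<close>.\<close>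

lemma pullback_proj_injective:
  fixes \<beta> \<beta>' :: "('a, real^3, 'v::real_normed_vector) form"
  assumes \<beta>: "\<beta> \<in> forms k M" "\<beta>' \<in> forms k M" and eq: "pullback P M \<pi> \<beta> = pullback P M \<pi> \<beta>'"
  shows "\<beta> = \<beta>'"
proof (rule pullback_p_injective[OF \<beta>])
  let ?i = "\<lambda>y. (y, (0, mat 1)) :: 'b \<times> se3_pair"
  have one: "(0, mat 1) \<in> carrier SE3" by (simp add: SE3_simps rotation_matrix_one)
  have "smooth_map Mt euclid (\<lambda>_. (0, mat 1) :: se3_pair)"
    by (rule smooth_map_into_openI[OF Mt open_UNIV])
      (use smooth_atlas_open[OF Mt] in \<open>auto simp: points_iff intro!: smooth_on_const\<close>)
  then have "smooth_map Mt SE3_atlas (\<lambda>_. (0, mat 1))" by (rule smooth_map_into_SE3[OF _ Mt]) (use one in auto)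
  then have i: "smooth_map Mt X ?i"
    using smooth_map_Pair[OF smooth_map_id[OF Mt] _ Mt Mt smooth_atlas_SE3] by simp
  have qi: "smooth_map Mt P (q \<circ> ?i)" by (rule smooth_map_compose[OF i P.smooth_map_q Mt P.X P.smooth_atlas_Q])
  have "pullback Mt M p \<gamma> = pullback Mt P (q \<circ> ?i) (pullback P M \<pi> \<gamma>)" for \<gamma> :: "('a, real^3, 'v) form"
  proof -
    have "pullback Mt P (q \<circ> ?i) (pullback P M \<pi> \<gamma>) = pullback Mt M (\<pi> \<circ> (q \<circ> ?i)) \<gamma>"
      by (rule pullback_compose[OF qi smooth_proj Mt P.smooth_atlas_Q M])
    also have "\<dots> = pullback Mt M p \<gamma>"
    proof (rule pullback_cong[OF Mt])
      fix y assume "y \<in> points Mt"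
      then have "?i y \<in> points X" using one by (simp add: points_X)
      from bundle_proj_q[OF this] show "(\<pi> \<circ> (q \<circ> ?i)) y = p y" by simp
    qed
    finally show ?thesis by simp
  qed
  then show "pullback Mt M p \<beta> = pullback Mt M p \<beta>'" using eq by simp
qed

lemma CS_eq:
  "CS P M p (inv_poly c1 c2) (omega_sigma P M p \<omega> \<sigma>) \<omega> = (2 * c1 + 6 * c2) *\<^sub>f sigma_vol"
  unfolding CS_def omega_sigma_def e_hat_eq
proof (rule descend_eqI)
  show f: "(2 * c1 + 6 * c2) *\<^sub>f sigma_vol \<in> forms 3 M" by (rule forms_scale[OF M sigma_vol_forms])
  show "pullback P M \<pi> ((2 * c1 + 6 * c2) *\<^sub>f sigma_vol) = CS_upstairs P (inv_poly c1 c2) (\<omega> +\<^sub>f aP) \<omega>"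
    by (rule CS_pullback[symmetric])
  show "\<beta>' = (2 * c1 + 6 * c2) *\<^sub>f sigma_vol"
    if "\<beta>' \<in> forms 3 M" "pullback P M \<pi> \<beta>' = pullback P M \<pi> ((2 * c1 + 6 * c2) *\<^sub>f sigma_vol)" for \<beta>'
    by (rule pullback_proj_injective[OF that(1) f that(2)])
qed

end

theorem proposition5p7:
  fixes M :: "('a, real^3) atlas" and Mt :: "('b, real^3) atlas"
    and p :: "'b \<Rightarrow> 'a" and y0 :: 'b
    and act :: "(real \<Rightarrow> 'a) set \<Rightarrow> 'b \<Rightarrow> 'b"
    and \<rho> :: "(real \<Rightarrow> 'a) set \<Rightarrow> se3_pair"
    and \<sigma> :: "'a \<Rightarrow> ('b \<times> (real^3)) set"
    and c1 c2 :: real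
  assumes "oriented_manifold M"
    and "compact_space (mtop M)" and "connected_space (mtop M)"
    and "universal_covering Mt M p" and "y0 \<in> points Mt"
    and "deck_action Mt M p y0 act"
    and "\<rho> \<in> hom (fundamental_group (mtop M) (p y0)) SE3"
    and "is_section M (PK_atlas Mt (fundamental_group (mtop M) (p y0)) act \<rho>) (bundle_proj p) \<sigma>"
  shows "let \<Gamma> = fundamental_group (mtop M) (p y0);
             P = P_atlas Mt \<Gamma> act \<rho>;
             \<omega> = omega_rho Mt \<Gamma> act \<rho>;
             \<sigma>vol = pullback M (PK_atlas Mt \<Gamma> act \<rho>) \<sigma> (vol_rho Mt \<Gamma> act \<rho>)
         in CS P M p (inv_poly c1 c2) (omega_sigma P M p \<omega> \<sigma>) \<omega> = (2 * c1 + 6 * c2) *\<^sub>f \<sigma>vol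
            \<and> \<sigma>vol \<in> forms 3 M"
proof -
  interpret flat_bundle Mt M p y0 act \<rho> \<sigma>
  proof
    show "smooth_atlas M" using assms(1) manifold_smooth_atlas by (auto simp: oriented_manifold_def)
  qed (use assms in simp_all)
  show ?thesis
    unfolding Let_def using CS_eq sigma_vol_forms by (simp add: P_atlas_def PK_atlas_def)
qed

end
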